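(* Let $V,g,U,H,\alpha,T,L$ be as described in the context, with $V'=\operatorname{Ker}H\neq\{0\}$, and let $T',T'',P$ be the associated tori and flat line bundle. Let $\beta:U''\to\mathbf{U}(1)$ be any map satisfying $\beta(u_1+u_2)=\beta(u_1)\beta(u_2)\exp(i\pi E(u_1,u_2))$, and let $L''=L(H,\beta)$ be the corresponding line bundle on $T''$. Let $\Box$ be the Dolbeault Laplacian on forms of type $(0,\bullet)$ on $T$ with values in $L$, and let $\widetilde\Box$ be the Dolbeault Laplacian on forms of type $(0,\bullet)$ on $T'\times T''$ with values in $\pi_1^*P\otimes\pi_2^*L''$, where $\pi_1,\pi_2$ are the projections of $T'\times T''$ onto $T'$ and $T''$. Then the spectra of $\Box$ and $\widetilde\Box$ coincide (in each degree $(0,k)$, with multiplicities).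
   Context: $V$ is a complex vector space of complex dimension $n$ with a positive definite hermitian form $g$, $U\subset V$ is a lattice (discrete subgroup of rank $2n$), and $H$ is a hermitian form on $V$ such that $E=\operatorname{Im}H$ takes integer values on $U\times U$. Hermitian forms are $\mathbf{C}$-linear in the first variable and antilinear in the second. $\alpha:U\to\mathbf{U}(1)$ satisfies $\alpha(u_1+u_2)=\alpha(u_1)\alpha(u_2)\exp(i\pi E(u_1,u_2))$. $T=V/U$ is the complex torus with the translation-invariant Kähler metric induced by $g$. For any such data, $L(H,\alpha)$ denotes the holomorphic line bundle on $V/U$ that is the quotient of $\mathbf{C}\times V$ by the action of $U$ $$\Phi_u(\lambda,z)=\left(\lambda\,\alpha(u)\exp\left[\pi H(z,u)+\tfrac{\pi}{2}H(u,u)\right],\,z+u\right),$$ with hermitian metric given over $z$ by $h(\lambda_1,\lambda_2)=\lambda_1\overline{\lambda_2}\exp[-\pi H(z,z)]$. Put $L=L(H,\alpha)$. Put $V'=\operatorname{Ker}H=\{v\in V:H(v,\cdot)=0\}$, $V''=V/V'$, $U'=U\cap V'$, and let $U''$ be the image of $U$ in $V''$. It is known that $U'$ and $U''$ are lattices in $V'$ and $V''$; put $T'=V'/U'$ and $T''=V''/U''$. $H$ induces a hermitian form on $V''$ with zero kernel, still denoted $H$, and $E=\operatorname{Im}H$ is integer-valued on $U''\times U''$. $V'$ carries the metric $g|_{V'}$; $V''$ carries the metric $g|_{V'^\perp}$, where $V'^\perp$ is the $g$-orthogonal complement of $V'$ in $V$, identified with $V''$ by the projection. $T'\times T''$ carries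 the product metric. $P$ is the flat hermitian line bundle on $T'$ that is the quotient of $\mathbf{C}\times V'$ by $u\cdot(\lambda,z)=(\lambda\alpha(u),z+u)$, $u\in U'$ (where $\alpha|_{U'}$ is a character), with metric $(\lambda_1,\lambda_2)\mapsto\lambda_1\overline{\lambda_2}$. It is the restriction of $L$ to the fibres of $T\to T''$. $L''=L(H,\beta)$, the quotient of $\mathbf{C}\times V''$ by the action $(\lambda,z)\mapsto\left(\lambda\,\beta(u)\exp\left[\pi H(z,u)+\tfrac{\pi}{2}H(u,u)\right],\,z+u\right)$ of $u\in U''$, carries the hermitian metric given over $z\in V''$ by $h(\lambda_1,\lambda_2)=\lambda_1\overline{\lambda_2}\exp[-\pi H(z,z)]$, and $\pi_1^*P\otimes\pi_2^*L''$ carries the induced metric. For a hermitian holomorphic line bundle on such a flat torus, the Dolbeault Laplacian is $\overline\partial\,\overline\partial^*+\overline\partial^*\overline\partial$ on forms of type $(0,k)$, with $\overline\partial^*$ the $L^2$ formal adjoint, normalized so that for the trivial bundle it is half the nonnegative Riemannian Laplacian of the Riemannian metric $\operatorname{Re}g$. *)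

theory Defs
  imports "HOL-Analysis.Analysis" "HOL-Library.Function_Algebras" "HOL-Library.Extended_Nat"
begin

section \<open>Finite-dimensional complex vector spaces\<close>

text \<open>
  The class provides a complex scalar multiplication on a Euclidean space. The real inner product of
  the class is only a source for the (unique) vector space topology and the Borel sets; hermitian
  metrics are always separate data and need not be related to it. Since the spaces involved may be
  zero, they are complex subspaces \<open>W\<close> of such a type.
\<close>

class complex_euclidean = euclidean_space +
  fixes scaleC :: "complex \<Rightarrow> 'a \<Rightarrow> 'a"  (infixr \<open>*\<^sub>C\<close> 75)
  assumes scaleC_add_right: "c *\<^sub>C (x + y) = c *\<^sub>C x + c *\<^sub>C y"
    and scaleC_add_left: "(c + d) *\<^sub>C x = c *\<^sub>C x + d *\<^sub>C x"
    and scaleC_scaleC: "c *\<^sub>C d *\<^sub>C x = (c * d) *\<^sub>C x"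
    and scaleC_of_real: "complex_of_real r *\<^sub>C x = r *\<^sub>R x"

lemma scaleC_one: "1 *\<^sub>C x = (x::'a::complex_euclidean)"
  using scaleC_of_real[of 1 x] by simp

instantiation complex :: complex_euclidean
begin
definition "scaleC_complex (c :: complex) (x :: complex) = c * x"
instance by standard (auto simp: scaleC_complex_def algebra_simps scaleR_conv_of_real)
end

instantiation vec :: (complex_euclidean, finite) complex_euclidean
begin
definition "scaleC_vec c (x :: 'a ^ 'b) = (\<chi> i. c *\<^sub>C (x $ i))"
instance
  by standard (auto simp: scaleC_vec_def vec_eq_iff scaleC_add_right scaleC_add_left
      scaleC_scaleC scaleC_of_real)
end

instantiation prod :: (complex_euclidean, complex_euclidean) complex_euclidean
begin
definition "scaleC_prod c (p :: 'a \<times> 'b) = (c *\<^sub>C fst p, c *\<^sub>C snd p)"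
instance
  by standard (auto simp: scaleC_prod_def prod_eq_iff scaleC_add_right scaleC_add_left
      scaleC_scaleC scaleC_of_real)
end

global_interpretation complex_space: vector_space "scaleC :: complex \<Rightarrow> 'a \<Rightarrow> 'a::complex_euclidean"
  by standard (simp_all add: scaleC_add_right scaleC_add_left scaleC_scaleC scaleC_one)

definition hermitian :: "('a::complex_euclidean \<Rightarrow> 'a \<Rightarrow> complex) \<Rightarrow> bool" where
  "hermitian H \<longleftrightarrow> (\<forall>y. Vector_Spaces.linear scaleC (*) (\<lambda>x. H x y)) \<and> (\<forall>x y. H y x = cnj (H x y))"

definition positive_definite :: "('a::complex_euclidean \<Rightarrow> 'a \<Rightarrow> complex) \<Rightarrow> bool" where
  "positive_definite g \<longleftrightarrow> (\<forall>x. x \<noteq> 0 \<longrightarrow> Re (g x x) > 0)"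

definition form_kernel :: "('a::complex_euclidean \<Rightarrow> 'a \<Rightarrow> complex) \<Rightarrow> 'a set" where
  "form_kernel H = {v. \<forall>w. H v w = 0}"

definition form_orthogonal :: "('a::complex_euclidean \<Rightarrow> 'a \<Rightarrow> complex) \<Rightarrow> 'a set \<Rightarrow> 'a set" where
  "form_orthogonal g S = {v. \<forall>w\<in>S. g v w = 0}"


section \<open>Lattices and flat tori\<close>

global_interpretation int_module: module "\<lambda>(k::int) (x::'a::real_vector). of_int k *\<^sub>R x"
  by standard (simp_all add: algebra_simps)

definition lattice_basis :: "'a::euclidean_space set \<Rightarrow> 'a set \<Rightarrow> bool" where
  "lattice_basis \<Lambda> B \<longleftrightarrow> finite B \<and> int_module.independent B \<and> int_module.span B = \<Lambda>"

text \<open>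
  Discrete subgroup, free of rank equal to the real dimension of \<open>W\<close>, i.e.\ twice its complex
  dimension.
\<close>

definition is_lattice :: "'a::euclidean_space set \<Rightarrow> 'a set \<Rightarrow> bool" where
  "is_lattice W \<Lambda> \<longleftrightarrow> \<Lambda> \<subseteq> W \<and> int_module.subspace \<Lambda> \<and> discrete \<Lambda> \<and>
     (\<exists>B. lattice_basis \<Lambda> B \<and> card B = dim W)"

text \<open>The torus \<open>W/\<Lambda>\<close> with the translation-invariant metric induced by a hermitian form on \<open>W\<close>.\<close>

record 'a torus =
  cover :: "'a set"
  lat :: "'a set"
  metric :: "'a \<Rightarrow> 'a \<Rightarrow> complex"

definition prod_torus :: "'a torus \<Rightarrow> 'b torus \<Rightarrow> ('a \<times> 'b) torus"  (infixr \<open>\<times>\<^sub>T\<close> 80) where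
  "S \<times>\<^sub>T T = \<lparr> cover = cover S \<times> cover T, lat = lat S \<times> lat T,
      metric = (\<lambda>x y. metric S (fst x) (fst y) + metric T (snd x) (snd y)) \<rparr>"

text \<open>Real bases of the covering space that are orthonormal for the Riemannian metric \<open>Re g\<close>.\<close>

definition orthonormal_basis :: "'a::euclidean_space torus \<Rightarrow> 'a set \<Rightarrow> bool" where
  "orthonormal_basis T E \<longleftrightarrow> finite E \<and> E \<subseteq> cover T \<and> span E = cover T \<and>
     (\<forall>x\<in>E. \<forall>y\<in>E. Re (metric T x y) = (if x = y then 1 else 0))"

definition onb :: "'a::euclidean_space torus \<Rightarrow> 'a set" where
  "onb T = (SOME E. orthonormal_basis T E)"

text \<open>
  The Riemannian volume of \<open>Re g\<close> on the covering space, and integration over the torus, i.e.\ of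
  \<open>\<Lambda>\<close>-periodic functions over a fundamental parallelotope. None of this depends on the bases chosen.
\<close>

definition volume :: "'a::euclidean_space torus \<Rightarrow> 'a measure" where
  "volume T = distr (\<Pi>\<^sub>M e\<in>onb T. lborel) borel (\<lambda>t. \<Sum>e\<in>onb T. t e *\<^sub>R e)"

definition fundamental_domain :: "'a::euclidean_space torus \<Rightarrow> 'a set" where
  "fundamental_domain T =
     (let B = (SOME B. lattice_basis (lat T) B) in {\<Sum>b\<in>B. t b *\<^sub>R b | t. \<forall>b\<in>B. 0 \<le> t b \<and> t b < 1})"

definition torus_integral :: "'a::euclidean_space torus \<Rightarrow> ('a \<Rightarrow> complex) \<Rightarrow> complex" where
  "torus_integral T f = (LINT z:fundamental_domain T|volume T. f z)"


section \<open>Hermitian line bundles on tori\<close>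

text \<open>
  A line bundle on \<open>W/\<Lambda>\<close> given as the quotient of \<open>\<complex> \<times> W\<close> by the action
  \<open>u \<cdot> (\<lambda>, z) = (\<lambda> * factor u z, z + u)\<close> of \<open>\<Lambda>\<close>, with hermitian metric
  \<open>(\<lambda>\<^sub>1, \<lambda>\<^sub>2) \<mapsto> \<lambda>\<^sub>1 * cnj \<lambda>\<^sub>2 * weight z\<close> over \<open>z\<close>.
\<close>

record 'a line_bundle =
  factor :: "'a \<Rightarrow> 'a \<Rightarrow> complex"
  weight :: "'a \<Rightarrow> real"

definition bundle_action :: "'a::euclidean_space line_bundle \<Rightarrow> 'a \<Rightarrow> complex \<times> 'a \<Rightarrow> complex \<times> 'a" where
  "bundle_action L u = (\<lambda>(c, z). (c * factor L u z, z + u))"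

definition fibre_metric :: "'a line_bundle \<Rightarrow> 'a \<Rightarrow> complex \<Rightarrow> complex \<Rightarrow> complex" where
  "fibre_metric L z c d = c * cnj d * of_real (weight L z)"

definition pullback :: "('b \<Rightarrow> 'a) \<Rightarrow> 'a line_bundle \<Rightarrow> 'b line_bundle" where
  "pullback p L = \<lparr> factor = (\<lambda>u z. factor L (p u) (p z)), weight = (\<lambda>z. weight L (p z)) \<rparr>"

definition tensor :: "'a line_bundle \<Rightarrow> 'a line_bundle \<Rightarrow> 'a line_bundle"  (infixl \<open>\<otimes>\<^sub>L\<close> 70) where
  "L \<otimes>\<^sub>L M = \<lparr> factor = (\<lambda>u z. factor L u z * factor M u z), weight = (\<lambda>z. weight L z * weight M z) \<rparr>"

definition semicharacter ::
    "('a::complex_euclidean \<Rightarrow> 'a \<Rightarrow> complex) \<Rightarrow> 'a set \<Rightarrow> ('a \<Rightarrow> complex) \<Rightarrow> bool" where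
  "semicharacter H \<Lambda> \<alpha> \<longleftrightarrow> (\<forall>u\<in>\<Lambda>. cmod (\<alpha> u) = 1) \<and>
     (\<forall>u\<^sub>1\<in>\<Lambda>. \<forall>u\<^sub>2\<in>\<Lambda>. \<alpha> (u\<^sub>1 + u\<^sub>2) = \<alpha> u\<^sub>1 * \<alpha> u\<^sub>2 * exp (\<i> * of_real (pi * Im (H u\<^sub>1 u\<^sub>2))))"

definition L_bundle ::
    "('a::complex_euclidean \<Rightarrow> 'a \<Rightarrow> complex) \<Rightarrow> ('a \<Rightarrow> complex) \<Rightarrow> 'a line_bundle" where
  "L_bundle H \<alpha> =
     \<lparr> factor = (\<lambda>u z. \<alpha> u * exp (of_real pi * H z u + of_real (pi / 2) * H u u)),
       weight = (\<lambda>z. exp (- pi * Re (H z z))) \<rparr>"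

definition flat_bundle :: "('a \<Rightarrow> complex) \<Rightarrow> 'a line_bundle" where
  "flat_bundle \<alpha> = \<lparr> factor = (\<lambda>u z. \<alpha> u), weight = (\<lambda>z. 1) \<rparr>"


section \<open>Forms of type \<open>(0,k)\<close> with values in a line bundle\<close>

definition dir_deriv :: "'a::real_vector \<Rightarrow> ('a \<Rightarrow> complex) \<Rightarrow> 'a \<Rightarrow> complex" where
  "dir_deriv v f z = vector_derivative (\<lambda>t::real. f (z + t *\<^sub>R v)) (at 0)"

text \<open>On a finite-dimensional space, \<open>C\<^sup>m\<close> means that iterated directional derivatives of order up to
  \<open>m\<close> exist and are continuous.\<close>

primrec Ck_on :: "nat \<Rightarrow> 'a::euclidean_space set \<Rightarrow> ('a \<Rightarrow> complex) \<Rightarrow> bool" where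
  "Ck_on 0 W f \<longleftrightarrow> continuous_on W f"
| "Ck_on (Suc m) W f \<longleftrightarrow> continuous_on W f \<and>
     (\<forall>v\<in>W. (\<forall>z\<in>W. (\<lambda>t::real. f (z + t *\<^sub>R v)) differentiable (at 0)) \<and> Ck_on m W (dir_deriv v f))"

definition smooth_fun_on :: "'a::euclidean_space set \<Rightarrow> ('a \<Rightarrow> complex) \<Rightarrow> bool" where
  "smooth_fun_on W f \<longleftrightarrow> (\<forall>m. Ck_on m W f)"

text \<open>
  Alternating complex-antilinear \<open>k\<close>-forms on \<open>W\<close>, as functions of the list of arguments. They are 0
  on lists that are not in \<open>W\<^sup>k\<close>, so that equality of forms is equality of functions.
\<close>

definition antilinear_alt :: "'a::complex_euclidean set \<Rightarrow> nat \<Rightarrow> ('a list \<Rightarrow> complex) \<Rightarrow> bool" where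
  "antilinear_alt W k \<omega> \<longleftrightarrow>
     (\<forall>vs. \<not> (length vs = k \<and> set vs \<subseteq> W) \<longrightarrow> \<omega> vs = 0) \<and>
     (\<forall>vs i. length vs = k \<and> set vs \<subseteq> W \<and> i < k \<longrightarrow>
        (\<forall>x\<in>W. \<forall>y\<in>W. \<omega> (vs[i := x + y]) = \<omega> (vs[i := x]) + \<omega> (vs[i := y])) \<and>
        (\<forall>c. \<forall>x\<in>W. \<omega> (vs[i := c *\<^sub>C x]) = cnj c * \<omega> (vs[i := x]))) \<and>
     (\<forall>vs i j. length vs = k \<and> set vs \<subseteq> W \<and> i < j \<and> j < k \<and> vs ! i = vs ! j \<longrightarrow> \<omega> vs = 0)"

type_synonym 'a form = "'a \<Rightarrow> 'a list \<Rightarrow> complex"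

text \<open>
  Smooth \<open>(0,k)\<close>-forms on \<open>W/\<Lambda>\<close> with values in the quotient bundle \<open>L\<close>: these are the forms on \<open>W\<close>
  with values in the trivial bundle \<open>\<complex> \<times> W\<close> that are invariant under the action of \<open>\<Lambda>\<close>. As usual
  the tangent spaces of \<open>W\<close> are identified with \<open>W\<close>, and \<open>\<phi> z vs\<close> is the value at \<open>z\<close> on \<open>vs\<close>.
\<close>

definition bundle_forms :: "'a::complex_euclidean torus \<Rightarrow> 'a line_bundle \<Rightarrow> nat \<Rightarrow> 'a form set" where
  "bundle_forms T L k = {\<phi>.
     (\<forall>z. z \<notin> cover T \<longrightarrow> \<phi> z = (\<lambda>vs. 0)) \<and>
     (\<forall>z\<in>cover T. antilinear_alt (cover T) k (\<phi> z)) \<and>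
     (\<forall>vs. smooth_fun_on (cover T) (\<lambda>z. \<phi> z vs)) \<and>
     (\<forall>u\<in>lat T. \<forall>z\<in>cover T. \<forall>vs. bundle_action L u (\<phi> z vs, z) = (\<phi> (z + u) vs, z + u))}"


section \<open>The Dolbeault Laplacian and its spectrum\<close>

text \<open>The \<open>(0,1)\<close>-part of \<open>df\<close>, evaluated on \<open>v\<close>.\<close>

definition dbar_dir :: "'a::complex_euclidean \<Rightarrow> ('a \<Rightarrow> complex) \<Rightarrow> 'a \<Rightarrow> complex" where
  "dbar_dir v f z = (dir_deriv v f z + \<i> * dir_deriv (\<i> *\<^sub>C v) f z) / 2"

definition dbar :: "'a::complex_euclidean torus \<Rightarrow> 'a form \<Rightarrow> 'a form" where
  "dbar T \<phi> = (\<lambda>z vs. if z \<in> cover T \<and> set vs \<subseteq> cover T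
     then \<Sum>i<length vs. (-1) ^ i * dbar_dir (vs ! i) (\<lambda>y. \<phi> y (take i vs @ drop (Suc i) vs)) z
     else 0)"

text \<open>
  Pointwise product of \<open>(0,k)\<close>-forms: the hermitian extension to complex-valued alternating forms of
  the metric induced by \<open>Re g\<close>, so that the increasing monomials in the dual of a real
  \<open>Re g\<close>-orthonormal basis are orthonormal. In coordinates that are unitary for \<open>g\<close> each
  \<open>d\<close>\<open>z\<close>-bar has squared norm 2, which makes the Laplacian below half the Riemannian one for the
  trivial bundle.
\<close>

definition pointwise_inner ::
    "'a::complex_euclidean torus \<Rightarrow> 'a line_bundle \<Rightarrow> nat \<Rightarrow> 'a form \<Rightarrow> 'a form \<Rightarrow> 'a \<Rightarrow> complex" where
  "pointwise_inner T L k \<phi> \<psi> z =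
     (\<Sum>es | length es = k \<and> set es \<subseteq> onb T. fibre_metric L z (\<phi> z es) (\<psi> z es)) / fact k"

definition L2_inner ::
    "'a::complex_euclidean torus \<Rightarrow> 'a line_bundle \<Rightarrow> nat \<Rightarrow> 'a form \<Rightarrow> 'a form \<Rightarrow> complex" where
  "L2_inner T L k \<phi> \<psi> = torus_integral T (pointwise_inner T L k \<phi> \<psi>)"

definition dbar_adjoint ::
    "'a::complex_euclidean torus \<Rightarrow> 'a line_bundle \<Rightarrow> nat \<Rightarrow> 'a form \<Rightarrow> 'a form" where
  "dbar_adjoint T L k \<phi> = (if k = 0 then 0 else
     (THE \<psi>. \<psi> \<in> bundle_forms T L (k - 1) \<and>
        (\<forall>\<eta>\<in>bundle_forms T L (k - 1). L2_inner T L k (dbar T \<eta>) \<phi> = L2_inner T L (k - 1) \<eta> \<psi>)))"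

definition dolbeault_laplacian ::
    "'a::complex_euclidean torus \<Rightarrow> 'a line_bundle \<Rightarrow> nat \<Rightarrow> 'a form \<Rightarrow> 'a form" where
  "dolbeault_laplacian T L k \<phi> =
     dbar T (dbar_adjoint T L k \<phi>) + dbar_adjoint T L (Suc k) (dbar T \<phi>)"

definition form_scale :: "complex \<Rightarrow> 'a form \<Rightarrow> 'a form" where
  "form_scale c \<phi> = (\<lambda>z vs. c * \<phi> z vs)"

global_interpretation form_space: vector_space "form_scale :: complex \<Rightarrow> 'a form \<Rightarrow> 'a form"
  by standard (simp_all add: form_scale_def fun_eq_iff algebra_simps)

definition eigenspace ::
    "'a::complex_euclidean torus \<Rightarrow> 'a line_bundle \<Rightarrow> nat \<Rightarrow> complex \<Rightarrow> 'a form set" where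
  "eigenspace T L k \<mu> =
     {\<phi> \<in> bundle_forms T L k. dolbeault_laplacian T L k \<phi> = form_scale \<mu> \<phi>}"

definition dolbeault_spectrum ::
    "'a::complex_euclidean torus \<Rightarrow> 'a line_bundle \<Rightarrow> nat \<Rightarrow> complex set" where
  "dolbeault_spectrum T L k = {\<mu>. \<exists>\<phi>\<in>eigenspace T L k \<mu>. \<phi> \<noteq> 0}"

definition multiplicity_of ::
    "'a::complex_euclidean torus \<Rightarrow> 'a line_bundle \<Rightarrow> nat \<Rightarrow> complex \<Rightarrow> enat" where
  "multiplicity_of T L k \<mu> =
     (if \<exists>B. finite B \<and> eigenspace T L k \<mu> \<subseteq> form_space.span B
      then enat (form_space.dim (eigenspace T L k \<mu>)) else \<infinity>)"

end

(*
  Choose a complex-linear section of V -> V'' with values in the g-orthogonal complement of V'. It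
  identifies V' x V'' with V isometrically and compatibly with the curvature forms, but maps neither
  lattice to the other and does not match the multipliers. Both kinds of defect lie in the directions
  of V', where the bundles are flat, and there they can be absorbed.

  On either side, translations by real multiples of vectors of V' act on forms in a frame in which
  they commute with the Dolbeault operator and its adjoint, and a basis of U' acts by the characters
  alpha. Hence each eigenspace is graded by the linear functionals c on V' with exp(2 pi i c(u)) = alpha(u)
  for u in U', the c-part being the forms with phi(z + v) = exp(2 pi i c(v)) phi(z) for all v in V'.
  The same c occur on both sides. On a c-part the defects above become a character of U'', up to
  the ratio of alpha and beta; since Im H is nondegenerate on V'' this character is
  exp(2 pi i Im H(a, .)) for some a, and pulling back along the translation by a, twisted by
  exp(-pi H(z, a)), removes it. So the c-parts of the eigenspaces are isomorphic, for every c.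

  Eigenspaces only have to be compared as algebraic objects, so no ellipticity is used: a
  finite-dimensional eigenspace is the direct sum of its c-parts, and an eigenform vanishes when all
  its Fourier components do.
*)

theory Submission
  imports Defs
begin

text \<open>The twist by exp(- pi H(z,a)) comes from completing the square: translation by a changes
  the weight exponent - pi H(z,z) by - 2 pi Re H(z,a) - pi H(a,a), and the holomorphic factor
  absorbs the cross term. What remains is constant, so twisted translations commute with both
  operators, also for a outside the lattice. The price is their commutator with a lattice vector u,
  the phase exp(2 pi i Im H(a,u)), and this is the supply of characters. For a in V' the phase is
  trivial, which is why all real kernel translations act on sections. The equation for a contains c,
  so no single isometry of bundles arises and the parts are matched one by one, each with its own
  translation. The obstacle is that the adjoint is given only by its L2 property, through
  arbitrarily chosen orthonormal and lattice bases. Before anything can be transported it has to be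
  identified with an explicit first-order operator. This takes integration by parts on the quotient,
  the independence of a trace from the orthonormal basis, and definiteness of the product on smooth
  forms.\<close>

section \<open>Discrete subgroups of a Euclidean space and their bases\<close>

text \<open>Coordinates along \<open>B\<close> are wanted as total linear functions on the ambient
  space, so that continuity and measurability are immediate even when \<open>B\<close> spans a
  proper subspace.\<close>

lemma dual_functionals:
  fixes B :: "'a::real_vector set"
  assumes "finite B" "independent B"
  obtains \<tau> :: "'a \<Rightarrow> 'a \<Rightarrow> real" where "\<And>b. linear (\<tau> b)"
    "\<And>b c. b \<in> B \<Longrightarrow> c \<in> B \<Longrightarrow> \<tau> b c = (if b = c then 1 else 0)"
    "\<And>z. z \<in> span B \<Longrightarrow> z = (\<Sum>b\<in>B. \<tau> b z *\<^sub>R b)"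
proof -
  have "\<forall>b. \<exists>f :: 'a \<Rightarrow> real. linear f \<and> (\<forall>c\<in>B. f c = (if b = c then 1 else 0))"
  proof
    fix b
    show "\<exists>f :: 'a \<Rightarrow> real. linear f \<and> (\<forall>c\<in>B. f c = (if b = c then 1 else 0))"
      using real_vector.linear_independent_extend[OF assms(2), of "\<lambda>c. if b = c then 1 else 0"] .
  qed
  then have "\<exists>\<tau> :: 'a \<Rightarrow> 'a \<Rightarrow> real. \<forall>b. linear (\<tau> b) \<and> (\<forall>c\<in>B. \<tau> b c = (if b = c then 1 else 0))"
    by (rule choice)
  then obtain \<tau> :: "'a \<Rightarrow> 'a \<Rightarrow> real" where lin: "\<And>b. linear (\<tau> b)"
    and del: "\<And>b c. c \<in> B \<Longrightarrow> \<tau> b c = (if b = c then 1 else 0)"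
    by blast
  have "z = (\<Sum>b\<in>B. \<tau> b z *\<^sub>R b)" if "z \<in> span B" for z
  proof -
    obtain u where u: "z = (\<Sum>b\<in>B. u b *\<^sub>R b)"
      using \<open>z \<in> span B\<close> by (auto simp: span_finite[OF assms(1)])
    have "\<tau> b z = u b" if "b \<in> B" for b
    proof -
      have "\<tau> b z = (\<Sum>c\<in>B. u c * \<tau> b c)"
        unfolding u by (simp add: linear_sum[OF lin] linear_scale[OF lin])
      also have "\<dots> = (\<Sum>c\<in>B. if b = c then u c else 0)"
        by (rule sum.cong) (auto simp: del)
      finally show ?thesis using assms(1) that by simp
    qed
    then show ?thesis using u by simp
  qed
  then show ?thesis using that lin del by blast
qed

text \<open>A subgroup is homogeneous: the difference of two close points is a short vector of the
  subgroup, so a gap around 0 is a uniform gap.\<close>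

lemma discrete_subgroup_iff:
  fixes \<Lambda> :: "'a::euclidean_space set"
  assumes "int_module.subspace \<Lambda>"
  shows "uniform_discrete \<Lambda> \<longleftrightarrow> (\<exists>e>0. \<forall>x\<in>\<Lambda>. norm x < e \<longrightarrow> x = 0)"
proof
  assume "uniform_discrete \<Lambda>"
  then obtain e where "e > 0" "\<forall>x\<in>\<Lambda>. \<forall>y\<in>\<Lambda>. dist x y < e \<longrightarrow> x = y"
    by (auto simp: uniform_discrete_def)
  then have "\<forall>x\<in>\<Lambda>. norm x < e \<longrightarrow> x = 0"
    using int_module.subspace_0[OF assms] by (metis dist_0_norm dist_commute)
  with \<open>e > 0\<close> show "\<exists>e>0. \<forall>x\<in>\<Lambda>. norm x < e \<longrightarrow> x = 0" by blast
next
  assume "\<exists>e>0. \<forall>x\<in>\<Lambda>. norm x < e \<longrightarrow> x = 0"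
  then obtain e where "e > 0" "\<forall>x\<in>\<Lambda>. norm x < e \<longrightarrow> x = 0" by blast
  then have "\<forall>x\<in>\<Lambda>. \<forall>y\<in>\<Lambda>. dist x y < e \<longrightarrow> x = y"
    using int_module.subspace_diff[OF assms] by (metis dist_norm eq_iff_diff_eq_0)
  with \<open>e > 0\<close> show "uniform_discrete \<Lambda>" by (auto simp: uniform_discrete_def)
qed

text \<open>A lattice is only required to have isolated points. Finiteness in bounded sets rests on
  the uniform version, which homogeneity provides.\<close>

lemma discrete_subgroup_uniform:
  fixes \<Lambda> :: "'a::euclidean_space set"
  assumes "int_module.subspace \<Lambda>" "discrete \<Lambda>"
  shows "uniform_discrete \<Lambda>"
proof -
  have "0 isolated_in \<Lambda>"
    using assms int_module.subspace_0 discreteD by blast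
  then obtain e where "e > 0" "\<forall>x\<in>\<Lambda>. dist 0 x < e \<longrightarrow> x = 0"
    unfolding isolated_in_dist_Ex_iff by blast
  then show ?thesis unfolding discrete_subgroup_iff[OF assms(1)] by auto
qed

lemma int_span_subset_span: "int_module.span B \<subseteq> span (B :: 'a::real_vector set)"
proof
  fix x assume "x \<in> int_module.span B"
  then show "x \<in> span B"
    by (induct rule: int_module.span_induct_alt) (auto intro: span_add span_scale span_base span_zero)
qed

lemma int_span_finite:
  fixes B :: "'a::real_vector set"
  assumes "finite B"
  shows "int_module.span B = range (\<lambda>u. \<Sum>v\<in>B. of_int (u v) *\<^sub>R v)"
  using int_module.span_finite[OF assms] by simp

lemma lattice_basis_subset: "lattice_basis \<Lambda> B \<Longrightarrow> B \<subseteq> \<Lambda>"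
  unfolding lattice_basis_def using int_module.span_superset by blast

lemma lattice_basis_span: "lattice_basis \<Lambda> B \<Longrightarrow> span B = span \<Lambda>"
  using lattice_basis_subset[of \<Lambda> B] int_span_subset_span[of B]
  by (metis lattice_basis_def span_mono span_span subset_antisym)

lemma finite_discrete_bounded:
  "uniform_discrete \<Lambda> \<Longrightarrow> bounded S \<Longrightarrow> finite (\<Lambda> \<inter> (S :: 'a::euclidean_space set))"
  by (metis bounded_subset inf_le1 inf_le2 uniform_discrete_finite_iff uniform_discrete_subset)

lemma bounded_parallelotope:
  fixes B :: "'a::real_normed_vector set"
  assumes "finite B"
  shows "bounded {\<Sum>b\<in>B. t b *\<^sub>R b | t. \<forall>b\<in>B. \<bar>t b\<bar> \<le> (1::real)}"
proof (rule boundedI)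
  fix x assume "x \<in> {\<Sum>b\<in>B. t b *\<^sub>R b | t. \<forall>b\<in>B. \<bar>t b\<bar> \<le> (1::real)}"
  then obtain t where t: "x = (\<Sum>b\<in>B. t b *\<^sub>R b)" "\<forall>b\<in>B. \<bar>t b\<bar> \<le> 1" by blast
  have "norm x \<le> (\<Sum>b\<in>B. norm (t b *\<^sub>R b))" unfolding t by (rule norm_sum)
  also have "\<dots> \<le> (\<Sum>b\<in>B. norm b)"
    using t(2) by (intro sum_mono) (simp add: mult_left_le_one_le)
  finally show "norm x \<le> (\<Sum>b\<in>B. norm b)" .
qed

text \<open>Pigeonhole: if \<open>b\<close> depends linearly on a real basis \<open>C \<subseteq> B\<close>, two multiples of \<open>b\<close> have the same
  remainder in the parallelotope of \<open>C\<close>, which gives an integral relation.\<close>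

lemma lattice_basis_independent:
  fixes \<Lambda> :: "'a::euclidean_space set"
  assumes "lattice_basis \<Lambda> B" "uniform_discrete \<Lambda>"
  shows "independent B"
proof (rule ccontr)
  assume dep: "\<not> independent B"
  have fin: "finite B" and ind: "int_module.independent B" and sp: "int_module.span B = \<Lambda>"
    using assms by (auto simp: lattice_basis_def)
  obtain C where C: "C \<subseteq> B" "independent C" "B \<subseteq> span C"
    using maximal_independent_subset[of B] by blast
  then obtain b where b: "b \<in> B" "b \<notin> C" using dep by (metis subset_antisym subsetI)
  have finC: "finite C" using C(1) fin finite_subset by blast
  obtain t where t: "b = (\<Sum>c\<in>C. t c *\<^sub>R c)"
    using b C by (auto simp: span_finite[OF finC])
  define y where "y m = (\<Sum>c\<in>C. frac (real m * t c) *\<^sub>R c)" for m :: nat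
  have y_eq: "y m = real m *\<^sub>R b - (\<Sum>c\<in>C. of_int \<lfloor>real m * t c\<rfloor> *\<^sub>R c)" for m
    unfolding y_def t frac_def by (simp add: scaleR_sum_right sum_subtractf algebra_simps)
  have "y m \<in> \<Lambda>" for m
  proof -
    have "of_int (int m) *\<^sub>R b - (\<Sum>c\<in>C. of_int \<lfloor>real m * t c\<rfloor> *\<^sub>R c) \<in> int_module.span B"
      using b C(1)
      by (intro int_module.span_diff int_module.span_sum int_module.span_scale int_module.span_base) auto
    then show ?thesis unfolding y_eq sp[symmetric] by simp
  qed
  moreover have "y m \<in> {\<Sum>c\<in>C. t c *\<^sub>R c | t. \<forall>c\<in>C. \<bar>t c\<bar> \<le> (1::real)}" for m
    unfolding y_def by (rule CollectI, rule exI[of _ "\<lambda>c. frac (real m * t c)"]) (simp add: less_imp_le[OF frac_lt_1])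
  ultimately have "finite (range y)"
    using finite_discrete_bounded[OF assms(2) bounded_parallelotope[OF finC]]
    by (meson IntI finite_subset image_subsetI)
  then have "\<not> inj y" using finite_imageD infinite_UNIV_nat by blast
  then obtain m n where mn: "y m = y n" "m \<noteq> n" by (auto simp: inj_def)
  \<comment> \<open>The difference of the two expressions for \<open>y m = y n\<close> in
    \<open>y_eq\<close>; the coefficient of \<open>b\<close> is m - n, hence nonzero.\<close>
  define u where "u c = (if c = b then int m - int n else \<lfloor>real n * t c\<rfloor> - \<lfloor>real m * t c\<rfloor>)" for c
  have "(\<Sum>c\<in>insert b C. of_int (u c) *\<^sub>R c) =
      of_int (int m - int n) *\<^sub>R b + (\<Sum>c\<in>C. of_int (\<lfloor>real n * t c\<rfloor> - \<lfloor>real m * t c\<rfloor>) *\<^sub>R c)"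
    using finC b(2) by (auto simp: u_def intro!: sum.cong)
  also have "\<dots> = 0"
    using mn(1) unfolding y_eq by (simp add: algebra_simps sum_subtractf)
  finally have rel: "(\<Sum>c\<in>insert b C. of_int (u c) *\<^sub>R c) = 0" .
  have "u b \<noteq> 0" using mn(2) by (simp add: u_def)
  with rel have "int_module.dependent B"
    unfolding int_module.dependent_explicit
    using finC b(1) C(1) by (intro exI[of _ "insert b C"] exI[of _ u] conjI bexI[of _ b]) simp_all
  with ind show False by blast
qed

lemma independent_imp_int_independent:
  assumes "independent (B :: 'a::real_vector set)"
  shows "int_module.independent B"
proof
  assume "int_module.dependent B"
  then obtain t u v where tu: "finite t" "t \<subseteq> B" "(\<Sum>v\<in>t. of_int (u v) *\<^sub>R v) = 0" "v \<in> t" "u v \<noteq> 0"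
    unfolding int_module.dependent_explicit by blast
  then have "of_int (u v) = (0::real)"
    using independentD[OF assms, of t "\<lambda>v. of_int (u v)"] by blast
  with tu show False by simp
qed

text \<open>Minkowski: extend a basis of \<open>\<Lambda> \<inter> span S\<close> by an element with the smallest positive value of a
  functional that vanishes on \<open>S\<close>.\<close>

lemma discrete_subgroup_basis_aux:
  fixes \<Lambda> :: "'a::euclidean_space set"
  assumes \<Lambda>: "int_module.subspace \<Lambda>" "uniform_discrete \<Lambda>"
    and "finite S" "independent S" "S \<subseteq> \<Lambda>"
  shows "\<exists>B. finite B \<and> independent B \<and> int_module.span B = \<Lambda> \<inter> span S"
  using assms(3-)
proof (induct S rule: finite_induct)
  case empty
  have "0 \<in> \<Lambda>" using int_module.subspace_0[OF \<Lambda>(1)] .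
  then show ?case by (intro exI[of _ "{}"]) (simp add: independent_empty)
next
  case (insert v S)
  have indS: "independent S" and vS: "v \<notin> span S" and v\<Lambda>: "v \<in> \<Lambda>"
    using insert by (auto simp: independent_insert)
  then obtain B where B: "finite B" "independent B" "int_module.span B = \<Lambda> \<inter> span S"
    using insert by auto
  have BS: "B \<subseteq> \<Lambda> \<inter> span S" using B(3) int_module.span_superset by blast
  have "S \<subseteq> span B"
    using B(3) insert(5) int_span_subset_span[of B] span_superset[of S] by auto
  then have spB: "span B = span S"
    using BS by (intro subset_antisym span_minimal) auto
  obtain \<tau> :: "'a \<Rightarrow> real" where \<tau>: "linear \<tau>" "\<tau> v = 1" "\<And>s. s \<in> span S \<Longrightarrow> \<tau> s = 0"
  proof -
    obtain f :: "'a \<Rightarrow> real" where f: "linear f" "\<forall>x\<in>insert v S. f x = (if x = v then 1 else 0)"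
      using real_vector.linear_independent_extend[OF insert(4), of "\<lambda>x. if x = v then 1 else 0"] by auto
    have "f s = 0" if "s \<in> span S" for s
      using that by (rule linear_eq_0_on_span[OF f(1), rotated]) (use f(2) insert(2) in auto)
    with f show thesis by (intro that[of f]) auto
  qed
  define Q where "Q = {\<Sum>b\<in>B. t b *\<^sub>R b | t. \<forall>b\<in>B. \<bar>t b\<bar> \<le> (1::real)}"
  have bQ: "bounded Q" unfolding Q_def by (rule bounded_parallelotope[OF B(1)])
  \<comment> \<open>A bounded region that meets the class, modulo the lattice of \<open>B\<close>,
    of every vector of the larger span whose \<tau>-value lies in [0,1]. Only finitely many lattice
    points lie in it, so a smallest positive \<tau>-value exists.\<close>
  define R where "R = {q + r *\<^sub>R v | q r. q \<in> Q \<and> 0 \<le> r \<and> r \<le> (1::real)}"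
  have bR: "bounded R"
  proof -
    have bv: "bounded ((\<lambda>r::real. r *\<^sub>R v) ` {0..1})"
      by (intro compact_imp_bounded compact_continuous_image continuous_intros) auto
    have "R \<subseteq> (\<Union>q\<in>Q. \<Union>c\<in>(\<lambda>r::real. r *\<^sub>R v) ` {0..1}. {q + c})"
    proof
      fix x assume "x \<in> R"
      then obtain q r where "x = q + r *\<^sub>R v" "q \<in> Q" "0 \<le> r" "r \<le> 1" unfolding R_def by blast
      then show "x \<in> (\<Union>q\<in>Q. \<Union>c\<in>(\<lambda>r::real. r *\<^sub>R v) ` {0..1}. {q + c})"
        by (intro UN_I[of q Q] UN_I[of "r *\<^sub>R v" "(\<lambda>r. r *\<^sub>R v) ` {0..1}"]) (auto intro: imageI)
    qed
    then show ?thesis by (rule bounded_subset[OF bounded_sums[OF bQ bv]])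
  qed
  define Y where "Y = {x \<in> \<Lambda> \<inter> R. \<tau> x > 0}"
  have "finite Y"
    using finite_discrete_bounded[OF \<Lambda>(2) bR] by (rule rev_finite_subset) (auto simp: Y_def)
  have Qspan: "q \<in> span S" if "q \<in> Q" for q
    using that unfolding Q_def spB[symmetric] by (auto intro: span_sum span_scale span_base)
  \<comment> \<open>Removing the integer parts of the \<open>B\<close>-coordinates leaves \<tau>
    unchanged, because \<tau> vanishes on \<open>span S\<close>.\<close>
  have reduce: "\<exists>y\<in>int_module.span B. x - y \<in> R \<and> \<tau> (x - y) = \<tau> x"
    if x: "x \<in> span (insert v S)" "0 \<le> \<tau> x" "\<tau> x \<le> 1" for x
  proof -
    obtain k where "x - k *\<^sub>R v \<in> span S" using x(1) by (auto simp: span_insert)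
    moreover have "k = \<tau> x"
      using \<tau>(3)[OF calculation] \<tau>(1,2) by (simp add: linear_diff linear_scale)
    ultimately obtain t where t: "x - \<tau> x *\<^sub>R v = (\<Sum>b\<in>B. t b *\<^sub>R b)"
      unfolding spB[symmetric] by (auto simp: span_finite[OF B(1)])
    define y where "y = (\<Sum>b\<in>B. of_int \<lfloor>t b\<rfloor> *\<^sub>R b)"
    have y: "y \<in> int_module.span B"
      unfolding y_def by (intro int_module.span_sum int_module.span_scale int_module.span_base)
    have "x - y = (\<Sum>b\<in>B. frac (t b) *\<^sub>R b) + \<tau> x *\<^sub>R v"
      using t unfolding y_def frac_def by (simp add: sum_subtractf algebra_simps)
    moreover have "(\<Sum>b\<in>B. frac (t b) *\<^sub>R b) \<in> Q"
      unfolding Q_def by (rule CollectI, rule exI[of _ "\<lambda>b. frac (t b)"]) (simp add: less_imp_le[OF frac_lt_1])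
    ultimately have "x - y \<in> R"
      unfolding R_def using x(2,3) by blast
    moreover have "\<tau> y = 0" using y B(3) \<tau>(3) by blast
    ultimately show ?thesis using y \<tau>(1) by (auto simp: linear_diff)
  qed
  have B\<Lambda>: "int_module.span B \<subseteq> \<Lambda>" using B(3) by blast
  have "Y \<noteq> {}"
  proof -
    obtain y where y: "y \<in> int_module.span B" "v - y \<in> R" "\<tau> (v - y) = \<tau> v"
      using reduce[of v] \<tau>(2) by (auto intro: span_base)
    then have "v - y \<in> Y"
      using v\<Lambda> B\<Lambda> \<tau>(2) int_module.subspace_diff[OF \<Lambda>(1)] by (auto simp: Y_def)
    then show ?thesis by blast
  qed
  define x0 where "x0 = arg_min_on \<tau> Y"
  have x0: "x0 \<in> Y" and x0_min: "\<And>y. y \<in> Y \<Longrightarrow> \<tau> x0 \<le> \<tau> y"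
    unfolding x0_def using arg_min_if_finite(1)[OF \<open>finite Y\<close> \<open>Y \<noteq> {}\<close>]
      arg_min_least[OF \<open>finite Y\<close> \<open>Y \<noteq> {}\<close>] by auto
  have x0\<Lambda>: "x0 \<in> \<Lambda>" and x0pos: "\<tau> x0 > 0" using x0 by (auto simp: Y_def)
  have x0R: "x0 \<in> span (insert v S)"
  proof -
    obtain q r where qr: "q \<in> Q" "x0 = q + r *\<^sub>R v" using x0 unfolding Y_def R_def by blast
    have "span S \<subseteq> span (insert v S)" by (rule span_mono) auto
    then have "q \<in> span (insert v S)" using Qspan[OF qr(1)] by blast
    then show ?thesis unfolding qr(2) by (rule span_add[OF _ span_scale[OF span_base]]) simp
  qed
  have x0le: "\<tau> x0 \<le> 1"
  proof -
    have "x0 \<in> R" using x0 by (simp add: Y_def)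
    then obtain q r where "q \<in> Q" "x0 = q + r *\<^sub>R v" "r \<le> 1" unfolding R_def by blast
    then show ?thesis using Qspan \<tau> by (simp add: linear_add linear_scale)
  qed
  have "int_module.span (insert x0 B) = \<Lambda> \<inter> span (insert v S)"
  proof (intro subset_antisym subsetI IntI)
    fix x assume x: "x \<in> int_module.span (insert x0 B)"
    show "x \<in> \<Lambda>" using x BS x0\<Lambda> int_module.span_minimal[OF _ \<Lambda>(1), of "insert x0 B"] by auto
    have "insert x0 B \<subseteq> span (insert v S)"
      using x0R BS span_mono[of S "insert v S"] by auto
    then show "x \<in> span (insert v S)"
      using x int_span_subset_span[of "insert x0 B"] span_minimal[of "insert x0 B"] by auto
  next
    fix x assume x: "x \<in> \<Lambda> \<inter> span (insert v S)"
    \<comment> \<open>Division with remainder by \<open>\<tau> x0\<close>. A nonzero remainder,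
      reduced into \<open>R\<close>, would undercut the minimal value.\<close>
    define q where "q = \<lfloor>\<tau> x / \<tau> x0\<rfloor>"
    define x' where "x' = x - of_int q *\<^sub>R x0"
    have x'\<Lambda>: "x' \<in> \<Lambda>"
      unfolding x'_def using x x0\<Lambda> \<Lambda>(1) by (intro int_module.subspace_diff int_module.subspace_scale) auto
    have x'S: "x' \<in> span (insert v S)"
      unfolding x'_def using x x0R by (intro span_diff span_scale) auto
    have \<tau>x': "\<tau> x' = \<tau> x - of_int q * \<tau> x0"
      unfolding x'_def using \<tau>(1) by (simp add: linear_diff linear_scale)
    have "of_int q \<le> \<tau> x / \<tau> x0" "\<tau> x / \<tau> x0 < of_int q + 1"
      unfolding q_def by linarith+
    then have r: "0 \<le> \<tau> x'" "\<tau> x' < \<tau> x0"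
      unfolding \<tau>x' using x0pos by (auto simp: field_simps)
    obtain y where y: "y \<in> int_module.span B" "x' - y \<in> R" "\<tau> (x' - y) = \<tau> x'"
      using reduce[OF x'S] r x0le by auto
    have "\<tau> x' = 0"
    proof (rule ccontr)
      assume "\<tau> x' \<noteq> 0"
      then have "x' - y \<in> Y"
        using y r x'\<Lambda> B\<Lambda> int_module.subspace_diff[OF \<Lambda>(1)] by (auto simp: Y_def)
      then show False using x0_min y(3) r by fastforce
    qed
    moreover obtain k where "x' - k *\<^sub>R v \<in> span S" using x'S by (auto simp: span_insert)
    moreover from this have "k = \<tau> x'"
      using \<tau>(3) \<tau>(1,2) by (fastforce simp: linear_diff linear_scale)
    ultimately have "x' \<in> span S" by simp
    then have "x' \<in> int_module.span B" using x'\<Lambda> B(3) by blast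
    then have "x' \<in> int_module.span (insert x0 B)"
      using int_module.span_mono[of B "insert x0 B"] by blast
    then have "x' + of_int q *\<^sub>R x0 \<in> int_module.span (insert x0 B)"
      by (rule int_module.span_add[OF _ int_module.span_scale[OF int_module.span_base]]) simp
    then show "x \<in> int_module.span (insert x0 B)" unfolding x'_def by simp
  qed
  moreover have "independent (insert x0 B)"
    using B(2) \<tau>(3)[of x0] x0pos spB by (intro independent_insertI) auto
  ultimately show ?case using B(1) by blast
qed

lemma discrete_subgroup_basis:
  fixes \<Lambda> :: "'a::euclidean_space set"
  assumes "int_module.subspace \<Lambda>" "uniform_discrete \<Lambda>"
  shows "\<exists>B. lattice_basis \<Lambda> B"
proof -
  obtain S where S: "S \<subseteq> \<Lambda>" "independent S" "\<Lambda> \<subseteq> span S"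
    using maximal_independent_subset[of \<Lambda>] by blast
  then obtain B where "finite B" "independent B" "int_module.span B = \<Lambda> \<inter> span S"
    using discrete_subgroup_basis_aux[OF assms independent_imp_finite[OF S(2)] S(2,1)] by blast
  then have "lattice_basis \<Lambda> B"
    using S(3) independent_imp_int_independent[of B] unfolding lattice_basis_def by (simp add: Int_absorb2)
  then show ?thesis ..
qed

section \<open>Real-linear maps on a subspace\<close>

lemma complex_subspace_imp_subspace:
  "complex_space.subspace W \<Longrightarrow> subspace (W :: 'a::complex_euclidean set)"
  unfolding complex_space.subspace_def subspace_def by (metis scaleC_of_real)

lemma complex_linear_imp_linear:
  fixes f :: "'a::complex_euclidean \<Rightarrow> 'b::complex_euclidean"
  assumes "Vector_Spaces.linear scaleC scaleC f"
  shows "linear f"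
proof -
  interpret f: Vector_Spaces.linear scaleC scaleC f by fact
  show ?thesis by (rule linearI) (auto simp: f.add f.scale simp flip: scaleC_of_real)
qed

text \<open>Linearity is asked on \<open>W\<close> only, because the forms on the quotient space are
  prescribed only on the range of the projection and may be arbitrary elsewhere.\<close>

definition rlinear_on :: "'a::real_vector set \<Rightarrow> ('a \<Rightarrow> 'b::real_vector) \<Rightarrow> bool" where
  "rlinear_on W f \<longleftrightarrow> (\<forall>x\<in>W. \<forall>y\<in>W. f (x + y) = f x + f y) \<and> (\<forall>r. \<forall>x\<in>W. f (r *\<^sub>R x) = r *\<^sub>R f x)"

lemma rlinear_onI:
  assumes "\<And>x y. x \<in> W \<Longrightarrow> y \<in> W \<Longrightarrow> f (x + y) = f x + f y"
    and "\<And>r x. x \<in> W \<Longrightarrow> f (r *\<^sub>R x) = r *\<^sub>R f x"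
  shows "rlinear_on W f"
  using assms by (simp add: rlinear_on_def)

lemma rlinear_on_add: "rlinear_on W f \<Longrightarrow> x \<in> W \<Longrightarrow> y \<in> W \<Longrightarrow> f (x + y) = f x + f y"
  and rlinear_on_scale: "rlinear_on W f \<Longrightarrow> x \<in> W \<Longrightarrow> f (r *\<^sub>R x) = r *\<^sub>R f x"
  by (auto simp: rlinear_on_def)

lemma rlinear_on_0: "rlinear_on W f \<Longrightarrow> subspace W \<Longrightarrow> f 0 = 0"
  using rlinear_on_scale[of W f 0 0] subspace_0 by auto

lemma rlinear_on_sum:
  assumes "rlinear_on W f" "subspace W" "finite I" "\<And>i. i \<in> I \<Longrightarrow> x i \<in> W"
  shows "f (\<Sum>i\<in>I. c i *\<^sub>R x i) = (\<Sum>i\<in>I. c i *\<^sub>R f (x i))"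
  using assms(3,4)
proof (induct I rule: finite_induct)
  case empty
  then show ?case using rlinear_on_0[OF assms(1,2)] by simp
next
  case (insert i I)
  then have "(\<Sum>i\<in>I. c i *\<^sub>R x i) \<in> W" "c i *\<^sub>R x i \<in> W"
    by (auto intro!: subspace_sum subspace_scale assms(2))
  with insert show ?case
    using rlinear_on_add[OF assms(1)] rlinear_on_scale[OF assms(1)] by simp
qed

text \<open>Gives access to facts about globally linear maps, such as continuity and boundedness,
  from which the statements on \<open>W\<close> are read off.\<close>

lemma rlinear_on_extend:
  fixes f :: "'a::real_vector \<Rightarrow> 'b::real_vector"
  assumes "rlinear_on W f" "subspace W"
  obtains F where "linear F" "\<And>x. x \<in> W \<Longrightarrow> F x = f x"
proof -
  obtain B where B: "B \<subseteq> W" "independent B" "W \<subseteq> span B"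
    using maximal_independent_subset[of W] by blast
  obtain F where F: "linear F" "\<forall>x\<in>B. F x = f x"
    using real_vector.linear_independent_extend[OF B(2), of f] by (auto simp: linear_def)
  have "x \<in> W \<and> F x = f x" if "x \<in> span B" for x
    using that
  proof (induct rule: span_induct_alt)
    case base
    then show ?case
      using rlinear_on_0[OF assms] linear_0[OF F(1)] subspace_0[OF assms(2)] by simp
  next
    case (step c x y)
    then have "x \<in> W" "y \<in> W" "c *\<^sub>R x \<in> W" using B(1) assms(2) by (auto intro: subspace_scale)
    with step show ?case
      using F assms by (auto simp: linear_add[OF F(1)] linear_scale[OF F(1)] rlinear_on_add rlinear_on_scale
          intro: subspace_add)
  qed
  then show ?thesis using that F(1) B(3) by blast
qed

lemma rlinear_on_continuous:
  fixes f :: "'a::euclidean_space \<Rightarrow> 'b::real_normed_vector"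
  assumes "rlinear_on W f" "subspace W"
  shows "continuous_on W f"
proof -
  obtain F where F: "linear F" "\<And>x. x \<in> W \<Longrightarrow> F x = f x"
    using rlinear_on_extend[OF assms] by blast
  have "continuous_on W F" using F(1) by (simp add: linear_continuous_on linear_conv_bounded_linear)
  then show ?thesis using F(2) continuous_on_cong by blast
qed


section \<open>Smooth functions on subspaces\<close>

lemma dir_deriv_eqI:
  "((\<lambda>t. f (z + t *\<^sub>R v)) has_vector_derivative D) (at 0) \<Longrightarrow> dir_deriv v f z = D"
  unfolding dir_deriv_def by (rule vector_derivative_at)

lemma line_in_subspace: "subspace W \<Longrightarrow> z \<in> W \<Longrightarrow> v \<in> W \<Longrightarrow> z + t *\<^sub>R v \<in> W"
  by (simp add: subspace_add subspace_scale)

lemma dir_deriv_cong: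
  assumes "subspace W" "z \<in> W" "v \<in> W" "\<And>z. z \<in> W \<Longrightarrow> f z = g z"
  shows "dir_deriv v f z = dir_deriv v g z"
proof -
  have "(\<lambda>t. f (z + t *\<^sub>R v)) = (\<lambda>t. g (z + t *\<^sub>R v))"
    using assms line_in_subspace by fastforce
  then show ?thesis by (simp add: dir_deriv_def)
qed

lemma Ck_on_continuous: "Ck_on m W f \<Longrightarrow> continuous_on W f"
  by (cases m) auto

lemma Ck_on_has_dir_deriv:
  assumes "Ck_on (Suc m) W f" "z \<in> W" "v \<in> W"
  shows "((\<lambda>t. f (z + t *\<^sub>R v)) has_vector_derivative dir_deriv v f z) (at 0)"
  using assms unfolding dir_deriv_def by (simp add: vector_derivative_works[symmetric])

text \<open>The definition of \<open>Ck_on\<close> differentiates at parameter 0 only; moving the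
  base point along the line yields every other parameter.\<close>

lemma Ck_on_has_dir_deriv_at:
  assumes "Ck_on (Suc m) W f" "z \<in> W" "v \<in> W" "subspace W"
  shows "((\<lambda>t. f (z + t *\<^sub>R v)) has_vector_derivative dir_deriv v f (z + t *\<^sub>R v)) (at t within S)"
proof -
  have "((\<lambda>s. f ((z + t *\<^sub>R v) + s *\<^sub>R v)) has_vector_derivative dir_deriv v f (z + t *\<^sub>R v)) (at (t - t))"
    using Ck_on_has_dir_deriv[OF assms(1) line_in_subspace[OF assms(4,2,3)] assms(3)] by simp
  then have "(((\<lambda>s. f ((z + t *\<^sub>R v) + s *\<^sub>R v)) \<circ> (\<lambda>s. s - t)) has_vector_derivative
      1 *\<^sub>R dir_deriv v f (z + t *\<^sub>R v)) (at t)"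
    by (intro vector_diff_chain_at) (auto intro!: derivative_eq_intros)
  then have "((\<lambda>t. f (z + t *\<^sub>R v)) has_vector_derivative dir_deriv v f (z + t *\<^sub>R v)) (at t)"
    by (simp add: o_def algebra_simps)
  then show ?thesis by (rule has_vector_derivative_at_within)
qed

lemma Ck_on_dir_deriv: "Ck_on (Suc m) W f \<Longrightarrow> v \<in> W \<Longrightarrow> Ck_on m W (dir_deriv v f)"
  by simp

lemma Ck_on_cong:
  assumes "subspace W" "\<And>z. z \<in> W \<Longrightarrow> f z = g z" "Ck_on m W f"
  shows "Ck_on m W g"
  using assms(2,3)
proof (induct m arbitrary: f g)
  case 0
  then show ?case by (simp cong: continuous_on_cong)
next
  case (Suc m)
  have "continuous_on W g" using Suc.prems by (simp cong: continuous_on_cong)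
  moreover have "(\<lambda>t::real. g (z + t *\<^sub>R v)) differentiable (at 0)" if "v \<in> W" "z \<in> W" for v z
  proof -
    have "(\<lambda>t. g (z + t *\<^sub>R v)) = (\<lambda>t. f (z + t *\<^sub>R v))"
      using that line_in_subspace[OF assms(1)] Suc.prems(1) by fastforce
    then show ?thesis using Suc.prems(2) that by simp
  qed
  moreover have "Ck_on m W (dir_deriv v g)" if "v \<in> W" for v
    using Suc.hyps[of "dir_deriv v f" "dir_deriv v g"] Suc.prems(2) that
      dir_deriv_cong[OF assms(1) _ that Suc.prems(1)] by simp
  ultimately show ?case by simp
qed

text \<open>An explicit candidate \<open>D\<close> for the directional derivatives is enough, which
  lets closure properties be proved by induction on the order without rewriting
  \<open>dir_deriv\<close> of a compound function.\<close>

lemma Ck_on_SucI: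
  assumes "subspace W" "continuous_on W f"
    and "\<And>v z. v \<in> W \<Longrightarrow> z \<in> W \<Longrightarrow> ((\<lambda>t. f (z + t *\<^sub>R v)) has_vector_derivative D v z) (at 0)"
    and "\<And>v. v \<in> W \<Longrightarrow> Ck_on m W (D v)"
  shows "Ck_on (Suc m) W f"
proof -
  have "Ck_on m W (dir_deriv v f)" if "v \<in> W" for v
    using assms(4)[OF that] dir_deriv_eqI[OF assms(3)[OF that]] Ck_on_cong[OF assms(1), of "D v" "dir_deriv v f"]
    by simp
  moreover have "(\<lambda>t::real. f (z + t *\<^sub>R v)) differentiable (at 0)" if "v \<in> W" "z \<in> W" for v z
    using assms(3)[OF that] differentiableI_vector by blast
  ultimately show ?thesis using assms(2) by simp
qed

lemma Ck_on_Suc_imp: "Ck_on (Suc m) W f \<Longrightarrow> Ck_on m W f"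
proof (induct m arbitrary: f)
  case (Suc m)
  have "continuous_on W f" "\<forall>v\<in>W. \<forall>z\<in>W. (\<lambda>t. f (z + t *\<^sub>R v)) differentiable at 0"
    "\<forall>v\<in>W. Ck_on (Suc m) W (dir_deriv v f)"
    using Suc.prems by simp_all
  then show ?case using Suc.hyps by (simp del: Ck_on.simps(2) add: Ck_on.simps(2)[of m W f])
qed simp

lemma Ck_on_const:
  assumes "subspace W"
  shows "Ck_on m W (\<lambda>z. c)"
proof (induct m arbitrary: c)
  case (Suc m)
  show ?case by (rule Ck_on_SucI[OF assms, where D="\<lambda>v z. 0"]) (use Suc in auto)
qed simp

lemma Ck_on_add:
  assumes "subspace W" "Ck_on m W f" "Ck_on m W g"
  shows "Ck_on m W (\<lambda>z. f z + g z)"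
  using assms(2,3)
proof (induct m arbitrary: f g)
  case 0
  then show ?case by (auto intro: continuous_intros)
next
  case (Suc m)
  show ?case
  proof (rule Ck_on_SucI[OF assms(1), where D="\<lambda>v z. dir_deriv v f z + dir_deriv v g z"])
    show "continuous_on W (\<lambda>z. f z + g z)"
      using Suc.prems by (auto intro: continuous_intros)
  next
    fix v z assume "v \<in> W" "z \<in> W"
    then show "((\<lambda>t. f (z + t *\<^sub>R v) + g (z + t *\<^sub>R v)) has_vector_derivative
        dir_deriv v f z + dir_deriv v g z) (at 0)"
      by (intro has_vector_derivative_add Ck_on_has_dir_deriv[OF Suc.prems(1)] Ck_on_has_dir_deriv[OF Suc.prems(2)])
  next
    fix v assume "v \<in> W"
    then show "Ck_on m W (\<lambda>z. dir_deriv v f z + dir_deriv v g z)"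
      using Suc.prems by (intro Suc.hyps) auto
  qed
qed

lemma Ck_on_mult:
  assumes "subspace W" "Ck_on m W f" "Ck_on m W g"
  shows "Ck_on m W (\<lambda>z. f z * g z)"
  using assms(2,3)
proof (induct m arbitrary: f g)
  case 0
  then show ?case by (auto intro: continuous_intros)
next
  case (Suc m)
  show ?case
  proof (rule Ck_on_SucI[OF assms(1), where D="\<lambda>v z. f z * dir_deriv v g z + dir_deriv v f z * g z"])
    show "continuous_on W (\<lambda>z. f z * g z)"
      using Suc.prems by (auto intro: continuous_intros)
  next
    fix v z assume *: "v \<in> W" "z \<in> W"
    show "((\<lambda>t. f (z + t *\<^sub>R v) * g (z + t *\<^sub>R v)) has_vector_derivative
        f z * dir_deriv v g z + dir_deriv v f z * g z) (at 0)"
      using has_vector_derivative_mult[OF Ck_on_has_dir_deriv[OF Suc.prems(1) *(2,1)]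
          Ck_on_has_dir_deriv[OF Suc.prems(2) *(2,1)]] by simp
  next
    fix v assume "v \<in> W"
    then show "Ck_on m W (\<lambda>z. f z * dir_deriv v g z + dir_deriv v f z * g z)"
      using Suc.prems by (intro Ck_on_add[OF assms(1)] Suc.hyps Ck_on_Suc_imp[OF Suc.prems(1)]
          Ck_on_Suc_imp[OF Suc.prems(2)] Ck_on_dir_deriv[OF Suc.prems(1)] Ck_on_dir_deriv[OF Suc.prems(2)])
  qed
qed

lemma Ck_on_exp:
  assumes "subspace W" "Ck_on m W f"
  shows "Ck_on m W (\<lambda>z. exp (f z))"
  using assms(2)
proof (induct m arbitrary: f)
  case 0
  then show ?case by (auto intro: continuous_intros)
next
  case (Suc m)
  show ?case
  proof (rule Ck_on_SucI[OF assms(1), where D="\<lambda>v z. dir_deriv v f z * exp (f z)"])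
    show "continuous_on W (\<lambda>z. exp (f z))"
      using Suc.prems by (auto intro: continuous_intros)
  next
    fix v z assume *: "v \<in> W" "z \<in> W"
    show "((\<lambda>t. exp (f (z + t *\<^sub>R v))) has_vector_derivative dir_deriv v f z * exp (f z)) (at 0)"
      using field_vector_diff_chain_at[OF Ck_on_has_dir_deriv[OF Suc.prems *(2,1)] DERIV_exp]
      by (simp add: o_def)
  next
    fix v assume "v \<in> W"
    then show "Ck_on m W (\<lambda>z. dir_deriv v f z * exp (f z))"
      by (intro Ck_on_mult[OF assms(1)] Suc.hyps Ck_on_Suc_imp[OF Suc.prems] Ck_on_dir_deriv[OF Suc.prems])
  qed
qed

lemma Ck_on_cnj:
  assumes "subspace W" "Ck_on m W f"
  shows "Ck_on m W (\<lambda>z. cnj (f z))"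
  using assms(2)
proof (induct m arbitrary: f)
  case 0
  then show ?case by (auto intro: continuous_intros)
next
  case (Suc m)
  show ?case
  proof (rule Ck_on_SucI[OF assms(1), where D="\<lambda>v z. cnj (dir_deriv v f z)"])
    show "continuous_on W (\<lambda>z. cnj (f z))"
      using Suc.prems by (auto intro: continuous_intros)
  next
    fix v z assume *: "v \<in> W" "z \<in> W"
    show "((\<lambda>t. cnj (f (z + t *\<^sub>R v))) has_vector_derivative cnj (dir_deriv v f z)) (at 0)"
      using Ck_on_has_dir_deriv[OF Suc.prems *(2,1)] by (rule has_vector_derivative_cnj)
  next
    fix v assume "v \<in> W"
    then show "Ck_on m W (\<lambda>z. cnj (dir_deriv v f z))"
      by (intro Suc.hyps Ck_on_dir_deriv[OF Suc.prems])
  qed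
qed

lemma has_dir_deriv_rlinear:
  fixes f :: "'a::euclidean_space \<Rightarrow> 'b::real_normed_vector"
  assumes "subspace W" "rlinear_on W f" "v \<in> W" "z \<in> W"
  shows "((\<lambda>t. f (z + t *\<^sub>R v)) has_vector_derivative f v) (at 0)"
proof -
  have "(\<lambda>t. f (z + t *\<^sub>R v)) = (\<lambda>t. f z + t *\<^sub>R f v)"
    using assms by (simp add: rlinear_on_add[OF assms(2)] rlinear_on_scale[OF assms(2)] subspace_scale)
  moreover have "((\<lambda>t. f z + t *\<^sub>R f v) has_vector_derivative f v) (at 0)"
    by (auto intro!: derivative_eq_intros)
  ultimately show ?thesis by simp
qed

lemma dir_deriv_rlinear:
  fixes f :: "'a::euclidean_space \<Rightarrow> complex"
  shows "subspace W \<Longrightarrow> rlinear_on W f \<Longrightarrow> v \<in> W \<Longrightarrow> z \<in> W \<Longrightarrow> dir_deriv v f z = f v"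
  by (rule dir_deriv_eqI) (rule has_dir_deriv_rlinear)

lemma Ck_on_rlinear:
  assumes "subspace W" "rlinear_on W f"
  shows "Ck_on m W f"
proof (cases m)
  case 0
  then show ?thesis using rlinear_on_continuous[OF assms(2,1)] by simp
next
  case (Suc n)
  show ?thesis unfolding Suc
    by (rule Ck_on_SucI[OF assms(1), where D="\<lambda>v z. f v"])
      (auto intro: rlinear_on_continuous[OF assms(2,1)] has_dir_deriv_rlinear[OF assms] Ck_on_const[OF assms(1)])
qed

lemma has_dir_deriv_affine:
  assumes "linear \<Theta>" "((\<lambda>t. f (\<Theta> z + a + t *\<^sub>R \<Theta> v)) has_vector_derivative D) (at 0)"
  shows "((\<lambda>t. f (\<Theta> (z + t *\<^sub>R v) + a)) has_vector_derivative D) (at 0)"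
  using assms(2) by (simp add: linear_add[OF assms(1)] linear_scale[OF assms(1)] ac_simps)

lemma dir_deriv_affine:
  assumes "linear \<Theta>"
  shows "dir_deriv v (\<lambda>z. f (\<Theta> z + a)) z = dir_deriv (\<Theta> v) f (\<Theta> z + a)"
  unfolding dir_deriv_def by (simp add: linear_add[OF assms(1)] linear_scale[OF assms(1)] ac_simps)

lemma Ck_on_affine:
  fixes \<Theta> :: "'a::euclidean_space \<Rightarrow> 'b::euclidean_space"
  assumes "subspace W1" "subspace W2" "linear \<Theta>" "\<Theta> ` W1 \<subseteq> W2" "a \<in> W2" "Ck_on m W2 f"
  shows "Ck_on m W1 (\<lambda>z. f (\<Theta> z + a))"
  using assms(6)
proof (induct m arbitrary: f)
  have c: "continuous_on W1 (\<lambda>z. f (\<Theta> z + a))" if "continuous_on W2 f" for f :: "'b \<Rightarrow> complex"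
  proof (rule continuous_on_compose2[OF that])
    show "continuous_on W1 (\<lambda>z. \<Theta> z + a)"
      using assms(3)
      by (intro continuous_on_add continuous_on_const linear_continuous_on) (simp add: linear_conv_bounded_linear)
    show "(\<lambda>z. \<Theta> z + a) ` W1 \<subseteq> W2" using assms by (auto intro: subspace_add)
  qed
  {
    case 0
    then show ?case using c by simp
  next
    case (Suc m)
    show ?case
    proof (rule Ck_on_SucI[OF assms(1), where D="\<lambda>v z. dir_deriv (\<Theta> v) f (\<Theta> z + a)"])
      show "continuous_on W1 (\<lambda>z. f (\<Theta> z + a))"
        using Suc.prems by (auto intro: c)
    next
      fix v z assume *: "v \<in> W1" "z \<in> W1"
      then have **: "\<Theta> v \<in> W2" "\<Theta> z + a \<in> W2" using assms by (auto intro: subspace_add)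
      show "((\<lambda>t. f (\<Theta> (z + t *\<^sub>R v) + a)) has_vector_derivative dir_deriv (\<Theta> v) f (\<Theta> z + a)) (at 0)"
        using Ck_on_has_dir_deriv[OF Suc.prems **(2,1)] by (rule has_dir_deriv_affine[OF assms(3)])
    next
      fix v assume "v \<in> W1"
      then show "Ck_on m W1 (\<lambda>z. dir_deriv (\<Theta> v) f (\<Theta> z + a))"
        using Suc.prems assms(4) by (intro Suc.hyps) auto
    qed
  }
qed

text \<open>Here continuity of the derivatives enters. The two-parameter function \<open>F\<close>
  has a partial derivative in the first variable at the origin and a continuous one in the second,
  so it is totally differentiable there; restricting it to the diagonal gives the sum.\<close>

lemma dir_deriv_add_direction:
  assumes W: "subspace W" and f: "Ck_on (Suc m) W f" and z: "z \<in> W" "v \<in> W" "w \<in> W"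
  shows "dir_deriv (v + w) f z = dir_deriv v f z + dir_deriv w f z"
proof -
  define F where "F s r = f ((z + s *\<^sub>R v) + r *\<^sub>R w)" for s r :: real
  have in_W: "(z + s *\<^sub>R v) + r *\<^sub>R w \<in> W" for s r
    using W z by (intro line_in_subspace) auto
  define G where "G s r = dir_deriv w f ((z + s *\<^sub>R v) + r *\<^sub>R w)" for s r :: real
  have "continuous_on W (dir_deriv w f)" using f z(3) Ck_on_continuous[of m] by auto
  then have "continuous_on UNIV (\<lambda>p. dir_deriv w f ((z + fst p *\<^sub>R v) + snd p *\<^sub>R w))"
    by (rule continuous_on_compose2) (use in_W in \<open>auto intro!: continuous_intros\<close>)
  then have G_cont: "continuous (at (0, 0)) (\<lambda>p. blinfun_scaleR_left (G (fst p) (snd p)))"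
    unfolding G_def
    by (intro bounded_linear.continuous[OF bounded_linear_blinfun_scaleR_left])
      (simp add: continuous_on_eq_continuous_at)
  have "((\<lambda>(s, r). F s r) has_derivative
      (\<lambda>(s, r). s *\<^sub>R dir_deriv v f z + blinfun_scaleR_left (G 0 0) r)) (at (0, 0) within UNIV \<times> UNIV)"
  proof (rule has_derivative_partialsI[where X=UNIV and Y=UNIV and fy="\<lambda>s r. blinfun_scaleR_left (G s r)"])
    show "((\<lambda>s. F s 0) has_derivative (\<lambda>s. s *\<^sub>R dir_deriv v f z)) (at 0)"
      using Ck_on_has_dir_deriv[OF f z(1,2)] unfolding F_def has_vector_derivative_def by simp
  next
    fix s r :: real
    show "((\<lambda>r. F s r) has_derivative blinfun_apply (blinfun_scaleR_left (G s r))) (at r)"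
      using Ck_on_has_dir_deriv_at[OF f line_in_subspace[OF W z(1,2)] z(3) W, of s r UNIV]
      unfolding F_def G_def has_vector_derivative_def blinfun_scaleR_left.rep_eq by simp
  qed (use G_cont in \<open>simp_all add: case_prod_unfold\<close>)
  then have D: "((\<lambda>(s, r). F s r) has_derivative
      (\<lambda>(s, r). s *\<^sub>R dir_deriv v f z + r *\<^sub>R dir_deriv w f z)) (at (0, 0))"
    by (simp add: G_def blinfun_scaleR_left.rep_eq)
  have "((\<lambda>t::real. (t, t)) has_derivative (\<lambda>t. (t, t))) (at 0)"
    by (auto intro!: derivative_eq_intros)
  from has_derivative_compose[OF this D]
  have "((\<lambda>t. F t t) has_derivative (\<lambda>t. t *\<^sub>R dir_deriv v f z + t *\<^sub>R dir_deriv w f z)) (at 0)"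
    by simp
  then have "((\<lambda>t. f (z + t *\<^sub>R (v + w))) has_vector_derivative dir_deriv v f z + dir_deriv w f z) (at 0)"
    unfolding has_vector_derivative_def F_def by (simp add: scaleR_add_right add.assoc)
  then show ?thesis by (rule dir_deriv_eqI)
qed

lemma dir_deriv_scale_direction:
  assumes f: "Ck_on (Suc m) W f" and z: "z \<in> W" "v \<in> W"
  shows "dir_deriv (r *\<^sub>R v) f z = r *\<^sub>R dir_deriv v f z"
proof (rule dir_deriv_eqI)
  have "((\<lambda>t. f (z + t *\<^sub>R v)) has_vector_derivative dir_deriv v f z) (at (0 * r))"
    using Ck_on_has_dir_deriv[OF f z] by simp
  then have "(((\<lambda>t. f (z + t *\<^sub>R v)) \<circ> (\<lambda>t. t * r)) has_vector_derivative r *\<^sub>R dir_deriv v f z) (at 0)"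
    by (intro vector_diff_chain_at) (auto intro!: derivative_eq_intros)
  then show "((\<lambda>t. f (z + t *\<^sub>R r *\<^sub>R v)) has_vector_derivative r *\<^sub>R dir_deriv v f z) (at 0)"
    by (simp add: o_def)
qed

lemma rlinear_on_dir_deriv:
  "subspace W \<Longrightarrow> Ck_on (Suc m) W f \<Longrightarrow> z \<in> W \<Longrightarrow> rlinear_on W (\<lambda>v. dir_deriv v f z)"
  by (intro rlinear_onI dir_deriv_add_direction dir_deriv_scale_direction)

lemma smooth_imp_Ck: "smooth_fun_on W f \<Longrightarrow> Ck_on m W f"
  by (simp add: smooth_fun_on_def)

lemma smooth_continuous: "smooth_fun_on W f \<Longrightarrow> continuous_on W f"
  using smooth_imp_Ck[of W f 0] by simp

lemma smooth_cong:
  "subspace W \<Longrightarrow> (\<And>z. z \<in> W \<Longrightarrow> f z = g z) \<Longrightarrow> smooth_fun_on W f \<Longrightarrow> smooth_fun_on W g"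
  unfolding smooth_fun_on_def using Ck_on_cong[of W f g] by blast

lemma smooth_const: "subspace W \<Longrightarrow> smooth_fun_on W (\<lambda>z. c)"
  and smooth_add: "subspace W \<Longrightarrow> smooth_fun_on W f \<Longrightarrow> smooth_fun_on W g \<Longrightarrow> smooth_fun_on W (\<lambda>z. f z + g z)"
  and smooth_mult: "subspace W \<Longrightarrow> smooth_fun_on W f \<Longrightarrow> smooth_fun_on W g \<Longrightarrow> smooth_fun_on W (\<lambda>z. f z * g z)"
  and smooth_exp: "subspace W \<Longrightarrow> smooth_fun_on W f \<Longrightarrow> smooth_fun_on W (\<lambda>z. exp (f z))"
  and smooth_cnj: "subspace W \<Longrightarrow> smooth_fun_on W f \<Longrightarrow> smooth_fun_on W (\<lambda>z. cnj (f z))"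
  and smooth_rlinear: "subspace W \<Longrightarrow> rlinear_on W f \<Longrightarrow> smooth_fun_on W f"
  unfolding smooth_fun_on_def
  by (auto intro: Ck_on_const Ck_on_add Ck_on_mult Ck_on_exp Ck_on_cnj Ck_on_rlinear)

lemma smooth_dir_deriv: "smooth_fun_on W f \<Longrightarrow> v \<in> W \<Longrightarrow> smooth_fun_on W (dir_deriv v f)"
  unfolding smooth_fun_on_def using Ck_on_dir_deriv by blast

lemma smooth_cmult: "subspace W \<Longrightarrow> smooth_fun_on W f \<Longrightarrow> smooth_fun_on W (\<lambda>z. c * f z)"
  by (intro smooth_mult smooth_const)

lemma smooth_minus: "subspace W \<Longrightarrow> smooth_fun_on W f \<Longrightarrow> smooth_fun_on W (\<lambda>z. - f z)"
  using smooth_cmult[of W f "-1"] by simp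

lemma smooth_sum:
  "subspace W \<Longrightarrow> (\<And>i. i \<in> I \<Longrightarrow> smooth_fun_on W (f i)) \<Longrightarrow> smooth_fun_on W (\<lambda>z. \<Sum>i\<in>I. f i z)"
  by (induct I rule: infinite_finite_induct) (auto intro: smooth_const smooth_add)

lemma smooth_affine:
  fixes \<Theta> :: "'a::euclidean_space \<Rightarrow> 'b::euclidean_space"
  shows "subspace W1 \<Longrightarrow> subspace W2 \<Longrightarrow> linear \<Theta> \<Longrightarrow> \<Theta> ` W1 \<subseteq> W2 \<Longrightarrow> a \<in> W2 \<Longrightarrow>
    smooth_fun_on W2 f \<Longrightarrow> smooth_fun_on W1 (\<lambda>z. f (\<Theta> z + a))"
  unfolding smooth_fun_on_def using Ck_on_affine by blast

lemma smooth_has_dir_deriv: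
  "smooth_fun_on W f \<Longrightarrow> z \<in> W \<Longrightarrow> v \<in> W \<Longrightarrow>
    ((\<lambda>t. f (z + t *\<^sub>R v)) has_vector_derivative dir_deriv v f z) (at 0)"
  by (rule Ck_on_has_dir_deriv[OF smooth_imp_Ck])

context
  fixes W :: "'a::euclidean_space set" and f g :: "'a \<Rightarrow> complex"
  assumes f: "smooth_fun_on W f" and g: "smooth_fun_on W g"
begin

lemma dir_deriv_add: "v \<in> W \<Longrightarrow> z \<in> W \<Longrightarrow> dir_deriv v (\<lambda>z. f z + g z) z = dir_deriv v f z + dir_deriv v g z"
  by (intro dir_deriv_eqI has_vector_derivative_add smooth_has_dir_deriv[OF f] smooth_has_dir_deriv[OF g])

lemma dir_deriv_mult:
  "v \<in> W \<Longrightarrow> z \<in> W \<Longrightarrow> dir_deriv v (\<lambda>z. f z * g z) z = f z * dir_deriv v g z + dir_deriv v f z * g z"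
  using has_vector_derivative_mult[OF smooth_has_dir_deriv[OF f] smooth_has_dir_deriv[OF g]]
  by (intro dir_deriv_eqI) simp

lemma dir_deriv_exp:
  "v \<in> W \<Longrightarrow> z \<in> W \<Longrightarrow> dir_deriv v (\<lambda>z. exp (f z)) z = dir_deriv v f z * exp (f z)"
  using field_vector_diff_chain_at[OF smooth_has_dir_deriv[OF f] DERIV_exp]
  by (intro dir_deriv_eqI) (simp add: o_def)

lemma dir_deriv_cnj:
  "v \<in> W \<Longrightarrow> z \<in> W \<Longrightarrow> dir_deriv v (\<lambda>z. cnj (f z)) z = cnj (dir_deriv v f z)"
  by (intro dir_deriv_eqI has_vector_derivative_cnj smooth_has_dir_deriv[OF f])

end

lemma dir_deriv_const: "dir_deriv v (\<lambda>z. c) z = 0"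
  by (rule dir_deriv_eqI) simp

lemma dir_deriv_cmult:
  "subspace W \<Longrightarrow> smooth_fun_on W f \<Longrightarrow> v \<in> W \<Longrightarrow> z \<in> W \<Longrightarrow>
    dir_deriv v (\<lambda>z. c * f z) z = c * dir_deriv v f z"
  using dir_deriv_mult[OF smooth_const, of W f v z c] by (simp add: dir_deriv_const)

section \<open>Dolbeault operators on forms over a complex subspace\<close>

definition hermitian_on :: "'a::complex_euclidean set \<Rightarrow> ('a \<Rightarrow> 'a \<Rightarrow> complex) \<Rightarrow> bool" where
  "hermitian_on W H \<longleftrightarrow> (\<forall>x\<in>W. \<forall>y\<in>W. \<forall>z\<in>W. H (x + y) z = H x z + H y z) \<and>
     (\<forall>c. \<forall>x\<in>W. \<forall>y\<in>W. H (c *\<^sub>C x) y = c * H x y) \<and> (\<forall>x\<in>W. \<forall>y\<in>W. H y x = cnj (H x y))"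

lemma hermitian_on_add_left: "hermitian_on W H \<Longrightarrow> x \<in> W \<Longrightarrow> y \<in> W \<Longrightarrow> z \<in> W \<Longrightarrow> H (x + y) z = H x z + H y z"
  and hermitian_on_scale_left: "hermitian_on W H \<Longrightarrow> x \<in> W \<Longrightarrow> y \<in> W \<Longrightarrow> H (c *\<^sub>C x) y = c * H x y"
  unfolding hermitian_on_def by blast+

lemma hermitian_on_cnj: "hermitian_on W H \<Longrightarrow> x \<in> W \<Longrightarrow> y \<in> W \<Longrightarrow> cnj (H x y) = H y x"
  unfolding hermitian_on_def by fastforce

lemma hermitian_on_UNIV: "hermitian H \<Longrightarrow> hermitian_on UNIV H"
  unfolding hermitian_def hermitian_on_def Vector_Spaces.linear_iff by blast

context
  fixes W :: "'a::complex_euclidean set" and H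
  assumes W: "complex_space.subspace W" and H: "hermitian_on W H"
begin

lemma hermitian_on_add_right: "x \<in> W \<Longrightarrow> y \<in> W \<Longrightarrow> z \<in> W \<Longrightarrow> H z (x + y) = H z x + H z y"
  using hermitian_on_cnj[OF H, of "x + y" z] hermitian_on_cnj[OF H, of x z] hermitian_on_cnj[OF H, of y z]
    complex_space.subspace_add[OF W] hermitian_on_add_left[OF H, of x y z]
  by (metis complex_cnj_add)

lemma hermitian_on_scale_right: "x \<in> W \<Longrightarrow> y \<in> W \<Longrightarrow> H y (c *\<^sub>C x) = cnj c * H y x"
  using hermitian_on_cnj[OF H, of "c *\<^sub>C x" y] hermitian_on_cnj[OF H, of x y]
    complex_space.subspace_scale[OF W] hermitian_on_scale_left[OF H, of x y c]
  by (metis complex_cnj_mult)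

lemma rlinear_hermitian_left: "y \<in> W \<Longrightarrow> rlinear_on W (\<lambda>x. H x y)"
  by (rule rlinear_onI)
    (auto simp: hermitian_on_add_left[OF H] hermitian_on_scale_left[OF H] scaleR_conv_of_real
      simp flip: scaleC_of_real)

lemma rlinear_hermitian_right: "y \<in> W \<Longrightarrow> rlinear_on W (\<lambda>x. H y x)"
  by (rule rlinear_onI)
    (auto simp: hermitian_on_add_right hermitian_on_scale_right scaleR_conv_of_real
      simp flip: scaleC_of_real)

lemma hermitian_on_diag_real: "x \<in> W \<Longrightarrow> H x x = of_real (Re (H x x))"
  using hermitian_on_cnj[OF H, of x x] by (simp add: complex_eq_iff)

end

text \<open>The (1,0)-part of df evaluated on \<open>v\<close>, the counterpart of
  \<open>dbar_dir\<close>.\<close>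

definition d_dir :: "'a::complex_euclidean \<Rightarrow> ('a \<Rightarrow> complex) \<Rightarrow> 'a \<Rightarrow> complex" where
  "d_dir v f z = (dir_deriv v f z - \<i> * dir_deriv (\<i> *\<^sub>C v) f z) / 2"

text \<open>The \<open>(1,0)\<close>-part of the Chern connection of the metric \<open>exp (- \<pi> H(z,z))\<close>.\<close>

definition cov_dir ::
    "('a::complex_euclidean \<Rightarrow> 'a \<Rightarrow> complex) \<Rightarrow> 'a \<Rightarrow> ('a \<Rightarrow> complex) \<Rightarrow> 'a \<Rightarrow> complex" where
  "cov_dir H v f z = d_dir v f z - of_real pi * H v z * f z"

lemma dbar_dir_zero: "dbar_dir v (\<lambda>y. 0) z = 0"
  and cov_dir_zero: "cov_dir H v (\<lambda>y. 0) z = 0"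
  by (simp_all add: dbar_dir_def cov_dir_def d_dir_def dir_deriv_const)

context
  fixes W :: "'a::complex_euclidean set"
  assumes W: "complex_space.subspace W"
begin

lemma i_scale_in: "v \<in> W \<Longrightarrow> \<i> *\<^sub>C v \<in> W"
  using complex_space.subspace_scale[OF W] .

lemma dbar_dir_add:
  assumes "smooth_fun_on W f" "smooth_fun_on W g" "v \<in> W" "z \<in> W"
  shows "dbar_dir v (\<lambda>y. f y + g y) z = dbar_dir v f z + dbar_dir v g z"
  and "cov_dir H v (\<lambda>y. f y + g y) z = cov_dir H v f z + cov_dir H v g z"
  using assms i_scale_in
  by (simp_all add: dbar_dir_def cov_dir_def d_dir_def dir_deriv_add[OF assms(1,2)] field_simps)

lemma dbar_dir_cmult:
  assumes "smooth_fun_on W f" "v \<in> W" "z \<in> W"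
  shows "dbar_dir v (\<lambda>y. c * f y) z = c * dbar_dir v f z"
    and "cov_dir H v (\<lambda>y. c * f y) z = c * cov_dir H v f z"
  using assms i_scale_in
  by (simp_all add: dbar_dir_def cov_dir_def d_dir_def dir_deriv_cmult[OF complex_subspace_imp_subspace[OF W] assms(1)] field_simps)

text \<open>Expanding c v and i c v in v and i v reduces the claim to real linearity of the
  differential in its direction. Together with additivity this makes the (0,1)-part
  antilinear.\<close>

lemma dbar_dir_scale_direction:
  assumes f: "smooth_fun_on W f" and vz: "v \<in> W" "z \<in> W"
  shows "dbar_dir (c *\<^sub>C v) f z = cnj c * dbar_dir v f z"
proof -
  have sW: "subspace W" using complex_subspace_imp_subspace[OF W] .
  have iv: "\<i> *\<^sub>C v \<in> W" using i_scale_in vz by blast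
  have rl: "rlinear_on W (\<lambda>v. dir_deriv v f z)"
    using rlinear_on_dir_deriv[OF sW smooth_imp_Ck[OF f] vz(2)] .
  have c1: "c *\<^sub>C v = Re c *\<^sub>R v + Im c *\<^sub>R (\<i> *\<^sub>C v)"
    by (simp add: scaleC_scaleC flip: scaleC_of_real scaleC_add_left) (simp add: complex_eq mult.commute)
  have c2: "\<i> *\<^sub>C c *\<^sub>C v = (- Im c) *\<^sub>R v + Re c *\<^sub>R (\<i> *\<^sub>C v)"
    by (simp add: scaleC_scaleC flip: scaleC_of_real scaleC_add_left del: of_real_minus)
      (simp add: complex_eq_iff)
  have "dir_deriv (c *\<^sub>C v) f z = Re c *\<^sub>R dir_deriv v f z + Im c *\<^sub>R dir_deriv (\<i> *\<^sub>C v) f z"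
    unfolding c1 using vz(1) iv sW
    by (simp only: rlinear_on_add[OF rl] rlinear_on_scale[OF rl] subspace_scale)
  moreover have "dir_deriv (\<i> *\<^sub>C c *\<^sub>C v) f z = (- Im c) *\<^sub>R dir_deriv v f z + Re c *\<^sub>R dir_deriv (\<i> *\<^sub>C v) f z"
    unfolding c2 using vz(1) iv sW
    by (simp only: rlinear_on_add[OF rl] rlinear_on_scale[OF rl] subspace_scale)
  ultimately show ?thesis
    unfolding dbar_dir_def by (simp only:) (simp add: complex_eq_iff field_simps)
qed

lemma dbar_dir_add_direction:
  assumes f: "smooth_fun_on W f" and vz: "v \<in> W" "w \<in> W" "z \<in> W"
  shows "dbar_dir (v + w) f z = dbar_dir v f z + dbar_dir w f z"
proof -
  have rl: "rlinear_on W (\<lambda>v. dir_deriv v f z)"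
    using rlinear_on_dir_deriv[OF complex_subspace_imp_subspace[OF W] smooth_imp_Ck[OF f] vz(3)] .
  show ?thesis
    using vz i_scale_in
    by (simp add: dbar_dir_def scaleC_add_right rlinear_on_add[OF rl] field_simps)
qed

text \<open>Real linearity in the direction is what the comparison of traces over real orthonormal
  bases asks for.\<close>

lemma rlinear_on_cov_dir:
  assumes f: "smooth_fun_on W f" and "z \<in> W" and H: "hermitian_on W H"
  shows "rlinear_on W (\<lambda>v. cov_dir H v f z)"
proof -
  have rl: "rlinear_on W (\<lambda>v. dir_deriv v f z)"
    using rlinear_on_dir_deriv[OF complex_subspace_imp_subspace[OF W] smooth_imp_Ck[OF f] assms(2)] .
  note rH = rlinear_hermitian_left[OF W H assms(2)]
  have i: "\<i> *\<^sub>C r *\<^sub>R v = r *\<^sub>R (\<i> *\<^sub>C v)" for r v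
    by (simp add: scaleC_scaleC mult.commute flip: scaleC_of_real)
  show ?thesis
    using i_scale_in
    by (intro rlinear_onI)
      (simp_all add: cov_dir_def d_dir_def scaleC_add_right i rlinear_on_add[OF rl] rlinear_on_scale[OF rl]
        rlinear_on_add[OF rH] rlinear_on_scale[OF rH] scaleR_conv_of_real field_simps)
qed

lemma smooth_dbar_dir: "smooth_fun_on W f \<Longrightarrow> v \<in> W \<Longrightarrow> smooth_fun_on W (dbar_dir v f)"
  using smooth_cmult[OF complex_subspace_imp_subspace[OF W] smooth_add[OF complex_subspace_imp_subspace[OF W]
        smooth_dir_deriv[of W f v] smooth_cmult[OF complex_subspace_imp_subspace[OF W]
          smooth_dir_deriv[of W f "\<i> *\<^sub>C v"], of \<i>]], of "1/2"] i_scale_in[of v]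
  unfolding dbar_dir_def by simp

lemma smooth_cov_dir:
  assumes "smooth_fun_on W f" "v \<in> W" "hermitian_on W H"
  shows "smooth_fun_on W (cov_dir H v f)"
proof -
  note sW = complex_subspace_imp_subspace[OF W]
  have "smooth_fun_on W (\<lambda>z. 1 / 2 * (dir_deriv v f z + (- \<i>) * dir_deriv (\<i> *\<^sub>C v) f z) +
      (- of_real pi) * H v z * f z)"
    by (intro smooth_add[OF sW] smooth_mult[OF sW] smooth_const[OF sW] smooth_dir_deriv assms(1,2) i_scale_in
        smooth_rlinear[OF sW rlinear_hermitian_right[OF W assms(3,2)]])
  then show ?thesis
    by (rule smooth_cong[OF sW, rotated]) (simp add: cov_dir_def d_dir_def)
qed

end

section \<open>Alternating antilinear forms and the operators on smooth forms\<close>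

lemma antilinear_alt_zero: "antilinear_alt W k \<omega> \<Longrightarrow> \<not> (length vs = k \<and> set vs \<subseteq> W) \<Longrightarrow> \<omega> vs = 0"
  unfolding antilinear_alt_def by blast

lemma antilinear_alt_add:
  assumes "antilinear_alt W k \<omega>" "Suc (length xs + length ys) = k" "set xs \<subseteq> W" "set ys \<subseteq> W" "x \<in> W" "y \<in> W"
  shows "\<omega> (xs @ (x + y) # ys) = \<omega> (xs @ x # ys) + \<omega> (xs @ y # ys)"
proof -
  have "\<forall>vs i. length vs = k \<and> set vs \<subseteq> W \<and> i < k \<longrightarrow>
      (\<forall>x\<in>W. \<forall>y\<in>W. \<omega> (vs[i := x + y]) = \<omega> (vs[i := x]) + \<omega> (vs[i := y]))"
    using assms(1) unfolding antilinear_alt_def by blast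
  from this[rule_format, of "xs @ x # ys" "length xs" x y] show ?thesis
    using assms(2-) by simp
qed

lemma antilinear_alt_scale:
  assumes "antilinear_alt W k \<omega>" "Suc (length xs + length ys) = k" "set xs \<subseteq> W" "set ys \<subseteq> W" "x \<in> W"
  shows "\<omega> (xs @ (c *\<^sub>C x) # ys) = cnj c * \<omega> (xs @ x # ys)"
proof -
  have "\<forall>vs i. length vs = k \<and> set vs \<subseteq> W \<and> i < k \<longrightarrow>
      (\<forall>c. \<forall>x\<in>W. \<omega> (vs[i := c *\<^sub>C x]) = cnj c * \<omega> (vs[i := x]))"
    using assms(1) unfolding antilinear_alt_def by blast
  from this[rule_format, of "xs @ x # ys" "length xs" x c] show ?thesis
    using assms(2-) by simp
qed

lemma antilinear_alt_alt:
  assumes "antilinear_alt W k \<omega>" "length (xs @ x # ys @ x # zs) = k" "set xs \<subseteq> W" "set ys \<subseteq> W" "set zs \<subseteq> W" "x \<in> W"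
  shows "\<omega> (xs @ x # ys @ x # zs) = 0"
proof -
  have "\<forall>vs i j. length vs = k \<and> set vs \<subseteq> W \<and> i < j \<and> j < k \<and> vs ! i = vs ! j \<longrightarrow> \<omega> vs = 0"
    using assms(1) unfolding antilinear_alt_def by blast
  from this[rule_format, of "xs @ x # ys @ x # zs" "length xs" "length xs + Suc (length ys)"] show ?thesis
    using assms(2-) by (simp add: nth_append)
qed

text \<open>Slots are exposed as \<open>xs @ x # ys\<close> instead of list updates: the operators
  delete or prepend entries, and the recursion then stays inside list algebra.\<close>

lemma antilinear_altI:
  assumes "\<And>vs. \<not> (length vs = k \<and> set vs \<subseteq> W) \<Longrightarrow> \<omega> vs = 0"
    and "\<And>xs ys x y. Suc (length xs + length ys) = k \<Longrightarrow> set xs \<subseteq> W \<Longrightarrow> set ys \<subseteq> W \<Longrightarrow> x \<in> W \<Longrightarrow> y \<in> W \<Longrightarrow>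
        \<omega> (xs @ (x + y) # ys) = \<omega> (xs @ x # ys) + \<omega> (xs @ y # ys)"
    and "\<And>xs ys x c. Suc (length xs + length ys) = k \<Longrightarrow> set xs \<subseteq> W \<Longrightarrow> set ys \<subseteq> W \<Longrightarrow> x \<in> W \<Longrightarrow>
        \<omega> (xs @ (c *\<^sub>C x) # ys) = cnj c * \<omega> (xs @ x # ys)"
    and "\<And>xs ys zs x. length (xs @ x # ys @ x # zs) = k \<Longrightarrow> set xs \<subseteq> W \<Longrightarrow> set ys \<subseteq> W \<Longrightarrow> set zs \<subseteq> W \<Longrightarrow> x \<in> W \<Longrightarrow>
        \<omega> (xs @ x # ys @ x # zs) = 0"
  shows "antilinear_alt W k \<omega>"
  unfolding antilinear_alt_def
proof (intro conjI allI impI ballI)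
  fix vs assume "\<not> (length vs = k \<and> set vs \<subseteq> W)"
  then show "\<omega> vs = 0" by (rule assms(1))
next
  fix vs i x y assume *: "length vs = k \<and> set vs \<subseteq> W \<and> i < k" "x \<in> W" "y \<in> W"
  then have "set (take i vs) \<subseteq> W" "set (drop (Suc i) vs) \<subseteq> W"
    using set_take_subset set_drop_subset by fast+
  with * show "\<omega> (vs[i := x + y]) = \<omega> (vs[i := x]) + \<omega> (vs[i := y])"
    by (simp add: upd_conv_take_nth_drop assms(2))
next
  fix vs i c x assume *: "length vs = k \<and> set vs \<subseteq> W \<and> i < k" "x \<in> W"
  then have "set (take i vs) \<subseteq> W" "set (drop (Suc i) vs) \<subseteq> W"
    using set_take_subset set_drop_subset by fast+
  with * show "\<omega> (vs[i := c *\<^sub>C x]) = cnj c * \<omega> (vs[i := x])"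
    by (simp add: upd_conv_take_nth_drop assms(3))
next
  fix vs i j assume *: "length vs = k \<and> set vs \<subseteq> W \<and> i < j \<and> j < k \<and> vs ! i = vs ! j"
  define xs ys zs where "xs = take i vs" and "ys = take (j - Suc i) (drop (Suc i) vs)" and "zs = drop (Suc j) vs"
  have "drop (Suc i) vs = ys @ vs ! i # zs"
    using * id_take_nth_drop[of "j - Suc i" "drop (Suc i) vs"] unfolding ys_def zs_def by (simp add: diff_less_mono)
  then have vs: "vs = xs @ vs ! i # ys @ vs ! i # zs"
    using * id_take_nth_drop[of i vs] unfolding xs_def by simp
  have "set xs \<subseteq> W" "set ys \<subseteq> W" "set zs \<subseteq> W" "vs ! i \<in> W"
    using * vs by (metis Un_iff list.set_intros(1,2) set_append subset_code(1))+
  moreover have "length (xs @ vs ! i # ys @ vs ! i # zs) = k" using * arg_cong[OF vs, of length] by metis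
  ultimately have "\<omega> (xs @ vs ! i # ys @ vs ! i # zs) = 0" by (intro assms(4))
  then show "\<omega> vs = 0" by (subst vs)
qed

text \<open>Polarization: the form vanishes when both adjacent slots carry x + y, and expanding
  leaves the two mixed terms.\<close>

lemma antilinear_alt_swap:
  assumes W: "subspace W" and \<omega>: "antilinear_alt W k \<omega>" "length (xs @ x # y # ys) = k"
    "set xs \<subseteq> W" "set ys \<subseteq> W" "x \<in> W" "y \<in> W"
  shows "\<omega> (xs @ x # y # ys) = - \<omega> (xs @ y # x # ys)"
proof -
  have xy: "x + y \<in> W" using W \<omega> by (simp add: subspace_add)
  have "0 = \<omega> (xs @ (x + y) # [] @ (x + y) # ys)"
    using antilinear_alt_alt[OF \<omega>(1), of xs "x + y" "[]" ys] \<omega> xy by simp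
  also have "\<dots> = \<omega> (xs @ x # (x + y) # ys) + \<omega> (xs @ y # (x + y) # ys)"
    using antilinear_alt_add[OF \<omega>(1), of xs "(x + y) # ys" x y] \<omega> xy by simp
  also have "\<omega> (xs @ x # (x + y) # ys) = \<omega> (xs @ x # x # ys) + \<omega> (xs @ x # y # ys)"
    using antilinear_alt_add[OF \<omega>(1), of "xs @ [x]" ys x y] \<omega> by simp
  also have "\<omega> (xs @ y # (x + y) # ys) = \<omega> (xs @ y # x # ys) + \<omega> (xs @ y # y # ys)"
    using antilinear_alt_add[OF \<omega>(1), of "xs @ [y]" ys x y] \<omega> by simp
  also have "\<omega> (xs @ x # x # ys) = 0"
    using antilinear_alt_alt[OF \<omega>(1), of xs x "[]" ys] \<omega> by simp
  also have "\<omega> (xs @ y # y # ys) = 0"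
    using antilinear_alt_alt[OF \<omega>(1), of xs y "[]" ys] \<omega> by simp
  finally show ?thesis by (simp add: eq_neg_iff_add_eq_0)
qed

text \<open>One transposition for each entry of \<open>ys\<close>. Both the alternation of
  \<open>dbar\<close> and the pairing with its adjoint reduce to this sign.\<close>

lemma antilinear_alt_move:
  assumes W: "subspace W" and \<omega>: "antilinear_alt W k \<omega>" "length (xs @ ys @ x # zs) = k"
    "set xs \<subseteq> W" "set ys \<subseteq> W" "set zs \<subseteq> W" "x \<in> W"
  shows "\<omega> (xs @ ys @ x # zs) = (-1) ^ length ys * \<omega> (xs @ x # ys @ zs)"
  using \<omega>(2-)
proof (induct ys arbitrary: xs)
  case (Cons y ys)
  then have "\<omega> ((xs @ [y]) @ ys @ x # zs) = (-1) ^ length ys * \<omega> ((xs @ [y]) @ x # ys @ zs)"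
    by (intro Cons.hyps) auto
  also have "\<omega> ((xs @ [y]) @ x # ys @ zs) = - \<omega> (xs @ x # y # ys @ zs)"
    using antilinear_alt_swap[OF W \<omega>(1), of xs y x "ys @ zs"] Cons.prems by simp
  finally show ?case by simp
qed simp

text \<open>Bundle forms without the equivariance condition. Operators and twists are studied here
  first, and equivariance is added afterwards as an eigenvalue equation.\<close>

definition smooth_forms :: "'a::complex_euclidean set \<Rightarrow> nat \<Rightarrow> 'a form set" where
  "smooth_forms W k = {\<phi>. (\<forall>z. z \<notin> W \<longrightarrow> \<phi> z = (\<lambda>vs. 0)) \<and> (\<forall>z\<in>W. antilinear_alt W k (\<phi> z)) \<and>
     (\<forall>vs. smooth_fun_on W (\<lambda>z. \<phi> z vs))}"

lemma smooth_forms_alt: "\<phi> \<in> smooth_forms W k \<Longrightarrow> antilinear_alt W k (\<phi> z)"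
  by (cases "z \<in> W") (auto simp: smooth_forms_def antilinear_alt_def)

lemma smooth_forms_smooth: "\<phi> \<in> smooth_forms W k \<Longrightarrow> smooth_fun_on W (\<lambda>z. \<phi> z vs)"
  by (simp add: smooth_forms_def)

lemma smooth_forms_outside: "\<phi> \<in> smooth_forms W k \<Longrightarrow> z \<notin> W \<Longrightarrow> \<phi> z vs = 0"
  by (simp add: smooth_forms_def)

lemma smooth_forms_zero: "\<phi> \<in> smooth_forms W k \<Longrightarrow> \<not> (length vs = k \<and> set vs \<subseteq> W) \<Longrightarrow> \<phi> z vs = 0"
  using smooth_forms_alt antilinear_alt_zero by blast

lemma smooth_forms_scale: 
  assumes "subspace W" "\<phi> \<in> smooth_forms W k" shows "form_scale c \<phi> \<in> smooth_forms W k"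
  using assms unfolding smooth_forms_def antilinear_alt_def form_scale_def
  by (auto intro: smooth_cmult simp: distrib_left mult.left_commute)

lemma smooth_forms_add:
  assumes "subspace W" "\<phi> \<in> smooth_forms W k" "\<psi> \<in> smooth_forms W k" shows "\<phi> + \<psi> \<in> smooth_forms W k"
  using assms unfolding smooth_forms_def antilinear_alt_def
  by (auto intro: smooth_add simp: distrib_left)

lemma smooth_forms_0:
  assumes "subspace W" shows "0 \<in> smooth_forms W k"
  using assms unfolding smooth_forms_def antilinear_alt_def by (auto intro: smooth_const simp: zero_fun_def)

text \<open>The candidate for the formal adjoint of \<open>dbar\<close>: minus the trace of the
  (1,0)-part of the Chern connection against the first slot. In a basis of pairs e, i e both members
  contribute the same, since the derivative is complex linear in its direction and the form
  antilinear in its slot; this doubling fits the squared norm 2 of each d z-bar.\<close>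

definition codbar :: "'a::complex_euclidean set \<Rightarrow> 'a set \<Rightarrow> ('a \<Rightarrow> 'a \<Rightarrow> complex) \<Rightarrow> 'a form \<Rightarrow> 'a form" where
  "codbar W E H \<phi> = (\<lambda>z vs. if z \<in> W \<and> set vs \<subseteq> W
     then - (\<Sum>e\<in>E. cov_dir H e (\<lambda>y. \<phi> y (e # vs)) z) else 0)"

lemma codbar_smooth:
  fixes W :: "'a::complex_euclidean set"
  assumes W: "complex_space.subspace W" and H: "hermitian_on W H" and E: "E \<subseteq> W"
    and \<phi>: "\<phi> \<in> smooth_forms W (Suc k)"
  shows "codbar W E H \<phi> \<in> smooth_forms W k"
proof -
  note sW = complex_subspace_imp_subspace[OF W]
  note alt = smooth_forms_alt[OF \<phi>] and sm = smooth_forms_smooth[OF \<phi>]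
  have "antilinear_alt W k (codbar W E H \<phi> z)" if z: "z \<in> W" for z
  proof (rule antilinear_altI)
    fix vs :: "'a list" assume *: "\<not> (length vs = k \<and> set vs \<subseteq> W)"
    then have "\<phi> y (e # vs) = 0" for y e using smooth_forms_zero[OF \<phi>] by force
    with * show "codbar W E H \<phi> z vs = 0" by (simp add: codbar_def cov_dir_zero)
  next
    fix xs ys x y assume *: "Suc (length xs + length ys) = k" "set xs \<subseteq> W" "set ys \<subseteq> W" "x \<in> W" "y \<in> W"
    have "cov_dir H e (\<lambda>w. \<phi> w (e # xs @ (x + y) # ys)) z =
        cov_dir H e (\<lambda>w. \<phi> w (e # xs @ x # ys)) z + cov_dir H e (\<lambda>w. \<phi> w (e # xs @ y # ys)) z"
      if "e \<in> E" for e
    proof -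
      have "(\<lambda>w. \<phi> w (e # xs @ (x + y) # ys)) = (\<lambda>w. \<phi> w (e # xs @ x # ys) + \<phi> w (e # xs @ y # ys))"
        using antilinear_alt_add[OF alt, of "e # xs" ys x y] * that E by auto
      then show ?thesis using dbar_dir_add(2)[OF W sm sm _ z] that E by auto
    qed
    moreover have "x + y \<in> W" using * sW by (simp add: subspace_add)
    ultimately show "codbar W E H \<phi> z (xs @ (x + y) # ys) =
        codbar W E H \<phi> z (xs @ x # ys) + codbar W E H \<phi> z (xs @ y # ys)"
      using * z by (simp add: codbar_def sum.distrib)
  next
    fix xs ys x and c :: complex assume *: "Suc (length xs + length ys) = k" "set xs \<subseteq> W" "set ys \<subseteq> W" "x \<in> W"
    have "cov_dir H e (\<lambda>w. \<phi> w (e # xs @ (c *\<^sub>C x) # ys)) z =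
        cnj c * cov_dir H e (\<lambda>w. \<phi> w (e # xs @ x # ys)) z"
      if "e \<in> E" for e
    proof -
      have "(\<lambda>w. \<phi> w (e # xs @ (c *\<^sub>C x) # ys)) = (\<lambda>w. cnj c * \<phi> w (e # xs @ x # ys))"
        using antilinear_alt_scale[OF alt, of "e # xs" ys x _ c] * that E by auto
      then show ?thesis using dbar_dir_cmult(2)[OF W sm _ z] that E by auto
    qed
    moreover have "c *\<^sub>C x \<in> W" using * complex_space.subspace_scale[OF W] by blast
    ultimately show "codbar W E H \<phi> z (xs @ (c *\<^sub>C x) # ys) = cnj c * codbar W E H \<phi> z (xs @ x # ys)"
      using * z by (simp add: codbar_def sum_distrib_left)
  next
    fix xs ys zs x assume *: "length (xs @ x # ys @ x # zs) = k" "set xs \<subseteq> W" "set ys \<subseteq> W" "set zs \<subseteq> W" "x \<in> W"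
    have "cov_dir H e (\<lambda>w. \<phi> w (e # xs @ x # ys @ x # zs)) z = 0" if "e \<in> E" for e
      using antilinear_alt_alt[OF alt, of "e # xs" x ys zs] * that E
      by (simp add: subset_iff cov_dir_zero)
    then show "codbar W E H \<phi> z (xs @ x # ys @ x # zs) = 0" by (simp add: codbar_def)
  qed
  moreover have "smooth_fun_on W (\<lambda>z. codbar W E H \<phi> z vs)" for vs
  proof (cases "set vs \<subseteq> W")
    case True
    have "smooth_fun_on W (\<lambda>z. - (\<Sum>e\<in>E. cov_dir H e (\<lambda>y. \<phi> y (e # vs)) z))"
      using E by (intro smooth_minus[OF sW] smooth_sum[OF sW] smooth_cov_dir[OF W sm _ H]) auto
    then show ?thesis by (rule smooth_cong[OF sW, rotated]) (simp add: codbar_def True)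
  next
    case False
    then show ?thesis using smooth_const[OF sW, of 0] by (simp add: codbar_def)
  qed
  ultimately show ?thesis by (auto simp: smooth_forms_def codbar_def)
qed

text \<open>\<open>codbar\<close> carries no degree: it evaluates the form on nonempty lists, where
  a form of degree 0 vanishes. This agrees with the convention that the adjoint is 0 in degree
  0.\<close>

lemma codbar_degree_0: "\<phi> \<in> smooth_forms W 0 \<Longrightarrow> codbar W E H \<phi> = 0"
  by (auto simp: codbar_def smooth_forms_zero[of \<phi> W 0] cov_dir_zero fun_eq_iff)

lemma dbar_zero_form: "dbar T 0 = 0"
  by (simp add: dbar_def zero_fun_def dbar_dir_zero fun_eq_iff)

lemma dbar_smooth:
  fixes T :: "'a::complex_euclidean torus"
  assumes W: "complex_space.subspace (cover T)" and \<phi>: "\<phi> \<in> smooth_forms (cover T) k"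
  shows "dbar T \<phi> \<in> smooth_forms (cover T) (Suc k)"
proof -
  let ?W = "cover T"
  note sW = complex_subspace_imp_subspace[OF W]
  note alt = smooth_forms_alt[OF \<phi>] and sm = smooth_forms_smooth[OF \<phi>]
  define trm where "trm z vs i = (-1) ^ i * dbar_dir (vs ! i) (\<lambda>y. \<phi> y (take i vs @ drop (Suc i) vs)) z"
    for z and vs :: "'a list" and i
  have dbar: "dbar T \<phi> z vs = (if set vs \<subseteq> ?W then \<Sum>i<length vs. trm z vs i else 0)" if "z \<in> ?W" for z vs
    using that by (simp add: dbar_def trm_def)
  have take_drop_sub: "set (take i xs) \<subseteq> ?W" "set (drop i xs) \<subseteq> ?W" if "set xs \<subseteq> ?W" for i xs
    using that set_take_subset set_drop_subset by fast+
  have "antilinear_alt ?W (Suc k) (dbar T \<phi> z)" if z: "z \<in> ?W" for z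
  proof (rule antilinear_altI)
    fix vs :: "'a list" assume *: "\<not> (length vs = Suc k \<and> set vs \<subseteq> ?W)"
    have "trm z vs i = 0" if "set vs \<subseteq> ?W" "i < length vs" for i
    proof -
      have "length (take i vs @ drop (Suc i) vs) \<noteq> k" using * that by auto
      then have "\<phi> y (take i vs @ drop (Suc i) vs) = 0" for y using smooth_forms_zero[OF \<phi>] by blast
      then show ?thesis by (simp add: trm_def dbar_dir_zero)
    qed
    then show "dbar T \<phi> z vs = 0" using z by (simp add: dbar)
  next
    fix xs ys x y assume *: "Suc (length xs + length ys) = Suc k" "set xs \<subseteq> ?W" "set ys \<subseteq> ?W" "x \<in> ?W" "y \<in> ?W"
    have xy: "x + y \<in> ?W" using * sW by (simp add: subspace_add)
    have "trm z (xs @ (x + y) # ys) i = trm z (xs @ x # ys) i + trm z (xs @ y # ys) i"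
      if i: "i < Suc (length xs + length ys)" for i
    \<comment> \<open>The omitted position is compared with the slot being varied. When they
      coincide, additivity comes from the direction of the derivative; otherwise from the form under
      the derivative.\<close>
    proof (cases rule: linorder_cases[of i "length xs"])
      case less
      have "(\<lambda>w. \<phi> w ((take i xs @ drop (Suc i) xs) @ (x + y) # ys)) =
          (\<lambda>w. \<phi> w ((take i xs @ drop (Suc i) xs) @ x # ys) + \<phi> w ((take i xs @ drop (Suc i) xs) @ y # ys))"
        using antilinear_alt_add[OF alt, of "take i xs @ drop (Suc i) xs" ys x y] * less take_drop_sub by auto
      moreover have "xs ! i \<in> ?W" using * less by auto
      ultimately show ?thesis
        using less dbar_dir_add(1)[OF W sm sm _ z] by (simp add: trm_def nth_append distrib_left)
    next
      case equal
      then show ?thesis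
        using dbar_dir_add_direction[OF W sm *(4,5) z] by (simp add: trm_def distrib_left)
    next
      case greater
      then obtain j where j: "i = Suc (length xs + j)" using less_iff_Suc_add by auto
      then have jl: "j < length ys" using i by simp
      have "(\<lambda>w. \<phi> w (xs @ (x + y) # (take j ys @ drop (Suc j) ys))) =
          (\<lambda>w. \<phi> w (xs @ x # (take j ys @ drop (Suc j) ys)) + \<phi> w (xs @ y # (take j ys @ drop (Suc j) ys)))"
        using antilinear_alt_add[OF alt, of xs "take j ys @ drop (Suc j) ys" x y] * jl take_drop_sub by auto
      moreover have "ys ! j \<in> ?W" using * jl by auto
      ultimately show ?thesis
        using j dbar_dir_add(1)[OF W sm sm _ z] by (simp add: trm_def nth_append distrib_left)
    qed
    then show "dbar T \<phi> z (xs @ (x + y) # ys) = dbar T \<phi> z (xs @ x # ys) + dbar T \<phi> z (xs @ y # ys)"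
      using * z xy by (simp add: dbar flip: sum.distrib)
  next
    fix xs ys x and c :: complex assume *: "Suc (length xs + length ys) = Suc k" "set xs \<subseteq> ?W" "set ys \<subseteq> ?W" "x \<in> ?W"
    have cx: "c *\<^sub>C x \<in> ?W" using * complex_space.subspace_scale[OF W] by blast
    have "trm z (xs @ (c *\<^sub>C x) # ys) i = cnj c * trm z (xs @ x # ys) i"
      if i: "i < Suc (length xs + length ys)" for i
    proof (cases rule: linorder_cases[of i "length xs"])
      case less
      have "(\<lambda>w. \<phi> w ((take i xs @ drop (Suc i) xs) @ (c *\<^sub>C x) # ys)) =
          (\<lambda>w. cnj c * \<phi> w ((take i xs @ drop (Suc i) xs) @ x # ys))"
        using antilinear_alt_scale[OF alt, of "take i xs @ drop (Suc i) xs" ys x _ c] * less take_drop_sub by auto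
      moreover have "xs ! i \<in> ?W" using * less by auto
      ultimately show ?thesis
        using less dbar_dir_cmult(1)[OF W sm _ z] by (simp add: trm_def nth_append mult.left_commute)
    next
      case equal
      then show ?thesis
        using dbar_dir_scale_direction[OF W sm *(4) z] by (simp add: trm_def mult.left_commute)
    next
      case greater
      then obtain j where j: "i = Suc (length xs + j)" using less_iff_Suc_add by auto
      then have jl: "j < length ys" using i by simp
      have "(\<lambda>w. \<phi> w (xs @ (c *\<^sub>C x) # (take j ys @ drop (Suc j) ys))) =
          (\<lambda>w. cnj c * \<phi> w (xs @ x # (take j ys @ drop (Suc j) ys)))"
        using antilinear_alt_scale[OF alt, of xs "take j ys @ drop (Suc j) ys" x _ c] * jl take_drop_sub by auto
      moreover have "ys ! j \<in> ?W" using * jl by auto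
      ultimately show ?thesis
        using j dbar_dir_cmult(1)[OF W sm _ z] by (simp add: trm_def nth_append mult.left_commute)
    qed
    then show "dbar T \<phi> z (xs @ (c *\<^sub>C x) # ys) = cnj c * dbar T \<phi> z (xs @ x # ys)"
      using * z cx by (simp add: dbar sum_distrib_left del: sum.lessThan_Suc)
  next
    fix xs ys zs x
    assume *: "length (xs @ x # ys @ x # zs) = Suc k" "set xs \<subseteq> ?W" "set ys \<subseteq> ?W" "set zs \<subseteq> ?W" "x \<in> ?W"
    define vs where "vs = xs @ x # ys @ x # zs"
    define p q where "p = length xs" and "q = Suc (p + length ys)"
    have pq: "p < length vs" "q < length vs" "p \<noteq> q" by (auto simp: vs_def p_def q_def)
    \<comment> \<open>Omitting any entry other than the two copies of x leaves both copies in the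
      argument.\<close>
    have other: "trm z vs i = 0" if i: "i < length vs" "i \<noteq> p" "i \<noteq> q" for i
    proof -
      consider "i < p" | j where "i = Suc (p + j)" "j < length ys" | j where "i = Suc (q + j)" "j < length zs"
      proof -
        have "i < p \<or> (\<exists>j. i = Suc (p + j) \<and> j < length ys) \<or> (\<exists>j. i = Suc (q + j) \<and> j < length zs)"
          using i unfolding vs_def p_def q_def by simp presburger
        then show thesis using that by blast
      qed
      then have "\<phi> y (take i vs @ drop (Suc i) vs) = 0" for y
      proof cases
        case 1
        then show ?thesis
          using antilinear_alt_alt[OF alt, of "take i xs @ drop (Suc i) xs" x ys zs y] * take_drop_sub
          by (simp add: vs_def p_def)
      next
        case (2 j)
        then show ?thesis
          using antilinear_alt_alt[OF alt, of xs x "take j ys @ drop (Suc j) ys" zs y] * take_drop_sub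
          by (simp add: vs_def p_def)
      next
        case (3 j)
        define us where "us = xs @ x # ys @ [x]"
        have "vs = us @ zs" "i = length us + j"
          using 3 by (simp_all add: us_def vs_def p_def q_def)
        then have "take i vs @ drop (Suc i) vs = us @ take j zs @ drop (Suc j) zs" by simp
        then show ?thesis
          using antilinear_alt_alt[OF alt, of xs x ys "take j zs @ drop (Suc j) zs" y] * take_drop_sub 3
          by (simp add: us_def)
      qed
      then show ?thesis by (simp add: trm_def dbar_dir_zero)
    qed
    \<comment> \<open>Omitting the first copy instead of the second gives the same entries with x
      moved across \<open>ys\<close>. As q = p + length ys + 1, the two signs are opposite.\<close>
    have move: "\<phi> y (xs @ ys @ x # zs) = (-1) ^ length ys * \<phi> y (xs @ x # ys @ zs)" for y
      using antilinear_alt_move[OF sW alt, of xs ys x zs] * by simp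
    have "trm z vs p = (-1) ^ p * dbar_dir x (\<lambda>y. \<phi> y (xs @ ys @ x # zs)) z"
      by (simp add: trm_def vs_def p_def)
    also have "\<dots> = (-1) ^ (p + length ys) * dbar_dir x (\<lambda>y. \<phi> y (xs @ x # ys @ zs)) z"
      unfolding move using dbar_dir_cmult(1)[OF W sm *(5) z] by (simp add: power_add)
    moreover have "trm z vs q = (-1) ^ q * dbar_dir x (\<lambda>y. \<phi> y (xs @ x # ys @ zs)) z"
      by (simp add: trm_def vs_def p_def q_def nth_append)
    ultimately have pq0: "trm z vs p + trm z vs q = 0" by (simp add: q_def)
    have "(\<Sum>i<length vs. trm z vs i) = (\<Sum>i\<in>{p, q}. trm z vs i)"
      using pq other by (intro sum.mono_neutral_right) auto
    also have "\<dots> = 0" using pq(3) pq0 by simp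
    finally show "dbar T \<phi> z (xs @ x # ys @ x # zs) = 0"
      using z unfolding vs_def[symmetric] by (simp add: dbar)
  qed
  moreover have "smooth_fun_on ?W (\<lambda>z. dbar T \<phi> z vs)" for vs
  proof (cases "set vs \<subseteq> ?W")
    case True
    have "smooth_fun_on ?W (\<lambda>z. \<Sum>i<length vs. trm z vs i)"
      unfolding trm_def using True nth_mem
      by (intro smooth_sum[OF sW] smooth_cmult[OF sW] smooth_dbar_dir[OF W sm]) auto
    then show ?thesis by (rule smooth_cong[OF sW, rotated]) (simp add: dbar True)
  next
    case False
    then show ?thesis using smooth_const[OF sW, of 0] by (simp add: dbar_def)
  qed
  ultimately show ?thesis by (auto simp: smooth_forms_def dbar_def)
qed

section \<open>Transport of forms along affine isometries\<close>

text \<open>Pullback along \<open>z \<mapsto> \<Theta> z + a\<close> in the frame in which it is a holomorphic isometry for the weights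
  \<open>exp (- \<pi> H(z,z))\<close>, up to a constant.\<close>

definition twist :: "'a::complex_euclidean set \<Rightarrow> ('b::complex_euclidean \<Rightarrow> 'b \<Rightarrow> complex) \<Rightarrow> ('a \<Rightarrow> 'b) \<Rightarrow> 'b \<Rightarrow>
    'b form \<Rightarrow> 'a form" where
  "twist W H \<Theta> a \<phi> = (\<lambda>z vs. if z \<in> W \<and> set vs \<subseteq> W
     then exp (- (of_real pi * H (\<Theta> z) a)) * \<phi> (\<Theta> z + a) (map \<Theta> vs) else 0)"

lemma dbar_form_scale:
  assumes "complex_space.subspace (cover T)" "\<phi> \<in> smooth_forms (cover T) k"
  shows "dbar T (form_scale c \<phi>) = form_scale c (dbar T \<phi>)"
proof (intro ext)
  fix z vs
  have "dbar_dir (vs ! i) (\<lambda>y. c * \<phi> y (take i vs @ drop (Suc i) vs)) z =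
      c * dbar_dir (vs ! i) (\<lambda>y. \<phi> y (take i vs @ drop (Suc i) vs)) z"
    if "i < length vs" "set vs \<subseteq> cover T" "z \<in> cover T" for i
    using that nth_mem by (intro dbar_dir_cmult(1)[OF assms(1) smooth_forms_smooth[OF assms(2)]]) auto
  then show "dbar T (form_scale c \<phi>) z vs = form_scale c (dbar T \<phi>) z vs"
    by (auto simp: dbar_def form_scale_def sum_distrib_left mult.left_commute intro!: sum.cong)
qed

lemma dbar_form_add:
  assumes "complex_space.subspace (cover T)" "\<phi> \<in> smooth_forms (cover T) k" "\<psi> \<in> smooth_forms (cover T) k"
  shows "dbar T (\<phi> + \<psi>) = dbar T \<phi> + dbar T \<psi>"
proof (intro ext)
  fix z vs
  have "dbar_dir (vs ! i) (\<lambda>y. \<phi> y (take i vs @ drop (Suc i) vs) + \<psi> y (take i vs @ drop (Suc i) vs)) z =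
      dbar_dir (vs ! i) (\<lambda>y. \<phi> y (take i vs @ drop (Suc i) vs)) z +
      dbar_dir (vs ! i) (\<lambda>y. \<psi> y (take i vs @ drop (Suc i) vs)) z"
    if "i < length vs" "set vs \<subseteq> cover T" "z \<in> cover T" for i
    using that nth_mem
    by (intro dbar_dir_add(1)[OF assms(1) smooth_forms_smooth[OF assms(2)] smooth_forms_smooth[OF assms(3)]]) auto
  then show "dbar T (\<phi> + \<psi>) z vs = (dbar T \<phi> + dbar T \<psi>) z vs"
    by (auto simp: dbar_def distrib_left simp flip: sum.distrib intro!: sum.cong)
qed

lemma codbar_form_scale:
  assumes "complex_space.subspace W" "\<phi> \<in> smooth_forms W k" "E \<subseteq> W"
  shows "codbar W E H (form_scale c \<phi>) = form_scale c (codbar W E H \<phi>)"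
proof (intro ext)
  fix z vs
  have "cov_dir H e (\<lambda>y. c * \<phi> y (e # vs)) z = c * cov_dir H e (\<lambda>y. \<phi> y (e # vs)) z" if "e \<in> E" "z \<in> W" for e
    using that assms(3) by (intro dbar_dir_cmult(2)[OF assms(1) smooth_forms_smooth[OF assms(2)]]) auto
  then show "codbar W E H (form_scale c \<phi>) z vs = form_scale c (codbar W E H \<phi>) z vs"
    by (auto simp: codbar_def form_scale_def sum_distrib_left intro!: sum.cong)
qed

lemma codbar_form_add:
  assumes "complex_space.subspace W" "\<phi> \<in> smooth_forms W k" "\<psi> \<in> smooth_forms W k" "E \<subseteq> W"
  shows "codbar W E H (\<phi> + \<psi>) = codbar W E H \<phi> + codbar W E H \<psi>"
proof (intro ext)
  fix z vs
  have "cov_dir H e (\<lambda>y. \<phi> y (e # vs) + \<psi> y (e # vs)) z =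
      cov_dir H e (\<lambda>y. \<phi> y (e # vs)) z + cov_dir H e (\<lambda>y. \<psi> y (e # vs)) z" if "e \<in> E" "z \<in> W" for e
    using that assms(4)
    by (intro dbar_dir_add(2)[OF assms(1) smooth_forms_smooth[OF assms(2)] smooth_forms_smooth[OF assms(3)]]) auto
  then show "codbar W E H (\<phi> + \<psi>) z vs = (codbar W E H \<phi> + codbar W E H \<psi>) z vs"
    by (auto simp: codbar_def sum.distrib)
qed

text \<open>One setting for several uses: translations by lattice vectors, where
  \<open>\<Theta>\<close> is the identity, and the two mutually inverse maps between V' x V'' and V,
  each followed by a translation.\<close>

locale affine_hermitian_map =
  fixes T1 :: "'a::complex_euclidean torus" and T2 :: "'b::complex_euclidean torus"
    and H1 :: "'a \<Rightarrow> 'a \<Rightarrow> complex" and H2 :: "'b \<Rightarrow> 'b \<Rightarrow> complex" and \<Theta> :: "'a \<Rightarrow> 'b" and a :: 'b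
  assumes W1: "complex_space.subspace (cover T1)" and W2: "complex_space.subspace (cover T2)"
    and H2: "hermitian_on (cover T2) H2"
    and \<Theta>: "Vector_Spaces.linear scaleC scaleC \<Theta>" and \<Theta>_in: "\<Theta> ` cover T1 \<subseteq> cover T2"
    and \<Theta>_H: "\<And>x y. x \<in> cover T1 \<Longrightarrow> y \<in> cover T1 \<Longrightarrow> H2 (\<Theta> x) (\<Theta> y) = H1 x y"
    and a: "a \<in> cover T2"
begin

lemma sW1: "subspace (cover T1)" and sW2: "subspace (cover T2)"
  using W1 W2 complex_subspace_imp_subspace by blast+

lemma lin: "linear \<Theta>" using complex_linear_imp_linear[OF \<Theta>] .

lemma \<Theta>_scale: "\<Theta> (c *\<^sub>C x) = c *\<^sub>C \<Theta> x"
  using \<Theta> by (simp add: Vector_Spaces.linear_iff)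

lemma \<Theta>_mem: "z \<in> cover T1 \<Longrightarrow> \<Theta> z \<in> cover T2"
  using \<Theta>_in by blast

lemma affine_mem: "z \<in> cover T1 \<Longrightarrow> \<Theta> z + a \<in> cover T2"
  using \<Theta>_mem a sW2 by (simp add: subspace_add)

lemma rlinear_frame: "rlinear_on (cover T1) (\<lambda>z. - (of_real pi * H2 (\<Theta> z) a))"
proof -
  note rl = rlinear_hermitian_left[OF W2 H2 a]
  show ?thesis
    by (rule rlinear_onI)
      (simp_all add: linear_add[OF lin] linear_scale[OF lin] rlinear_on_add[OF rl] rlinear_on_scale[OF rl]
        \<Theta>_mem field_simps scaleR_conv_of_real)
qed

lemma smooth_frame: "smooth_fun_on (cover T1) (\<lambda>z. exp (- (of_real pi * H2 (\<Theta> z) a)))"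
  using smooth_exp[OF sW1 smooth_rlinear[OF sW1 rlinear_frame]] .

context
  fixes f :: "'b \<Rightarrow> complex"
  assumes f: "smooth_fun_on (cover T2) f"
begin

lemma smooth_affine_pullback: "smooth_fun_on (cover T1) (\<lambda>z. f (\<Theta> z + a))"
  using smooth_affine[OF sW1 sW2 lin \<Theta>_in a f] .

lemma smooth_twisted: "smooth_fun_on (cover T1) (\<lambda>z. exp (- (of_real pi * H2 (\<Theta> z) a)) * f (\<Theta> z + a))"
  by (intro smooth_mult[OF sW1] smooth_frame smooth_affine_pullback)

lemma dir_deriv_twisted:
  assumes "z \<in> cover T1" "v \<in> cover T1"
  shows "dir_deriv v (\<lambda>z. exp (- (of_real pi * H2 (\<Theta> z) a)) * f (\<Theta> z + a)) z =
    exp (- (of_real pi * H2 (\<Theta> z) a)) *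
      (dir_deriv (\<Theta> v) f (\<Theta> z + a) - of_real pi * H2 (\<Theta> v) a * f (\<Theta> z + a))"
  unfolding dir_deriv_mult[OF smooth_frame smooth_affine_pullback assms(2,1)]
    dir_deriv_exp[OF smooth_rlinear[OF sW1 rlinear_frame] smooth_rlinear[OF sW1 rlinear_frame] assms(2,1)]
    dir_deriv_rlinear[OF sW1 rlinear_frame assms(2,1)] dir_deriv_affine[OF lin]
  by (simp add: algebra_simps)

text \<open>The derivative of the frame exponential is complex linear in the direction, so the
  (0,1)-part does not see it.\<close>

lemma dbar_dir_twisted:
  assumes "z \<in> cover T1" "v \<in> cover T1"
  shows "dbar_dir v (\<lambda>z. exp (- (of_real pi * H2 (\<Theta> z) a)) * f (\<Theta> z + a)) z =
    exp (- (of_real pi * H2 (\<Theta> z) a)) * dbar_dir (\<Theta> v) f (\<Theta> z + a)"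
  unfolding dbar_dir_def dir_deriv_twisted[OF assms] dir_deriv_twisted[OF assms(1) i_scale_in[OF W1 assms(2)]]
    \<Theta>_scale hermitian_on_scale_left[OF H2 \<Theta>_mem[OF assms(2)] a]
  by (simp add: algebra_simps)

text \<open>The (1,0)-part keeps the term - pi H(\<open>\<Theta>\<close> v, a) of the frame
  exponential, and this is exactly what turns the connection term at \<open>\<Theta> z\<close> into
  the one at \<open>\<Theta> z + a\<close>.\<close>

lemma cov_dir_twisted:
  assumes z: "z \<in> cover T1" "v \<in> cover T1"
  shows "cov_dir H1 v (\<lambda>z. exp (- (of_real pi * H2 (\<Theta> z) a)) * f (\<Theta> z + a)) z =
    exp (- (of_real pi * H2 (\<Theta> z) a)) * cov_dir H2 (\<Theta> v) f (\<Theta> z + a)"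
proof -
  have H1: "H1 v z = H2 (\<Theta> v) (\<Theta> z)" using \<Theta>_H[OF z(2,1)] by simp
  show ?thesis
    unfolding cov_dir_def d_dir_def dir_deriv_twisted[OF z] dir_deriv_twisted[OF z(1) i_scale_in[OF W1 z(2)]]
      \<Theta>_scale hermitian_on_scale_left[OF H2 \<Theta>_mem[OF z(2)] a] H1
      hermitian_on_add_right[OF W2 H2 \<Theta>_mem[OF z(1)] a \<Theta>_mem[OF z(2)]]
    by (simp add: field_simps)
qed

end

lemma map_subset: "set vs \<subseteq> cover T1 \<Longrightarrow> set (map \<Theta> vs) \<subseteq> cover T2"
  using \<Theta>_in by auto

lemma twist_smooth:
  assumes \<phi>: "\<phi> \<in> smooth_forms (cover T2) k"
  shows "twist (cover T1) H2 \<Theta> a \<phi> \<in> smooth_forms (cover T1) k"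
proof -
  note alt = smooth_forms_alt[OF \<phi>]
  let ?\<psi> = "twist (cover T1) H2 \<Theta> a \<phi>"
  have "antilinear_alt (cover T1) k (?\<psi> z)" if z: "z \<in> cover T1" for z
  proof (rule antilinear_altI)
    fix vs :: "'a list" assume "\<not> (length vs = k \<and> set vs \<subseteq> cover T1)"
    then show "?\<psi> z vs = 0"
      using smooth_forms_zero[OF \<phi>, of "map \<Theta> vs"] by (auto simp: twist_def)
  next
    fix xs ys x y
    assume *: "Suc (length xs + length ys) = k" "set xs \<subseteq> cover T1" "set ys \<subseteq> cover T1" "x \<in> cover T1" "y \<in> cover T1"
    then show "?\<psi> z (xs @ (x + y) # ys) = ?\<psi> z (xs @ x # ys) + ?\<psi> z (xs @ y # ys)"
      using antilinear_alt_add[OF alt, of "map \<Theta> xs" "map \<Theta> ys" "\<Theta> x" "\<Theta> y"] map_subset \<Theta>_mem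
      by (simp add: twist_def linear_add[OF lin] subspace_add[OF sW1] distrib_left)
  next
    fix xs ys x and c :: complex
    assume *: "Suc (length xs + length ys) = k" "set xs \<subseteq> cover T1" "set ys \<subseteq> cover T1" "x \<in> cover T1"
    then show "?\<psi> z (xs @ (c *\<^sub>C x) # ys) = cnj c * ?\<psi> z (xs @ x # ys)"
      using antilinear_alt_scale[OF alt, of "map \<Theta> xs" "map \<Theta> ys" "\<Theta> x" _ c] map_subset \<Theta>_mem
        complex_space.subspace_scale[OF W1]
      by (simp add: twist_def \<Theta>_scale)
  next
    fix xs ys zs x
    assume "length (xs @ x # ys @ x # zs) = k" "set xs \<subseteq> cover T1" "set ys \<subseteq> cover T1" "set zs \<subseteq> cover T1" "x \<in> cover T1"
    then show "?\<psi> z (xs @ x # ys @ x # zs) = 0"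
      using antilinear_alt_alt[OF alt, of "map \<Theta> xs" "\<Theta> x" "map \<Theta> ys" "map \<Theta> zs"] map_subset \<Theta>_mem
      by (simp add: twist_def)
  qed
  moreover have "smooth_fun_on (cover T1) (\<lambda>z. ?\<psi> z vs)" for vs
  proof (cases "set vs \<subseteq> cover T1")
    case True
    show ?thesis
      by (rule smooth_cong[OF sW1 _ smooth_twisted[OF smooth_forms_smooth[OF \<phi>, of "map \<Theta> vs"]]])
        (simp add: twist_def True)
  next
    case False
    then show ?thesis using smooth_const[OF sW1, of 0] by (simp add: twist_def)
  qed
  ultimately show ?thesis by (auto simp: smooth_forms_def twist_def)
qed

lemma dbar_dir_twist:
  assumes "smooth_fun_on (cover T2) (\<lambda>z. \<phi> z (map \<Theta> vs))" "set vs \<subseteq> cover T1" "z \<in> cover T1" "v \<in> cover T1"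
  shows "dbar_dir v (\<lambda>z. twist (cover T1) H2 \<Theta> a \<phi> z vs) z =
      exp (- (of_real pi * H2 (\<Theta> z) a)) * dbar_dir (\<Theta> v) (\<lambda>z. \<phi> z (map \<Theta> vs)) (\<Theta> z + a)" (is ?d)
    and "cov_dir H1 v (\<lambda>z. twist (cover T1) H2 \<Theta> a \<phi> z vs) z =
      exp (- (of_real pi * H2 (\<Theta> z) a)) * cov_dir H2 (\<Theta> v) (\<lambda>z. \<phi> z (map \<Theta> vs)) (\<Theta> z + a)" (is ?c)
proof -
  have dd: "dir_deriv w (\<lambda>z. twist (cover T1) H2 \<Theta> a \<phi> z vs) z =
      dir_deriv w (\<lambda>z. exp (- (of_real pi * H2 (\<Theta> z) a)) * \<phi> (\<Theta> z + a) (map \<Theta> vs)) z"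
    if "w \<in> cover T1" for w
    by (rule dir_deriv_cong[OF sW1 assms(3) that]) (simp add: twist_def assms(2))
  show ?d
    using dbar_dir_twisted[OF assms(1,3,4)] assms i_scale_in[OF W1] by (simp add: dbar_dir_def dd)
  show ?c
    using cov_dir_twisted[OF assms(1,3,4)] assms i_scale_in[OF W1]
    by (simp add: cov_dir_def d_dir_def dd) (simp add: twist_def assms)
qed

lemma dbar_twist:
  assumes \<phi>: "\<phi> \<in> smooth_forms (cover T2) k"
  shows "dbar T1 (twist (cover T1) H2 \<Theta> a \<phi>) = twist (cover T1) H2 \<Theta> a (dbar T2 \<phi>)"
proof (intro ext)
  fix z vs
  show "dbar T1 (twist (cover T1) H2 \<Theta> a \<phi>) z vs = twist (cover T1) H2 \<Theta> a (dbar T2 \<phi>) z vs"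
  proof (cases "z \<in> cover T1 \<and> set vs \<subseteq> cover T1")
    case True
    have "dbar_dir (vs ! i) (\<lambda>y. twist (cover T1) H2 \<Theta> a \<phi> y (take i vs @ drop (Suc i) vs)) z =
        exp (- (of_real pi * H2 (\<Theta> z) a)) * dbar_dir (\<Theta> (vs ! i))
          (\<lambda>z. \<phi> z (take i (map \<Theta> vs) @ drop (Suc i) (map \<Theta> vs))) (\<Theta> z + a)" if "i < length vs" for i
    proof -
      have "set (take i vs @ drop (Suc i) vs) \<subseteq> cover T1"
        using True set_take_subset[of i vs] set_drop_subset[of "Suc i" vs] by auto
      moreover have "vs ! i \<in> cover T1" using True that nth_mem by blast
      ultimately show ?thesis
        using dbar_dir_twist(1)[OF smooth_forms_smooth[OF \<phi>], of "take i vs @ drop (Suc i) vs" z "vs ! i"] True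
        by (simp add: take_map drop_map)
    qed
    then have "dbar T1 (twist (cover T1) H2 \<Theta> a \<phi>) z vs = (\<Sum>i<length vs. (-1) ^ i *
        (exp (- (of_real pi * H2 (\<Theta> z) a)) * dbar_dir (\<Theta> (vs ! i))
          (\<lambda>z. \<phi> z (take i (map \<Theta> vs) @ drop (Suc i) (map \<Theta> vs))) (\<Theta> z + a)))"
      unfolding dbar_def using True by (simp only: simp_thms if_True) (rule sum.cong, simp_all)
    also have "\<dots> = exp (- (of_real pi * H2 (\<Theta> z) a)) * dbar T2 \<phi> (\<Theta> z + a) (map \<Theta> vs)"
      unfolding dbar_def using True map_subset[of vs] affine_mem
      by (simp add: sum_distrib_left mult.left_commute del: set_map)
    finally show ?thesis using True by (simp add: twist_def)
  next
    case False
    then show ?thesis by (auto simp: dbar_def twist_def)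
  qed
qed

text \<open>The orthonormal set travels along with \<open>\<Theta>\<close>, and injectivity keeps
  the two sums in bijection. That the image may be replaced by any other orthonormal basis is a
  separate fact about traces.\<close>

lemma codbar_twist:
  assumes \<phi>: "\<phi> \<in> smooth_forms (cover T2) k" and E: "E \<subseteq> cover T1" "inj_on \<Theta> E"
  shows "codbar (cover T1) E H1 (twist (cover T1) H2 \<Theta> a \<phi>) =
    twist (cover T1) H2 \<Theta> a (codbar (cover T2) (\<Theta> ` E) H2 \<phi>)"
proof (intro ext)
  fix z vs
  show "codbar (cover T1) E H1 (twist (cover T1) H2 \<Theta> a \<phi>) z vs =
    twist (cover T1) H2 \<Theta> a (codbar (cover T2) (\<Theta> ` E) H2 \<phi>) z vs"
  proof (cases "z \<in> cover T1 \<and> set vs \<subseteq> cover T1")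
    case True
    have "cov_dir H1 e (\<lambda>y. twist (cover T1) H2 \<Theta> a \<phi> y (e # vs)) z =
        exp (- (of_real pi * H2 (\<Theta> z) a)) * cov_dir H2 (\<Theta> e) (\<lambda>z. \<phi> z (\<Theta> e # map \<Theta> vs)) (\<Theta> z + a)"
      if "e \<in> E" for e
      using dbar_dir_twist(2)[OF smooth_forms_smooth[OF \<phi>], of "e # vs" z e] True that E by auto
    then show ?thesis
      using True map_subset affine_mem
      by (simp add: codbar_def twist_def[of _ _ _ _ "\<lambda>z vs. if _ z vs then _ z vs else 0"]
          sum_distrib_left sum.reindex[OF E(2)] del: set_map cong: sum.cong)
  next
    case False
    then show ?thesis by (auto simp: codbar_def twist_def)
  qed
qed

end


section \<open>Orthonormal bases\<close>

locale hermitian_torus =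
  fixes T :: "'a::complex_euclidean torus"
  assumes W: "complex_space.subspace (cover T)"
    and g: "hermitian_on (cover T) (metric T)"
    and g_pos: "\<And>x. x \<in> cover T \<Longrightarrow> x \<noteq> 0 \<Longrightarrow> Re (metric T x x) > 0"
begin

abbreviation G :: "'a \<Rightarrow> 'a \<Rightarrow> real" where "G x y \<equiv> Re (metric T x y)"

lemma sW: "subspace (cover T)"
  using complex_subspace_imp_subspace[OF W] .

lemma G_left: "y \<in> cover T \<Longrightarrow> rlinear_on (cover T) (\<lambda>x. G x y)"
  using rlinear_hermitian_left[OF W g, of y] by (simp add: rlinear_on_def)

lemma G_sym: "x \<in> cover T \<Longrightarrow> y \<in> cover T \<Longrightarrow> G x y = G y x"
  using hermitian_on_cnj[OF g, of x y] by (metis complex_cnj_cnj cnj.simps(1))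

lemma G_combination:
  assumes "finite E" "E \<subseteq> cover T" "\<forall>x\<in>E. \<forall>y\<in>E. G x y = (if x = y then 1 else 0)" "f \<in> E"
  shows "G (\<Sum>e\<in>E. u e *\<^sub>R e) f = u f"
proof -
  have "G (\<Sum>e\<in>E. u e *\<^sub>R e) f = (\<Sum>e\<in>E. u e *\<^sub>R G e f)"
    using assms by (intro rlinear_on_sum[OF G_left sW]) auto
  also have "\<dots> = (\<Sum>e\<in>E. if e = f then u e else 0)"
    using assms by (intro sum.cong) auto
  finally show ?thesis using assms by simp
qed

lemma orthonormal_independent:
  assumes "finite E" "E \<subseteq> cover T" "\<forall>x\<in>E. \<forall>y\<in>E. G x y = (if x = y then 1 else 0)"
  shows "independent E"
proof (rule independent_if_scalars_zero[OF assms(1)])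
  fix u x assume *: "(\<Sum>x\<in>E. u x *\<^sub>R x) = 0" "x \<in> E"
  then have "u x = G 0 x" using G_combination[OF assms *(2), of u] by simp
  also have "\<dots> = 0" using rlinear_on_0[OF G_left sW, of x] * assms by auto
  finally show "u x = 0" .
qed

text \<open>An orthonormal system of maximal size must span: otherwise the normalized component of
  an outside vector orthogonal to the system would enlarge it.\<close>

lemma orthonormal_basis_exists: "\<exists>E. orthonormal_basis T E"
proof -
  define P where "P E \<longleftrightarrow> finite E \<and> E \<subseteq> cover T \<and> (\<forall>x\<in>E. \<forall>y\<in>E. G x y = (if x = y then 1 else 0))" for E
  have "P {}" by (simp add: P_def)
  moreover have "card E \<le> DIM('a)" if "P E" for E
    using orthonormal_independent[of E] that independent_bound[of E] by (auto simp: P_def)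
  ultimately obtain E where E: "P E" and max: "\<And>F. P F \<Longrightarrow> card F \<le> card E"
    using ex_has_greatest_nat[of P "{}" card "Suc DIM('a)"] by (metis le_imp_less_Suc)
  have E': "finite E" "E \<subseteq> cover T" "\<forall>x\<in>E. \<forall>y\<in>E. G x y = (if x = y then 1 else 0)"
    using E by (auto simp: P_def)
  have "cover T \<subseteq> span E"
  proof (rule ccontr)
    assume "\<not> cover T \<subseteq> span E"
    then obtain x where x: "x \<in> cover T" "x \<notin> span E" by blast
    define p where "p = (\<Sum>e\<in>E. G x e *\<^sub>R e)"
    define y where "y = x - p"
    have "p \<in> span E" unfolding p_def by (intro span_sum span_scale span_base)
    have p: "p \<in> cover T" unfolding p_def using E' by (intro subspace_sum[OF sW] subspace_scale[OF sW]) auto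
    have y: "y \<in> cover T" unfolding y_def using x p sW by (simp add: subspace_diff)
    have "y \<noteq> 0" using x \<open>p \<in> span E\<close> by (auto simp: y_def)
    then have pos: "G y y > 0" using g_pos y by blast
    have ortho: "G y e = 0" if "e \<in> E" for e
    proof -
      have e: "e \<in> cover T" using that E' by auto
      have "G (y + p) e = G y e + G p e" using rlinear_on_add[OF G_left[OF e] y p] .
      moreover have "G p e = G x e" unfolding p_def by (rule G_combination[OF E' that])
      ultimately show ?thesis by (simp add: y_def)
    qed
    define n where "n = (1 / sqrt (G y y)) *\<^sub>R y"
    have n: "n \<in> cover T" unfolding n_def using y sW by (simp add: subspace_scale)
    have Gn: "G n e = G y e / sqrt (G y y)" if "e \<in> cover T" for e
      unfolding n_def using rlinear_on_scale[OF G_left[OF that] y] by simp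
    have "G n n = G n y / sqrt (G y y)" using Gn[OF n] G_sym[OF n y] by simp
    also have "\<dots> = 1" using Gn[OF y] pos by (simp add: real_div_sqrt flip: divide_divide_eq_left)
    finally have nn: "G n n = 1" .
    have ne: "G n e = 0" "G e n = 0" if "e \<in> E" for e
    proof -
      have e: "e \<in> cover T" using that E' by auto
      show "G n e = 0" using Gn[OF e] ortho[OF that] by simp
      then show "G e n = 0" using G_sym[OF n e] by simp
    qed
    have nE: "n \<notin> E" using ne(1)[of n] nn by auto
    have "P (insert n E)"
      using E' n nn ne nE by (auto simp: P_def)
    then show False using max[of "insert n E"] E' nE by simp
  qed
  moreover have "span E \<subseteq> cover T" using E' sW by (simp add: span_minimal)
  ultimately have "orthonormal_basis T E"
    using E' unfolding orthonormal_basis_def by blast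
  then show ?thesis ..
qed

lemma onb: "orthonormal_basis T (onb T)"
  unfolding onb_def using orthonormal_basis_exists by (rule someI_ex)

lemma orthonormal_basisD:
  assumes "orthonormal_basis T E"
  shows "finite E" "E \<subseteq> cover T" "span E = cover T" "\<forall>x\<in>E. \<forall>y\<in>E. G x y = (if x = y then 1 else 0)"
  using assms by (auto simp: orthonormal_basis_def)

lemma orthonormal_expansion:
  assumes "orthonormal_basis T E" "x \<in> cover T"
  shows "x = (\<Sum>e\<in>E. G x e *\<^sub>R e)"
proof -
  note E = orthonormal_basisD[OF assms(1)]
  obtain u where u: "x = (\<Sum>e\<in>E. u e *\<^sub>R e)"
    using assms(2) E(3) by (auto simp: span_finite[OF E(1)])
  have "G x e = u e" if "e \<in> E" for e
    unfolding u by (rule G_combination[OF E(1,2,4) that])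
  then show ?thesis using u by simp
qed

text \<open>Expand both arguments of each diagonal term over \<open>E\<close> in the basis
  \<open>F\<close>. The coefficients sum over \<open>E\<close> to the product of f and f', which is
  Parseval for \<open>E\<close> and equals the Kronecker symbol on \<open>F\<close>.\<close>

lemma orthonormal_trace:
  fixes B :: "'a \<Rightarrow> 'a \<Rightarrow> complex"
  assumes E: "orthonormal_basis T E" and F: "orthonormal_basis T F"
    and l: "\<And>y. y \<in> cover T \<Longrightarrow> rlinear_on (cover T) (\<lambda>x. B x y)"
    and r: "\<And>x. x \<in> cover T \<Longrightarrow> rlinear_on (cover T) (\<lambda>y. B x y)"
  shows "(\<Sum>e\<in>E. B e e) = (\<Sum>f\<in>F. B f f)"
proof -
  note E' = orthonormal_basisD[OF E] and F' = orthonormal_basisD[OF F]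
  have "B e e = (\<Sum>f\<in>F. \<Sum>f'\<in>F. (G e f * G e f') *\<^sub>R B f f')" if "e \<in> E" for e
  proof -
    have e: "e \<in> cover T" using that E' by auto
    have "B e e = B (\<Sum>f\<in>F. G e f *\<^sub>R f) e"
      using orthonormal_expansion[OF F e] by simp
    also have "\<dots> = (\<Sum>f\<in>F. G e f *\<^sub>R B f e)"
      using F'(1,2) by (intro rlinear_on_sum[OF l[OF e] sW]) auto
    also have "\<dots> = (\<Sum>f\<in>F. G e f *\<^sub>R (\<Sum>f'\<in>F. G e f' *\<^sub>R B f f'))"
    proof (rule sum.cong[OF refl])
      fix f assume "f \<in> F"
      then have f: "f \<in> cover T" using F' by auto
      have "B f e = B f (\<Sum>f'\<in>F. G e f' *\<^sub>R f')"
        using orthonormal_expansion[OF F e] by simp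
      also have "\<dots> = (\<Sum>f'\<in>F. G e f' *\<^sub>R B f f')"
        using F'(1,2) by (intro rlinear_on_sum[OF r[OF f] sW]) auto
      finally show "G e f *\<^sub>R B f e = G e f *\<^sub>R (\<Sum>f'\<in>F. G e f' *\<^sub>R B f f')" by simp
    qed
    finally show ?thesis by (simp add: scaleR_sum_right)
  qed
  then have "(\<Sum>e\<in>E. B e e) = (\<Sum>e\<in>E. \<Sum>f\<in>F. \<Sum>f'\<in>F. (G e f * G e f') *\<^sub>R B f f')" by simp
  also have "\<dots> = (\<Sum>f\<in>F. \<Sum>e\<in>E. \<Sum>f'\<in>F. (G e f * G e f') *\<^sub>R B f f')" by (rule sum.swap)
  also have "\<dots> = (\<Sum>f\<in>F. \<Sum>f'\<in>F. \<Sum>e\<in>E. (G e f * G e f') *\<^sub>R B f f')"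
    by (rule sum.cong[OF refl]) (rule sum.swap)
  also have "\<dots> = (\<Sum>f\<in>F. \<Sum>f'\<in>F. (if f = f' then 1 else 0) *\<^sub>R B f f')"
  proof (intro sum.cong refl)
    fix f f' assume ff': "f \<in> F" "f' \<in> F"
    then have f: "f \<in> cover T" "f' \<in> cover T" using F' by auto
    have "(if f = f' then 1 else 0) = G f f'" using F'(4) ff' by auto
    also have "\<dots> = G (\<Sum>e\<in>E. G f e *\<^sub>R e) f'"
      using orthonormal_expansion[OF E f(1)] by simp
    also have "\<dots> = (\<Sum>e\<in>E. G f e *\<^sub>R G e f')"
      using E'(1,2) by (intro rlinear_on_sum[OF G_left[OF f(2)] sW]) auto
    also have "\<dots> = (\<Sum>e\<in>E. G e f * G e f')"
      using E'(2) f by (intro sum.cong) (auto simp: G_sym)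
    finally show "(\<Sum>e\<in>E. (G e f * G e f') *\<^sub>R B f f') = (if f = f' then 1 else 0) *\<^sub>R B f f'"
      by (simp add: scaleR_sum_left)
  qed
  also have "\<dots> = (\<Sum>f\<in>F. B f f)"
    using F'(1) by (intro sum.cong refl) (simp add: if_distrib[of "\<lambda>c. c *\<^sub>R _"] cong: if_cong)
  finally show ?thesis .
qed

text \<open>The adjoint is computed with the arbitrary choice \<open>onb T\<close>, and an isometry
  need not carry the choice on one torus to the choice on the other. The trace form of
  \<open>codbar\<close> removes the dependence.\<close>

lemma codbar_onb_independent:
  assumes E: "orthonormal_basis T E" and F: "orthonormal_basis T F"
    and H: "hermitian_on (cover T) H" and \<phi>: "\<phi> \<in> smooth_forms (cover T) k"
  shows "codbar (cover T) E H \<phi> = codbar (cover T) F H \<phi>"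
proof (intro ext)
  fix z vs
  show "codbar (cover T) E H \<phi> z vs = codbar (cover T) F H \<phi> z vs"
  proof (cases "z \<in> cover T \<and> set vs \<subseteq> cover T \<and> Suc (length vs) = k")
    case True
    note alt = smooth_forms_alt[OF \<phi>] and sm = smooth_forms_smooth[OF \<phi>]
    have "rlinear_on (cover T) (\<lambda>w. cov_dir H v (\<lambda>y. \<phi> y (w # vs)) z)" if v: "v \<in> cover T" for v
    proof (rule rlinear_onI)
      fix x w assume xw: "x \<in> cover T" "w \<in> cover T"
      have "(\<lambda>y. \<phi> y ((x + w) # vs)) = (\<lambda>y. \<phi> y (x # vs) + \<phi> y (w # vs))"
        using antilinear_alt_add[OF alt, of "[]" vs x w] True xw by auto
      then show "cov_dir H v (\<lambda>y. \<phi> y ((x + w) # vs)) z =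
          cov_dir H v (\<lambda>y. \<phi> y (x # vs)) z + cov_dir H v (\<lambda>y. \<phi> y (w # vs)) z"
        using dbar_dir_add(2)[OF W sm sm v] True by auto
    next
      fix r x assume x: "x \<in> cover T"
      have "(\<lambda>y. \<phi> y ((r *\<^sub>R x) # vs)) = (\<lambda>y. of_real r * \<phi> y (x # vs))"
        using antilinear_alt_scale[OF alt, of "[]" vs x _ "of_real r"] True x by (auto simp: scaleC_of_real)
      then show "cov_dir H v (\<lambda>y. \<phi> y ((r *\<^sub>R x) # vs)) z = r *\<^sub>R cov_dir H v (\<lambda>y. \<phi> y (x # vs)) z"
        using dbar_dir_cmult(2)[OF W sm v] True by (auto simp: scaleR_conv_of_real)
    qed
    then have "(\<Sum>e\<in>E. cov_dir H e (\<lambda>y. \<phi> y (e # vs)) z) = (\<Sum>f\<in>F. cov_dir H f (\<lambda>y. \<phi> y (f # vs)) z)"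
      using True by (intro orthonormal_trace[OF E F] rlinear_on_cov_dir[OF W sm _ H]) auto
    then show ?thesis using True by (simp add: codbar_def)
  next
    case False
    then consider "\<not> (z \<in> cover T \<and> set vs \<subseteq> cover T)" | "Suc (length vs) \<noteq> k" by blast
    then show ?thesis
    proof cases
      case 2
      then have "\<phi> y (e # vs) = 0" for y e using smooth_forms_zero[OF \<phi>, of "e # vs"] by auto
      then show ?thesis by (simp add: codbar_def cov_dir_zero)
    qed (auto simp: codbar_def)
  qed
qed

end

section \<open>Integration over tori\<close>

text \<open>A lattice in the form of a uniformly discrete spanning subgroup. An integral basis and
  its real independence are recovered from this, so subgroups and images of a lattice can be treated
  without counting ranks.\<close>

locale lattice_torus = hermitian_torus +
  assumes lat: "int_module.subspace (lat T)" and lat_discrete: "uniform_discrete (lat T)"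
    and lat_span: "span (lat T) = cover T"
begin

text \<open>The same choice as inside \<open>fundamental_domain\<close>, which is therefore its
  half-open parallelotope.\<close>

definition fbasis :: "'a set" where "fbasis = (SOME B. lattice_basis (lat T) B)"

lemma fbasis_lattice: "lattice_basis (lat T) fbasis"
  unfolding fbasis_def by (rule someI_ex) (rule discrete_subgroup_basis[OF lat lat_discrete])

lemma fbasis_finite: "finite fbasis" and fbasis_int_span: "int_module.span fbasis = lat T"
  using fbasis_lattice by (auto simp: lattice_basis_def)

lemma fbasis_independent: "independent fbasis"
  using lattice_basis_independent[OF fbasis_lattice lat_discrete] .

lemma fbasis_span: "span fbasis = cover T"
  using lattice_basis_span[OF fbasis_lattice] lat_span by simp

lemma fbasis_lat: "fbasis \<subseteq> lat T"
  using lattice_basis_subset[OF fbasis_lattice] .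

lemma lat_cover: "lat T \<subseteq> cover T"
  using span_superset[of "lat T"] lat_span by simp

lemma fbasis_cover: "b \<in> fbasis \<Longrightarrow> b \<in> cover T"
  using fbasis_lat lat_cover by blast

text \<open>Coordinates with respect to \<open>fbasis\<close>, fixed once as functions on the
  ambient type.\<close>

definition crd :: "'a \<Rightarrow> 'a \<Rightarrow> real" where
  "crd = (SOME \<tau>. (\<forall>b. linear (\<tau> b)) \<and> (\<forall>b\<in>fbasis. \<forall>c\<in>fbasis. \<tau> b c = (if b = c then 1 else 0)) \<and>
     (\<forall>z\<in>span fbasis. z = (\<Sum>b\<in>fbasis. \<tau> b z *\<^sub>R b)))"

lemma crd_linear: "linear (crd b)"
  and crd_basis: "b \<in> fbasis \<Longrightarrow> c \<in> fbasis \<Longrightarrow> crd b c = (if b = c then 1 else 0)"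
  and crd_expansion: "z \<in> cover T \<Longrightarrow> z = (\<Sum>b\<in>fbasis. crd b z *\<^sub>R b)"
proof -
  have "\<exists>\<tau>. (\<forall>b. linear (\<tau> b)) \<and> (\<forall>b\<in>fbasis. \<forall>c\<in>fbasis. \<tau> b c = (if b = c then 1 else (0::real))) \<and>
     (\<forall>z\<in>span fbasis. z = (\<Sum>b\<in>fbasis. \<tau> b z *\<^sub>R b))"
  proof (rule dual_functionals[OF fbasis_finite fbasis_independent])
    fix \<tau> :: "'a \<Rightarrow> 'a \<Rightarrow> real"
    assume "\<And>b. linear (\<tau> b)"
      "\<And>b c. b \<in> fbasis \<Longrightarrow> c \<in> fbasis \<Longrightarrow> \<tau> b c = (if b = c then 1 else 0)"
      "\<And>z. z \<in> span fbasis \<Longrightarrow> z = (\<Sum>b\<in>fbasis. \<tau> b z *\<^sub>R b)"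
    then show ?thesis by (intro exI[of _ \<tau>] conjI allI ballI)
  qed
  from someI_ex[OF this]
  have *: "(\<forall>b. linear (crd b)) \<and> (\<forall>b\<in>fbasis. \<forall>c\<in>fbasis. crd b c = (if b = c then 1 else 0)) \<and>
     (\<forall>z\<in>span fbasis. z = (\<Sum>b\<in>fbasis. crd b z *\<^sub>R b))" unfolding crd_def .
  show "linear (crd b)" using * by blast
  show "crd b c = (if b = c then 1 else 0)" if "b \<in> fbasis" "c \<in> fbasis" using * that by blast
  show "z = (\<Sum>b\<in>fbasis. crd b z *\<^sub>R b)" if "z \<in> cover T" using * that fbasis_span by blast
qed

lemma crd_combination: "b \<in> fbasis \<Longrightarrow> crd b (\<Sum>c\<in>fbasis. u c *\<^sub>R c) = u b"
proof -
  assume b: "b \<in> fbasis"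
  have "crd b (\<Sum>c\<in>fbasis. u c *\<^sub>R c) = (\<Sum>c\<in>fbasis. u c * crd b c)"
    by (simp add: linear_sum[OF crd_linear] linear_scale[OF crd_linear])
  also have "\<dots> = (\<Sum>c\<in>fbasis. if b = c then u c else 0)"
    using b by (intro sum.cong) (auto simp: crd_basis)
  finally show ?thesis using b fbasis_finite by simp
qed

lemma combination_cover: "(\<Sum>b\<in>fbasis. u b *\<^sub>R b) \<in> cover T"
  by (intro subspace_sum[OF sW] subspace_scale[OF sW] fbasis_cover)

lemma crd_continuous: "continuous_on S (crd b)"
  using crd_linear by (simp add: linear_continuous_on linear_conv_bounded_linear)

abbreviation F where "F \<equiv> fundamental_domain T"

lemma F_eq: "F = {z \<in> cover T. \<forall>b\<in>fbasis. 0 \<le> crd b z \<and> crd b z < 1}"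
proof (intro subset_antisym subsetI)
  fix z assume "z \<in> F"
  then obtain t where "z = (\<Sum>b\<in>fbasis. t b *\<^sub>R b)" "\<forall>b\<in>fbasis. 0 \<le> t b \<and> t b < 1"
    unfolding fundamental_domain_def fbasis_def[symmetric] by (auto simp: Let_def)
  then show "z \<in> {z \<in> cover T. \<forall>b\<in>fbasis. 0 \<le> crd b z \<and> crd b z < 1}"
    using crd_combination combination_cover by auto
next
  fix z assume "z \<in> {z \<in> cover T. \<forall>b\<in>fbasis. 0 \<le> crd b z \<and> crd b z < 1}"
  then show "z \<in> F"
    unfolding fundamental_domain_def fbasis_def[symmetric] Let_def
    using crd_expansion[of z] by (intro CollectI exI[of _ "\<lambda>b. crd b z"]) auto
qed

lemma F_cover: "F \<subseteq> cover T" by (auto simp: F_eq)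

lemma closed_cover: "closed (cover T)"
  using sW by (rule closed_subspace)

lemma crd_measurable [measurable]: "crd b \<in> borel_measurable borel"
  using borel_measurable_continuous_onI[OF crd_continuous] .

lemma cover_measurable [measurable]: "cover T \<in> sets borel"
  using closed_cover by simp

lemma F_measurable [measurable]: "F \<in> sets borel"
proof -
  have "F = cover T \<inter> (\<Inter>b\<in>fbasis. {z. 0 \<le> crd b z \<and> crd b z < 1})"
    by (auto simp: F_eq)
  moreover have "{z. 0 \<le> crd b z \<and> crd b z < 1} \<in> sets borel" for b
    by measurable
  ultimately show ?thesis
    using fbasis_finite
    by (cases "fbasis = {}") (auto intro!: sets.Int sets.finite_INT)
qed

lemma F_bounded: "bounded F"
proof (rule bounded_subset[OF bounded_parallelotope[OF fbasis_finite]])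
  show "F \<subseteq> {\<Sum>b\<in>fbasis. t b *\<^sub>R b | t. \<forall>b\<in>fbasis. \<bar>t b\<bar> \<le> (1::real)}"
  proof
    fix z assume "z \<in> F"
    then show "z \<in> {\<Sum>b\<in>fbasis. t b *\<^sub>R b | t. \<forall>b\<in>fbasis. \<bar>t b\<bar> \<le> (1::real)}"
      using crd_expansion[of z]
      by (intro CollectI exI[of _ "\<lambda>b. crd b z"]) (auto simp: F_eq)
  qed
qed

abbreviation orth where "orth \<equiv> onb T"
abbreviation M where "M \<equiv> \<Pi>\<^sub>M e\<in>orth. (lborel :: real measure)"
abbreviation \<Phi> where "\<Phi> \<equiv> \<lambda>t. \<Sum>e\<in>orth. t e *\<^sub>R e"

lemma orthD: "finite orth" "orth \<subseteq> cover T" "span orth = cover T"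
    "\<forall>x\<in>orth. \<forall>y\<in>orth. G x y = (if x = y then 1 else 0)"
  using orthonormal_basisD[OF onb] by auto

lemma \<Phi>_measurable [measurable]: "\<Phi> \<in> measurable M borel"
  by measurable

lemma sets_volume [measurable_cong, simp]: "sets (volume T) = sets borel"
  by (simp add: volume_def)

lemma space_volume [simp]: "space (volume T) = UNIV"
  by (simp add: volume_def)

lemma \<Phi>_cover: "\<Phi> t \<in> cover T"
  using orthD(2) by (intro subspace_sum[OF sW] subspace_scale[OF sW]) auto

lemma AE_volume_cover: "AE z in volume T. z \<in> cover T"
  unfolding volume_def by (subst AE_distr_iff) (auto simp: \<Phi>_cover)

lemma product_sigma_finite_lborel: "product_sigma_finite (\<lambda>_. lborel :: real measure)"
  by standard

text \<open>Boxes determine the product measure, and on a box the shift acts in each factor as a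
  translation of the line.\<close>

lemma M_translation:
  "distr M M (\<lambda>t. \<lambda>e\<in>orth. t e + c e) = M"
proof (rule product_sigma_finite.PiM_eqI[OF product_sigma_finite_lborel orthD(1)])
  show "sets (distr M M (\<lambda>t. \<lambda>e\<in>orth. t e + c e)) = sets M" by simp
next
  fix A :: "'a \<Rightarrow> real set" assume A: "\<And>e. e \<in> orth \<Longrightarrow> A e \<in> sets lborel"
  have meas: "(\<lambda>t. \<lambda>e\<in>orth. t e + c e) \<in> measurable M M" by measurable
  have Am: "(+) (c e) -` A e \<in> sets lborel" if "e \<in> orth" for e
    using measurable_sets[of "(+) (c e)" borel borel "A e"] A[OF that] by simp
  have "emeasure (distr M M (\<lambda>t. \<lambda>e\<in>orth. t e + c e)) (Pi\<^sub>E orth A) =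
      emeasure M ((\<lambda>t. \<lambda>e\<in>orth. t e + c e) -` Pi\<^sub>E orth A \<inter> space M)"
    using A orthD(1) by (intro emeasure_distr meas sets_PiM_I_finite) auto
  also have "(\<lambda>t. \<lambda>e\<in>orth. t e + c e) -` Pi\<^sub>E orth A \<inter> space M = Pi\<^sub>E orth (\<lambda>e. (+) (c e) -` A e)"
    by (auto simp: space_PiM PiE_iff add.commute)
  also have "emeasure M (Pi\<^sub>E orth (\<lambda>e. (+) (c e) -` A e)) = (\<Prod>e\<in>orth. emeasure lborel ((+) (c e) -` A e))"
    by (rule product_sigma_finite.emeasure_PiM[OF product_sigma_finite_lborel orthD(1) Am])
  also have "\<dots> = (\<Prod>e\<in>orth. emeasure lborel (A e))"
  proof (rule prod.cong[OF refl])
    fix e assume e: "e \<in> orth"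
    have "emeasure (distr lborel borel ((+) (c e))) (A e) = emeasure lborel ((+) (c e) -` A e)"
      using A[OF e] by (subst emeasure_distr) auto
    then show "emeasure lborel ((+) (c e) -` A e) = emeasure lborel (A e)"
      by (simp add: lborel_distr_plus)
  qed
  finally show "emeasure (distr M M (\<lambda>t. \<lambda>e\<in>orth. t e + c e)) (Pi\<^sub>E orth A) = (\<Prod>e\<in>orth. emeasure lborel (A e))" .
qed

lemma volume_translation:
  assumes w: "w \<in> cover T"
  shows "distr (volume T) borel (\<lambda>z. z + w) = volume T"
proof -
  have we: "w = (\<Sum>e\<in>orth. G w e *\<^sub>R e)" using orthonormal_expansion[OF onb w] .
  have "distr (volume T) borel (\<lambda>z. z + w) = distr M borel (\<lambda>t. \<Phi> t + w)"
    unfolding volume_def by (subst distr_distr) (auto simp: o_def)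
  also have "\<dots> = distr M borel (\<Phi> \<circ> (\<lambda>t. \<lambda>e\<in>orth. t e + G w e))"
  proof (rule distr_cong[OF refl refl])
    fix t
    have "\<Phi> (\<lambda>e\<in>orth. t e + G w e) = \<Phi> t + (\<Sum>e\<in>orth. G w e *\<^sub>R e)"
      by (simp add: scaleR_add_left sum.distrib)
    then show "\<Phi> t + w = (\<Phi> \<circ> (\<lambda>t. \<lambda>e\<in>orth. t e + G w e)) t" using we by simp
  qed
  also have "\<dots> = distr (distr M M (\<lambda>t. \<lambda>e\<in>orth. t e + G w e)) borel \<Phi>"
    by (subst distr_distr) auto
  also have "\<dots> = volume T" unfolding M_translation volume_def ..
  finally show ?thesis .
qed

lemma integral_translation:
  fixes h :: "'a \<Rightarrow> complex"
  assumes "w \<in> cover T" "h \<in> borel_measurable borel"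
  shows "(LINT z|volume T. h (z + w)) = (LINT z|volume T. h z)"
proof -
  have "(LINT z|volume T. h z) = (LINT z|distr (volume T) borel (\<lambda>z. z + w). h z)"
    using volume_translation[OF assms(1)] by simp
  also have "\<dots> = (LINT z|volume T. h (z + w))"
    using assms(2) by (intro integral_distr) auto
  finally show ?thesis by simp
qed

text \<open>Orthonormal coordinates are linear, so they are bounded on a bounded set, which thus
  pulls back into a box of finite measure.\<close>

lemma volume_bounded_finite:
  assumes "S \<in> sets borel" "bounded S"
  shows "emeasure (volume T) S < \<infinity>"
proof -
  obtain R where R: "R > 0" "\<And>z. z \<in> S \<Longrightarrow> norm z \<le> R" using assms(2) bounded_pos by metis
  have "\<exists>K\<ge>0. \<forall>z\<in>cover T. \<bar>G z e\<bar> \<le> K * norm z" if e: "e \<in> orth" for e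
  proof -
    have ec: "e \<in> cover T" using e orthD by auto
    obtain f where f: "linear f" "\<And>x. x \<in> cover T \<Longrightarrow> f x = G x e"
      using rlinear_on_extend[OF G_left[OF ec] sW] by blast
    then obtain K where "K > 0" "\<forall>x. norm (f x) \<le> norm x * K"
      using bounded_linear.pos_bounded[of f] by (auto simp: linear_conv_bounded_linear)
    then show ?thesis using f(2) by (metis less_imp_le mult.commute real_norm_def)
  qed
  then obtain K where K: "\<And>e. e \<in> orth \<Longrightarrow> K e \<ge> 0 \<and> (\<forall>z\<in>cover T. \<bar>G z e\<bar> \<le> K e * norm z)" by metis
  define A where "A e = {- (K e * R) .. K e * R}" for e
  have "emeasure (volume T) S = emeasure M (\<Phi> -` S \<inter> space M)"
    unfolding volume_def using assms(1) by (intro emeasure_distr) auto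
  also have "\<dots> \<le> emeasure M (Pi\<^sub>E orth A)"
  proof (rule emeasure_mono)
    show "\<Phi> -` S \<inter> space M \<subseteq> Pi\<^sub>E orth A"
    proof
      fix t assume t: "t \<in> \<Phi> -` S \<inter> space M"
      have "t e \<in> A e" if e: "e \<in> orth" for e
      proof -
        have "t e = G (\<Phi> t) e" using G_combination[OF orthD(1,2,4) e, of t] by simp
        moreover have "\<bar>G (\<Phi> t) e\<bar> \<le> K e * norm (\<Phi> t)" using K[OF e] \<Phi>_cover by blast
        moreover have "K e * norm (\<Phi> t) \<le> K e * R" using K[OF e] R(2) t by (intro mult_left_mono) auto
        ultimately show ?thesis by (auto simp: A_def)
      qed
      then show "t \<in> Pi\<^sub>E orth A" using t by (auto simp: space_PiM PiE_iff)
    qed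
  qed (use orthD(1) in \<open>auto intro!: sets_PiM_I_finite simp: A_def\<close>)
  also have "\<dots> = (\<Prod>e\<in>orth. emeasure lborel (A e))"
    by (rule product_sigma_finite.emeasure_PiM[OF product_sigma_finite_lborel orthD(1)]) (auto simp: A_def)
  also have "\<dots> = (\<Prod>e\<in>orth. ennreal (2 * (K e * R)))"
    using K R(1) by (intro prod.cong refl) (simp add: A_def)
  also have "\<dots> < \<infinity>" by (simp add: ennreal_prod_eq_top less_top[symmetric])
  finally show ?thesis .
qed

text \<open>A small coordinate box around the coordinates of z is mapped into the open set. The
  point must lie in the covering space, which carries all of the volume.\<close>

lemma volume_open_pos:
  assumes "open S" "z \<in> S" "z \<in> cover T"
  shows "emeasure (volume T) S > 0"
proof -
  obtain r where r: "r > 0" "ball z r \<subseteq> S" using assms open_contains_ball by blast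
  \<comment> \<open>Coordinates off by at most r / N move the point by at most (r / N) times the sum
    of the norms, which is less than r; the added 1 makes this strict and keeps N positive for an
    empty basis.\<close>
  define N where "N = (\<Sum>e\<in>orth. norm e) + 1"
  have N: "N > 0" unfolding N_def by (intro add_nonneg_pos sum_nonneg) auto
  define d where "d = r / N"
  have d: "d > 0" unfolding d_def using r N by simp
  define A where "A e = {G z e - d <..< G z e + d}" for e
  have "0 < (\<Prod>e\<in>orth. ennreal (2 * d))" using d by (simp add: ennreal_power)
  also have "\<dots> = (\<Prod>e\<in>orth. emeasure lborel (A e))"
    using d by (intro prod.cong refl) (simp add: A_def)
  also have "\<dots> = emeasure M (Pi\<^sub>E orth A)"
    by (rule product_sigma_finite.emeasure_PiM[OF product_sigma_finite_lborel orthD(1), symmetric]) (auto simp: A_def)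
  also have "\<dots> \<le> emeasure M (\<Phi> -` S \<inter> space M)"
  proof (rule emeasure_mono)
    show "Pi\<^sub>E orth A \<subseteq> \<Phi> -` S \<inter> space M"
    proof
      fix t assume t: "t \<in> Pi\<^sub>E orth A"
      have "\<Phi> t - z = (\<Sum>e\<in>orth. (t e - G z e) *\<^sub>R e)"
        using orthonormal_expansion[OF onb assms(3)] by (simp add: scaleR_diff_left sum_subtractf)
      then have "norm (\<Phi> t - z) \<le> (\<Sum>e\<in>orth. norm ((t e - G z e) *\<^sub>R e))" by (simp only: norm_sum)
      also have "\<dots> \<le> (\<Sum>e\<in>orth. d * norm e)"
      proof (rule sum_mono)
        fix e assume "e \<in> orth"
        then have "\<bar>t e - G z e\<bar> \<le> d" using t by (fastforce simp: A_def PiE_iff)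
        then show "norm ((t e - G z e) *\<^sub>R e) \<le> d * norm e" by (simp add: mult_right_mono)
      qed
      also have "\<dots> < d * N" using d by (simp add: N_def distrib_left flip: sum_distrib_left)
      also have "\<dots> = r" using N by (simp add: d_def)
      finally have "\<Phi> t \<in> ball z r" by (simp add: dist_norm norm_minus_commute)
      then show "t \<in> \<Phi> -` S \<inter> space M" using r t by (auto simp: space_PiM PiE_iff)
    qed
    show "\<Phi> -` S \<inter> space M \<in> sets M" using assms(1) by (intro measurable_sets[OF \<Phi>_measurable]) auto
  qed
  also have "\<dots> = emeasure (volume T) S"
    unfolding volume_def using assms(1) by (intro emeasure_distr[symmetric]) auto
  finally show ?thesis .
qed

lemma torus_integral_eq: "torus_integral T f = (LINT z|volume T. indicator F z *\<^sub>R f z)"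
  by (simp add: torus_integral_def set_lebesgue_integral_def)

lemma F_closure: "compact (closure F)" "closure F \<subseteq> cover T"
  using F_bounded closure_minimal[OF F_cover closed_cover] by (auto simp: compact_closure)

lemma continuous_bounded_F:
  assumes "continuous_on (cover T) f"
  obtains C where "\<And>z. z \<in> F \<Longrightarrow> norm (f z) \<le> (C::real)"
proof -
  have "compact (f ` closure F)"
    using F_closure assms by (intro compact_continuous_image) (auto intro: continuous_on_subset)
  then obtain C where "\<And>x. x \<in> f ` closure F \<Longrightarrow> norm x \<le> C"
    using compact_imp_bounded bounded_iff by metis
  then show thesis using that[of C] closure_subset[of F] by blast
qed

lemma indicator_measurable:
  fixes f :: "'a \<Rightarrow> 'b::real_normed_vector"
  assumes "continuous_on (cover T) f" "S \<subseteq> cover T" "S \<in> sets borel"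
  shows "(\<lambda>z. indicator S z *\<^sub>R f z) \<in> borel_measurable borel"
  using assms by (intro borel_measurable_continuous_on_indicator continuous_on_subset[OF assms(1)]) auto

lemma integrable_F:
  fixes f :: "'a \<Rightarrow> 'b::{banach, second_countable_topology}"
  assumes "continuous_on (cover T) f"
  shows "integrable (volume T) (\<lambda>z. indicator F z *\<^sub>R f z)"
proof -
  obtain C where C: "\<And>z. z \<in> F \<Longrightarrow> norm (f z) \<le> C" using continuous_bounded_F[OF assms] by blast
  show ?thesis
  proof (rule integrableI_bounded_set[where A=F and B=C])
    show "(\<lambda>z. indicator F z *\<^sub>R f z) \<in> borel_measurable (volume T)"
      using indicator_measurable[OF assms F_cover] by (simp cong: measurable_cong_sets)
    show "emeasure (volume T) F < \<infinity>" using volume_bounded_finite[OF F_measurable F_bounded] .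
  qed (use C in \<open>auto simp: indicator_def\<close>)
qed

lemma torus_integral_add:
  assumes "continuous_on (cover T) f" "continuous_on (cover T) h"
  shows "torus_integral T (\<lambda>z. f z + h z) = torus_integral T f + torus_integral T h"
  unfolding torus_integral_eq scaleR_add_right
  by (intro Bochner_Integration.integral_add integrable_F assms)

lemma torus_integral_sum:
  assumes "\<And>i. i \<in> I \<Longrightarrow> continuous_on (cover T) (f i)"
  shows "torus_integral T (\<lambda>z. \<Sum>i\<in>I. f i z) = (\<Sum>i\<in>I. torus_integral T (f i))"
  unfolding torus_integral_eq scaleR_sum_right
  by (intro Bochner_Integration.integral_sum integrable_F assms)

lemma torus_integral_cmult: "torus_integral T (\<lambda>z. c * f z) = c * torus_integral T f"
  unfolding torus_integral_eq by (simp flip: mult_scaleR_right)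

lemma torus_integral_cong:
  assumes "\<And>z. z \<in> cover T \<Longrightarrow> f z = h z"
  shows "torus_integral T f = torus_integral T h"
  unfolding torus_integral_eq using assms F_cover
  by (intro Bochner_Integration.integral_cong refl) (auto simp: indicator_def)

definition periodic :: "('a \<Rightarrow> complex) \<Rightarrow> bool" where
  "periodic f \<longleftrightarrow> (\<forall>u\<in>lat T. \<forall>z\<in>cover T. f (z + u) = f z)"

text \<open>The shifted parallelotope leaves \<open>F\<close> through one face only. Its points with
  coordinate still below 1 cover the part \<open>F1\<close>; the others return to \<open>F2\<close>
  after subtracting b, which periodicity permits. Each piece is moved by a volume-preserving
  translation.\<close>

lemma torus_integral_shift:
  assumes f: "continuous_on (cover T) f" "periodic f" and b: "b \<in> fbasis" and s: "0 \<le> s" "s < 1"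
  shows "torus_integral T (\<lambda>z. f (z + s *\<^sub>R b)) = torus_integral T f"
proof -
  define F1 F2 where "F1 = {z \<in> F. s \<le> crd b z}" and "F2 = {z \<in> F. crd b z < s}"
  define h1 h2 where "h1 z = indicator F1 z *\<^sub>R f z" and "h2 z = indicator F2 z *\<^sub>R f z" for z
  have F12m: "F1 \<in> sets borel" "F2 \<in> sets borel"
  proof -
    have "F1 = F \<inter> {z. s \<le> crd b z}" "F2 = F \<inter> {z. crd b z < s}" by (auto simp: F1_def F2_def)
    moreover have "{z. s \<le> crd b z} \<in> sets borel" "{z. crd b z < s} \<in> sets borel" by measurable
    ultimately show "F1 \<in> sets borel" "F2 \<in> sets borel" by auto
  qed
  have F12: "F1 \<subseteq> cover T" "F2 \<subseteq> cover T" using F_cover by (auto simp: F1_def F2_def)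
  have hm: "h1 \<in> borel_measurable borel" "h2 \<in> borel_measurable borel"
    unfolding h1_def h2_def using F12m F12 by (auto intro: indicator_measurable[OF f(1)])
  have bc: "b \<in> cover T" using fbasis_cover[OF b] .
  have sb: "t *\<^sub>R b \<in> cover T" for t using bc sW by (simp add: subspace_scale)
  have int12: "integrable (volume T) h1" "integrable (volume T) h2"
  proof -
    obtain C where C: "\<And>z. z \<in> F \<Longrightarrow> norm (f z) \<le> C" using continuous_bounded_F[OF f(1)] by blast
    have C': "norm (h1 z) \<le> \<bar>C\<bar>" "norm (h2 z) \<le> \<bar>C\<bar>" for z
      using C[of z] by (auto simp: h1_def h2_def F1_def F2_def indicator_def)
    have F': "h1 z = 0" "h2 z = 0" if "z \<notin> F" for z
      using that by (auto simp: h1_def h2_def F1_def F2_def)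
    have fin: "emeasure (volume T) F < \<infinity>" using volume_bounded_finite[OF F_measurable F_bounded] .
    show "integrable (volume T) h1"
      by (rule integrableI_bounded_set[where A=F and B="\<bar>C\<bar>"])
        (use fin C' F' hm in \<open>simp_all cong: measurable_cong_sets\<close>)
    show "integrable (volume T) h2"
      by (rule integrableI_bounded_set[where A=F and B="\<bar>C\<bar>"])
        (use fin C' F' hm in \<open>simp_all cong: measurable_cong_sets\<close>)
  qed
  have crd_shift: "crd c (z + t *\<^sub>R b) = crd c z + (if c = b then t else 0)" if "c \<in> fbasis" for c z t
    using crd_basis[OF that b] by (simp add: linear_add[OF crd_linear] linear_scale[OF crd_linear])
  have split: "indicator F z *\<^sub>R f (z + s *\<^sub>R b) = h1 (z + s *\<^sub>R b) + h2 (z + (s - 1) *\<^sub>R b)" for z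
  proof (cases "z \<in> cover T")
    case False
    then have "z + t *\<^sub>R b \<notin> cover T" for t
      using sb[of t] subspace_diff[OF sW, of "z + t *\<^sub>R b" "t *\<^sub>R b"] by auto
    then show ?thesis using False F_cover F12 by (auto simp: h1_def h2_def indicator_def)
  next
    case True
    have zt: "z + t *\<^sub>R b \<in> cover T" for t using True sb sW by (simp add: subspace_add)
    have "b \<in> lat T" using b fbasis_lat by blast
    then have per: "f (z + (s - 1) *\<^sub>R b + b) = f (z + (s - 1) *\<^sub>R b)" using f(2) zt by (auto simp: periodic_def)
    have per': "f (z + (s - 1) *\<^sub>R b) = f (z + s *\<^sub>R b)"
      using per by (simp add: scaleR_diff_left add.assoc)
    have 1: "z + s *\<^sub>R b \<in> F1 \<longleftrightarrow> z \<in> F \<and> crd b z + s < 1"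
      using s zt True b unfolding F1_def F_eq
      by (auto simp: crd_shift split: if_splits)
    have 2: "z + (s - 1) *\<^sub>R b \<in> F2 \<longleftrightarrow> z \<in> F \<and> \<not> crd b z + s < 1"
      using s zt True b unfolding F2_def F_eq
      by (auto simp: crd_shift split: if_splits)
    show ?thesis
      unfolding h1_def h2_def indicator_def 1 2 per' by auto
  qed
  have "torus_integral T (\<lambda>z. f (z + s *\<^sub>R b)) = (LINT z|volume T. h1 (z + s *\<^sub>R b) + h2 (z + (s - 1) *\<^sub>R b))"
    unfolding torus_integral_eq split ..
  also have "\<dots> = (LINT z|volume T. h1 (z + s *\<^sub>R b)) + (LINT z|volume T. h2 (z + (s - 1) *\<^sub>R b))"
  proof (rule Bochner_Integration.integral_add)
    have "integrable (volume T) (\<lambda>z. h (z + t *\<^sub>R b))"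
      if "integrable (volume T) h" "h \<in> borel_measurable borel" for h :: "'a \<Rightarrow> complex" and t
    proof -
      have "integrable (distr (volume T) borel (\<lambda>z. z + t *\<^sub>R b)) h"
        using that(1) volume_translation[OF sb] by simp
      then show ?thesis using that(2) by (subst (asm) integrable_distr_eq) auto
    qed
    then show "integrable (volume T) (\<lambda>z. h1 (z + s *\<^sub>R b))" "integrable (volume T) (\<lambda>z. h2 (z + (s - 1) *\<^sub>R b))"
      using int12 hm by blast+
  qed
  also have "\<dots> = (LINT z|volume T. h1 z) + (LINT z|volume T. h2 z)"
    by (simp only: integral_translation[OF sb] hm)
  also have "\<dots> = (LINT z|volume T. h1 z + h2 z)"
    using int12 by simp
  also have "\<dots> = torus_integral T f"
    unfolding torus_integral_eq
    by (intro Bochner_Integration.integral_cong refl) (auto simp: h1_def h2_def F1_def F2_def indicator_def)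
  finally show ?thesis .
qed

text \<open>Difference quotients along a lattice basis vector have integral 0 by shift invariance.
  They converge to the derivative and are uniformly bounded on the fundamental domain, so the limit
  passes under the integral.\<close>

lemma torus_integral_dir_deriv_basis:
  assumes f: "smooth_fun_on (cover T) f" "periodic f" and b: "b \<in> fbasis"
  shows "torus_integral T (dir_deriv b f) = 0"
proof -
  have bc: "b \<in> cover T" using fbasis_cover[OF b] .
  have fc: "continuous_on (cover T) f" using smooth_continuous[OF f(1)] .
  have dc: "continuous_on (cover T) (dir_deriv b f)" using smooth_continuous[OF smooth_dir_deriv[OF f(1) bc]] .
  \<comment> \<open>Starting at 1/2 keeps every step inside the range [0,1) of
    \<open>torus_integral_shift\<close>.\<close>
  define s where "s n = 1 / real (n + 2)" for n
  have s: "0 < s n" "s n < 1" for n by (auto simp: s_def)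
  have s_lim: "s \<longlonglongrightarrow> 0" unfolding s_def using LIMSEQ_ignore_initial_segment[OF lim_1_over_n, of 2] by simp
  define q where "q n z = of_real (1 / s n) * (f (z + s n *\<^sub>R b) - f z)" for n z
  have zt: "z + t *\<^sub>R b \<in> cover T" if "z \<in> cover T" for z t using line_in_subspace[OF sW that bc] .
  have shift_c: "continuous_on (cover T) (\<lambda>z. f (z + t *\<^sub>R b))" for t
    by (rule continuous_on_compose2[OF fc]) (auto intro!: continuous_intros zt)
  have qc: "continuous_on (cover T) (q n)" for n
    unfolding q_def by (intro continuous_intros shift_c fc)
  have q0: "torus_integral T (q n) = 0" for n
  proof -
    have "torus_integral T (q n) = of_real (1 / s n) * torus_integral T (\<lambda>z. f (z + s n *\<^sub>R b) + (-1) * f z)"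
      unfolding q_def torus_integral_cmult by simp
    also have "torus_integral T (\<lambda>z. f (z + s n *\<^sub>R b) + (-1) * f z) =
        torus_integral T (\<lambda>z. f (z + s n *\<^sub>R b)) + (-1) * torus_integral T f"
      by (subst torus_integral_add[OF shift_c]) (auto intro!: continuous_intros fc simp: torus_integral_cmult[of "-1", simplified])
    also have "\<dots> = 0"
      using torus_integral_shift[OF fc f(2) b, of "s n"] s[of n] by (simp add: less_imp_le)
    finally show ?thesis by simp
  qed
  have "compact ((\<lambda>(z, t). z + t *\<^sub>R b) ` (closure F \<times> {0..1}))"
    using F_closure(1) by (intro compact_continuous_image compact_Times) (auto intro!: continuous_intros simp: split_def)
  moreover have "(\<lambda>(z, t). z + t *\<^sub>R b) ` (closure F \<times> {0..1}) \<subseteq> cover T"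
    using F_closure(2) zt by auto
  ultimately have "bounded (dir_deriv b f ` (\<lambda>(z, t). z + t *\<^sub>R b) ` (closure F \<times> {0..1}))"
    using compact_imp_bounded[OF compact_continuous_image[OF continuous_on_subset[OF dc]]] by blast
  then obtain C where C: "\<And>z t. z \<in> closure F \<Longrightarrow> t \<in> {0..1} \<Longrightarrow> norm (dir_deriv b f (z + t *\<^sub>R b)) \<le> C"
    unfolding bounded_iff by force
  \<comment> \<open>\<open>C\<close> bounds the derivative on the compact set swept out by the
    closure of \<open>F\<close> in unit time. On a segment the derivative varies by at most 2 C,
    which bounds the linearization error, and the linear term adds one more C.\<close>
  have bound: "norm (q n z) \<le> 3 * C" if z: "z \<in> F" for n z
  proof -
    have zc: "z \<in> cover T" "z \<in> closure F" using z F_cover closure_subset by blast+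
    have "norm (f (z + s n *\<^sub>R b) - f (z + 0 *\<^sub>R b) - (s n - 0) *\<^sub>R dir_deriv b f (z + 0 *\<^sub>R b)) \<le> norm (s n - 0) * (C + C)"
    proof (rule vector_differentiable_bound_linearization[where S="{0..1}" and f'="\<lambda>t. dir_deriv b f (z + t *\<^sub>R b)"])
      fix t :: real assume t: "t \<in> {0..1}"
      show "((\<lambda>t. f (z + t *\<^sub>R b)) has_vector_derivative dir_deriv b f (z + t *\<^sub>R b)) (at t within {0..1})"
        using Ck_on_has_dir_deriv_at[OF smooth_imp_Ck[OF f(1)] zc(1) bc sW] .
      show "norm (dir_deriv b f (z + t *\<^sub>R b) - dir_deriv b f (z + 0 *\<^sub>R b)) \<le> C + C"
        using C[OF zc(2) t] C[OF zc(2), of 0] by (intro norm_triangle_le_diff add_mono) auto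
    next
      show "closed_segment 0 (s n) \<subseteq> {0..1}" using s[of n] by (auto simp: closed_segment_eq_real_ivl)
    qed auto
    then have *: "norm (f (z + s n *\<^sub>R b) - f z - s n *\<^sub>R dir_deriv b f z) \<le> s n * (C + C)"
      using s[of n] by simp
    have "norm (f (z + s n *\<^sub>R b) - f z) \<le>
        norm (f (z + s n *\<^sub>R b) - f z - s n *\<^sub>R dir_deriv b f z) + norm (s n *\<^sub>R dir_deriv b f z)"
      by (metis diff_add_cancel norm_triangle_ineq)
    also have "norm (s n *\<^sub>R dir_deriv b f z) \<le> s n * C"
      using C[OF zc(2), of 0] s[of n] by simp
    finally have "norm (f (z + s n *\<^sub>R b) - f z) \<le> 3 * C * s n" using * by (simp add: algebra_simps)
    then show ?thesis
      unfolding q_def norm_mult norm_of_real using s[of n] by (simp add: field_simps)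
  qed
  have lim: "(\<lambda>n. q n z) \<longlonglongrightarrow> dir_deriv b f z" if z: "z \<in> F" for z
  proof -
    have zc: "z \<in> cover T" using z F_cover by blast
    have "((\<lambda>t. f (z + t *\<^sub>R b)) has_vector_derivative dir_deriv b f z) (at 0)"
      using smooth_has_dir_deriv[OF f(1) zc bc] .
    then have "((\<lambda>t. norm (f (z + t *\<^sub>R b) - f z - t *\<^sub>R dir_deriv b f z) / norm t) \<longlongrightarrow> 0) (at 0)"
      unfolding has_vector_derivative_def has_derivative_iff_norm by simp
    then have "((\<lambda>t. norm ((f (z + t *\<^sub>R b) - f z) /\<^sub>R t - dir_deriv b f z)) \<longlongrightarrow> 0) (at 0)"
    proof (rule Lim_transform_eventually)
      have eq: "norm (f (z + t *\<^sub>R b) - f z - t *\<^sub>R dir_deriv b f z) / norm t =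
          norm ((f (z + t *\<^sub>R b) - f z) /\<^sub>R t - dir_deriv b f z)" if "t \<noteq> 0" for t
      proof -
        have "(f (z + t *\<^sub>R b) - f z) /\<^sub>R t - dir_deriv b f z =
            (f (z + t *\<^sub>R b) - f z - t *\<^sub>R dir_deriv b f z) /\<^sub>R t"
          using that by (simp add: scaleR_diff_right)
        then show ?thesis by (simp add: divide_inverse mult.commute)
      qed
      show "\<forall>\<^sub>F t in at 0. norm (f (z + t *\<^sub>R b) - f z - t *\<^sub>R dir_deriv b f z) / norm t =
          norm ((f (z + t *\<^sub>R b) - f z) /\<^sub>R t - dir_deriv b f z)"
        unfolding eventually_at_filter by (intro always_eventually allI impI, rule eq)
    qed
    then have "((\<lambda>t. (f (z + t *\<^sub>R b) - f z) /\<^sub>R t) \<longlongrightarrow> dir_deriv b f z) (at 0)"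
      by (rule LIM_zero_cancel[OF tendsto_norm_zero_cancel])
    moreover have "filterlim s (at 0) sequentially"
    proof -
      have "s n \<noteq> 0" for n using s(1)[of n] by simp
      then show ?thesis by (simp add: filterlim_at s_lim)
    qed
    ultimately have "(\<lambda>n. (f (z + s n *\<^sub>R b) - f z) /\<^sub>R s n) \<longlonglongrightarrow> dir_deriv b f z"
      by (rule filterlim_compose)
    then show ?thesis by (simp add: q_def scaleR_conv_of_real divide_inverse)
  qed
  have "(\<lambda>n. LINT z|volume T. indicator F z *\<^sub>R q n z) \<longlonglongrightarrow> (LINT z|volume T. indicator F z *\<^sub>R dir_deriv b f z)"
  proof (rule integral_dominated_convergence[where w="\<lambda>z. indicator F z *\<^sub>R (3 * C)"])
    show "(\<lambda>z. indicator F z *\<^sub>R dir_deriv b f z) \<in> borel_measurable (volume T)"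
      "(\<lambda>z. indicator F z *\<^sub>R q n z) \<in> borel_measurable (volume T)" for n
      using indicator_measurable[OF dc F_cover] indicator_measurable[OF qc F_cover]
      by (simp_all cong: measurable_cong_sets)
    show "integrable (volume T) (\<lambda>z. indicator F z *\<^sub>R (3 * C))" by (intro integrable_F continuous_intros)
  qed (use lim bound in \<open>auto simp: indicator_def\<close>)
  then have "(\<lambda>n. 0) \<longlonglongrightarrow> torus_integral T (dir_deriv b f)"
    using q0 by (simp add: torus_integral_eq)
  then show ?thesis using LIMSEQ_unique tendsto_const by blast
qed

lemma torus_integral_dir_deriv:
  assumes f: "smooth_fun_on (cover T) f" "periodic f" and v: "v \<in> cover T"
  shows "torus_integral T (dir_deriv v f) = 0"
proof -
  have "dir_deriv v f z = (\<Sum>b\<in>fbasis. of_real (crd b v) * dir_deriv b f z)" if z: "z \<in> cover T" for z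
  proof -
    have "dir_deriv v f z = dir_deriv (\<Sum>b\<in>fbasis. crd b v *\<^sub>R b) f z"
      using crd_expansion[OF v] by simp
    also have "\<dots> = (\<Sum>b\<in>fbasis. crd b v *\<^sub>R dir_deriv b f z)"
      by (rule rlinear_on_sum[OF rlinear_on_dir_deriv[OF sW smooth_imp_Ck[OF f(1)] z] sW fbasis_finite fbasis_cover])
    finally show ?thesis by (simp add: scaleR_conv_of_real)
  qed
  then have "torus_integral T (dir_deriv v f) = torus_integral T (\<lambda>z. \<Sum>b\<in>fbasis. of_real (crd b v) * dir_deriv b f z)"
    by (rule torus_integral_cong)
  also have "\<dots> = (\<Sum>b\<in>fbasis. of_real (crd b v) * torus_integral T (dir_deriv b f))"
    using smooth_continuous[OF smooth_dir_deriv[OF f(1) fbasis_cover]]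
    by (subst torus_integral_sum) (auto intro!: continuous_intros simp: torus_integral_cmult)
  also have "\<dots> = 0" using torus_integral_dir_deriv_basis[OF f] by simp
  finally show ?thesis .
qed

text \<open>The point is first reduced modulo the lattice. Its representative may still lie on the
  boundary of \<open>F\<close>, so it is pushed towards the centre of the parallelotope, to an
  interior point where r remains positive; a neighbourhood of it has positive volume.\<close>

lemma torus_integral_nonneg_zero:
  assumes r: "continuous_on (cover T) r" "\<And>z. z \<in> cover T \<Longrightarrow> 0 \<le> r z"
    and per: "periodic (\<lambda>z. of_real (r z))" and int: "torus_integral T (\<lambda>z. of_real (r z)) = 0"
    and z: "z \<in> cover T"
  shows "r z = 0"
proof (rule ccontr)
  assume "r z \<noteq> 0"
  define u where "u = (\<Sum>b\<in>fbasis. of_int (- \<lfloor>crd b z\<rfloor>) *\<^sub>R b)"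
  have u: "u \<in> lat T"
    unfolding u_def fbasis_int_span[symmetric]
    by (intro int_module.span_sum int_module.span_scale int_module.span_base)
  define z0 where "z0 = z + u"
  have z0: "z0 \<in> cover T" unfolding z0_def using z u lat_cover sW by (auto intro: subspace_add)
  have "r z0 = r z" using per u z by (simp add: periodic_def z0_def)
  then have "r z0 > 0" using r(2)[OF z] \<open>r z \<noteq> 0\<close> by simp
  have z0_crd: "0 \<le> crd b z0 \<and> crd b z0 < 1" if b: "b \<in> fbasis" for b
  proof -
    have "crd b u = of_int (- \<lfloor>crd b z\<rfloor>)" unfolding u_def by (rule crd_combination[OF b])
    then have "crd b z0 = crd b z - of_int \<lfloor>crd b z\<rfloor>"
      unfolding z0_def by (simp add: linear_add[OF crd_linear])
    then show ?thesis by linarith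
  qed
  \<comment> \<open>The centre of the parallelotope. Any point on the open segment from
    \<open>z0\<close> to it has coordinates strictly between 0 and 1.\<close>
  define c where "c = (\<Sum>b\<in>fbasis. (1/2::real) *\<^sub>R b)"
  have c: "c \<in> cover T" unfolding c_def by (rule combination_cover)
  obtain Q where Q: "open Q" "Q \<inter> cover T = r -` {0<..} \<inter> cover T"
    using r(1) unfolding continuous_on_open_invariant by (metis open_greaterThan)
  have "z0 \<in> Q" using Q(2) z0 \<open>r z0 > 0\<close> by auto
  then obtain \<rho> where \<rho>: "\<rho> > 0" "ball z0 \<rho> \<subseteq> Q" using Q(1) open_contains_ball by blast
  \<comment> \<open>Small enough to stay in the ball where r is positive and below 1 for the convex
    combination; the 1 in the denominator covers the case \<open>z0 = c\<close>.\<close>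
  define \<epsilon> where "\<epsilon> = min (1/2) (\<rho> / (2 * (1 + norm (c - z0))))"
  have \<epsilon>: "0 < \<epsilon>" "\<epsilon> < 1"
    unfolding \<epsilon>_def using \<rho> by (auto intro!: divide_pos_pos add_pos_nonneg mult_pos_pos)
  define z1 where "z1 = z0 + \<epsilon> *\<^sub>R (c - z0)"
  have z1: "z1 \<in> cover T" unfolding z1_def using z0 c sW by (intro line_in_subspace subspace_diff) auto
  have "\<epsilon> * norm (c - z0) \<le> \<rho> / (2 * (1 + norm (c - z0))) * (1 + norm (c - z0))"
    using \<epsilon> by (intro mult_mono) (auto simp: \<epsilon>_def intro!: divide_nonneg_nonneg less_imp_le[OF \<rho>(1)])
  also have "\<dots> = \<rho> / 2" using add_pos_nonneg[OF zero_less_one norm_ge_zero[of "c - z0"]] by (simp add: field_simps)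
  finally have "norm (z0 - z1) < \<rho>"
    unfolding z1_def using \<rho>(1) \<epsilon> by simp
  then have "z1 \<in> Q" using \<rho>(2) by (auto simp: dist_norm)
  have z1_crd: "0 < crd b z1 \<and> crd b z1 < 1" if b: "b \<in> fbasis" for b
  proof -
    have *: "crd b z1 = (1 - \<epsilon>) * crd b z0 + \<epsilon> / 2"
      unfolding z1_def c_def
      by (simp add: linear_add[OF crd_linear] linear_diff[OF crd_linear] linear_scale[OF crd_linear]
          crd_combination[OF b] algebra_simps)
    have "(1 - \<epsilon>) * crd b z0 \<le> (1 - \<epsilon>) * 1" "0 \<le> (1 - \<epsilon>) * crd b z0"
      using z0_crd[OF b] \<epsilon> by (auto intro: mult_left_mono)
    moreover have "0 < y + \<epsilon> / 2 \<and> y + \<epsilon> / 2 < 1" if "y \<le> (1 - \<epsilon>) * 1" "0 \<le> y" for y :: real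
      using that \<epsilon> by simp
    ultimately show ?thesis unfolding * by blast
  qed
  define S where "S = Q \<inter> (\<Inter>b\<in>fbasis. {y. 0 < crd b y \<and> crd b y < 1})"
  have "open {y. 0 < crd b y \<and> crd b y < 1}" for b
    by (intro open_Collect_conj open_Collect_less continuous_on_const crd_continuous)
  then have "open S" unfolding S_def using Q(1) fbasis_finite by (intro open_Int open_INT) auto
  have "z1 \<in> S" using z1_crd \<open>z1 \<in> Q\<close> by (auto simp: S_def)
  then have pos: "emeasure (volume T) S > 0" using volume_open_pos[OF \<open>open S\<close> _ z1] by blast
  have "of_real (LINT z|volume T. indicator F z *\<^sub>R r z) = torus_integral T (\<lambda>z. of_real (r z))"
  proof -
    have "(\<lambda>z. indicator F z *\<^sub>R complex_of_real (r z)) = (\<lambda>z. complex_of_real (indicator F z *\<^sub>R r z))"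
      by (simp add: fun_eq_iff scaleR_conv_of_real)
    then show ?thesis unfolding torus_integral_eq by (simp only: integral_complex_of_real)
  qed
  then have "(LINT z|volume T. indicator F z *\<^sub>R r z) = 0" using int by simp
  moreover have "AE z in volume T. 0 \<le> indicator F z *\<^sub>R r z"
    using r(2) F_cover by (intro AE_I2) (auto simp: indicator_def)
  ultimately have "AE z in volume T. indicator F z *\<^sub>R r z = 0"
    using integral_nonneg_eq_0_iff_AE[OF integrable_F[OF r(1)]] by blast
  then have "AE z in volume T. z \<notin> S"
    using AE_volume_cover
  proof eventually_elim
    fix y assume y: "indicator F y *\<^sub>R r y = 0" "y \<in> cover T"
    show "y \<notin> S"
    proof
      assume "y \<in> S"
      then have "y \<in> F" "r y > 0" using y(2) Q(2) by (auto simp: S_def F_eq less_imp_le)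
      with y(1) show False by simp
    qed
  qed
  then have "emeasure (volume T) S = 0"
    using \<open>open S\<close> AE_iff_measurable[of S "volume T" "\<lambda>z. z \<notin> S"] by auto
  with pos show False by simp
qed

end

section \<open>The formal adjoint of the Dolbeault operator\<close>

text \<open>Both sides of the comparison are instances: the tensor product on T' x T'' is again of
  the form \<open>L_bundle\<close>, for the form pulled back from V'' and the product of the
  multipliers.\<close>

locale torus_bundle = lattice_torus T for T :: "'a::complex_euclidean torus" +
  fixes H :: "'a \<Rightarrow> 'a \<Rightarrow> complex" and \<alpha> :: "'a \<Rightarrow> complex"
  assumes H: "hermitian_on (cover T) H" and \<alpha>_norm: "\<And>u. u \<in> lat T \<Longrightarrow> cmod (\<alpha> u) = 1"
begin

abbreviation "L \<equiv> L_bundle H \<alpha>"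

text \<open>The weight as a complex exponential without \<open>Re\<close>, so that it can be
  differentiated through sesquilinearity. On the covering space H(z,z) is real and the two weights
  agree.\<close>

definition wgt :: "'a \<Rightarrow> complex" where "wgt z = exp (- (of_real pi * H z z))"

lemma weight_L: "z \<in> cover T \<Longrightarrow> of_real (weight L z) = wgt z"
proof -
  assume z: "z \<in> cover T"
  have "wgt z = exp (of_real (- pi * Re (H z z)))"
    unfolding wgt_def by (subst hermitian_on_diag_real[OF W H z]) simp
  then show ?thesis by (simp only: L_bundle_def line_bundle.simps exp_of_real)
qed

text \<open>Expanding one argument in lattice coordinates writes the quadratic function as a sum of
  products of real-linear ones.\<close>

lemma smooth_diag: "smooth_fun_on (cover T) (\<lambda>z. - (of_real pi * H z z))"
proof -
  have rl: "rlinear_on (cover T) (\<lambda>z. complex_of_real (crd b z))" for b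
    by (rule rlinear_onI)
      (simp_all add: linear_add[OF crd_linear] linear_scale[OF crd_linear] scaleR_conv_of_real)
  have "smooth_fun_on (cover T) (\<lambda>z. - (of_real pi * (\<Sum>b\<in>fbasis. of_real (crd b z) * H b z)))"
    by (intro smooth_minus[OF sW] smooth_cmult[OF sW] smooth_sum[OF sW] smooth_mult[OF sW]
        smooth_rlinear[OF sW rl] smooth_rlinear[OF sW rlinear_hermitian_right[OF W H fbasis_cover]])
  then show ?thesis
  proof (rule smooth_cong[OF sW, rotated])
    fix z assume z: "z \<in> cover T"
    have "H z z = H (\<Sum>b\<in>fbasis. crd b z *\<^sub>R b) z" using crd_expansion[OF z] by simp
    also have "\<dots> = (\<Sum>b\<in>fbasis. crd b z *\<^sub>R H b z)"
      by (rule rlinear_on_sum[OF rlinear_hermitian_left[OF W H z] sW fbasis_finite fbasis_cover])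
    finally show "- (of_real pi * (\<Sum>b\<in>fbasis. of_real (crd b z) * H b z)) = - (of_real pi * H z z)"
      by (simp add: scaleR_conv_of_real)
  qed
qed

lemma smooth_wgt: "smooth_fun_on (cover T) wgt"
  unfolding wgt_def by (rule smooth_exp[OF sW smooth_diag])

lemma dir_deriv_wgt:
  assumes v: "v \<in> cover T" and z: "z \<in> cover T"
  shows "dir_deriv v wgt z = - (of_real pi * (H v z + H z v)) * wgt z"
proof -
  have "- (of_real pi * H (z + t *\<^sub>R v) (z + t *\<^sub>R v)) =
      - (of_real pi * (H z z + of_real t * (H v z + H z v) + of_real t * (of_real t * H v v)))" for t
  proof -
    have tv: "t *\<^sub>R v \<in> cover T" "z + t *\<^sub>R v \<in> cover T" using v z sW by (auto intro: subspace_scale line_in_subspace)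
    have "H (z + t *\<^sub>R v) (z + t *\<^sub>R v) = H z (z + t *\<^sub>R v) + H (t *\<^sub>R v) (z + t *\<^sub>R v)"
      using rlinear_on_add[OF rlinear_hermitian_left[OF W H tv(2)] z tv(1)] .
    also have "H (t *\<^sub>R v) (z + t *\<^sub>R v) = t *\<^sub>R H v (z + t *\<^sub>R v)"
      using rlinear_on_scale[OF rlinear_hermitian_left[OF W H tv(2)] v] .
    also have "H z (z + t *\<^sub>R v) = H z z + t *\<^sub>R H z v"
      using rlinear_on_add[OF rlinear_hermitian_right[OF W H z] z tv(1)]
        rlinear_on_scale[OF rlinear_hermitian_right[OF W H z] v] by simp
    also have "H v (z + t *\<^sub>R v) = H v z + t *\<^sub>R H v v"
      using rlinear_on_add[OF rlinear_hermitian_right[OF W H v] z tv(1)]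
        rlinear_on_scale[OF rlinear_hermitian_right[OF W H v] v] by simp
    finally show ?thesis by (simp add: scaleR_conv_of_real algebra_simps)
  qed
  moreover have "((\<lambda>t. - (of_real pi * (H z z + of_real t * (H v z + H z v) + of_real t * (of_real t * H v v))))
      has_vector_derivative - (of_real pi * (H v z + H z v))) (at 0)"
    by (auto intro!: derivative_eq_intros)
  ultimately have "dir_deriv v (\<lambda>z. - (of_real pi * H z z)) z = - (of_real pi * (H v z + H z v))"
    by (intro dir_deriv_eqI) simp
  then show ?thesis
    unfolding wgt_def dir_deriv_exp[OF smooth_diag smooth_diag v z] by simp
qed

lemma dbar_dir_wgt:
  assumes v: "v \<in> cover T" and z: "z \<in> cover T"
  shows "dbar_dir v wgt z = - (of_real pi * H z v) * wgt z"
  unfolding dbar_dir_def dir_deriv_wgt[OF v z] dir_deriv_wgt[OF i_scale_in[OF W v] z]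
    hermitian_on_scale_left[OF H v z] hermitian_on_scale_right[OF W H v z]
  by (simp add: field_simps)

lemma dbar_dir_mult:
  assumes f: "smooth_fun_on (cover T) f" and h: "smooth_fun_on (cover T) h" and v: "v \<in> cover T" "z \<in> cover T"
  shows "dbar_dir v (\<lambda>z. f z * h z) z = f z * dbar_dir v h z + dbar_dir v f z * h z"
  unfolding dbar_dir_def dir_deriv_mult[OF f h v] dir_deriv_mult[OF f h i_scale_in[OF W v(1)] v(2)]
  by (simp add: field_simps)

lemma dbar_dir_cnj:
  assumes h: "smooth_fun_on (cover T) h" and v: "v \<in> cover T" "z \<in> cover T"
  shows "dbar_dir v (\<lambda>z. cnj (h z)) z = cnj (d_dir v h z)"
  unfolding dbar_dir_def d_dir_def dir_deriv_cnj[OF h h v] dir_deriv_cnj[OF h h i_scale_in[OF W v(1)] v(2)]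
  by simp

text \<open>The product P of f, the conjugate of h and the weight is periodic, so its derivatives
  integrate to 0. In the product rule the weight contributes - pi H(z,e), the conjugate of the
  connection term, and completes the derivative of h to the covariant one.\<close>

lemma integration_by_parts:
  assumes f: "smooth_fun_on (cover T) f" and h: "smooth_fun_on (cover T) h"
    and per: "periodic (\<lambda>z. f z * cnj (h z) * wgt z)" and e: "e \<in> cover T"
  shows "torus_integral T (\<lambda>z. dbar_dir e f z * cnj (h z) * wgt z) =
    - torus_integral T (\<lambda>z. f z * cnj (cov_dir H e h z) * wgt z)"
proof -
  define P where "P z = f z * cnj (h z) * wgt z" for z
  have fh: "smooth_fun_on (cover T) (\<lambda>z. f z * cnj (h z))"
    by (intro smooth_mult[OF sW f] smooth_cnj[OF sW h])
  have P: "smooth_fun_on (cover T) P" unfolding P_def by (intro smooth_mult[OF sW fh] smooth_wgt)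
  have P_per: "periodic P" using per by (simp add: P_def[abs_def])
  have ie: "\<i> *\<^sub>C e \<in> cover T" using i_scale_in[OF W e] .
  have "torus_integral T (dbar_dir e P) = torus_integral T (\<lambda>z. (1/2) * (dir_deriv e P z + \<i> * dir_deriv (\<i> *\<^sub>C e) P z))"
    by (simp add: dbar_dir_def[abs_def])
  also have "\<dots> = (1/2) * (torus_integral T (dir_deriv e P) + \<i> * torus_integral T (dir_deriv (\<i> *\<^sub>C e) P))"
    using smooth_continuous[OF smooth_dir_deriv[OF P e]] smooth_continuous[OF smooth_dir_deriv[OF P ie]]
    unfolding torus_integral_cmult
    by (subst torus_integral_add) (auto intro!: continuous_intros simp: torus_integral_cmult)
  also have "\<dots> = 0" using torus_integral_dir_deriv[OF P P_per] e ie by simp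
  finally have 0: "torus_integral T (dbar_dir e P) = 0" .
  have c1: "continuous_on (cover T) (\<lambda>z. dbar_dir e f z * cnj (h z) * wgt z)"
    by (intro continuous_intros smooth_continuous[OF smooth_dbar_dir[OF W f e]] smooth_continuous[OF h]
        smooth_continuous[OF smooth_wgt])
  have c2: "continuous_on (cover T) (\<lambda>z. f z * cnj (cov_dir H e h z) * wgt z)"
    by (intro continuous_intros smooth_continuous[OF smooth_cov_dir[OF W h e H]] smooth_continuous[OF f]
        smooth_continuous[OF smooth_wgt])
  have "dbar_dir e P z = dbar_dir e f z * cnj (h z) * wgt z + f z * cnj (cov_dir H e h z) * wgt z"
    if z: "z \<in> cover T" for z
    unfolding P_def dbar_dir_mult[OF fh smooth_wgt e z] dbar_dir_mult[OF f smooth_cnj[OF sW h] e z]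
      dbar_dir_cnj[OF h e z] dbar_dir_wgt[OF e z] cov_dir_def
    using hermitian_on_cnj[OF H e z] by (simp add: algebra_simps)
  then have "torus_integral T (dbar_dir e P) =
      torus_integral T (\<lambda>z. dbar_dir e f z * cnj (h z) * wgt z + f z * cnj (cov_dir H e h z) * wgt z)"
    by (rule torus_integral_cong)
  also have "\<dots> = torus_integral T (\<lambda>z. dbar_dir e f z * cnj (h z) * wgt z) +
      torus_integral T (\<lambda>z. f z * cnj (cov_dir H e h z) * wgt z)"
    by (rule torus_integral_add[OF c1 c2])
  finally show ?thesis using 0 by (simp add: eq_neg_iff_add_eq_0)
qed

abbreviation BF where "BF k \<equiv> bundle_forms T L k"

lemma bundle_forms_iff:
  "\<phi> \<in> BF k \<longleftrightarrow> \<phi> \<in> smooth_forms (cover T) k \<and>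
    (\<forall>u\<in>lat T. \<forall>z\<in>cover T. \<forall>vs. \<phi> (z + u) vs = factor L u z * \<phi> z vs)"
  by (auto simp: bundle_forms_def smooth_forms_def bundle_action_def mult.commute)

lemma BF_smooth: "\<phi> \<in> BF k \<Longrightarrow> \<phi> \<in> smooth_forms (cover T) k"
  and BF_equivariant: "\<phi> \<in> BF k \<Longrightarrow> u \<in> lat T \<Longrightarrow> z \<in> cover T \<Longrightarrow> \<phi> (z + u) vs = factor L u z * \<phi> z vs"
  by (auto simp: bundle_forms_iff)

text \<open>What is left of the factor of automorphy once the frame exponential of
  \<open>twist\<close> has been taken out; it does not depend on z.\<close>

definition multiplier :: "'a \<Rightarrow> complex" where
  "multiplier u = \<alpha> u * exp (of_real (pi / 2) * H u u)"

lemma factor_multiplier: "factor L u z = exp (of_real pi * H z u) * multiplier u"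
  by (simp add: L_bundle_def multiplier_def exp_add mult.commute mult.left_commute)

text \<open>Dividing the transformation law by exp(pi H(z,u)) turns it into an eigenvalue equation
  for twisted lattice translations. Operators that commute with these translations therefore
  preserve bundle forms.\<close>

lemma bundle_forms_iff_twist:
  "\<phi> \<in> BF k \<longleftrightarrow> \<phi> \<in> smooth_forms (cover T) k \<and>
    (\<forall>u\<in>lat T. twist (cover T) H id u \<phi> = form_scale (multiplier u) \<phi>)"
proof (cases "\<phi> \<in> smooth_forms (cover T) k")
  case True
  have "(\<forall>z\<in>cover T. \<forall>vs. \<phi> (z + u) vs = factor L u z * \<phi> z vs) \<longleftrightarrow>
      twist (cover T) H id u \<phi> = form_scale (multiplier u) \<phi>" for u
  proof -
    have "twist (cover T) H id u \<phi> = form_scale (multiplier u) \<phi> \<longleftrightarrow>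
        (\<forall>z\<in>cover T. \<forall>vs. set vs \<subseteq> cover T \<longrightarrow> exp (- (of_real pi * H z u)) * \<phi> (z + u) vs = multiplier u * \<phi> z vs)"
    proof (intro iffI ballI allI impI ext)
      fix z vs assume eq: "twist (cover T) H id u \<phi> = form_scale (multiplier u) \<phi>" "z \<in> cover T" "set vs \<subseteq> cover T"
      have "twist (cover T) H id u \<phi> z vs = form_scale (multiplier u) \<phi> z vs" by (simp only: eq(1))
      with eq(2,3) show "exp (- (of_real pi * H z u)) * \<phi> (z + u) vs = multiplier u * \<phi> z vs"
        by (simp add: twist_def form_scale_def)
    next
      fix z vs
      assume eq: "\<forall>z\<in>cover T. \<forall>vs. set vs \<subseteq> cover T \<longrightarrow>
          exp (- (of_real pi * H z u)) * \<phi> (z + u) vs = multiplier u * \<phi> z vs"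
      show "twist (cover T) H id u \<phi> z vs = form_scale (multiplier u) \<phi> z vs"
      proof (cases "z \<in> cover T \<and> set vs \<subseteq> cover T")
        case False
        then have "\<phi> z vs = 0" using smooth_forms_outside[OF True] smooth_forms_zero[OF True] by blast
        then show ?thesis using False by (auto simp: twist_def form_scale_def)
      qed (use eq in \<open>simp add: twist_def form_scale_def\<close>)
    qed
    also have "\<dots> \<longleftrightarrow> (\<forall>z\<in>cover T. \<forall>vs. set vs \<subseteq> cover T \<longrightarrow> \<phi> (z + u) vs = factor L u z * \<phi> z vs)"
      by (simp add: factor_multiplier exp_minus field_simps)
    also have "\<dots> \<longleftrightarrow> (\<forall>z\<in>cover T. \<forall>vs. \<phi> (z + u) vs = factor L u z * \<phi> z vs)"
    proof -
      have "\<phi> (z + u) vs = factor L u z * \<phi> z vs" if "\<not> set vs \<subseteq> cover T" for z vs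
        using smooth_forms_zero[OF True] that by simp
      then show ?thesis by blast
    qed
    finally show ?thesis by blast
  qed
  then show ?thesis using True by (simp add: bundle_forms_iff)
qed (simp add: bundle_forms_iff)

lemma translation_map:
  assumes "u \<in> cover T" shows "affine_hermitian_map T T H H id u"
  using W H assms
  by unfold_locales (auto simp: Vector_Spaces.linear_iff complex_space.vector_space_axioms)

lemma BF_add: "\<phi> \<in> BF k \<Longrightarrow> \<psi> \<in> BF k \<Longrightarrow> \<phi> + \<psi> \<in> BF k"
  by (auto simp: bundle_forms_iff smooth_forms_add[OF sW] distrib_left)

lemma BF_scale: "\<phi> \<in> BF k \<Longrightarrow> form_scale c \<phi> \<in> BF k"
  by (auto simp: bundle_forms_iff smooth_forms_scale[OF sW]) (simp add: form_scale_def mult.left_commute)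

lemma BF_zero: "0 \<in> BF k"
  by (simp add: bundle_forms_iff smooth_forms_0[OF sW])

lemma dbar_BF:
  assumes "\<phi> \<in> BF k" shows "dbar T \<phi> \<in> BF (Suc k)"
  unfolding bundle_forms_iff_twist
proof (intro conjI ballI)
  note \<phi> = BF_smooth[OF assms]
  show "dbar T \<phi> \<in> smooth_forms (cover T) (Suc k)" using dbar_smooth[OF W \<phi>] .
  fix u assume u: "u \<in> lat T"
  interpret affine_hermitian_map T T H H id u using translation_map u lat_cover by blast
  show "twist (cover T) H id u (dbar T \<phi>) = form_scale (multiplier u) (dbar T \<phi>)"
    using dbar_twist[OF \<phi>] dbar_form_scale[OF W \<phi>] assms u by (simp add: bundle_forms_iff_twist)
qed

abbreviation cod where "cod \<equiv> codbar (cover T) orth H"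

lemma cod_BF:
  assumes "\<phi> \<in> BF (Suc k)" shows "cod \<phi> \<in> BF k"
  unfolding bundle_forms_iff_twist
proof (intro conjI ballI)
  note \<phi> = BF_smooth[OF assms]
  show "cod \<phi> \<in> smooth_forms (cover T) k" using codbar_smooth[OF W H orthD(2) \<phi>] .
  fix u assume u: "u \<in> lat T"
  interpret affine_hermitian_map T T H H id u using translation_map u lat_cover by blast
  show "twist (cover T) H id u (cod \<phi>) = form_scale (multiplier u) (cod \<phi>)"
    using codbar_twist[OF \<phi> orthD(2)] codbar_form_scale[OF W \<phi> orthD(2)] assms u
    by (simp add: bundle_forms_iff_twist)
qed

text \<open>The exponent of the factor was designed for this: twice its real part is the increment
  of pi H(z,z) under translation by u. Hence the fibre metric descends to the quotient.\<close>

lemma factor_weight: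
  assumes u: "u \<in> lat T" and z: "z \<in> cover T"
  shows "factor L u z * cnj (factor L u z) * wgt (z + u) = wgt z"
proof -
  have uc: "u \<in> cover T" using u lat_cover by blast
  have zu: "z + u \<in> cover T" using z uc sW by (simp add: subspace_add)
  have aa: "\<alpha> u * cnj (\<alpha> u) = 1" using \<alpha>_norm[OF u] by (simp add: complex_norm_square[symmetric])
  define a where "a = of_real pi * H z u + of_real (pi / 2) * H u u"
  have "H (z + u) (z + u) = H z z + H z u + H u z + H u u"
    using hermitian_on_add_left[OF H z uc zu] hermitian_on_add_right[OF W H z uc z] hermitian_on_add_right[OF W H z uc uc]
    by simp
  then have "a + cnj a + - (of_real pi * H (z + u) (z + u)) = - (of_real pi * H z z)"
    using hermitian_on_cnj[OF H z uc] hermitian_on_cnj[OF H uc uc]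
    by (simp add: a_def field_simps)
  then have "exp a * cnj (exp a) * wgt (z + u) = wgt z"
    unfolding wgt_def exp_cnj exp_add[symmetric] by simp
  moreover have "factor L u z = \<alpha> u * exp a" by (simp add: L_bundle_def a_def)
  ultimately show ?thesis using aa by (simp add: ac_simps)
qed

lemma periodic_pairing:
  assumes "\<phi> \<in> BF k" "\<psi> \<in> BF m"
  shows "periodic (\<lambda>z. \<phi> z vs * cnj (\<psi> z ws) * wgt z)"
  unfolding periodic_def
proof (intro ballI)
  fix u z assume uz: "u \<in> lat T" "z \<in> cover T"
  have "\<phi> (z + u) vs * cnj (\<psi> (z + u) ws) * wgt (z + u) =
      \<phi> z vs * cnj (\<psi> z ws) * (factor L u z * cnj (factor L u z) * wgt (z + u))"
    using uz assms by (simp add: BF_equivariant)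
  then show "\<phi> (z + u) vs * cnj (\<psi> (z + u) ws) * wgt (z + u) = \<phi> z vs * cnj (\<psi> z ws) * wgt z"
    unfolding factor_weight[OF uz] .
qed

definition tuples :: "nat \<Rightarrow> 'a list set" where
  "tuples k = {es. length es = k \<and> set es \<subseteq> orth}"

lemma finite_tuples: "finite (tuples k)"
  unfolding tuples_def using finite_lists_length_eq[OF orthD(1), of k] by (simp add: conj_commute)

lemma tuples_cover: "es \<in> tuples k \<Longrightarrow> set es \<subseteq> cover T"
  using orthD(2) by (auto simp: tuples_def)

lemma pointwise_inner_eq:
  "z \<in> cover T \<Longrightarrow> pointwise_inner T L k \<phi> \<psi> z = (\<Sum>es\<in>tuples k. \<phi> z es * cnj (\<psi> z es) * wgt z) / fact k"
  unfolding pointwise_inner_def fibre_metric_def tuples_def[symmetric] by (simp add: weight_L)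

lemma continuous_wgt: "continuous_on (cover T) wgt"
  using smooth_continuous[OF smooth_wgt] .

lemma continuous_form: "\<phi> \<in> smooth_forms (cover T) k \<Longrightarrow> continuous_on (cover T) (\<lambda>z. \<phi> z vs)"
  using smooth_continuous[OF smooth_forms_smooth] .

lemma L2_inner_eq:
  assumes "\<phi> \<in> smooth_forms (cover T) k" "\<psi> \<in> smooth_forms (cover T) k"
  shows "L2_inner T L k \<phi> \<psi> = (\<Sum>es\<in>tuples k. torus_integral T (\<lambda>z. \<phi> z es * cnj (\<psi> z es) * wgt z)) / fact k"
proof -
  have "L2_inner T L k \<phi> \<psi> = torus_integral T (\<lambda>z. (1 / fact k) * (\<Sum>es\<in>tuples k. \<phi> z es * cnj (\<psi> z es) * wgt z))"
    unfolding L2_inner_def by (rule torus_integral_cong) (simp add: pointwise_inner_eq)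
  also have "\<dots> = (1 / fact k) * (\<Sum>es\<in>tuples k. torus_integral T (\<lambda>z. \<phi> z es * cnj (\<psi> z es) * wgt z))"
    unfolding torus_integral_cmult
    by (subst torus_integral_sum)
      (intro continuous_intros continuous_form[OF assms(1)] continuous_form[OF assms(2)] continuous_wgt, simp)
  finally show ?thesis by simp
qed

text \<open>Moving the i-th entry to the front of the second form absorbs the sign (-1)^i, so each
  of the k+1 positions contributes the same sum over a k-tuple and one extra basis vector. The
  resulting factor k+1 is the quotient of the factorials in the two pointwise products.\<close>

lemma dbar_pairing:
  assumes \<eta>: "\<eta> \<in> smooth_forms (cover T) k" and \<phi>: "\<phi> \<in> smooth_forms (cover T) (Suc k)" and z: "z \<in> cover T"
  shows "(\<Sum>es\<in>tuples (Suc k). dbar T \<eta> z es * cnj (\<phi> z es)) =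
    of_nat (Suc k) * (\<Sum>es\<in>tuples k. \<Sum>e\<in>orth. dbar_dir e (\<lambda>y. \<eta> y es) z * cnj (\<phi> z (e # es)))"
proof -
  define X where "X e es = dbar_dir e (\<lambda>y. \<eta> y es) z * cnj (\<phi> z (e # es))" for e es
  have "dbar T \<eta> z es * cnj (\<phi> z es) = (\<Sum>i<Suc k. X (es ! i) (take i es @ drop (Suc i) es))"
    if es: "es \<in> tuples (Suc k)" for es
  proof -
    have esW: "set es \<subseteq> cover T" "length es = Suc k" using tuples_cover[OF es] es by (auto simp: tuples_def)
    have "dbar T \<eta> z es * cnj (\<phi> z es) = (\<Sum>i<Suc k. ((-1) ^ i *
        dbar_dir (es ! i) (\<lambda>y. \<eta> y (take i es @ drop (Suc i) es)) z) * cnj (\<phi> z es))"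
      using z esW by (simp add: dbar_def sum_distrib_right del: sum.lessThan_Suc)
    also have "\<dots> = (\<Sum>i<Suc k. X (es ! i) (take i es @ drop (Suc i) es))"
    proof (rule sum.cong[OF refl])
      fix i assume "i \<in> {..<Suc k}"
      then have i: "i < length es" using esW by simp
      have sub: "set (take i es) \<subseteq> cover T" "set (drop (Suc i) es) \<subseteq> cover T" "es ! i \<in> cover T"
        using esW i set_take_subset[of i es] set_drop_subset[of "Suc i" es] by auto
      have "\<phi> z es = \<phi> z ([] @ take i es @ es ! i # drop (Suc i) es)"
        using id_take_nth_drop[OF i] by simp
      also have "\<dots> = (-1) ^ length (take i es) * \<phi> z ([] @ es ! i # take i es @ drop (Suc i) es)"
        using i esW sub by (intro antilinear_alt_move[OF sW smooth_forms_alt[OF \<phi>]]) auto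
      finally have "\<phi> z es = (-1) ^ i * \<phi> z (es ! i # take i es @ drop (Suc i) es)" using i by simp
      then show "(-1) ^ i * dbar_dir (es ! i) (\<lambda>y. \<eta> y (take i es @ drop (Suc i) es)) z * cnj (\<phi> z es) =
          X (es ! i) (take i es @ drop (Suc i) es)"
        by (simp add: X_def flip: power_mult_distrib)
    qed
    finally show ?thesis .
  qed
  then have "(\<Sum>es\<in>tuples (Suc k). dbar T \<eta> z es * cnj (\<phi> z es)) =
      (\<Sum>es\<in>tuples (Suc k). \<Sum>i<Suc k. X (es ! i) (take i es @ drop (Suc i) es))"
    by (rule sum.cong[OF refl])
  also have "\<dots> = (\<Sum>i<Suc k. \<Sum>es\<in>tuples (Suc k). X (es ! i) (take i es @ drop (Suc i) es))"
    by (rule sum.swap)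
  also have "\<dots> = (\<Sum>i<Suc k. \<Sum>es\<in>tuples k. \<Sum>e\<in>orth. X e es)"
  proof (rule sum.cong[OF refl])
    fix i assume "i \<in> {..<Suc k}"
    then have i: "i \<le> k" by simp
    have "(\<Sum>es\<in>tuples (Suc k). X (es ! i) (take i es @ drop (Suc i) es)) = (\<Sum>(es, e)\<in>tuples k \<times> orth. X e es)"
    proof (rule sum.reindex_bij_witness[where j="\<lambda>es. (take i es @ drop (Suc i) es, es ! i)"
          and i="\<lambda>(es, e). take i es @ e # drop i es"])
      fix es assume es: "es \<in> tuples (Suc k)"
      then have l: "i < length es" using i by (auto simp: tuples_def)
      then show "(case (take i es @ drop (Suc i) es, es ! i) of (es, e) \<Rightarrow> take i es @ e # drop i es) = es"
        using id_take_nth_drop[OF l] by (simp add: min_def)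
      have "set (take i es @ drop (Suc i) es) \<subseteq> orth" "es ! i \<in> orth"
        using es l set_take_subset[of i es] set_drop_subset[of "Suc i" es] by (auto simp: tuples_def)
      then show "(take i es @ drop (Suc i) es, es ! i) \<in> tuples k \<times> orth"
        using l es by (simp add: tuples_def)
    next
      fix p assume p: "p \<in> tuples k \<times> orth"
      then show "(take i (case p of (es, e) \<Rightarrow> take i es @ e # drop i es) @
          drop (Suc i) (case p of (es, e) \<Rightarrow> take i es @ e # drop i es),
          (case p of (es, e) \<Rightarrow> take i es @ e # drop i es) ! i) = p"
        using i by (auto simp: tuples_def nth_append min_def)
      have "set (take i (fst p)) \<subseteq> orth" "set (drop i (fst p)) \<subseteq> orth"
        using p by (auto simp: tuples_def subset_iff dest: in_set_takeD in_set_dropD)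
      then show "(case p of (es, e) \<Rightarrow> take i es @ e # drop i es) \<in> tuples (Suc k)"
        using p i by (auto simp: tuples_def)
    qed auto
    then show "(\<Sum>es\<in>tuples (Suc k). X (es ! i) (take i es @ drop (Suc i) es)) = (\<Sum>es\<in>tuples k. \<Sum>e\<in>orth. X e es)"
      by (simp add: sum.cartesian_product)
  qed
  finally show ?thesis by (simp add: X_def)
qed

lemma dbar_cod_adjoint:
  assumes \<eta>: "\<eta> \<in> BF k" and \<phi>: "\<phi> \<in> BF (Suc k)"
  shows "L2_inner T L (Suc k) (dbar T \<eta>) \<phi> = L2_inner T L k \<eta> (cod \<phi>)"
proof -
  note \<eta>s = BF_smooth[OF \<eta>] and \<phi>s = BF_smooth[OF \<phi>]
  note sm\<eta> = smooth_forms_smooth[OF \<eta>s] and sm\<phi> = smooth_forms_smooth[OF \<phi>s]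
  have orth_cover: "e \<in> cover T" if "e \<in> orth" for e using that orthD(2) by blast
  have c1: "continuous_on (cover T) (\<lambda>z. dbar_dir e (\<lambda>y. \<eta> y es) z * cnj (\<phi> z (e # es)) * wgt z)" if "e \<in> orth" for e es
    by (intro continuous_intros smooth_continuous[OF smooth_dbar_dir[OF W sm\<eta> orth_cover[OF that]]]
        continuous_form[OF \<phi>s] continuous_wgt)
  have c2: "continuous_on (cover T) (\<lambda>z. \<eta> z es * cnj (cov_dir H e (\<lambda>y. \<phi> y (e # es)) z) * wgt z)" if "e \<in> orth" for e es
    by (intro continuous_intros smooth_continuous[OF smooth_cov_dir[OF W sm\<phi> orth_cover[OF that] H]]
        continuous_form[OF \<eta>s] continuous_wgt)
  have pw: "pointwise_inner T L (Suc k) (dbar T \<eta>) \<phi> z =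
      (1 / fact k) * (\<Sum>es\<in>tuples k. \<Sum>e\<in>orth. dbar_dir e (\<lambda>y. \<eta> y es) z * cnj (\<phi> z (e # es)) * wgt z)"
    if z: "z \<in> cover T" for z
  proof -
    have "pointwise_inner T L (Suc k) (dbar T \<eta>) \<phi> z =
        (\<Sum>es\<in>tuples (Suc k). dbar T \<eta> z es * cnj (\<phi> z es)) * wgt z / fact (Suc k)"
      unfolding pointwise_inner_eq[OF z] sum_distrib_right ..
    also have "\<dots> = (1 / fact k) * ((\<Sum>es\<in>tuples k. \<Sum>e\<in>orth. dbar_dir e (\<lambda>y. \<eta> y es) z * cnj (\<phi> z (e # es))) * wgt z)"
      unfolding dbar_pairing[OF \<eta>s \<phi>s z] fact_Suc
      using of_nat_neq_0[of k, where 'a=complex] by (simp del: of_nat_Suc)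
    finally show ?thesis by (simp add: sum_distrib_right)
  qed
  have "L2_inner T L (Suc k) (dbar T \<eta>) \<phi> = (1 / fact k) * (\<Sum>es\<in>tuples k. \<Sum>e\<in>orth.
      torus_integral T (\<lambda>z. dbar_dir e (\<lambda>y. \<eta> y es) z * cnj (\<phi> z (e # es)) * wgt z))"
  proof -
    have "L2_inner T L (Suc k) (dbar T \<eta>) \<phi> = torus_integral T (\<lambda>z. (1 / fact k) *
        (\<Sum>es\<in>tuples k. \<Sum>e\<in>orth. dbar_dir e (\<lambda>y. \<eta> y es) z * cnj (\<phi> z (e # es)) * wgt z))"
      unfolding L2_inner_def using pw by (rule torus_integral_cong)
    then show ?thesis
      unfolding torus_integral_cmult
      by (simp add: torus_integral_sum c1 continuous_on_sum)
  qed
  also have "\<dots> = (1 / fact k) * (\<Sum>es\<in>tuples k. \<Sum>e\<in>orth.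
      - torus_integral T (\<lambda>z. \<eta> z es * cnj (cov_dir H e (\<lambda>y. \<phi> y (e # es)) z) * wgt z))"
    using integration_by_parts[OF sm\<eta> sm\<phi> periodic_pairing[OF \<eta> \<phi>] orth_cover] by simp
  also have "\<dots> = (1 / fact k) * (\<Sum>es\<in>tuples k. torus_integral T (\<lambda>z. \<eta> z es * cnj (cod \<phi> z es) * wgt z))"
  proof (intro arg_cong[where f="(*) (1 / fact k)"] sum.cong refl)
    fix es assume es: "es \<in> tuples k"
    have "torus_integral T (\<lambda>z. \<eta> z es * cnj (cod \<phi> z es) * wgt z) =
        torus_integral T (\<lambda>z. (-1) * (\<Sum>e\<in>orth. \<eta> z es * cnj (cov_dir H e (\<lambda>y. \<phi> y (e # es)) z) * wgt z))"
      by (rule torus_integral_cong)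
        (simp add: codbar_def tuples_cover[OF es] sum_distrib_left sum_distrib_right sum_negf)
    also have "\<dots> = (-1) * (\<Sum>e\<in>orth. torus_integral T (\<lambda>z. \<eta> z es * cnj (cov_dir H e (\<lambda>y. \<phi> y (e # es)) z) * wgt z))"
      unfolding torus_integral_cmult by (simp add: torus_integral_sum c2)
    finally show "(\<Sum>e\<in>orth. - torus_integral T (\<lambda>z. \<eta> z es * cnj (cov_dir H e (\<lambda>y. \<phi> y (e # es)) z) * wgt z)) =
        torus_integral T (\<lambda>z. \<eta> z es * cnj (cod \<phi> z es) * wgt z)"
      by (simp add: sum_negf)
  qed
  also have "\<dots> = L2_inner T L k \<eta> (cod \<phi>)"
    unfolding L2_inner_eq[OF \<eta>s BF_smooth[OF cod_BF[OF \<phi>]]] by simp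
  finally show ?thesis .
qed

text \<open>The pointwise product sees only tuples from the orthonormal basis. Real linearity
  extends the vanishing slot by slot: the list \<open>es\<close> holds slots already restricted to
  basis vectors, \<open>ws\<close> the slots still arbitrary.\<close>

lemma form_zero_on_basis:
  assumes \<omega>: "antilinear_alt (cover T) k \<omega>" and zero: "\<And>es. es \<in> tuples k \<Longrightarrow> \<omega> es = 0"
  shows "\<omega> vs = 0"
proof (cases "length vs = k \<and> set vs \<subseteq> cover T")
  case True
  have "\<omega> (es @ ws) = 0" if "set es \<subseteq> orth" "set ws \<subseteq> cover T" "length es + length ws = k" for es ws
    using that
  proof (induct ws arbitrary: es)
    case Nil
    then show ?case using zero[of es] by (simp add: tuples_def)
  next
    case (Cons w ws)
    have es: "set es \<subseteq> cover T" using Cons.prems orthD(2) by blast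
    have wspan: "w \<in> span orth" using Cons.prems orthD(3) by simp
    have "w \<in> cover T \<and> \<omega> (es @ w # ws) = 0"
      using wspan
    proof (induct rule: span_induct_alt)
      case base
      have "\<omega> (es @ (0 + 0) # ws) = \<omega> (es @ 0 # ws) + \<omega> (es @ 0 # ws)"
        using Cons.prems es subspace_0[OF sW] by (intro antilinear_alt_add[OF \<omega>]) auto
      then show ?case using subspace_0[OF sW] by simp
    next
      case (step c e y)
      have e: "e \<in> cover T" using step orthD(2) by blast
      have ce: "c *\<^sub>R e \<in> cover T" using e sW by (simp add: subspace_scale)
      have "\<omega> (es @ e # ws) = 0"
        using Cons.hyps[of "es @ [e]"] Cons.prems step(1) by simp
      then have "\<omega> (es @ (c *\<^sub>R e) # ws) = 0"
        using antilinear_alt_scale[OF \<omega>, of es ws e "of_real c"] Cons.prems es e by (simp add: scaleC_of_real)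
      then have "\<omega> (es @ (c *\<^sub>R e + y) # ws) = 0"
        using antilinear_alt_add[OF \<omega>, of es ws "c *\<^sub>R e" y] Cons.prems es ce step by simp
      then show ?case using step ce sW by (simp add: subspace_add)
    qed
    then show ?case by blast
  qed
  from this[of "[]" vs] show ?thesis using True by simp
next
  case False
  then show ?thesis using antilinear_alt_zero[OF \<omega>] by blast
qed

text \<open>The density of the norm is continuous, nonnegative and periodic, so zero integral forces
  it to vanish, and with it all values on orthonormal tuples.\<close>

lemma L2_inner_definite:
  assumes \<psi>: "\<psi> \<in> BF k" and 0: "L2_inner T L k \<psi> \<psi> = 0"
  shows "\<psi> = 0"
proof -
  note \<psi>s = BF_smooth[OF \<psi>]
  define r where "r z = (\<Sum>es\<in>tuples k. (cmod (\<psi> z es))\<^sup>2 * weight L z) / fact k" for z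
  have wpos: "weight L z > 0" for z by (simp add: L_bundle_def)
  have r_eq: "of_real (r z) = pointwise_inner T L k \<psi> \<psi> z" for z
    unfolding r_def pointwise_inner_def fibre_metric_def tuples_def[symmetric]
    by (simp add: complex_norm_square[symmetric] of_real_power)
  have r_eq': "of_real (r z) = (1 / fact k) * (\<Sum>es\<in>tuples k. \<psi> z es * cnj (\<psi> z es) * wgt z)" if "z \<in> cover T" for z
    unfolding r_eq pointwise_inner_eq[OF that] by simp
  have "continuous_on (cover T) (\<lambda>z. (1 / fact k) * (\<Sum>es\<in>tuples k. \<psi> z es * cnj (\<psi> z es) * wgt z))"
    by (intro continuous_intros continuous_form[OF \<psi>s] continuous_wgt)
  then have "continuous_on (cover T) (\<lambda>z. Re ((1 / fact k) * (\<Sum>es\<in>tuples k. \<psi> z es * cnj (\<psi> z es) * wgt z)))"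
    by (rule continuous_on_Re)
  moreover have "r z = Re ((1 / fact k) * (\<Sum>es\<in>tuples k. \<psi> z es * cnj (\<psi> z es) * wgt z))" if "z \<in> cover T" for z
    using arg_cong[OF r_eq'[OF that], of Re] by (simp only: Re_complex_of_real)
  ultimately have r_cont: "continuous_on (cover T) r" by (simp cong: continuous_on_cong)
  have r_nonneg: "0 \<le> r z" for z
    unfolding r_def using wpos[of z] by (intro divide_nonneg_pos sum_nonneg) auto
  have per: "periodic (\<lambda>z. of_real (r z))"
    unfolding periodic_def
  proof (intro ballI)
    fix u z assume uz: "u \<in> lat T" "z \<in> cover T"
    then have "z + u \<in> cover T" using lat_cover sW by (auto intro: subspace_add)
    moreover have "\<psi> (z + u) es * cnj (\<psi> (z + u) es) * wgt (z + u) = \<psi> z es * cnj (\<psi> z es) * wgt z" for es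
      using periodic_pairing[OF \<psi> \<psi>] uz by (auto simp: periodic_def)
    ultimately show "complex_of_real (r (z + u)) = complex_of_real (r z)" using uz by (simp only: r_eq')
  qed
  have "torus_integral T (\<lambda>z. of_real (r z)) = 0"
    using 0 unfolding L2_inner_def r_eq .
  then have r0: "r z = 0" if "z \<in> cover T" for z
    using torus_integral_nonneg_zero[OF r_cont r_nonneg per _ that] by blast
  have "\<psi> z vs = 0" for z vs
  proof (cases "z \<in> cover T")
    case True
    have "\<psi> z es = 0" if es: "es \<in> tuples k" for es
    proof -
      have "(\<Sum>es\<in>tuples k. (cmod (\<psi> z es))\<^sup>2 * weight L z) = 0"
        using r0[OF True] by (simp add: r_def)
      then have "(cmod (\<psi> z es))\<^sup>2 * weight L z = 0"
        using es wpos[of z] finite_tuples by (subst (asm) sum_nonneg_eq_0_iff) auto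
      then show ?thesis using wpos[of z] by simp
    qed
    then show ?thesis using form_zero_on_basis[OF smooth_forms_alt[OF \<psi>s]] by blast
  next
    case False
    then show ?thesis using smooth_forms_outside[OF \<psi>s] by blast
  qed
  then show ?thesis by (simp add: fun_eq_iff)
qed

text \<open>The difference of the two forms is itself an admissible test form. This is the
  uniqueness behind the definite description of the adjoint.\<close>

lemma L2_inner_unique:
  assumes \<psi>: "\<psi> \<in> BF k" and \<psi>': "\<psi>' \<in> BF k"
    and eq: "\<And>\<eta>. \<eta> \<in> BF k \<Longrightarrow> L2_inner T L k \<eta> \<psi> = L2_inner T L k \<eta> \<psi>'"
  shows "\<psi> = \<psi>'"
proof -
  define \<delta> where "\<delta> = \<psi> + form_scale (-1) \<psi>'"
  have \<delta>: "\<delta> \<in> BF k" unfolding \<delta>_def by (intro BF_add BF_scale \<psi> \<psi>')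
  note s = BF_smooth[OF \<psi>] BF_smooth[OF \<psi>'] BF_smooth[OF \<delta>]
  have c: "continuous_on (cover T) (\<lambda>z. \<delta> z es * cnj (\<psi> z es) * wgt z)"
    "continuous_on (cover T) (\<lambda>z. (-1) * (\<delta> z es * cnj (\<psi>' z es) * wgt z))" for es
    by (intro continuous_intros continuous_form[OF s(1)] continuous_form[OF s(2)] continuous_form[OF s(3)] continuous_wgt)+
  have "torus_integral T (\<lambda>z. \<delta> z es * cnj (\<delta> z es) * wgt z) =
      torus_integral T (\<lambda>z. \<delta> z es * cnj (\<psi> z es) * wgt z) - torus_integral T (\<lambda>z. \<delta> z es * cnj (\<psi>' z es) * wgt z)" for es
  proof -
    have "torus_integral T (\<lambda>z. \<delta> z es * cnj (\<delta> z es) * wgt z) =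
        torus_integral T (\<lambda>z. \<delta> z es * cnj (\<psi> z es) * wgt z + (-1) * (\<delta> z es * cnj (\<psi>' z es) * wgt z))"
      by (rule arg_cong[where f="torus_integral T"])
        (simp add: \<delta>_def form_scale_def fun_eq_iff algebra_simps)
    also have "\<dots> = torus_integral T (\<lambda>z. \<delta> z es * cnj (\<psi> z es) * wgt z) +
        (-1) * torus_integral T (\<lambda>z. \<delta> z es * cnj (\<psi>' z es) * wgt z)"
      unfolding torus_integral_add[OF c] torus_integral_cmult ..
    finally show ?thesis by simp
  qed
  then have "L2_inner T L k \<delta> \<delta> = L2_inner T L k \<delta> \<psi> - L2_inner T L k \<delta> \<psi>'"
    by (simp add: L2_inner_eq s sum_subtractf diff_divide_distrib)
  then have "\<delta> = 0" using eq[OF \<delta>] L2_inner_definite[OF \<delta>] by simp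
  then show ?thesis by (simp add: \<delta>_def form_scale_def fun_eq_iff)
qed

text \<open>Existence comes from the explicit operator, uniqueness from definiteness of the product
  on smooth bundle forms.\<close>

lemma dbar_adjoint_eq:
  assumes \<phi>: "\<phi> \<in> BF (Suc k)"
  shows "dbar_adjoint T L (Suc k) \<phi> = cod \<phi>"
proof -
  have "(THE \<psi>. \<psi> \<in> BF k \<and> (\<forall>\<eta>\<in>BF k. L2_inner T L (Suc k) (dbar T \<eta>) \<phi> = L2_inner T L k \<eta> \<psi>)) = cod \<phi>"
  proof (rule the_equality)
    show "cod \<phi> \<in> BF k \<and> (\<forall>\<eta>\<in>BF k. L2_inner T L (Suc k) (dbar T \<eta>) \<phi> = L2_inner T L k \<eta> (cod \<phi>))"
      using cod_BF[OF \<phi>] dbar_cod_adjoint[OF _ \<phi>] by blast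
  next
    fix \<psi> assume "\<psi> \<in> BF k \<and> (\<forall>\<eta>\<in>BF k. L2_inner T L (Suc k) (dbar T \<eta>) \<phi> = L2_inner T L k \<eta> \<psi>)"
    then show "\<psi> = cod \<phi>"
      using dbar_cod_adjoint[OF _ \<phi>] cod_BF[OF \<phi>] by (intro L2_inner_unique[of \<psi> k]) auto
  qed
  then show ?thesis by (simp add: dbar_adjoint_def)
qed

text \<open>The Laplacian without reference to degree or multiplier. It acts on all smooth forms, so
  it can be compared across a twist before the twisted form is known to be equivariant.\<close>

definition box :: "'a form \<Rightarrow> 'a form" where
  "box \<phi> = dbar T (cod \<phi>) + cod (dbar T \<phi>)"

theorem dolbeault_laplacian_eq:
  assumes \<phi>: "\<phi> \<in> BF k"
  shows "dolbeault_laplacian T L k \<phi> = box \<phi>"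
proof (cases k)
  case 0
  then have "cod \<phi> = 0" using codbar_degree_0 BF_smooth[OF \<phi>] by blast
  then show ?thesis
    using 0 dbar_adjoint_eq[OF dbar_BF[OF \<phi>]] by (simp add: dolbeault_laplacian_def box_def dbar_adjoint_def)
next
  case (Suc m)
  then show ?thesis
    using dbar_adjoint_eq[OF dbar_BF[OF \<phi>]] dbar_adjoint_eq[of \<phi> m] \<phi> by (simp add: dolbeault_laplacian_def box_def)
qed

lemma eigenspace_eq: "eigenspace T L k \<mu> = {\<phi> \<in> BF k. box \<phi> = form_scale \<mu> \<phi>}"
  using dolbeault_laplacian_eq by (auto simp: eigenspace_def)

end

section \<open>Fourier decomposition along the kernel\<close>

text \<open>Multiplying by the cosine shifts frequencies by 1 in both directions, so if all moments
  of f vanish, the property survives each factor A - cos(2 pi t). The induction needs all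
  frequencies m at once.\<close>

lemma cos_kernel_moments:
  fixes f :: "real \<Rightarrow> complex"
  assumes cont: "continuous_on {0..1} f"
    and zero: "\<And>m::int. integral {0..1} (\<lambda>t. cis (2 * pi * of_int m * t) * f t) = 0"
  shows "integral {0..1} (\<lambda>t. cis (2 * pi * of_int m * t) * (of_real ((A - cos (2 * pi * t)) ^ n) * f t)) = 0"
proof (induct n arbitrary: m)
  case 0
  then show ?case using zero by simp
next
  case (Suc n)
  define g where "g m t = cis (2 * pi * of_int m * t) * (of_real ((A - cos (2 * pi * t)) ^ n) * f t)" for m :: int and t
  have "continuous_on {0..1} (g m)" for m
    unfolding g_def cis_conv_exp by (intro continuous_intros cont)
  then have int: "g m integrable_on {0..1}" for m by (rule integrable_continuous_interval)
  have "cis (2 * pi * of_int m * t) * (of_real ((A - cos (2 * pi * t)) ^ Suc n) * f t) =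
      of_real A * g m t - (1/2) * g (m + 1) t - (1/2) * g (m - 1) t" for t
  proof -
    have c: "cos (2 * pi * t) = (1/2) * (cis (2 * pi * t) + cis (- (2 * pi * t)))"
      by (simp add: complex_eq_iff)
    have 1: "cis (2 * pi * of_int (m + 1) * t) = cis (2 * pi * of_int m * t) * cis (2 * pi * t)"
      "cis (2 * pi * of_int (m - 1) * t) = cis (2 * pi * of_int m * t) * cis (- (2 * pi * t))"
      by (simp_all add: cis_mult algebra_simps)
    show ?thesis
      unfolding g_def 1 power_Suc of_real_mult of_real_diff c by (simp add: algebra_simps)
  qed
  then have "integral {0..1} (\<lambda>t. cis (2 * pi * of_int m * t) * (of_real ((A - cos (2 * pi * t)) ^ Suc n) * f t)) =
      integral {0..1} (\<lambda>t. of_real A * g m t - (1/2) * g (m + 1) t - (1/2) * g (m - 1) t)" by simp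
  also have "\<dots> = of_real A * integral {0..1} (g m) - (1/2) * integral {0..1} (g (m + 1)) - (1/2) * integral {0..1} (g (m - 1))"
    by (simp add: integral_diff int integrable_diff integrable_on_mult_right integral_mult_right)
  also have "\<dots> = 0"
  proof -
    have "integral {0..1} (g j) = 0" for j unfolding g_def[abs_def] by (rule Suc)
    then show ?thesis by simp
  qed
  finally show ?case .
qed

text \<open>Testing \<open>f\<close> against powers of a trigonometric polynomial that exceeds 1 only near \<open>1/2\<close>.\<close>

lemma fourier_uniqueness:
  fixes f :: "real \<Rightarrow> complex"
  assumes cont: "continuous_on {0..1} f"
    and zero: "\<And>m::int. integral {0..1} (\<lambda>t. cis (2 * pi * of_int m * t) * f t) = 0"
  shows "f (1/2) = 0"
proof (rule ccontr)
  assume nz: "f (1/2) \<noteq> 0"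
  define w where "w = f (1/2)"
  \<comment> \<open>Rotating by the conjugate of the value at 1/2 gives a real function that is
    positive there.\<close>
  define F where "F t = Re (cnj w * f t)" for t
  have F_cont: "continuous_on {0..1} F" unfolding F_def by (intro continuous_intros cont)
  define c where "c = (cmod w)\<^sup>2 / 2"
  have c: "c > 0" using nz by (simp add: c_def w_def)
  have Fhalf: "F (1/2) = 2 * c"
  proof -
    have "cnj w * w = of_real ((cmod w)\<^sup>2)" by (simp only: complex_norm_square mult.commute)
    then show ?thesis by (simp add: F_def c_def w_def[symmetric] del: of_real_power)
  qed
  obtain d where d: "d > 0" "\<And>t. t \<in> {0..1} \<Longrightarrow> \<bar>t - 1/2\<bar> < d \<Longrightarrow> \<bar>F t - F (1/2)\<bar> < c"
    using F_cont[unfolded continuous_on_iff dist_real_def, rule_format, of "1/2" c] c by auto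
  \<comment> \<open>Strictly below \<open>d\<close>, so that \<open>F\<close> stays at least c on
    the closed interval around 1/2; the bound 1/4 keeps this interval inside [0,1] and the angles
    where the cosine decreases.\<close>
  define \<delta> where "\<delta> = min (d / 2) (1 / 4)"
  have \<delta>: "0 < \<delta>" "\<delta> < d" "\<delta> \<le> 1/4" using d(1) by (auto simp: \<delta>_def)
  define \<kappa> where "\<kappa> = cos (2 * pi * \<delta>)"
  \<comment> \<open>Since - cos(2 pi t) = cos(2 pi |t - 1/2|), this is 1 + cos(2 pi |t - 1/2|) -
    \<open>\<kappa>\<close>: at least 1 within distance \<open>\<delta>\<close> of 1/2, and of
    modulus at most 1 on the rest of [0,1].\<close>
  define K where "K t = (1 - \<kappa>) - cos (2 * pi * t)" for t
  have cosK: "- cos (2 * pi * t) = cos (2 * pi * \<bar>t - 1/2\<bar>)" for t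
  proof -
    have "cos (2 * pi * \<bar>t - 1/2\<bar>) = cos \<bar>2 * pi * (t - 1/2)\<bar>" by (simp add: abs_mult)
    also have "\<dots> = cos (2 * pi * t - pi)" by (simp add: algebra_simps)
    also have "\<dots> = - cos (2 * pi * t)" by (simp add: cos_diff)
    finally show ?thesis by simp
  qed
  have mono: "cos (2 * pi * y) \<le> cos (2 * pi * x)" if "0 \<le> x" "x \<le> y" "y \<le> 1/2" for x y
    using that by (intro cos_monotone_0_pi_le) auto
  have near: "F t \<ge> c" "K t \<ge> 1" if "t \<in> {0..1}" "\<bar>t - 1/2\<bar> \<le> \<delta>" for t
  proof -
    show "F t \<ge> c" using d(2)[of t] that \<delta> Fhalf by linarith
    show "K t \<ge> 1" using mono[of "\<bar>t - 1/2\<bar>" \<delta>] that \<delta> cosK[of t] by (simp add: K_def \<kappa>_def)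
  qed
  \<comment> \<open>The value of K at distance \<delta>/2 from 1/2, hence its minimum on the inner
    interval; exceeding 1, it makes the powers grow there.\<close>
  define q where "q = 1 + cos (2 * pi * (\<delta> / 2)) - \<kappa>"
  have q: "q > 1"
  proof -
    have "cos (2 * pi * \<delta>) < cos (2 * pi * (\<delta> / 2))"
      using \<delta> by (intro cos_monotone_0_pi) (auto simp: field_simps)
    then show ?thesis by (simp add: q_def \<kappa>_def)
  qed
  have inner: "K t \<ge> q" if "t \<in> {0..1}" "\<bar>t - 1/2\<bar> \<le> \<delta> / 2" for t
    using mono[of "\<bar>t - 1/2\<bar>" "\<delta> / 2"] that \<delta> cosK[of t] by (simp add: K_def q_def)
  have far: "\<bar>K t\<bar> \<le> 1" if "t \<in> {0..1}" "\<not> \<bar>t - 1/2\<bar> \<le> \<delta>" for t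
  proof -
    have "\<bar>t - 1/2\<bar> \<le> 1/2" unfolding abs_le_iff using that(1) by auto
    then have "cos (2 * pi * \<bar>t - 1/2\<bar>) \<le> \<kappa>"
      unfolding \<kappa>_def using that \<delta> by (intro mono) auto
    moreover have "cos (2 * pi * \<bar>t - 1/2\<bar>) \<ge> -1" "\<kappa> \<le> 1" by (auto simp: \<kappa>_def)
    moreover have "cos (2 * pi * t) \<le> 1" by simp
    ultimately have "- 1 \<le> K t" "K t \<le> 1" using cosK[of t] unfolding K_def by linarith+
    then show ?thesis by (simp add: abs_le_iff)
  qed
  have "bounded (F ` {0..1})"
    using compact_continuous_image[OF F_cont] by (simp add: compact_imp_bounded)
  then obtain M where "\<forall>t\<in>{0..1}. \<bar>F t\<bar> \<le> M" unfolding bounded_iff by (metis imageI real_norm_def)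
  then have M: "\<bar>F t\<bar> \<le> M" if "t \<in> {0..1}" for t using that by blast
  have "0 \<le> M" using M[of 0] by (auto intro: order_trans[OF abs_ge_zero])
  have bound: "\<delta> * (c * q ^ n) \<le> M" for n
  proof -
    \<comment> \<open>Adding the bound \<open>M\<close> makes the integrand nonnegative, so its
      integral over the inner interval is at most the total, which is M because the moments vanish.
      The inner part grows like a power of q.\<close>
    define h where "h t = K t ^ n * F t + M" for t
    have K_cont: "continuous_on S K" for S unfolding K_def by (intro continuous_intros)
    have h_cont: "continuous_on S h" if "S \<subseteq> {0..1}" for S
      unfolding h_def by (intro continuous_intros K_cont continuous_on_subset[OF F_cont that])
    have h_nonneg: "0 \<le> h t" if t: "t \<in> {0..1}" for t
    proof (cases "\<bar>t - 1/2\<bar> \<le> \<delta>")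
      case True
      have "0 \<le> K t ^ n * F t" using near[OF t True] c by (intro mult_nonneg_nonneg) auto
      then show ?thesis using \<open>0 \<le> M\<close> by (simp add: h_def)
    next
      case False
      have "\<bar>K t ^ n * F t\<bar> \<le> 1 * M"
        unfolding abs_mult power_abs
        using far[OF t False] M[OF t] by (intro mult_mono power_le_one) auto
      then show ?thesis by (simp add: h_def abs_le_iff)
    qed
    have h_inner: "c * q ^ n \<le> h t" if t: "t \<in> {1/2 - \<delta>/2..1/2 + \<delta>/2}" for t
    proof -
      have t': "t \<in> {0..1}" "\<bar>t - 1/2\<bar> \<le> \<delta> / 2" "\<bar>t - 1/2\<bar> \<le> \<delta>" using t \<delta> unfolding abs_le_iff by auto
      have "q ^ n * c \<le> K t ^ n * F t"
        using inner[OF t'(1,2)] near(1)[OF t'(1,3)] q c by (intro mult_mono power_mono) auto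
      then show ?thesis using \<open>0 \<le> M\<close> by (simp add: h_def mult.commute)
    qed
    have KF_int: "integral {0..1} (\<lambda>t. K t ^ n * F t) = 0"
    proof -
      have "continuous_on {0..1} (\<lambda>t. of_real (K t ^ n) * f t)"
        by (intro continuous_intros K_cont cont)
      then have int: "(\<lambda>t. of_real (K t ^ n) * f t) integrable_on {0..1}" by (rule integrable_continuous_interval)
      have "integral {0..1} (\<lambda>t. of_real (K t ^ n) * f t) = 0"
        using cos_kernel_moments[OF cont zero, of 0 "1 - \<kappa>" n] by (simp add: K_def)
      then have "integral {0..1} (\<lambda>t. cnj w * (of_real (K t ^ n) * f t)) = 0"
        by (simp only: integral_mult_right mult_zero_right)
      moreover have "integral {0..1} (Re \<circ> (\<lambda>t. cnj w * (of_real (K t ^ n) * f t))) =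
          Re (integral {0..1} (\<lambda>t. cnj w * (of_real (K t ^ n) * f t)))"
        by (rule integral_linear[OF integrable_on_mult_right[OF int] bounded_linear_Re])
      moreover have "Re \<circ> (\<lambda>t. cnj w * (of_real (K t ^ n) * f t)) = (\<lambda>t. K t ^ n * F t)"
        by (auto simp: F_def algebra_simps simp flip: of_real_power)
      ultimately show ?thesis by (simp only: zero_complex.sel)
    qed
    have "(\<lambda>t. K t ^ n * F t) integrable_on {0..1}"
      by (intro integrable_continuous_interval continuous_intros K_cont F_cont)
    then have "integral {0..1} h = integral {0..1} (\<lambda>t. K t ^ n * F t) + integral {0..1} (\<lambda>t::real. M)"
      unfolding h_def by (rule integral_add[OF _ integrable_const_ivl])
    moreover have "integral {0..1} (\<lambda>t::real. M) = M"
      using integral_const_real[of 0 1 M] by simp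
    ultimately have int_h: "integral {0..1} h = M" using KF_int by simp
    have sub: "{1/2 - \<delta>/2..1/2 + \<delta>/2} \<subseteq> {0..1}" using \<delta> by auto
    have "\<delta> * (c * q ^ n) = integral {1/2 - \<delta>/2..1/2 + \<delta>/2} (\<lambda>t. c * q ^ n)"
      using \<delta> by simp
    also have "\<dots> \<le> integral {1/2 - \<delta>/2..1/2 + \<delta>/2} h"
      using h_inner h_cont[OF sub] by (intro integral_le integrable_continuous_interval) auto
    also have "\<dots> \<le> integral {0..1} h"
      using h_nonneg h_cont sub by (intro integral_subset_le integrable_continuous_interval) auto
    finally show ?thesis using int_h by simp
  qed
  obtain n where "M / (\<delta> * c) < q ^ n" using real_arch_pow[OF q] by blast
  then have "M < \<delta> * (c * q ^ n)" using \<delta> c by (simp add: field_simps)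
  with bound[of n] show False by simp
qed

text \<open>Differentiating under the integral, the derivative in s is the integral of p' over one
  period, p(s+1) - p(s) = 0.\<close>

lemma integral_periodic_shift:
  fixes p :: "real \<Rightarrow> complex"
  assumes p: "\<And>t. (p has_vector_derivative p' t) (at t)" and p': "continuous_on UNIV p'"
    and per: "\<And>t. p (t + 1) = p t"
  shows "integral {0..1} (\<lambda>t. p (s + t)) = integral {0..1} p"
proof -
  have p_cont: "continuous_on UNIV p"
    using has_vector_derivative_continuous[OF p] by (simp add: continuous_on_eq_continuous_at)
  have shift: "((\<lambda>s. p (s + t)) has_vector_derivative p' (s + t)) (at s)" for s t
  proof -
    have "((p \<circ> (\<lambda>s. s + t)) has_vector_derivative 1 *\<^sub>R p' (s + t)) (at s)"
      by (rule vector_diff_chain_at) (auto intro!: derivative_eq_intros p)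
    then show ?thesis by (simp add: o_def)
  qed
  have "((\<lambda>s. integral (cbox 0 1) (\<lambda>t. p (s + t))) has_vector_derivative 0) (at s within UNIV)" for s
  proof -
    have "((\<lambda>s. integral (cbox 0 1) (\<lambda>t. p (s + t))) has_vector_derivative
        integral (cbox 0 1) (\<lambda>t. p' (s + t))) (at s within UNIV)"
    proof (rule leibniz_rule_vector_derivative)
      show "((\<lambda>s. p (s + t)) has_vector_derivative p' (s + t)) (at s within UNIV)" for s t
        using shift by simp
      show "(\<lambda>t. p (s + t)) integrable_on cbox 0 1" for s
        by (intro integrable_continuous continuous_on_compose2[OF p_cont]) (auto intro!: continuous_intros)
      show "continuous_on (UNIV \<times> cbox 0 1) (\<lambda>(s, t). p' (s + t))"
        unfolding split_def by (rule continuous_on_compose2[OF p']) (auto intro!: continuous_intros)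
    qed auto
    moreover have "((\<lambda>t. p' (s + t)) has_integral p (s + 1) - p (s + 0)) {0..1}"
      by (rule fundamental_theorem_of_calculus)
        (use shift[where ?t=s] in \<open>auto simp: add.commute intro: has_vector_derivative_at_within\<close>)
    ultimately show ?thesis using per by (simp add: integral_unique)
  qed
  then have "(\<lambda>s. integral (cbox 0 1) (\<lambda>t. p (s + t))) s = (\<lambda>s. integral (cbox 0 1) (\<lambda>t. p (s + t))) 0"
    using has_vector_derivative_zero_constant[of UNIV "\<lambda>s. integral (cbox 0 1) (\<lambda>t. p (s + t))"]
    by (metis UNIV_I convex_UNIV)
  then show ?thesis by simp
qed

lemma integral_cis_int:
  assumes "m \<noteq> (0::int)"
  shows "integral {0..1} (\<lambda>t. cis (2 * pi * of_int m * t)) = 0"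
proof -
  define F where "F t = cis (2 * pi * of_int m * t) / (2 * pi * of_int m * \<i>)" for t
  have "((\<lambda>t. cis (2 * pi * of_int m * t)) has_integral F 1 - F 0) {0..1}"
  proof (rule fundamental_theorem_of_calculus)
    fix t :: real
    have "((\<lambda>z. exp (2 * pi * of_int m * \<i> * z) / (2 * pi * of_int m * \<i>)) has_field_derivative
        exp (2 * pi * of_int m * \<i> * of_real t)) (at (of_real t))"
      using assms by (auto intro!: derivative_eq_intros simp: field_simps)
    from has_vector_derivative_real_field[OF this]
    have "((\<lambda>t. exp (2 * pi * of_int m * \<i> * of_real t) / (2 * pi * of_int m * \<i>)) has_vector_derivative
        exp (2 * pi * of_int m * \<i> * of_real t)) (at t within {0..1})" .
    then show "(F has_vector_derivative cis (2 * pi * of_int m * t)) (at t within {0..1})"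
      by (simp add: F_def[abs_def] cis_conv_exp ac_simps)
  qed simp
  moreover have "F 1 = F 0"
  proof -
    have "cis (2 * pi * of_int m) = 1" by (simp add: cis_multiple_2pi)
    then show ?thesis by (simp add: F_def)
  qed
  ultimately show ?thesis by (simp add: integral_unique)
qed

lemma cis_2pi_eq_imp_int:
  assumes "cis (2 * pi * x) = cis (2 * pi * y)"
  obtains m :: int where "x - y = of_int m"
proof -
  have "sin (2 * pi * x) = sin (2 * pi * y) \<and> cos (2 * pi * x) = cos (2 * pi * y)"
    using assms by (simp add: complex_eq_iff)
  then obtain n :: int where "2 * pi * x = 2 * pi * y + 2 * pi * of_int n"
    unfolding sin_cos_eq_iff by auto
  then have "2 * pi * (x - y) = 2 * pi * of_int n" by (simp add: algebra_simps)
  then show thesis using that[of n] by simp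
qed

section \<open>Weighted averages along a line\<close>

text \<open>For an exponential \<open>k\<close> this is a Fourier coefficient of f on the line
  through z in direction b, regarded as a function of z.\<close>

definition line_average :: "(real \<Rightarrow> complex) \<Rightarrow> 'a::real_vector \<Rightarrow> ('a \<Rightarrow> complex) \<Rightarrow> 'a \<Rightarrow> complex" where
  "line_average k b f z = integral {0..1} (\<lambda>t. k t * f (z + t *\<^sub>R b))"

context
  fixes W :: "'a::euclidean_space set" and b :: 'a and k :: "real \<Rightarrow> complex"
  assumes W: "subspace W" and b: "b \<in> W" and k: "continuous_on UNIV k"
begin

lemma line_average_continuous_joint:
  assumes "continuous_on W f" "z \<in> W" "v \<in> W"
  shows "continuous_on (UNIV \<times> cbox 0 1) (\<lambda>(s, t). k t * f (z + s *\<^sub>R v + t *\<^sub>R b))"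
  unfolding split_def
  by (intro continuous_intros continuous_on_compose2[OF k] continuous_on_compose2[OF assms(1)])
    (use assms b W in \<open>auto intro!: line_in_subspace\<close>)

lemma line_average_integrand_continuous:
  assumes "continuous_on W f" "z \<in> W"
  shows "continuous_on S (\<lambda>t. k t * f (z + t *\<^sub>R b))"
  by (intro continuous_intros continuous_on_compose2[OF k] continuous_on_compose2[OF assms(1)])
    (use assms b W in \<open>auto intro!: line_in_subspace\<close>)

lemma line_average_integrable:
  assumes "continuous_on W f" "z \<in> W"
  shows "(\<lambda>t. k t * f (z + t *\<^sub>R b)) integrable_on {0..1}"
  using integrable_continuous_interval[OF line_average_integrand_continuous[OF assms]] .

lemma line_average_continuous:
  assumes "continuous_on W f"
  shows "continuous_on W (line_average k b f)"
proof -
  have "continuous_on (W \<times> cbox 0 1) (\<lambda>(z, t). k t * f (z + t *\<^sub>R b))"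
    unfolding split_def
    by (intro continuous_intros continuous_on_compose2[OF k] continuous_on_compose2[OF assms(1)])
      (use b W in \<open>auto intro!: line_in_subspace\<close>)
  from integral_continuous_on_param[OF this] show ?thesis
    by (simp add: line_average_def[abs_def])
qed

lemma has_dir_deriv_line_average:
  assumes f: "Ck_on (Suc m) W f" and v: "v \<in> W" and z: "z \<in> W"
  shows "((\<lambda>s. line_average k b f (z + s *\<^sub>R v)) has_vector_derivative line_average k b (dir_deriv v f) z) (at 0)"
proof -
  have fc: "continuous_on W f" and dc: "continuous_on W (dir_deriv v f)"
    using f v Ck_on_continuous[of m W] by auto
  have "((\<lambda>s. integral (cbox 0 1) (\<lambda>t. k t * f (z + s *\<^sub>R v + t *\<^sub>R b))) has_vector_derivative
      integral (cbox 0 1) (\<lambda>t. k t * dir_deriv v f (z + 0 *\<^sub>R v + t *\<^sub>R b))) (at 0 within UNIV)"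
  proof (rule leibniz_rule_vector_derivative)
    fix s t :: real
    have zt: "z + t *\<^sub>R b \<in> W" using line_in_subspace[OF W z b] .
    have "((\<lambda>s. f (z + t *\<^sub>R b + s *\<^sub>R v)) has_vector_derivative dir_deriv v f (z + t *\<^sub>R b + s *\<^sub>R v)) (at s within UNIV)"
      using Ck_on_has_dir_deriv_at[OF f zt v W] .
    then have "((\<lambda>s. f (z + s *\<^sub>R v + t *\<^sub>R b)) has_vector_derivative dir_deriv v f (z + s *\<^sub>R v + t *\<^sub>R b)) (at s within UNIV)"
      by (simp add: ac_simps)
    then show "((\<lambda>s. k t * f (z + s *\<^sub>R v + t *\<^sub>R b)) has_vector_derivative
        k t * dir_deriv v f (z + s *\<^sub>R v + t *\<^sub>R b)) (at s within UNIV)"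
      by (rule has_vector_derivative_mult_right)
  next
    fix s :: real
    show "(\<lambda>t. k t * f (z + s *\<^sub>R v + t *\<^sub>R b)) integrable_on cbox 0 1"
      using line_average_integrable[OF fc line_in_subspace[OF W z v]] by simp
  qed (use line_average_continuous_joint[OF dc z v] in auto)
  then show ?thesis by (simp add: line_average_def)
qed

lemma Ck_on_line_average:
  assumes "Ck_on m W f"
  shows "Ck_on m W (line_average k b f)"
  using assms
proof (induct m arbitrary: f)
  case 0
  then show ?case using line_average_continuous by simp
next
  case (Suc m)
  show ?case
    by (rule Ck_on_SucI[OF W, where D="\<lambda>v. line_average k b (dir_deriv v f)"])
      (use Suc line_average_continuous has_dir_deriv_line_average[OF Suc.prems] in auto)
qed

lemma smooth_line_average: "smooth_fun_on W f \<Longrightarrow> smooth_fun_on W (line_average k b f)"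
  unfolding smooth_fun_on_def using Ck_on_line_average by blast

lemma dir_deriv_line_average:
  "smooth_fun_on W f \<Longrightarrow> v \<in> W \<Longrightarrow> z \<in> W \<Longrightarrow>
    dir_deriv v (line_average k b f) z = line_average k b (dir_deriv v f) z"
  by (rule dir_deriv_eqI[OF has_dir_deriv_line_average[OF smooth_imp_Ck]])

lemma line_average_add:
  assumes "continuous_on W f" "continuous_on W g" "z \<in> W"
  shows "line_average k b (\<lambda>y. f y + g y) z = line_average k b f z + line_average k b g z"
  unfolding line_average_def distrib_left
  using assms by (intro integral_add line_average_integrable)

lemma line_average_cmult: "line_average k b (\<lambda>y. c * f y) z = c * line_average k b f z"
proof -
  have "line_average k b (\<lambda>y. c * f y) z = integral {0..1} (\<lambda>t. c * (k t * f (z + t *\<^sub>R b)))"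
    by (simp add: line_average_def mult.left_commute)
  then show ?thesis by (simp add: line_average_def integral_mult_right)
qed

lemma line_average_sum:
  assumes "finite I" "\<And>i. i \<in> I \<Longrightarrow> continuous_on W (f i)" "z \<in> W"
  shows "line_average k b (\<lambda>y. \<Sum>i\<in>I. f i y) z = (\<Sum>i\<in>I. line_average k b (f i) z)"
  unfolding line_average_def sum_distrib_left
  using assms by (intro integral_sum line_average_integrable)

lemma line_average_cong:
  assumes "\<And>y. y \<in> W \<Longrightarrow> f y = g y" "z \<in> W"
  shows "line_average k b f z = line_average k b g z"
  unfolding line_average_def using assms line_in_subspace[OF W _ b] by simp

end

text \<open>The defining condition of a c-part in one direction, for all real multiples of b. The
  parameter c is a frequency, not just the character value exp(2 pi i c).\<close>

definition equivariant_along :: "'a::real_vector set \<Rightarrow> 'a \<Rightarrow> real \<Rightarrow> 'a form \<Rightarrow> bool" where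
  "equivariant_along W b c \<phi> \<longleftrightarrow> (\<forall>s. \<forall>z\<in>W. \<forall>vs. \<phi> (z + s *\<^sub>R b) vs = cis (2 * pi * c * s) * \<phi> z vs)"

section \<open>Fourier projections of bundle forms along kernel directions\<close>

context torus_bundle
begin

definition kerH :: "'a set" where "kerH = {v \<in> cover T. \<forall>w\<in>cover T. H v w = 0}"

lemma kerH_cover: "b \<in> kerH \<Longrightarrow> b \<in> cover T"
  and kerH_left: "b \<in> kerH \<Longrightarrow> w \<in> cover T \<Longrightarrow> H b w = 0"
  and kerH_right: "b \<in> kerH \<Longrightarrow> w \<in> cover T \<Longrightarrow> H w b = 0"
  using hermitian_on_cnj[OF H, of b] by (auto simp: kerH_def)

text \<open>On bundle forms, with b a lattice vector of the kernel and \<open>\<alpha> b\<close>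
  equal to exp(2 pi i c), this is the projection onto frequency c along b.\<close>

definition avg :: "'a \<Rightarrow> real \<Rightarrow> 'a form \<Rightarrow> 'a form" where
  "avg b c \<phi> = (\<lambda>z vs. if z \<in> cover T then line_average (\<lambda>t. cis (- (2 * pi * c * t))) b (\<lambda>y. \<phi> y vs) z else 0)"

abbreviation (input) ker :: "real \<Rightarrow> real \<Rightarrow> complex" where "ker c \<equiv> \<lambda>t. cis (- (2 * pi * c * t))"

lemma continuous_ker: "continuous_on UNIV (ker c)"
  unfolding cis_conv_exp by (intro continuous_intros)

lemma smooth_avg:
  assumes b: "b \<in> cover T" and \<phi>: "\<phi> \<in> smooth_forms (cover T) k"
  shows "avg b c \<phi> \<in> smooth_forms (cover T) k"
proof -
  note alt = smooth_forms_alt[OF \<phi>]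
  note add = line_average_add[OF sW b continuous_ker continuous_form[OF \<phi>] continuous_form[OF \<phi>]]
  have "antilinear_alt (cover T) k (avg b c \<phi> z)" if z: "z \<in> cover T" for z
  proof (rule antilinear_altI)
    fix vs :: "'a list" assume "\<not> (length vs = k \<and> set vs \<subseteq> cover T)"
    then show "avg b c \<phi> z vs = 0" using smooth_forms_zero[OF \<phi>] by (simp add: avg_def line_average_def)
  next
    fix xs ys x y
    assume "Suc (length xs + length ys) = k" "set xs \<subseteq> cover T" "set ys \<subseteq> cover T" "x \<in> cover T" "y \<in> cover T"
    then show "avg b c \<phi> z (xs @ (x + y) # ys) = avg b c \<phi> z (xs @ x # ys) + avg b c \<phi> z (xs @ y # ys)"
      using z add antilinear_alt_add[OF alt] by (simp add: avg_def)
  next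
    fix xs ys x and d :: complex
    assume "Suc (length xs + length ys) = k" "set xs \<subseteq> cover T" "set ys \<subseteq> cover T" "x \<in> cover T"
    then show "avg b c \<phi> z (xs @ (d *\<^sub>C x) # ys) = cnj d * avg b c \<phi> z (xs @ x # ys)"
      using z antilinear_alt_scale[OF alt] line_average_cmult[OF sW b continuous_ker] by (simp add: avg_def)
  next
    fix xs ys zs x
    assume "length (xs @ x # ys @ x # zs) = k" "set xs \<subseteq> cover T" "set ys \<subseteq> cover T" "set zs \<subseteq> cover T" "x \<in> cover T"
    then show "avg b c \<phi> z (xs @ x # ys @ x # zs) = 0"
      using antilinear_alt_alt[OF alt, of xs x ys zs] by (simp add: avg_def line_average_def)
  qed
  moreover have "smooth_fun_on (cover T) (\<lambda>z. avg b c \<phi> z vs)" for vs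
    by (rule smooth_cong[OF sW _ smooth_line_average[OF sW b continuous_ker smooth_forms_smooth[OF \<phi>]]])
      (simp add: avg_def)
  ultimately show ?thesis by (auto simp: smooth_forms_def avg_def)
qed

lemma dir_deriv_avg:
  assumes b: "b \<in> cover T" and \<phi>: "\<phi> \<in> smooth_forms (cover T) k" and v: "v \<in> cover T" "z \<in> cover T"
  shows "dir_deriv v (\<lambda>y. avg b c \<phi> y vs) z = line_average (ker c) b (dir_deriv v (\<lambda>y. \<phi> y vs)) z"
proof -
  have "dir_deriv v (\<lambda>y. avg b c \<phi> y vs) z = dir_deriv v (line_average (ker c) b (\<lambda>y. \<phi> y vs)) z"
    by (rule dir_deriv_cong[OF sW v(2,1)]) (simp add: avg_def)
  also have "\<dots> = line_average (ker c) b (dir_deriv v (\<lambda>y. \<phi> y vs)) z"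
    by (rule dir_deriv_line_average[OF sW b continuous_ker smooth_forms_smooth[OF \<phi>] v])
  finally show ?thesis .
qed

lemma dbar_dir_avg:
  assumes b: "b \<in> cover T" and \<phi>: "\<phi> \<in> smooth_forms (cover T) k" and v: "v \<in> cover T" "z \<in> cover T"
  shows "dbar_dir v (\<lambda>y. avg b c \<phi> y vs) z = line_average (ker c) b (dbar_dir v (\<lambda>y. \<phi> y vs)) z"
proof -
  note iv = i_scale_in[OF W v(1)]
  note sm = smooth_forms_smooth[OF \<phi>, of vs]
  note c = smooth_continuous[OF smooth_dir_deriv[OF sm v(1)]] smooth_continuous[OF smooth_dir_deriv[OF sm iv]]
  have "line_average (ker c) b (dbar_dir v (\<lambda>y. \<phi> y vs)) z =
      line_average (ker c) b (\<lambda>z. (1/2) * (dir_deriv v (\<lambda>y. \<phi> y vs) z + \<i> * dir_deriv (\<i> *\<^sub>C v) (\<lambda>y. \<phi> y vs) z)) z"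
    by (simp add: dbar_dir_def[abs_def])
  also have "\<dots> = (1/2) * (line_average (ker c) b (dir_deriv v (\<lambda>y. \<phi> y vs)) z +
      \<i> * line_average (ker c) b (dir_deriv (\<i> *\<^sub>C v) (\<lambda>y. \<phi> y vs)) z)"
    unfolding line_average_cmult[OF sW b continuous_ker]
    by (subst line_average_add[OF sW b continuous_ker c(1) _ v(2)])
      (auto intro!: continuous_intros c simp: line_average_cmult[OF sW b continuous_ker])
  finally show ?thesis
    unfolding dbar_dir_def[of v "\<lambda>y. avg b c \<phi> y vs"] dir_deriv_avg[OF b \<phi> v] dir_deriv_avg[OF b \<phi> iv v(2)] by simp
qed

text \<open>The only coefficient of the covariant derivative that varies with the base point is
  H(v,z), and it is constant along kernel directions, so it can be pulled out of the
  average.\<close>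

lemma cov_dir_avg:
  assumes b: "b \<in> kerH" and \<phi>: "\<phi> \<in> smooth_forms (cover T) k" and v: "v \<in> cover T" "z \<in> cover T"
  shows "cov_dir H v (\<lambda>y. avg b c \<phi> y vs) z = line_average (ker c) b (cov_dir H v (\<lambda>y. \<phi> y vs)) z"
proof -
  note iv = i_scale_in[OF W v(1)]
  note bc = kerH_cover[OF b]
  note sm = smooth_forms_smooth[OF \<phi>, of vs]
  note c = smooth_continuous[OF smooth_dir_deriv[OF sm v(1)]] smooth_continuous[OF smooth_dir_deriv[OF sm iv]]
    smooth_continuous[OF sm]
  note cm = line_average_cmult[OF sW bc continuous_ker]
  have Hv: "H v (z + t *\<^sub>R b) = H v z" for t
    using rlinear_on_add[OF rlinear_hermitian_right[OF W H v(1)] v(2), of "t *\<^sub>R b"]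
      rlinear_on_scale[OF rlinear_hermitian_right[OF W H v(1)] bc, of t] subspace_scale[OF sW bc, of t]
      kerH_right[OF b v(1)] by simp
  have "line_average (ker c) b (cov_dir H v (\<lambda>y. \<phi> y vs)) z =
      line_average (ker c) b (\<lambda>z'. (1/2) * (dir_deriv v (\<lambda>y. \<phi> y vs) z' + (- \<i>) * dir_deriv (\<i> *\<^sub>C v) (\<lambda>y. \<phi> y vs) z')
        + (- of_real pi * H v z) * \<phi> z' vs) z"
    unfolding line_average_def cov_dir_def d_dir_def Hv by (rule integral_cong) (simp add: field_simps)
  also have "\<dots> = (1/2) * (line_average (ker c) b (dir_deriv v (\<lambda>y. \<phi> y vs)) z +
      (- \<i>) * line_average (ker c) b (dir_deriv (\<i> *\<^sub>C v) (\<lambda>y. \<phi> y vs)) z)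
      + (- of_real pi * H v z) * line_average (ker c) b (\<lambda>y. \<phi> y vs) z"
  proof -
    have c12: "continuous_on (cover T) (\<lambda>z'. (- \<i>) * dir_deriv (\<i> *\<^sub>C v) (\<lambda>y. \<phi> y vs) z')"
      "continuous_on (cover T) (\<lambda>z'. dir_deriv v (\<lambda>y. \<phi> y vs) z' + (- \<i>) * dir_deriv (\<i> *\<^sub>C v) (\<lambda>y. \<phi> y vs) z')"
      by (intro continuous_intros c)+
    have "continuous_on (cover T) (\<lambda>z'. (1/2) * (dir_deriv v (\<lambda>y. \<phi> y vs) z' + (- \<i>) * dir_deriv (\<i> *\<^sub>C v) (\<lambda>y. \<phi> y vs) z'))"
      "continuous_on (cover T) (\<lambda>z'. (- of_real pi * H v z) * \<phi> z' vs)"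
      by (intro continuous_intros c)+
    from line_average_add[OF sW bc continuous_ker this v(2)]
    show ?thesis
      unfolding cm by (simp only: line_average_add[OF sW bc continuous_ker c(1) c12(1) v(2)] cm)
  qed
  finally show ?thesis
    unfolding cov_dir_def[of H v "\<lambda>y. avg b c \<phi> y vs"] d_dir_def dir_deriv_avg[OF bc \<phi> v] dir_deriv_avg[OF bc \<phi> iv v(2)]
    using v(2) by (simp add: avg_def algebra_simps)
qed

lemma dbar_avg:
  assumes b: "b \<in> cover T" and \<phi>: "\<phi> \<in> smooth_forms (cover T) k"
  shows "dbar T (avg b c \<phi>) = avg b c (dbar T \<phi>)"
proof (intro ext)
  fix z vs
  show "dbar T (avg b c \<phi>) z vs = avg b c (dbar T \<phi>) z vs"
  proof (cases "z \<in> cover T \<and> set vs \<subseteq> cover T")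
    case True
    have vi: "vs ! i \<in> cover T" if "i < length vs" for i using True that nth_mem by blast
    note cm = line_average_cmult[OF sW b continuous_ker]
    have "dbar T (avg b c \<phi>) z vs = (\<Sum>i<length vs. (-1) ^ i *
        line_average (ker c) b (dbar_dir (vs ! i) (\<lambda>y. \<phi> y (take i vs @ drop (Suc i) vs))) z)"
      using True vi by (simp add: dbar_def dbar_dir_avg[OF b \<phi>])
    also have "\<dots> = (\<Sum>i<length vs. line_average (ker c) b (\<lambda>y. (-1) ^ i *
        dbar_dir (vs ! i) (\<lambda>y. \<phi> y (take i vs @ drop (Suc i) vs)) y) z)"
      by (simp only: cm)
    also have "\<dots> = line_average (ker c) b (\<lambda>y. \<Sum>i<length vs. (-1) ^ i *
        dbar_dir (vs ! i) (\<lambda>y. \<phi> y (take i vs @ drop (Suc i) vs)) y) z"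
      using True vi
      by (intro line_average_sum[OF sW b continuous_ker, symmetric] continuous_intros
          smooth_continuous[OF smooth_dbar_dir[OF W smooth_forms_smooth[OF \<phi>]]]) auto
    also have "\<dots> = line_average (ker c) b (\<lambda>y. dbar T \<phi> y vs) z"
      using True by (intro line_average_cong[OF sW b continuous_ker]) (auto simp: dbar_def)
    finally show ?thesis using True by (simp add: avg_def)
  next
    case False
    then show ?thesis by (auto simp: avg_def dbar_def line_average_def)
  qed
qed

lemma cod_avg:
  assumes b: "b \<in> kerH" and \<phi>: "\<phi> \<in> smooth_forms (cover T) k"
  shows "cod (avg b c \<phi>) = avg b c (cod \<phi>)"
proof (intro ext)
  fix z vs
  note bc = kerH_cover[OF b]
  show "cod (avg b c \<phi>) z vs = avg b c (cod \<phi>) z vs"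
  proof (cases "z \<in> cover T \<and> set vs \<subseteq> cover T")
    case True
    have e: "e \<in> cover T" if "e \<in> orth" for e using that orthD(2) by blast
    have "cod (avg b c \<phi>) z vs = (-1) * (\<Sum>e\<in>orth. line_average (ker c) b (cov_dir H e (\<lambda>y. \<phi> y (e # vs))) z)"
      using True e by (simp add: codbar_def cov_dir_avg[OF b \<phi>])
    also have "(\<Sum>e\<in>orth. line_average (ker c) b (cov_dir H e (\<lambda>y. \<phi> y (e # vs))) z) =
        line_average (ker c) b (\<lambda>y. \<Sum>e\<in>orth. cov_dir H e (\<lambda>y. \<phi> y (e # vs)) y) z"
      using True e orthD(1)
      by (intro line_average_sum[OF sW bc continuous_ker, symmetric]
          smooth_continuous[OF smooth_cov_dir[OF W smooth_forms_smooth[OF \<phi>] _ H]]) auto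
    also have "(-1) * \<dots> = line_average (ker c) b (\<lambda>y. (-1) * (\<Sum>e\<in>orth. cov_dir H e (\<lambda>y. \<phi> y (e # vs)) y)) z"
      by (simp only: line_average_cmult[OF sW bc continuous_ker])
    also have "\<dots> = line_average (ker c) b (\<lambda>y. cod \<phi> y vs) z"
      using True by (intro line_average_cong[OF sW bc continuous_ker]) (auto simp: codbar_def)
    finally show ?thesis using True by (simp add: avg_def)
  next
    case False
    then show ?thesis by (auto simp: avg_def codbar_def line_average_def)
  qed
qed

lemma avg_add:
  assumes b: "b \<in> cover T" and "\<phi> \<in> smooth_forms (cover T) k" "\<psi> \<in> smooth_forms (cover T) k"
  shows "avg b c (\<phi> + \<psi>) = avg b c \<phi> + avg b c \<psi>"
  using line_average_add[OF sW b continuous_ker continuous_form[OF assms(2)] continuous_form[OF assms(3)]]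
  by (auto simp: avg_def fun_eq_iff)

lemma avg_scale:
  assumes b: "b \<in> cover T" shows "avg b c (form_scale d \<phi>) = form_scale d (avg b c \<phi>)"
  using line_average_cmult[OF sW b continuous_ker] by (auto simp: avg_def form_scale_def fun_eq_iff)

lemma avg_zero_form: "avg b c 0 = 0"
  by (auto simp: avg_def line_average_def fun_eq_iff)

text \<open>The factor of automorphy depends on z through H(z,u), which does not change along a
  kernel direction.\<close>

lemma avg_BF:
  assumes b: "b \<in> kerH" and \<phi>: "\<phi> \<in> BF k"
  shows "avg b c \<phi> \<in> BF k"
  unfolding bundle_forms_iff
proof (intro conjI ballI allI)
  note bc = kerH_cover[OF b]
  show "avg b c \<phi> \<in> smooth_forms (cover T) k" using smooth_avg[OF bc BF_smooth[OF \<phi>]] .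
  fix u z vs assume u: "u \<in> lat T" and z: "z \<in> cover T"
  have uc: "u \<in> cover T" using u lat_cover by blast
  have zu: "z + u \<in> cover T" using z uc sW by (simp add: subspace_add)
  have "\<phi> (z + u + t *\<^sub>R b) vs = factor L u z * \<phi> (z + t *\<^sub>R b) vs" for t
  proof -
    have zt: "z + t *\<^sub>R b \<in> cover T" "t *\<^sub>R b \<in> cover T" using line_in_subspace[OF sW z bc] subspace_scale[OF sW bc] by auto
    have "H (z + t *\<^sub>R b) u = H z u"
      using rlinear_on_add[OF rlinear_hermitian_left[OF W H uc] z zt(2)]
        rlinear_on_scale[OF rlinear_hermitian_left[OF W H uc] bc, of t] kerH_left[OF b uc] by simp
    then have "factor L u (z + t *\<^sub>R b) = factor L u z" by (simp add: L_bundle_def)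
    then show ?thesis using BF_equivariant[OF \<phi> u zt(1), of vs] by (simp add: ac_simps)
  qed
  then show "avg b c \<phi> (z + u) vs = factor L u z * avg b c \<phi> z vs"
    using z zu line_average_cmult[OF sW bc continuous_ker[of c], of "factor L u z" "\<lambda>y. \<phi> y vs" z]
    by (simp add: avg_def line_average_def)
qed

lemma box_add:
  assumes "\<phi> \<in> BF k" "\<psi> \<in> BF k" shows "box (\<phi> + \<psi>) = box \<phi> + box \<psi>"
proof -
  note s = BF_smooth[OF assms(1)] BF_smooth[OF assms(2)]
  note d = dbar_smooth[OF W s(1)] dbar_smooth[OF W s(2)]
  have "dbar T (cod \<phi> + cod \<psi>) = dbar T (cod \<phi>) + dbar T (cod \<psi>)"
  \<comment> \<open>\<open>cod\<close> lowers the degree. In degree 0 it gives the zero form, while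
    for k = m + 1 its values are smooth forms of degree m.\<close>
  proof (cases k)
    case 0
    then have "cod \<phi> = 0" "cod \<psi> = 0" using codbar_degree_0 s by blast+
    then show ?thesis using dbar_zero_form[of T] by simp
  next
    case (Suc m)
    then show ?thesis
      using codbar_smooth[OF W H orthD(2)] s by (intro dbar_form_add[OF W, of _ m]) auto
  qed
  then show ?thesis
    by (simp add: box_def codbar_form_add[OF W s orthD(2)] dbar_form_add[OF W s] codbar_form_add[OF W d orthD(2)])
qed

lemma box_scale:
  assumes "\<phi> \<in> BF k" shows "box (form_scale c \<phi>) = form_scale c (box \<phi>)"
proof -
  note s = BF_smooth[OF assms(1)]
  have "dbar T (form_scale c (cod \<phi>)) = form_scale c (dbar T (cod \<phi>))"
  proof (cases k)
    case 0
    then have "cod \<phi> = 0" using codbar_degree_0 s by blast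
    moreover have "form_scale c 0 = (0 :: 'a form)" by (rule form_space.scale_zero_right)
    ultimately show ?thesis using dbar_zero_form[of T] by simp
  next
    case (Suc m)
    then show ?thesis
      using codbar_smooth[OF W H orthD(2)] s by (intro dbar_form_scale[OF W, of _ m]) auto
  qed
  then show ?thesis
    by (simp add: box_def codbar_form_scale[OF W s orthD(2)] dbar_form_scale[OF W s]
        codbar_form_scale[OF W dbar_smooth[OF W s] orthD(2)] form_space.scale_right_distrib)
qed

lemma box_avg:
  assumes b: "b \<in> kerH" and \<phi>: "\<phi> \<in> BF k"
  shows "box (avg b c \<phi>) = avg b c (box \<phi>)"
proof -
  note s = BF_smooth[OF \<phi>] and bc = kerH_cover[OF b]
  note d = dbar_smooth[OF W s]
  have 1: "cod (dbar T (avg b c \<phi>)) = avg b c (cod (dbar T \<phi>))"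
    by (simp add: dbar_avg[OF bc s] cod_avg[OF b d])
  show ?thesis
  proof (cases k)
    case 0
    then have "cod \<phi> = 0" using codbar_degree_0 s by blast
    then show ?thesis by (simp add: box_def 1 cod_avg[OF b s] avg_zero_form dbar_zero_form)
  next
    case (Suc m)
    have cs: "cod \<phi> \<in> smooth_forms (cover T) m" using codbar_smooth[OF W H orthD(2)] s Suc by blast
    have "dbar T (cod \<phi>) \<in> smooth_forms (cover T) k" using dbar_smooth[OF W cs] Suc by simp
    moreover have "cod (dbar T \<phi>) \<in> smooth_forms (cover T) k" using codbar_smooth[OF W H orthD(2) d] .
    ultimately have "avg b c (box \<phi>) = avg b c (dbar T (cod \<phi>)) + avg b c (cod (dbar T \<phi>))"
      unfolding box_def by (rule avg_add[OF bc])
    then show ?thesis by (simp add: box_def 1 cod_avg[OF b s] dbar_avg[OF bc cs])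
  qed
qed

lemma eigenspace_avg:
  "b \<in> kerH \<Longrightarrow> \<phi> \<in> eigenspace T L k \<mu> \<Longrightarrow> avg b c \<phi> \<in> eigenspace T L k \<mu>"
  by (auto simp: eigenspace_eq avg_BF box_avg avg_scale[OF kerH_cover])

lemma eigenspace_subspace: "form_space.subspace (eigenspace T L k \<mu>)"
  unfolding form_space.subspace_def
proof (intro conjI ballI allI)
  have "box (form_scale 0 0) = form_scale 0 (box 0)" by (rule box_scale[OF BF_zero])
  then show "0 \<in> eigenspace T L k \<mu>" by (simp add: eigenspace_eq BF_zero)
  show "\<phi> + \<psi> \<in> eigenspace T L k \<mu>" if "\<phi> \<in> eigenspace T L k \<mu>" "\<psi> \<in> eigenspace T L k \<mu>" for \<phi> \<psi>
    using that box_add[of \<phi> k \<psi>] by (simp add: eigenspace_eq BF_add form_space.scale_right_distrib)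
  show "form_scale c \<phi> \<in> eigenspace T L k \<mu>" if "\<phi> \<in> eigenspace T L k \<mu>" for c \<phi>
    using that box_scale[of \<phi> k c] by (simp add: eigenspace_eq BF_scale mult.commute)
qed

abbreviation eqv where "eqv \<equiv> equivariant_along (cover T)"

lemma eqvD: "eqv b c \<phi> \<Longrightarrow> z \<in> cover T \<Longrightarrow> \<phi> (z + s *\<^sub>R b) vs = cis (2 * pi * c * s) * \<phi> z vs"
  by (simp add: equivariant_along_def)

lemma factor_ker:
  assumes "b \<in> lat T" "b \<in> kerH" "z \<in> cover T" shows "factor L b z = \<alpha> b"
  using kerH_right[OF assms(2,3)] kerH_right[OF assms(2) kerH_cover[OF assms(2)]] by (simp add: L_bundle_def)

text \<open>A translation by s b shifts the variable of integration. The integrand \<open>p\<close>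
  has period 1, because b acts by \<alpha> b and the exponential kernel cancels this value; a
  shifted period has the same integral, and the leftover phase is the desired factor.\<close>

lemma avg_eqv:
  assumes b: "b \<in> lat T" "b \<in> kerH" and c: "\<alpha> b = cis (2 * pi * c)" and \<phi>: "\<phi> \<in> BF k"
  shows "eqv b c (avg b c \<phi>)"
  unfolding equivariant_along_def
proof (intro allI ballI)
  fix s z vs assume z: "z \<in> cover T"
  note bc = kerH_cover[OF b(2)]
  note sm = smooth_forms_smooth[OF BF_smooth[OF \<phi>], of vs]
  have zt: "z + t *\<^sub>R b \<in> cover T" for t using line_in_subspace[OF sW z bc] .
  define p where "p t = cis (- (2 * pi * c * t)) * \<phi> (z + t *\<^sub>R b) vs" for t
  define p' where "p' t = cis (- (2 * pi * c * t)) * dir_deriv b (\<lambda>y. \<phi> y vs) (z + t *\<^sub>R b) +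
      (cis (- (2 * pi * c * t)) * (- (2 * pi * c) * \<i>)) * \<phi> (z + t *\<^sub>R b) vs" for t
  have "((\<lambda>t. cis (- (2 * pi * c * t))) has_vector_derivative cis (- (2 * pi * c * t)) * (- (2 * pi * c) * \<i>)) (at t)" for t
  proof -
    have "((\<lambda>z. exp (- (2 * pi * c) * \<i> * z)) has_field_derivative
        exp (- (2 * pi * c) * \<i> * of_real t) * (- (2 * pi * c) * \<i>)) (at (of_real t))"
      by (auto intro!: derivative_eq_intros)
    from has_vector_derivative_real_field[OF this] show ?thesis by (simp add: cis_conv_exp ac_simps)
  qed
  moreover have "((\<lambda>t. \<phi> (z + t *\<^sub>R b) vs) has_vector_derivative dir_deriv b (\<lambda>y. \<phi> y vs) (z + t *\<^sub>R b)) (at t)" for t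
    using Ck_on_has_dir_deriv_at[OF smooth_imp_Ck[OF sm] z bc sW, of t UNIV] by simp
  ultimately have "(p has_vector_derivative p' t) (at t)" for t
    unfolding p_def p'_def by (rule has_vector_derivative_mult)
  moreover have "continuous_on UNIV p'"
    unfolding p'_def cis_conv_exp
    by (intro continuous_intros continuous_on_compose2[OF smooth_continuous[OF sm]]
        continuous_on_compose2[OF smooth_continuous[OF smooth_dir_deriv[OF sm bc]]]) (auto simp: zt)
  moreover have "p (t + 1) = p t" for t
  proof -
    have "\<phi> (z + (t + 1) *\<^sub>R b) vs = cis (2 * pi * c) * \<phi> (z + t *\<^sub>R b) vs"
      using BF_equivariant[OF \<phi> b(1) zt[of t], of vs] factor_ker[OF b zt] c by (simp add: scaleR_add_left ac_simps)
    moreover have "cis (- (2 * pi * c * (t + 1))) * cis (2 * pi * c) = cis (- (2 * pi * c * t))"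
      by (simp add: cis_mult algebra_simps)
    ultimately show ?thesis by (simp only: p_def mult.assoc[symmetric])
  qed
  ultimately have shift: "integral {0..1} (\<lambda>t. p (s + t)) = integral {0..1} p"
    by (rule integral_periodic_shift)
  have "avg b c \<phi> (z + s *\<^sub>R b) vs = integral {0..1} (\<lambda>t. cis (2 * pi * c * s) * p (s + t))"
  proof -
    have "cis (- (2 * pi * c * t)) * \<phi> (z + s *\<^sub>R b + t *\<^sub>R b) vs = cis (2 * pi * c * s) * p (s + t)" for t
    proof -
      have "cis (2 * pi * c * s) * cis (- (2 * pi * c * (s + t))) = cis (- (2 * pi * c * t))"
        by (simp add: cis_mult algebra_simps)
      then show ?thesis by (simp add: p_def mult.assoc[symmetric] scaleR_add_left add.assoc)
    qed
    then show ?thesis using zt by (simp add: avg_def line_average_def)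
  qed
  also have "\<dots> = cis (2 * pi * c * s) * integral {0..1} p" by (simp add: integral_mult_right shift)
  also have "integral {0..1} p = avg b c \<phi> z vs" using z by (simp add: avg_def line_average_def p_def[abs_def])
  finally show "avg b c \<phi> (z + s *\<^sub>R b) vs = cis (2 * pi * c * s) * avg b c \<phi> z vs" .
qed

text \<open>Translations commute, so an average along b keeps the equivariance already gained in
  other directions. This is what makes iterated averages joint projections.\<close>

lemma avg_eqv_other:
  assumes b: "b \<in> cover T" and b': "b' \<in> cover T" and eqv: "eqv b' c' \<phi>"
  shows "eqv b' c' (avg b c \<phi>)"
  unfolding equivariant_along_def
proof (intro allI ballI)
  fix s z vs assume z: "z \<in> cover T"
  have "\<phi> (z + s *\<^sub>R b' + t *\<^sub>R b) vs = cis (2 * pi * c' * s) * \<phi> (z + t *\<^sub>R b) vs" for t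
    using eqvD[OF eqv line_in_subspace[OF sW z b], of t s vs] by (simp add: ac_simps)
  then show "avg b c \<phi> (z + s *\<^sub>R b') vs = cis (2 * pi * c' * s) * avg b c \<phi> z vs"
    using z line_in_subspace[OF sW z b'] line_average_cmult[OF sW b continuous_ker[of c], of "cis (2 * pi * c' * s)" "\<lambda>y. \<phi> y vs" z]
    by (simp add: avg_def line_average_def)
qed

lemma avg_id:
  assumes \<phi>: "\<phi> \<in> smooth_forms (cover T) k" and eqv: "eqv b c \<phi>"
  shows "avg b c \<phi> = \<phi>"
proof (intro ext)
  fix z vs
  show "avg b c \<phi> z vs = \<phi> z vs"
  proof (cases "z \<in> cover T")
    case True
    then show ?thesis using eqv
      by (simp add: avg_def line_average_def equivariant_along_def cis_mult mult.assoc[symmetric])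
  next
    case False
    then show ?thesis using smooth_forms_outside[OF \<phi>] by (simp add: avg_def)
  qed
qed

text \<open>Two frequencies of the same character differ by a nonzero integer, and a nontrivial
  character of the circle has mean 0.\<close>

lemma avg_other_zero:
  assumes eqv: "eqv b c' \<phi>" and c: "cis (2 * pi * c') = cis (2 * pi * c)" "c' \<noteq> c"
  shows "avg b c \<phi> = 0"
proof -
  obtain m :: int where m: "c' - c = of_int m" using cis_2pi_eq_imp_int[OF c(1)] .
  have m0: "m \<noteq> 0" using m c(2) by auto
  have "avg b c \<phi> z vs = 0" if z: "z \<in> cover T" for z vs
  proof -
    have "cis (- (2 * pi * c * t)) * \<phi> (z + t *\<^sub>R b) vs = \<phi> z vs * cis (2 * pi * of_int m * t)" for t
    proof -
      have "2 * pi * of_int m * t = - (2 * pi * c * t) + 2 * pi * c' * t"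
        unfolding m[symmetric] by (simp add: algebra_simps)
      then have "cis (- (2 * pi * c * t)) * cis (2 * pi * c' * t) = cis (2 * pi * of_int m * t)"
        by (simp only: cis_mult)
      then have "cis (- (2 * pi * c * t)) * (cis (2 * pi * c' * t) * \<phi> z vs) = \<phi> z vs * cis (2 * pi * of_int m * t)"
        by (metis mult.assoc mult.commute)
      then show ?thesis by (simp only: eqvD[OF eqv z])
    qed
    then have "avg b c \<phi> z vs = integral {0..1} (\<lambda>t. \<phi> z vs * cis (2 * pi * of_int m * t))"
      using z by (simp add: avg_def line_average_def)
    also have "\<dots> = 0" using integral_cis_int[OF m0] by (simp add: integral_mult_right)
    finally show ?thesis .
  qed
  then show ?thesis by (auto simp: fun_eq_iff avg_def)
qed

text \<open>If all averages of the right character vanished, the form restricted to a line and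
  untwisted by one admissible frequency would have no Fourier coefficients.\<close>

lemma avg_separates:
  assumes b: "b \<in> lat T" "b \<in> kerH" and \<phi>: "\<phi> \<in> BF k" "\<phi> \<noteq> 0"
  shows "\<exists>c. cis (2 * pi * c) = \<alpha> b \<and> avg b c \<phi> \<noteq> 0"
proof (rule ccontr)
  assume no: "\<not> (\<exists>c. cis (2 * pi * c) = \<alpha> b \<and> avg b c \<phi> \<noteq> 0)"
  note bc = kerH_cover[OF b(2)]
  obtain \<theta> where \<theta>: "\<alpha> b = cis \<theta>"
    using rcis_cmod_Arg[of "\<alpha> b"] \<alpha>_norm[OF b(1)] that[of "Arg (\<alpha> b)"] by (simp add: rcis_def)
  define c0 where "c0 = \<theta> / (2 * pi)"
  have c0: "cis (2 * pi * c0) = \<alpha> b" using \<theta> by (simp add: c0_def)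
  obtain z vs where nz: "\<phi> z vs \<noteq> 0" using \<phi>(2) by (auto simp: fun_eq_iff)
  have z: "z \<in> cover T" using smooth_forms_outside[OF BF_smooth[OF \<phi>(1)]] nz by blast
  \<comment> \<open>Places z at parameter 1/2, the point where \<open>fourier_uniqueness\<close>
    evaluates.\<close>
  define y where "y = z - (1/2) *\<^sub>R b"
  have y: "y \<in> cover T" using z bc sW by (simp add: y_def subspace_diff subspace_scale)
  define f where "f t = cis (- (2 * pi * c0 * t)) * \<phi> (y + t *\<^sub>R b) vs" for t
  have "continuous_on {0..1} f"
    unfolding f_def by (rule line_average_integrand_continuous[OF sW bc continuous_ker continuous_form[OF BF_smooth[OF \<phi>(1)]] y])
  moreover have "integral {0..1} (\<lambda>t. cis (2 * pi * of_int m * t) * f t) = 0" for m :: int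
  proof -
    \<comment> \<open>Integer shifts of \<open>c0\<close> run through frequencies of the same
      character, so their averages are the Fourier coefficients of \<open>f\<close>.\<close>
    have "cis (2 * pi * (c0 - of_int m)) = \<alpha> b"
      unfolding c0[symmetric] by (simp add: right_diff_distrib cis_divide[symmetric] cis_multiple_2pi)
    then have "avg b (c0 - of_int m) \<phi> y vs = 0" using no by (metis zero_fun_apply)
    moreover have "cis (- (2 * pi * (c0 - of_int m) * t)) * \<phi> (y + t *\<^sub>R b) vs = cis (2 * pi * of_int m * t) * f t" for t
    proof -
      have "cis (- (2 * pi * (c0 - of_int m) * t)) = cis (2 * pi * of_int m * t) * cis (- (2 * pi * c0 * t))"
        by (simp add: cis_mult algebra_simps)
      then show ?thesis by (simp only: f_def mult.assoc)
    qed
    ultimately show ?thesis using y by (simp add: avg_def line_average_def)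
  qed
  ultimately have "f (1/2) = 0" by (rule fourier_uniqueness)
  then have "\<phi> (y + (1/2) *\<^sub>R b) vs = 0" by (simp add: f_def)
  with nz show False by (simp add: y_def)
qed

end

section \<open>Joint frequencies along a list of kernel vectors\<close>

context torus_bundle
begin

text \<open>The average is taken along the first i vectors of the list; the intermediate stages
  carry the inductions below.\<close>

primrec proj :: "'a list \<Rightarrow> (nat \<Rightarrow> real) \<Rightarrow> nat \<Rightarrow> 'a form \<Rightarrow> 'a form" where
  "proj bs c 0 \<phi> = \<phi>"
| "proj bs c (Suc i) \<phi> = avg (bs ! i) (c i) (proj bs c i \<phi>)"

text \<open>For a basis of U' these are the coordinates of the functionals c of the grading. The
  value 0 beyond the list makes every functional correspond to exactly one sequence, and one type of
  index serves both tori.\<close>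

definition freqs :: "'a list \<Rightarrow> (nat \<Rightarrow> real) set" where
  "freqs bs = {c. (\<forall>i<length bs. cis (2 * pi * c i) = \<alpha> (bs ! i)) \<and> (\<forall>i\<ge>length bs. c i = 0)}"

definition component :: "'a list \<Rightarrow> nat \<Rightarrow> complex \<Rightarrow> (nat \<Rightarrow> real) \<Rightarrow> 'a form set" where
  "component bs k \<mu> c = {\<phi> \<in> eigenspace T L k \<mu>. \<forall>i<length bs. eqv (bs ! i) (c i) \<phi>}"

lemma eigenspace_BF: "\<phi> \<in> eigenspace T L k \<mu> \<Longrightarrow> \<phi> \<in> BF k"
  by (simp add: eigenspace_def)

lemma component_subspace: "form_space.subspace (component bs k \<mu> c)"
  using form_space.subspace_0[OF eigenspace_subspace] form_space.subspace_add[OF eigenspace_subspace]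
    form_space.subspace_scale[OF eigenspace_subspace]
  unfolding form_space.subspace_def component_def
  by (auto simp: equivariant_along_def form_scale_def distrib_left mult.left_commute)

context
  fixes bs :: "'a list"
  assumes bs: "set bs \<subseteq> lat T \<inter> kerH"
begin

lemma bs_nth: "i < length bs \<Longrightarrow> bs ! i \<in> lat T" "i < length bs \<Longrightarrow> bs ! i \<in> kerH"
    "i < length bs \<Longrightarrow> bs ! i \<in> cover T"
  using bs nth_mem lat_cover by blast+

lemma proj_eigenspace: "i \<le> length bs \<Longrightarrow> \<phi> \<in> eigenspace T L k \<mu> \<Longrightarrow> proj bs c i \<phi> \<in> eigenspace T L k \<mu>"
  by (induct i) (auto intro!: eigenspace_avg bs_nth)

lemma proj_eqv:
  "c \<in> freqs bs \<Longrightarrow> \<phi> \<in> eigenspace T L k \<mu> \<Longrightarrow> i \<le> length bs \<Longrightarrow> j < i \<Longrightarrow> eqv (bs ! j) (c j) (proj bs c i \<phi>)"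
proof (induct i arbitrary: j)
  case (Suc i)
  have i: "i < length bs" using Suc.prems by simp
  show ?case
  proof (cases "j = i")
    case True
    have "proj bs c i \<phi> \<in> BF k"
      using proj_eigenspace[of i \<phi> k \<mu> c] Suc.prems eigenspace_BF by simp
    then show ?thesis
      using True avg_eqv[OF bs_nth(1,2)[OF i], of "c i"] i Suc.prems by (simp add: freqs_def)
  next
    case False
    then show ?thesis
      using Suc i by (auto intro!: avg_eqv_other bs_nth)
  qed
qed simp

lemma proj_component: "c \<in> freqs bs \<Longrightarrow> \<phi> \<in> eigenspace T L k \<mu> \<Longrightarrow> proj bs c (length bs) \<phi> \<in> component bs k \<mu> c"
  by (auto simp: component_def proj_eqv intro: proj_eigenspace)

lemma proj_add:
  assumes "\<phi> \<in> eigenspace T L k \<mu>" "\<psi> \<in> eigenspace T L k \<mu>"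
  shows "i \<le> length bs \<Longrightarrow> proj bs c i (\<phi> + \<psi>) = proj bs c i \<phi> + proj bs c i \<psi>"
proof (induct i)
  case (Suc i)
  have "proj bs c i \<phi> \<in> smooth_forms (cover T) k" "proj bs c i \<psi> \<in> smooth_forms (cover T) k"
    using proj_eigenspace[of i] assms Suc.prems eigenspace_BF BF_smooth by (metis Suc_leD)+
  moreover have "proj bs c i (\<phi> + \<psi>) = proj bs c i \<phi> + proj bs c i \<psi>"
    using Suc.prems by (intro Suc.hyps) simp
  ultimately have "proj bs c (Suc i) (\<phi> + \<psi>) = proj bs c (Suc i) \<phi> + proj bs c (Suc i) \<psi>"
    using avg_add[OF bs_nth(3)] Suc.prems by simp
  then show ?case .
qed simp

lemma proj_scale: "i \<le> length bs \<Longrightarrow> proj bs c i (form_scale d \<phi>) = form_scale d (proj bs c i \<phi>)"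
  by (induct i) (auto simp: avg_scale bs_nth)

text \<open>Each average is the identity as long as the frequencies agree, and the first
  disagreement gives 0, which later averages keep.\<close>

lemma proj_of_component:
  assumes "\<phi> \<in> component bs k \<mu> c'" "c \<in> freqs bs" "c' \<in> freqs bs"
  shows "i \<le> length bs \<Longrightarrow> proj bs c i \<phi> = (if \<exists>j<i. c j \<noteq> c' j then 0 else \<phi>)"
proof (induct i)
  case (Suc i)
  then have i: "i < length bs" by simp
  have eqv: "eqv (bs ! i) (c' i) \<phi>" and \<phi>: "\<phi> \<in> BF k" using assms(1) i eigenspace_BF by (auto simp: component_def)
  have IH: "proj bs c i \<phi> = (if \<exists>j<i. c j \<noteq> c' j then 0 else \<phi>)"
    using Suc.prems by (intro Suc.hyps) simp
  have "proj bs c (Suc i) \<phi> = (if \<exists>j<Suc i. c j \<noteq> c' j then 0 else \<phi>)"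
  proof (cases "\<exists>j<i. c j \<noteq> c' j")
    case True
    then have "\<exists>j<Suc i. c j \<noteq> c' j" by (auto simp: less_Suc_eq)
    then show ?thesis using True IH avg_zero_form by simp
  next
    case False
    then have "proj bs c i \<phi> = \<phi>" using IH if_not_P[of "\<exists>j<i. c j \<noteq> c' j"] by metis
    then have "proj bs c (Suc i) \<phi> = avg (bs ! i) (c i) \<phi>" by simp
    also have "\<dots> = (if c i \<noteq> c' i then 0 else \<phi>)"
      using avg_id[OF BF_smooth[OF \<phi>], of "bs ! i" "c i"] avg_other_zero[OF eqv, of "c i"] eqv assms(2,3) i
      by (auto simp: freqs_def)
    also have "(c i \<noteq> c' i) = (\<exists>j<Suc i. c j \<noteq> c' j)" using False by (auto simp: less_Suc_eq)
    finally show ?thesis .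
  qed
  then show ?case .
qed simp

lemma proj_cong: "(\<And>j. j < i \<Longrightarrow> c j = c' j) \<Longrightarrow> proj bs c i \<phi> = proj bs c' i \<phi>"
  by (induct i) auto

text \<open>Frequencies are found one direction at a time: the form obtained so far is a nonzero
  eigenform, so one further direction can be separated, and fixing \<open>c i\<close> does not
  affect the averages already taken.\<close>

lemma proj_separates:
  assumes "\<phi> \<in> eigenspace T L k \<mu>" "\<phi> \<noteq> 0"
  shows "\<exists>c\<in>freqs bs. proj bs c (length bs) \<phi> \<noteq> 0"
proof -
  have "\<exists>c. (\<forall>j<i. cis (2 * pi * c j) = \<alpha> (bs ! j)) \<and> (\<forall>j\<ge>i. c j = 0) \<and> proj bs c i \<phi> \<noteq> 0" if "i \<le> length bs" for i
    using that
  proof (induct i)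
    case 0
    have "\<exists>c. (\<forall>j<0. cis (2 * pi * c j) = \<alpha> (bs ! j)) \<and> (\<forall>j\<ge>0. c j = 0) \<and> proj bs c 0 \<phi> \<noteq> 0"
      using assms(2) by (intro exI[of _ "\<lambda>_. 0"]) simp
    then show ?case .
  next
    case (Suc i)
    have i: "i < length bs" using Suc.prems by simp
    have "\<exists>c. (\<forall>j<i. cis (2 * pi * c j) = \<alpha> (bs ! j)) \<and> (\<forall>j\<ge>i. c j = 0) \<and> proj bs c i \<phi> \<noteq> 0"
      using i by (intro Suc.hyps) simp
    then obtain c where c: "\<forall>j<i. cis (2 * pi * c j) = \<alpha> (bs ! j)" "\<forall>j\<ge>i. c j = 0" "proj bs c i \<phi> \<noteq> 0" by blast
    have "proj bs c i \<phi> \<in> BF k" by (rule eigenspace_BF[OF proj_eigenspace[OF _ assms(1)]]) (use i in simp)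
    then obtain x where x: "cis (2 * pi * x) = \<alpha> (bs ! i)" "avg (bs ! i) x (proj bs c i \<phi>) \<noteq> 0"
      using avg_separates[OF bs_nth(1,2)[OF i] _ c(3)] by blast
    have "proj bs (c(i := x)) i \<phi> = proj bs c i \<phi>" by (rule proj_cong) simp
    then have "\<exists>c. (\<forall>j<Suc i. cis (2 * pi * c j) = \<alpha> (bs ! j)) \<and> (\<forall>j\<ge>Suc i. c j = 0) \<and> proj bs c (Suc i) \<phi> \<noteq> 0"
      using c x by (intro exI[of _ "c(i := x)"]) (auto simp: less_Suc_eq)
    then show ?case .
  qed
  from this[of "length bs"] show ?thesis by (auto simp: freqs_def)
qed

end

end


section \<open>Graded eigenspaces\<close>

text \<open>The algebraic content of a Fourier decomposition: projections that annihilate the other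
  parts and together detect every nonzero vector. Separation replaces convergence of the series, so
  an infinite-dimensional E need not be the algebraic direct sum of its parts.\<close>

definition graded :: "'a form set \<Rightarrow> 'i set \<Rightarrow> ('i \<Rightarrow> 'a form set) \<Rightarrow> ('i \<Rightarrow> 'a form \<Rightarrow> 'a form) \<Rightarrow> bool" where
  "graded E Q X P \<longleftrightarrow> form_space.subspace E \<and>
     (\<forall>c\<in>Q. form_space.subspace (X c) \<and> X c \<subseteq> E \<and> P c ` E \<subseteq> X c \<and> (\<forall>x\<in>X c. P c x = x) \<and>
        (\<forall>x\<in>E. \<forall>y\<in>E. P c (x + y) = P c x + P c y) \<and> (\<forall>x\<in>E. \<forall>d. P c (form_scale d x) = form_scale d (P c x)) \<and>
        (\<forall>c'\<in>Q. c' \<noteq> c \<longrightarrow> (\<forall>x\<in>X c'. P c x = 0))) \<and>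
     (\<forall>x\<in>E. x \<noteq> 0 \<longrightarrow> (\<exists>c\<in>Q. P c x \<noteq> 0))"

definition linear_between :: "'a form set \<Rightarrow> 'b form set \<Rightarrow> ('a form \<Rightarrow> 'b form) \<Rightarrow> bool" where
  "linear_between X Y f \<longleftrightarrow> f ` X \<subseteq> Y \<and> (\<forall>x\<in>X. \<forall>y\<in>X. f (x + y) = f x + f y) \<and>
     (\<forall>x\<in>X. \<forall>d. f (form_scale d x) = form_scale d (f x))"

lemma gradedD:
  assumes "graded E Q X P"
  shows "form_space.subspace E" "c \<in> Q \<Longrightarrow> form_space.subspace (X c)" "c \<in> Q \<Longrightarrow> x \<in> X c \<Longrightarrow> x \<in> E"
    "c \<in> Q \<Longrightarrow> x \<in> E \<Longrightarrow> P c x \<in> X c" "c \<in> Q \<Longrightarrow> x \<in> X c \<Longrightarrow> P c x = x"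
    "c \<in> Q \<Longrightarrow> x \<in> E \<Longrightarrow> y \<in> E \<Longrightarrow> P c (x + y) = P c x + P c y"
    "c \<in> Q \<Longrightarrow> x \<in> E \<Longrightarrow> P c (form_scale d x) = form_scale d (P c x)"
    "c \<in> Q \<Longrightarrow> c' \<in> Q \<Longrightarrow> c' \<noteq> c \<Longrightarrow> x \<in> X c' \<Longrightarrow> P c x = 0"
    "x \<in> E \<Longrightarrow> x \<noteq> 0 \<Longrightarrow> \<exists>c\<in>Q. P c x \<noteq> 0"
  using assms unfolding graded_def by blast+

lemma graded_P_zero: "graded E Q X P \<Longrightarrow> c \<in> Q \<Longrightarrow> P c 0 = 0"
  using gradedD(5)[of E Q X P c 0] gradedD(2)[of E Q X P c] form_space.subspace_0 by blast

lemma graded_P_sum: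
  assumes g: "graded E Q X P" and c: "c \<in> Q" and x: "\<And>i. i \<in> I \<Longrightarrow> x i \<in> E" and "finite I"
  shows "P c (\<Sum>i\<in>I. x i) = (\<Sum>i\<in>I. P c (x i))"
  using assms(4) x
proof (induct I rule: finite_induct)
  case empty
  have "P c (\<Sum>i\<in>{}. x i) = (\<Sum>i\<in>{}. P c (x i))" using graded_P_zero[OF g c] by simp
  then show ?case .
next
  case (insert i I)
  have xE: "x i \<in> E" "(\<Sum>i\<in>I. x i) \<in> E"
    using insert.prems by (auto intro: form_space.subspace_sum[OF gradedD(1)[OF g]])
  have "P c (\<Sum>i\<in>I. x i) = (\<Sum>i\<in>I. P c (x i))" using insert.prems by (intro insert.hyps(3)) simp
  then have "P c (\<Sum>i\<in>insert i I. x i) = (\<Sum>i\<in>insert i I. P c (x i))"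
    using insert.hyps(1,2) gradedD(6)[OF g c xE] by simp
  then show ?case .
qed

definition support :: "'i set \<Rightarrow> ('i \<Rightarrow> 'a form set) \<Rightarrow> 'i set" where
  "support Q X = {c \<in> Q. \<exists>x\<in>X c. x \<noteq> 0}"

text \<open>One nonzero vector from each nonzero part forms an independent family, as the
  projections isolate its members.\<close>

lemma finite_support:
  assumes g: "graded E Q X P" and B: "finite B" "E \<subseteq> form_space.span B"
  shows "finite (support Q X)"
proof -
  have "\<forall>c\<in>support Q X. \<exists>y. y \<in> X c \<and> y \<noteq> 0" by (auto simp: support_def)
  from bchoice[OF this] obtain x where x: "\<And>c. c \<in> support Q X \<Longrightarrow> x c \<in> X c \<and> x c \<noteq> 0" by blast
  have sQ: "c \<in> Q" if "c \<in> support Q X" for c using that by (simp add: support_def)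
  have other: "P c (x c') = 0" if "c \<in> support Q X" "c' \<in> support Q X" "c' \<noteq> c" for c c'
    using gradedD(8)[OF g sQ[OF that(1)] sQ[OF that(2)]] x[OF that(2)] that(3) by blast
  have self: "P c (x c) = x c" if "c \<in> support Q X" for c
    using gradedD(5)[OF g sQ[OF that]] x[OF that] by blast
  have inj: "inj_on x (support Q X)"
    by (rule inj_onI) (metis other self x)
  have "form_space.independent (x ` support Q X)"
  proof
    assume "form_space.dependent (x ` support Q X)"
    then obtain t u v where t: "finite t" "t \<subseteq> x ` support Q X" "(\<Sum>v\<in>t. form_scale (u v) v) = 0" "v \<in> t" "u v \<noteq> 0"
      unfolding form_space.dependent_explicit by blast
    obtain c where c: "c \<in> support Q X" "v = x c" using t by blast
    have inE: "w \<in> E" if "w \<in> t" for w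
      using that t(2) x gradedD(3)[OF g sQ] by blast
    have "0 = P c (\<Sum>v\<in>t. form_scale (u v) v)"
      using graded_P_zero[OF g sQ[OF c(1)]] t(3) by simp
    also have "\<dots> = (\<Sum>w\<in>t. P c (form_scale (u w) w))"
      by (rule graded_P_sum[OF g sQ[OF c(1)] _ t(1)]) (intro form_space.subspace_scale[OF gradedD(1)[OF g]] inE)
    also have "\<dots> = (\<Sum>w\<in>t. if w = v then form_scale (u v) v else 0)"
    proof (rule sum.cong[OF refl])
      fix w assume w: "w \<in> t"
      then obtain c' where c': "c' \<in> support Q X" "w = x c'" using t by blast
      have *: "P c (form_scale (u w) w) = form_scale (u w) (P c w)"
        by (rule gradedD(7)[OF g sQ[OF c(1)] inE[OF w]])
      show "P c (form_scale (u w) w) = (if w = v then form_scale (u v) v else 0)"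
      proof (cases "w = v")
        case True
        then show ?thesis using * c self[OF c(1)] by simp
      next
        case False
        then have "P c w = 0" using c c' other[OF c(1) c'(1)] by blast
        then show ?thesis using * False form_space.scale_zero_right by simp
      qed
    qed
    also have "\<dots> = form_scale (u v) v" using t by simp
    finally have "v = 0" using t(5) by simp
    then show False using x[OF c(1)] c(2) by simp
  qed
  moreover have "x ` support Q X \<subseteq> form_space.span B"
    using B(2) x gradedD(3)[OF g sQ] by blast
  ultimately have "finite (x ` support Q X)"
    using form_space.independent_span_bound[OF B(1)] by blast
  then show ?thesis using finite_imageD inj by blast
qed

text \<open>The difference of both sides has all its components 0, hence is 0 by separation.\<close>

lemma graded_expansion:
  assumes g: "graded E Q X P" and fin: "finite (support Q X)" and x: "x \<in> E"
  shows "x = (\<Sum>c\<in>support Q X. P c x)"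
proof -
  have sQ: "c \<in> Q" if "c \<in> support Q X" for c using that by (simp add: support_def)
  have PE: "P c x \<in> E" if "c \<in> Q" for c using gradedD(3,4)[OF g that] x by blast
  define y where "y = x + form_scale (-1) (\<Sum>c\<in>support Q X. P c x)"
  have sE: "(\<Sum>c\<in>support Q X. P c x) \<in> E" by (intro form_space.subspace_sum[OF gradedD(1)[OF g]] PE sQ)
  have yE: "y \<in> E" unfolding y_def
    by (intro form_space.subspace_add[OF gradedD(1)[OF g]] form_space.subspace_scale[OF gradedD(1)[OF g]] x sE)
  have "P c y = 0" if c: "c \<in> Q" for c
  proof -
    have "P c (\<Sum>c'\<in>support Q X. P c' x) = (\<Sum>c'\<in>support Q X. P c (P c' x))"
      by (rule graded_P_sum[OF g c PE[OF sQ] fin])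
    also have "\<dots> = (\<Sum>c'\<in>support Q X. if c' = c then P c x else 0)"
      using gradedD(8)[OF g c sQ] gradedD(5)[OF g c] gradedD(4)[OF g _ x] sQ by (intro sum.cong refl) auto
    also have "\<dots> = (if c \<in> support Q X then P c x else 0)" using fin by simp
    also have "\<dots> = P c x"
      using gradedD(4)[OF g c x] c by (auto simp: support_def)
    finally show ?thesis
      unfolding y_def gradedD(6)[OF g c x form_space.subspace_scale[OF gradedD(1)[OF g] sE]] gradedD(7)[OF g c sE]
      by (simp add: form_scale_def fun_eq_iff)
  qed
  then have "y = 0" using gradedD(9)[OF g yE] by blast
  then show ?thesis by (simp add: y_def form_scale_def fun_eq_iff)
qed

lemma linear_between_0: "form_space.subspace X \<Longrightarrow> linear_between X Y f \<Longrightarrow> f 0 = 0"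
  unfolding linear_between_def
  by (metis form_space.scale_zero_left form_space.subspace_0)

text \<open>Applying \<open>P2 c\<close> to the assembled sum isolates the term
  \<open>J c (P1 c x)\<close>, which \<open>K c\<close> takes back to \<open>P1 c x\<close>; the
  finite expansion then recovers x. The index set \<open>F\<close> may exceed the support, so that
  one set serves both directions.\<close>

lemma graded_map_inverse:
  assumes g1: "graded E1 Q X1 P1" and g2: "graded E2 Q X2 P2" and fin: "finite F" "F \<subseteq> Q" "support Q X1 \<subseteq> F"
    and J: "\<And>c. c \<in> Q \<Longrightarrow> linear_between (X1 c) (X2 c) (J c)"
    and KJ: "\<And>c x. c \<in> Q \<Longrightarrow> x \<in> X1 c \<Longrightarrow> K c (J c x) = x"
    and x: "x \<in> E1"
  shows "(\<Sum>c\<in>F. J c (P1 c x)) \<in> E2" "(\<Sum>c\<in>F. K c (P2 c (\<Sum>c\<in>F. J c (P1 c x)))) = x"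
proof -
  have JX: "J c (P1 c x) \<in> X2 c" if "c \<in> F" for c
    using J[of c] gradedD(4)[OF g1 _ x, of c] that fin(2) unfolding linear_between_def by blast
  have JE: "J c (P1 c x) \<in> E2" if "c \<in> F" for c
    using JX[OF that] gradedD(3)[OF g2] that fin(2) by blast
  show "(\<Sum>c\<in>F. J c (P1 c x)) \<in> E2" by (intro form_space.subspace_sum[OF gradedD(1)[OF g2]] JE)
  have "P2 c (\<Sum>c\<in>F. J c (P1 c x)) = J c (P1 c x)" if c: "c \<in> F" for c
  proof -
    have cQ: "c \<in> Q" using c fin(2) by blast
    have "P2 c (\<Sum>c\<in>F. J c (P1 c x)) = (\<Sum>c'\<in>F. P2 c (J c' (P1 c' x)))"
      by (rule graded_P_sum[OF g2 cQ JE fin(1)])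
    also have "\<dots> = (\<Sum>c'\<in>F. if c' = c then J c (P1 c x) else 0)"
      using gradedD(5)[OF g2 cQ JX[OF c]] gradedD(8)[OF g2 cQ] JX fin(2) by (intro sum.cong refl) auto
    finally show ?thesis using c fin(1) by simp
  qed
  then have "(\<Sum>c\<in>F. K c (P2 c (\<Sum>c\<in>F. J c (P1 c x)))) = (\<Sum>c\<in>F. P1 c x)"
    using KJ gradedD(4)[OF g1 _ x] fin(2) by (intro sum.cong refl) auto
  also have "\<dots> = (\<Sum>c\<in>support Q X1. P1 c x)"
  proof (rule sum.mono_neutral_right[OF fin(1,3)], rule ballI)
    fix c assume "c \<in> F - support Q X1"
    then show "P1 c x = 0" using gradedD(4)[OF g1 _ x] fin(2) by (auto simp: support_def)
  qed
  also have "\<dots> = x"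
    using graded_expansion[OF g1 _ x] finite_subset[OF fin(3,1)] by simp
  finally show "(\<Sum>c\<in>F. K c (P2 c (\<Sum>c\<in>F. J c (P1 c x)))) = x" .
qed

text \<open>Finite dimension leaves finitely many nonzero parts, so the partwise maps add up to a
  bijection, and this carries a basis over to the other side.\<close>

lemma graded_dim_eq:
  fixes E1 :: "'a form set" and E2 :: "'b form set"
  assumes g1: "graded E1 Q X1 P1" and g2: "graded E2 Q X2 P2"
    and J: "\<And>c. c \<in> Q \<Longrightarrow> linear_between (X1 c) (X2 c) (J c)"
    and K: "\<And>c. c \<in> Q \<Longrightarrow> linear_between (X2 c) (X1 c) (K c)"
    and KJ: "\<And>c x. c \<in> Q \<Longrightarrow> x \<in> X1 c \<Longrightarrow> K c (J c x) = x"
    and JK: "\<And>c y. c \<in> Q \<Longrightarrow> y \<in> X2 c \<Longrightarrow> J c (K c y) = y"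
    and B: "finite B" "E1 \<subseteq> form_space.span B"
  shows "(\<exists>B'. finite B' \<and> E2 \<subseteq> form_space.span B') \<and> form_space.dim E2 = form_space.dim E1"
proof -
  define F where "F = support Q X1"
  have fin: "finite F" unfolding F_def using finite_support[OF g1 B] .
  have FQ: "F \<subseteq> Q" by (auto simp: F_def support_def)
  have F2: "support Q X2 \<subseteq> F"
  proof
    fix c assume "c \<in> support Q X2"
    then obtain y where y: "c \<in> Q" "y \<in> X2 c" "y \<noteq> 0" by (auto simp: support_def)
    then have "K c y \<in> X1 c" using K[of c] unfolding linear_between_def by blast
    moreover have "K c y \<noteq> 0"
      using JK[OF y(1,2)] y(3) linear_between_0[OF gradedD(2)[OF g1 y(1)] J[OF y(1)]] by auto
    ultimately show "c \<in> F" using y(1) by (auto simp: F_def support_def)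
  qed
  define \<Psi> where "\<Psi> x = (\<Sum>c\<in>F. J c (P1 c x))" for x
  define \<Psi>' where "\<Psi>' y = (\<Sum>c\<in>F. K c (P2 c y))" for y
  have F1: "support Q X1 \<subseteq> F" by (simp add: F_def)
  have inv: "\<Psi> x \<in> E2" "\<Psi>' (\<Psi> x) = x" if "x \<in> E1" for x
    unfolding \<Psi>_def \<Psi>'_def
    by (rule graded_map_inverse(1)[OF g1 g2 fin FQ F1 J KJ that], assumption+)
      (rule graded_map_inverse(2)[OF g1 g2 fin FQ F1 J KJ that], assumption+)
  have inv': "\<Psi>' y \<in> E1" "\<Psi> (\<Psi>' y) = y" if "y \<in> E2" for y
    unfolding \<Psi>_def \<Psi>'_def
    by (rule graded_map_inverse(1)[OF g2 g1 fin FQ F2 K JK that], assumption+)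
      (rule graded_map_inverse(2)[OF g2 g1 fin FQ F2 K JK that], assumption+)
  have \<Psi>_add: "\<Psi> (x + y) = \<Psi> x + \<Psi> y" if "x \<in> E1" "y \<in> E1" for x y
  proof -
    have "J c (P1 c (x + y)) = J c (P1 c x) + J c (P1 c y)" if c: "c \<in> F" for c
    proof -
      have cQ: "c \<in> Q" using c FQ by blast
      show ?thesis
        using J[OF cQ] gradedD(4)[OF g1 cQ] gradedD(6)[OF g1 cQ] \<open>x \<in> E1\<close> \<open>y \<in> E1\<close>
        unfolding linear_between_def by simp
    qed
    then show ?thesis by (simp add: \<Psi>_def sum.distrib)
  qed
  have \<Psi>_scale: "\<Psi> (form_scale d x) = form_scale d (\<Psi> x)" if "x \<in> E1" for x d
  proof -
    have "J c (P1 c (form_scale d x)) = form_scale d (J c (P1 c x))" if c: "c \<in> F" for c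
    proof -
      have cQ: "c \<in> Q" using c FQ by blast
      show ?thesis
        using J[OF cQ] gradedD(4)[OF g1 cQ] gradedD(7)[OF g1 cQ] \<open>x \<in> E1\<close>
        unfolding linear_between_def by simp
    qed
    then show ?thesis by (simp add: \<Psi>_def form_space.scale_sum_right)
  qed
  interpret vp: vector_space_pair "form_scale :: complex \<Rightarrow> 'a form \<Rightarrow> 'a form"
    "form_scale :: complex \<Rightarrow> 'b form \<Rightarrow> 'b form" ..
  obtain C where C: "C \<subseteq> E1" "form_space.independent C" "E1 \<subseteq> form_space.span C"
    using form_space.maximal_independent_subset[of E1] by blast
  have spC: "form_space.span C = E1"
    using C form_space.span_minimal[OF C(1) gradedD(1)[OF g1]] by blast
  have finC: "finite C"
    using form_space.independent_span_bound[OF B(1) C(2)] C(1) B(2) by blast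
  \<comment> \<open>\<open>\<Psi>\<close> is linear on \<open>E1\<close> only; a globally linear map
    that agrees with it on a basis makes the results on images of independent and spanning sets
    applicable.\<close>
  obtain f where f: "Vector_Spaces.linear form_scale form_scale f" "\<forall>x\<in>C. f x = \<Psi> x"
    using vp.linear_independent_extend[OF C(2), of \<Psi>] by blast
  interpret f: Vector_Spaces.linear "form_scale :: complex \<Rightarrow> 'a form \<Rightarrow> 'a form"
    "form_scale :: complex \<Rightarrow> 'b form \<Rightarrow> 'b form" f by fact
  have \<Psi>0: "\<Psi> 0 = 0"
    using \<Psi>_scale[of 0 0] form_space.subspace_0[OF gradedD(1)[OF g1]] by simp
  have f\<Psi>: "f x = \<Psi> x" if "x \<in> E1" for x
  proof -
    have "x \<in> E1 \<and> f x = \<Psi> x"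
      using that unfolding spC[symmetric]
    proof (induct rule: form_space.span_induct_alt)
      case base
      have "0 \<in> form_space.span C \<and> f 0 = \<Psi> 0" using \<Psi>0 f.zero form_space.span_zero[of C] by simp
      then show ?case .
    next
      case (step c x y)
      then have "x \<in> E1" "y \<in> E1" "form_scale c x \<in> E1"
        using C(1) spC form_space.subspace_scale[OF gradedD(1)[OF g1]] by auto
      then have "form_scale c x + y \<in> form_space.span C \<and> f (form_scale c x + y) = \<Psi> (form_scale c x + y)"
        using step f(2) \<Psi>_add \<Psi>_scale form_space.subspace_add[OF gradedD(1)[OF g1]] spC
        by (simp add: f.add f.scale)
      then show ?case .
    qed
    then show ?thesis by blast
  qed
  have inj: "inj_on f (form_space.span C)"
    unfolding spC by (rule inj_onI) (metis f\<Psi> inv(2))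
  have ind: "form_space.independent (f ` C)"
    using f.independent_injective_image[OF C(2) inj] .
  have "f ` E1 = E2"
  proof
    show "f ` E1 \<subseteq> E2" using f\<Psi> inv(1) by auto
    show "E2 \<subseteq> f ` E1"
    proof
      fix y assume "y \<in> E2"
      then show "y \<in> f ` E1" using inv'[of y] f\<Psi>[of "\<Psi>' y"] by (metis image_eqI)
    qed
  qed
  then have sp: "form_space.span (f ` C) = E2"
    using f.span_image[of C] spC by simp
  have "card (f ` C) = card C"
    using inj form_space.span_superset[of C] by (intro card_image) (metis inj_on_subset)
  moreover have "form_space.dim E1 = card C"
  proof (rule form_space.dim_eq_card[OF _ C(2)])
    have "form_space.span E1 = E1" using gradedD(1)[OF g1] by (simp only: form_space.span_eq_iff)
    then show "form_space.span C = form_space.span E1" using spC by (rule trans[OF _ sym, rotated])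
  qed
  moreover have "form_space.dim E2 = card (f ` C)"
  proof (rule form_space.dim_eq_card[OF _ ind])
    have "form_space.span E2 = E2" using gradedD(1)[OF g2] by (simp only: form_space.span_eq_iff)
    then show "form_space.span (f ` C) = form_space.span E2" using sp by (rule trans[OF _ sym, rotated])
  qed
  ultimately show ?thesis using finC sp by (metis finite_imageI order_refl)
qed

text \<open>Spectra are compared without any finiteness: one nonzero component of an eigenform is
  carried over, and an injective map keeps it nonzero.\<close>

lemma graded_nonzero:
  assumes g1: "graded E1 Q X1 P1" and g2: "graded E2 Q X2 P2"
    and J: "\<And>c. c \<in> Q \<Longrightarrow> linear_between (X1 c) (X2 c) (J c)"
    and K: "\<And>c. c \<in> Q \<Longrightarrow> linear_between (X2 c) (X1 c) (K c)"
    and KJ: "\<And>c x. c \<in> Q \<Longrightarrow> x \<in> X1 c \<Longrightarrow> K c (J c x) = x"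
    and x: "x \<in> E1" "x \<noteq> 0"
  shows "\<exists>y\<in>E2. y \<noteq> 0"
proof -
  obtain c where c: "c \<in> Q" "P1 c x \<noteq> 0" using gradedD(9)[OF g1 x] by blast
  have PX: "P1 c x \<in> X1 c" using gradedD(4)[OF g1 c(1) x(1)] .
  have "J c (P1 c x) \<in> X2 c" using J[OF c(1)] PX unfolding linear_between_def by blast
  moreover have "J c (P1 c x) \<noteq> 0"
    using KJ[OF c(1) PX] c(2) linear_between_0[OF gradedD(2)[OF g2 c(1)] K[OF c(1)]] by auto
  ultimately show ?thesis using gradedD(3)[OF g2 c(1)] by blast
qed

lemma (in torus_bundle) graded_eigenspace:
  assumes bs: "set bs \<subseteq> lat T \<inter> kerH"
  shows "graded (eigenspace T L k \<mu>) (freqs bs) (component bs k \<mu>) (\<lambda>c. proj bs c (length bs))"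
  unfolding graded_def
proof (intro conjI ballI impI allI)
  show "form_space.subspace (eigenspace T L k \<mu>)" by (rule eigenspace_subspace)
  fix c assume c: "c \<in> freqs bs"
  show "form_space.subspace (component bs k \<mu> c)" by (rule component_subspace)
  show "component bs k \<mu> c \<subseteq> eigenspace T L k \<mu>" by (auto simp: component_def)
  show "proj bs c (length bs) ` eigenspace T L k \<mu> \<subseteq> component bs k \<mu> c"
    using proj_component[OF bs c] by blast
  show "proj bs c (length bs) x = x" if "x \<in> component bs k \<mu> c" for x
    using proj_of_component[OF bs that c c order_refl] by simp
  show "proj bs c (length bs) (x + y) = proj bs c (length bs) x + proj bs c (length bs) y"
    if "x \<in> eigenspace T L k \<mu>" "y \<in> eigenspace T L k \<mu>" for x y
    using proj_add[OF bs that order_refl] .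
  show "proj bs c (length bs) (form_scale d x) = form_scale d (proj bs c (length bs) x)" for x d
    using proj_scale[OF bs order_refl] .
  show "proj bs c (length bs) x = 0" if "c' \<in> freqs bs" "c' \<noteq> c" "x \<in> component bs k \<mu> c'" for c' x
  proof -
    \<comment> \<open>Distinct frequency sequences must differ within the list, because both are 0
      beyond it.\<close>
    have "\<exists>j<length bs. c j \<noteq> c' j"
    proof (rule ccontr)
      assume "\<not> (\<exists>j<length bs. c j \<noteq> c' j)"
      then have "c = c'" using c that(1) by (auto simp: freqs_def fun_eq_iff) (metis linorder_not_le)
      then show False using that(2) by simp
    qed
    then show ?thesis using proj_of_component[OF bs that(3) c that(1) order_refl] by simp
  qed
next
  fix x assume "x \<in> eigenspace T L k \<mu>" "x \<noteq> 0"
  then show "\<exists>c\<in>freqs bs. proj bs c (length bs) x \<noteq> 0" by (rule proj_separates[OF bs])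
qed


section \<open>Twisted translations between components\<close>

text \<open>The data for one frequency c. \<open>\<kappa>\<close> is c as a linear functional, and
  \<open>lattice_match\<close> says that \<open>\<Theta> u\<close> misses a lattice vector v by a
  kernel vector, whose action on the c-part is a phase; together with the phase due to the
  translation a it makes up for the difference of the multipliers.\<close>

locale bundle_morphism = A: torus_bundle T1 H1 \<alpha>1 + B: torus_bundle T2 H2 \<alpha>2
  for T1 :: "'a::complex_euclidean torus" and H1 \<alpha>1 and T2 :: "'b::complex_euclidean torus" and H2 \<alpha>2 +
  fixes \<Theta> :: "'a \<Rightarrow> 'b" and a :: 'b and bs1 :: "'a list" and bs2 :: "'b list"
    and c :: "nat \<Rightarrow> real" and \<kappa> :: "'b \<Rightarrow> real"
  assumes \<Theta>_linear: "Vector_Spaces.linear scaleC scaleC \<Theta>" and bij: "bij_betw \<Theta> (cover T1) (cover T2)"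
    and isometry: "\<And>x y. x \<in> cover T1 \<Longrightarrow> y \<in> cover T1 \<Longrightarrow> metric T2 (\<Theta> x) (\<Theta> y) = metric T1 x y"
    and \<Theta>_H: "\<And>x y. x \<in> cover T1 \<Longrightarrow> y \<in> cover T1 \<Longrightarrow> H2 (\<Theta> x) (\<Theta> y) = H1 x y"
    and a: "a \<in> cover T2"
    and bs_map: "bs2 = map \<Theta> bs1" and bs1: "set bs1 \<subseteq> cover T1" and bs2: "set bs2 \<subseteq> B.kerH"
    and ker_span: "B.kerH \<subseteq> span (set bs2)"
    and \<kappa>: "linear \<kappa>" "\<And>i. i < length bs2 \<Longrightarrow> \<kappa> (bs2 ! i) = c i"
    and lattice_match: "\<And>u. u \<in> lat T1 \<Longrightarrow> \<exists>v\<in>lat T2. \<Theta> u - v \<in> B.kerH \<and>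
        \<alpha>1 u = \<alpha>2 v * cis (2 * pi * Im (H2 a v)) * cis (2 * pi * \<kappa> (\<Theta> u - v))"
begin

sublocale affine_hermitian_map T1 T2 H1 H2 \<Theta> a
  by (rule affine_hermitian_map.intro[OF A.W B.W B.H \<Theta>_linear _ \<Theta>_H a])
    (use bij in \<open>auto simp: bij_betw_def\<close>)

abbreviation tw where "tw \<equiv> twist (cover T1) H2 \<Theta> a"

lemma orthonormal_image: "orthonormal_basis T2 (\<Theta> ` A.orth)"
proof -
  note E = A.orthD
  have inj: "inj_on \<Theta> (cover T1)" using bij by (simp add: bij_betw_def)
  have "span (\<Theta> ` A.orth) = cover T2"
    using linear_span_image[OF lin, of A.orth] E(3) bij by (simp add: bij_betw_def)
  moreover have "Re (metric T2 (\<Theta> x) (\<Theta> y)) = (if \<Theta> x = \<Theta> y then 1 else 0)" if "x \<in> A.orth" "y \<in> A.orth" for x y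
    using that E(2,4) isometry[of x y] inj_on_eq_iff[OF inj, of x y] by (simp add: subset_iff)
  ultimately show ?thesis
    using E(1) image_mono[OF E(2), of \<Theta>] \<Theta>_in unfolding orthonormal_basis_def by auto
qed

text \<open>The twist carries the trace over \<open>A.orth\<close> to a trace over its image, which
  is then exchanged for the basis chosen on the other torus.\<close>

lemma cod_tw:
  assumes \<phi>: "\<phi> \<in> smooth_forms (cover T2) k"
  shows "A.cod (tw \<phi>) = tw (B.cod \<phi>)"
proof -
  have "inj_on \<Theta> A.orth" using bij A.orthD(2) by (meson bij_betw_def inj_on_subset)
  then show ?thesis
    using codbar_twist[OF \<phi> A.orthD(2)] B.codbar_onb_independent[OF orthonormal_image B.onb B.H \<phi>] by simp
qed

lemma tw_add: "tw (\<phi> + \<psi>) = tw \<phi> + tw \<psi>"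
  by (auto simp: twist_def fun_eq_iff distrib_left)

lemma tw_scale: "tw (form_scale d \<phi>) = form_scale d (tw \<phi>)"
  by (auto simp: twist_def form_scale_def fun_eq_iff)

lemma tw_zero: "tw 0 = 0"
  by (auto simp: twist_def fun_eq_iff)

lemma box_tw:
  assumes \<phi>: "\<phi> \<in> smooth_forms (cover T2) k"
  shows "A.box (tw \<phi>) = tw (B.box \<phi>)"
proof -
  have 1: "A.cod (dbar T1 (tw \<phi>)) = tw (B.cod (dbar T2 \<phi>))"
    unfolding dbar_twist[OF \<phi>] by (rule cod_tw[OF dbar_smooth[OF B.W \<phi>]])
  have 2: "dbar T1 (A.cod (tw \<phi>)) = tw (dbar T2 (B.cod \<phi>))"
  proof (cases k)
    case 0
    then have "B.cod \<phi> = 0" using codbar_degree_0 \<phi> by blast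
    then show ?thesis by (simp add: cod_tw[OF \<phi>] tw_zero dbar_zero_form)
  next
    case (Suc m)
    then have "B.cod \<phi> \<in> smooth_forms (cover T2) m" using codbar_smooth[OF B.W B.H B.orthD(2)] \<phi> by blast
    then show ?thesis unfolding cod_tw[OF \<phi>] by (rule dbar_twist)
  qed
  show ?thesis by (simp add: A.box_def B.box_def 1 2 tw_add)
qed

text \<open>Frequencies along a spanning list determine the action of every kernel translation:
  exponents add up along a linear combination to the functional \<open>\<kappa>\<close>.\<close>

lemma equivariant_ker:
  assumes eqv: "\<And>i. i < length bs2 \<Longrightarrow> B.eqv (bs2 ! i) (c i) \<phi>" and t: "t \<in> B.kerH" and z: "z \<in> cover T2"
  shows "\<phi> (z + t) vs = cis (2 * pi * \<kappa> t) * \<phi> z vs"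
proof -
  have bs2c: "x \<in> cover T2" if "x \<in> set bs2" for x using that bs2 B.kerH_cover by blast
  have "t \<in> span (set bs2)" using t ker_span by blast
  then have "t \<in> cover T2 \<and> (\<forall>z\<in>cover T2. \<forall>vs. \<phi> (z + t) vs = cis (2 * pi * \<kappa> t) * \<phi> z vs)"
  proof (induct rule: span_induct_alt)
    case base
    then show ?case using subspace_0[OF sW2] linear_0[OF \<kappa>(1)] by simp
  next
    case (step r x y)
    obtain i where i: "i < length bs2" "x = bs2 ! i" using step(1) by (auto simp: in_set_conv_nth)
    have rx: "r *\<^sub>R x \<in> cover T2" using bs2c[OF step(1)] sW2 by (simp add: subspace_scale)
    have "\<phi> (z + (r *\<^sub>R x + y)) vs = cis (2 * pi * \<kappa> (r *\<^sub>R x + y)) * \<phi> z vs" if z: "z \<in> cover T2" for z vs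
    proof -
      have "\<phi> (z + r *\<^sub>R x + y) vs = cis (2 * pi * \<kappa> y) * \<phi> (z + r *\<^sub>R x) vs"
        using step(2) z rx sW2 by (auto intro: subspace_add)
      also have "\<phi> (z + r *\<^sub>R x) vs = cis (2 * pi * c i * r) * \<phi> z vs"
        using B.eqvD[OF eqv[OF i(1)] z] i(2) by simp
      also have "cis (2 * pi * \<kappa> y) * (cis (2 * pi * c i * r) * \<phi> z vs) = cis (2 * pi * \<kappa> (r *\<^sub>R x + y)) * \<phi> z vs"
      proof -
        have "2 * pi * \<kappa> y + 2 * pi * c i * r = 2 * pi * \<kappa> (r *\<^sub>R x + y)"
          using \<kappa>(2)[OF i(1)] i(2) by (simp add: linear_add[OF \<kappa>(1)] linear_scale[OF \<kappa>(1)] algebra_simps)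
        then show ?thesis by (simp only: mult.assoc[symmetric] cis_mult)
      qed
      finally show ?thesis by (simp only: add.assoc)
    qed
    then show ?case using step(2) rx sW2 by (auto intro: subspace_add)
  qed
  then show ?thesis using z by blast
qed

text \<open>Write \<Theta> u = v + t. The kernel vector t acts by the phase of
  \<open>\<kappa>\<close>, and v by its factor at \<Theta> z + a. Evaluating there instead of at
  \<Theta> z costs exp(pi H(a,v)), the frame costs exp(- pi H(v,a)), and their product exp(2 pi i Im
  H(a,v)) is the phase provided for in \<open>lattice_match\<close>.\<close>

lemma tw_BF:
  assumes \<phi>: "\<phi> \<in> B.BF k" and eqv: "\<And>i. i < length bs2 \<Longrightarrow> B.eqv (bs2 ! i) (c i) \<phi>"
  shows "tw \<phi> \<in> A.BF k"
  unfolding A.bundle_forms_iff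
proof (intro conjI ballI allI)
  show "tw \<phi> \<in> smooth_forms (cover T1) k" using twist_smooth[OF B.BF_smooth[OF \<phi>]] .
  fix u z vs assume u: "u \<in> lat T1" and z: "z \<in> cover T1"
  obtain v where v: "v \<in> lat T2" "\<Theta> u - v \<in> B.kerH"
    "\<alpha>1 u = \<alpha>2 v * cis (2 * pi * Im (H2 a v)) * cis (2 * pi * \<kappa> (\<Theta> u - v))"
    using lattice_match[OF u] by blast
  define t where "t = \<Theta> u - v"
  have \<Theta>u: "\<Theta> u = v + t" by (simp add: t_def)
  have uc: "u \<in> cover T1" using u A.lat_cover by blast
  have vc: "v \<in> cover T2" using v B.lat_cover by blast
  have tc: "t \<in> cover T2" and tk: "t \<in> B.kerH" using v(2) B.kerH_cover by (auto simp: t_def)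
  have zu: "z + u \<in> cover T1" using z uc sW1 by (simp add: subspace_add)
  note \<Theta>z = \<Theta>_mem[OF z]
  have za: "\<Theta> z + a \<in> cover T2" using affine_mem[OF z] .
  have zav: "\<Theta> z + a + v \<in> cover T2" using za vc sW2 by (simp add: subspace_add)
  \<comment> \<open>Kernel components drop out of the form, so u may be replaced by v in every
    exponent.\<close>
  have Hzu: "H1 z u = H2 (\<Theta> z) v"
    using \<Theta>_H[OF z uc] hermitian_on_add_right[OF B.W B.H vc tc \<Theta>z] B.kerH_right[OF tk \<Theta>z] by (simp add: \<Theta>u)
  have Huu: "H1 u u = H2 v v"
  proof -
    have "H1 u u = H2 (v + t) (v + t)" using \<Theta>_H[OF uc uc] by (simp add: \<Theta>u)
    also have "\<dots> = H2 v (v + t) + H2 t (v + t)"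
      using hermitian_on_add_left[OF B.H vc tc] vc tc sW2 by (simp add: subspace_add)
    also have "H2 t (v + t) = 0" using B.kerH_left[OF tk] vc tc sW2 by (simp add: subspace_add)
    also have "H2 v (v + t) = H2 v v" using hermitian_on_add_right[OF B.W B.H vc tc vc] B.kerH_right[OF tk vc] by simp
    finally show ?thesis by simp
  qed
  have H\<Theta>a: "H2 (\<Theta> (z + u)) a = H2 (\<Theta> z) a + H2 v a"
  proof -
    have "\<Theta> (z + u) = \<Theta> z + (v + t)" using linear_add[OF lin] by (simp add: \<Theta>u)
    moreover have "H2 (\<Theta> z + (v + t)) a = H2 (\<Theta> z) a + (H2 v a + H2 t a)"
      using hermitian_on_add_left[OF B.H \<Theta>z _ a, of "v + t"] hermitian_on_add_left[OF B.H vc tc a] vc tc sW2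
      by (simp add: subspace_add)
    ultimately show ?thesis using B.kerH_left[OF tk a] by simp
  qed
  have arg: "\<Theta> (z + u) + a = (\<Theta> z + a + v) + t"
    using linear_add[OF lin, of z u] by (simp add: \<Theta>u)
  have val: "\<phi> (\<Theta> (z + u) + a) ws = cis (2 * pi * \<kappa> t) * (factor B.L v (\<Theta> z + a) * \<phi> (\<Theta> z + a) ws)" for ws
    using equivariant_ker[OF eqv tk zav, of ws] B.BF_equivariant[OF \<phi> v(1) za, of ws] by (simp only: arg)
  have Hav: "H2 (\<Theta> z + a) v = H2 (\<Theta> z) v + H2 a v" using hermitian_on_add_left[OF B.H \<Theta>z a vc] .
  have va: "H2 v a = cnj (H2 a v)" using hermitian_on_cnj[OF B.H a vc] by simp
  have cisE: "cis (2 * pi * Im (H2 a v)) = exp (of_real pi * (H2 a v - cnj (H2 a v)))"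
    unfolding cis_conv_exp by (rule arg_cong[where f=exp]) (simp add: complex_eq_iff)
  have "exp (- (of_real pi * H2 (\<Theta> (z + u)) a)) * (cis (2 * pi * \<kappa> t) * factor B.L v (\<Theta> z + a)) =
      factor A.L u z * exp (- (of_real pi * H2 (\<Theta> z) a))"
  proof -
    have "exp (- (of_real pi * H2 (\<Theta> (z + u)) a)) * (cis (2 * pi * \<kappa> t) * factor B.L v (\<Theta> z + a)) =
        (cis (2 * pi * \<kappa> t) * \<alpha>2 v) * (exp (- (of_real pi * (H2 (\<Theta> z) a + cnj (H2 a v)))) *
          exp (of_real pi * (H2 (\<Theta> z) v + H2 a v) + of_real (pi / 2) * H2 v v))"
      by (simp add: L_bundle_def H\<Theta>a va Hav)
    also have "exp (- (of_real pi * (H2 (\<Theta> z) a + cnj (H2 a v)))) *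
          exp (of_real pi * (H2 (\<Theta> z) v + H2 a v) + of_real (pi / 2) * H2 v v) =
        exp (of_real pi * (H2 a v - cnj (H2 a v))) * (exp (of_real pi * H2 (\<Theta> z) v + of_real (pi / 2) * H2 v v) *
          exp (- (of_real pi * H2 (\<Theta> z) a)))"
      unfolding exp_add[symmetric] by (simp add: algebra_simps)
    also have "(cis (2 * pi * \<kappa> t) * \<alpha>2 v) * \<dots> = factor A.L u z * exp (- (of_real pi * H2 (\<Theta> z) a))"
      using v(3) by (simp add: L_bundle_def Hzu Huu cisE t_def)
    finally show ?thesis .
  qed
  then have "exp (- (of_real pi * H2 (\<Theta> (z + u)) a)) * \<phi> (\<Theta> (z + u) + a) ws =
      factor A.L u z * (exp (- (of_real pi * H2 (\<Theta> z) a)) * \<phi> (\<Theta> z + a) ws)" for ws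
    unfolding val by (simp only: mult.assoc[symmetric])
  then show "tw \<phi> (z + u) vs = factor A.L u z * tw \<phi> z vs"
    using z zu by (simp add: twist_def)
qed

lemma tw_component:
  assumes \<phi>: "\<phi> \<in> B.component bs2 k \<mu> c"
  shows "tw \<phi> \<in> A.component bs1 k \<mu> c"
proof -
  have BF: "\<phi> \<in> B.BF k" and box: "B.box \<phi> = form_scale \<mu> \<phi>" and eqv: "\<And>i. i < length bs2 \<Longrightarrow> B.eqv (bs2 ! i) (c i) \<phi>"
    using \<phi> by (auto simp: B.component_def B.eigenspace_eq)
  have len: "length bs2 = length bs1" by (simp add: bs_map)
  have "A.eqv (bs1 ! i) (c i) (tw \<phi>)" if i: "i < length bs1" for i
    unfolding equivariant_along_def
  proof (intro allI ballI)
    fix s z vs assume z: "z \<in> cover T1"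
    define b where "b = bs1 ! i"
    have bc: "b \<in> cover T1" using bs1 i by (auto simp: b_def)
    have \<Theta>b: "\<Theta> b = bs2 ! i" using i by (simp add: b_def bs_map)
    have \<Theta>bk: "\<Theta> b \<in> B.kerH" using bs2 i len by (auto simp: \<Theta>b)
    note \<Theta>z = \<Theta>_mem[OF z]
    have zs: "z + s *\<^sub>R b \<in> cover T1" using line_in_subspace[OF sW1 z bc] .
    have \<Theta>s: "\<Theta> (z + s *\<^sub>R b) = \<Theta> z + s *\<^sub>R \<Theta> b" by (simp add: linear_add[OF lin] linear_scale[OF lin])
    \<comment> \<open>The frame exponential is constant along kernel directions, so the twist leaves
      frequencies unchanged.\<close>
    have "H2 (\<Theta> z + s *\<^sub>R \<Theta> b) a = H2 (\<Theta> z) a"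
      using rlinear_on_add[OF rlinear_hermitian_left[OF B.W B.H a] \<Theta>z, of "s *\<^sub>R \<Theta> b"]
        rlinear_on_scale[OF rlinear_hermitian_left[OF B.W B.H a] B.kerH_cover[OF \<Theta>bk], of s]
        subspace_scale[OF sW2 B.kerH_cover[OF \<Theta>bk], of s] B.kerH_left[OF \<Theta>bk a] by simp
    moreover have "\<phi> (\<Theta> z + s *\<^sub>R \<Theta> b + a) ws = cis (2 * pi * c i * s) * \<phi> (\<Theta> z + a) ws" for ws
      using B.eqvD[OF eqv affine_mem[OF z], of i s ws] i len by (simp add: \<Theta>b ac_simps)
    ultimately show "tw \<phi> (z + s *\<^sub>R bs1 ! i) vs = cis (2 * pi * c i * s) * tw \<phi> z vs"
      using z zs unfolding b_def[symmetric] by (simp add: twist_def \<Theta>s)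
  qed
  moreover have "tw \<phi> \<in> eigenspace T1 A.L k \<mu>"
    using tw_BF[OF BF eqv] box_tw[OF B.BF_smooth[OF BF]] box tw_scale by (simp add: A.eigenspace_eq)
  ultimately show ?thesis by (simp add: A.component_def)
qed

lemma tw_linear_between: "linear_between (B.component bs2 k \<mu> c) (A.component bs1 k \<mu> c) tw"
  unfolding linear_between_def using tw_component tw_add tw_scale by blast

end

text \<open>The two frame exponents are pi H(z,a) and - pi H(z - a, a). Their sum is the constant pi
  H(a,a), so the opposite twist inverts the first one up to a scalar.\<close>

lemma twist_twist:
  assumes W1: "subspace W1" and W2: "subspace W2" and H2: "hermitian_on W2 H2"
    and lin: "linear \<Theta>" "linear \<Xi>"
    and mem: "\<And>x. x \<in> W1 \<Longrightarrow> \<Theta> x \<in> W2" "\<And>y. y \<in> W2 \<Longrightarrow> \<Xi> y \<in> W1"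
    and inv: "\<And>y. y \<in> W2 \<Longrightarrow> \<Theta> (\<Xi> y) = y"
    and H: "\<And>x y. x \<in> W1 \<Longrightarrow> y \<in> W1 \<Longrightarrow> H2 (\<Theta> x) (\<Theta> y) = H1 x y"
    and cW2: "complex_space.subspace W2"
    and a: "a \<in> W2" and \<phi>: "\<phi> \<in> smooth_forms W2 k"
  shows "twist W2 H1 \<Xi> (- \<Xi> a) (twist W1 H2 \<Theta> a \<phi>) = form_scale (exp (of_real pi * H2 a a)) \<phi>"
proof (intro ext)
  fix z vs
  show "twist W2 H1 \<Xi> (- \<Xi> a) (twist W1 H2 \<Theta> a \<phi>) z vs = form_scale (exp (of_real pi * H2 a a)) \<phi> z vs"
  proof (cases "z \<in> W2 \<and> set vs \<subseteq> W2")
    case True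
    then have z: "z \<in> W2" and vs: "set vs \<subseteq> W2" by auto
    have \<Xi>a: "- \<Xi> a \<in> W1" using mem(2)[OF a] W1 by (simp add: subspace_neg)
    have y: "\<Xi> z + - \<Xi> a \<in> W1" using mem(2)[OF z] \<Xi>a W1 by (simp only: subspace_add)
    have \<Theta>y: "\<Theta> (\<Xi> z + - \<Xi> a) = z - a"
      using inv[OF z] inv[OF a] by (simp add: linear_diff[OF lin(1)])
    have \<Theta>a: "\<Theta> (- \<Xi> a) = - a" using inv[OF a] by (simp add: linear_neg[OF lin(1)])
    have na: "- a \<in> W2" using a W2 by (simp add: subspace_neg)
    have "H1 (\<Xi> z) (- \<Xi> a) = H2 z (- a)"
      using H[OF mem(2)[OF z] \<Xi>a] inv[OF z] \<Theta>a by simp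
    also have "\<dots> = - H2 z a"
      using rlinear_on_scale[OF rlinear_hermitian_right[OF cW2 H2 z] a, of "-1"] by simp
    finally have H1: "H1 (\<Xi> z) (- \<Xi> a) = - H2 z a" .
    have "H2 (z + - a) a = H2 z a + H2 (- a) a" by (rule hermitian_on_add_left[OF H2 z na a])
    moreover have "H2 (- a) a = - H2 a a"
      using rlinear_on_scale[OF rlinear_hermitian_left[OF cW2 H2 a] a, of "-1"] by simp
    ultimately have H2: "H2 (z - a) a = H2 z a - H2 a a" by simp
    have map_vs: "map \<Theta> (map \<Xi> vs) = vs"
      using inv vs by (auto simp: map_idI subset_iff)
    have "set (map \<Xi> vs) \<subseteq> W1" using mem(2) vs by auto
    then have "twist W2 H1 \<Xi> (- \<Xi> a) (twist W1 H2 \<Theta> a \<phi>) z vs =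
        exp (- (of_real pi * - H2 z a)) * (exp (- (of_real pi * (H2 z a - H2 a a))) * \<phi> z vs)"
      using z vs y \<Theta>y by (simp add: twist_def H1 H2 map_vs del: map_map set_map)
    also have "\<dots> = exp (of_real pi * H2 a a) * \<phi> z vs"
      unfolding mult.assoc[symmetric] exp_add[symmetric] by (simp add: algebra_simps)
    finally show ?thesis by (simp add: form_scale_def)
  next
    case False
    then have "\<phi> z vs = 0" using smooth_forms_outside[OF \<phi>] smooth_forms_zero[OF \<phi>] by blast
    then show ?thesis using False by (auto simp: twist_def form_scale_def)
  qed
qed

lemma linear_between_scale:
  assumes X: "form_space.subspace Y" and f: "linear_between X Y f"
  shows "linear_between X Y (\<lambda>x. form_scale d (f x))"
  unfolding linear_between_def
proof (intro conjI ballI allI)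
  show "(\<lambda>x. form_scale d (f x)) ` X \<subseteq> Y"
    using f form_space.subspace_scale[OF X] unfolding linear_between_def by blast
  show "form_scale d (f (x + y)) = form_scale d (f x) + form_scale d (f y)" if "x \<in> X" "y \<in> X" for x y
    using f that unfolding linear_between_def by (simp add: form_space.scale_right_distrib)
  show "form_scale d (f (form_scale e x)) = form_scale e (form_scale d (f x))" if "x \<in> X" for x e
    using f that unfolding linear_between_def by (simp add: mult.commute)
qed

text \<open>The translation depends on the frequency. The maps are therefore chosen separately for
  each c and assembled only at the level of graded eigenspaces, where no compatibility between
  different c is required.\<close>

theorem isospectral:
  fixes T1 :: "'a::complex_euclidean torus" and T2 :: "'b::complex_euclidean torus"
  assumes A: "torus_bundle T1 H1 \<alpha>1" and B: "torus_bundle T2 H2 \<alpha>2"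
    and bs1: "set bs1 \<subseteq> lat T1 \<inter> torus_bundle.kerH T1 H1" and bs2: "set bs2 \<subseteq> lat T2 \<inter> torus_bundle.kerH T2 H2"
    and freqs: "torus_bundle.freqs \<alpha>1 bs1 = torus_bundle.freqs \<alpha>2 bs2"
    and inv1: "\<And>x. x \<in> cover T1 \<Longrightarrow> \<Xi> (\<Theta> x) = x" and inv2: "\<And>y. y \<in> cover T2 \<Longrightarrow> \<Theta> (\<Xi> y) = y"
    and morph: "\<And>c. c \<in> torus_bundle.freqs \<alpha>2 bs2 \<Longrightarrow> \<exists>a \<kappa> \<kappa>'.
        bundle_morphism T1 H1 \<alpha>1 T2 H2 \<alpha>2 \<Theta> a bs1 bs2 c \<kappa> \<and>
        bundle_morphism T2 H2 \<alpha>2 T1 H1 \<alpha>1 \<Xi> (- \<Xi> a) bs2 bs1 c \<kappa>'"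
  shows "dolbeault_spectrum T1 (L_bundle H1 \<alpha>1) k = dolbeault_spectrum T2 (L_bundle H2 \<alpha>2) k"
    and "multiplicity_of T1 (L_bundle H1 \<alpha>1) k \<mu> = multiplicity_of T2 (L_bundle H2 \<alpha>2) k \<mu>"
proof -
  interpret A: torus_bundle T1 H1 \<alpha>1 by fact
  interpret B: torus_bundle T2 H2 \<alpha>2 by fact
  define Q where "Q = B.freqs bs2"
  have "\<forall>c\<in>Q. \<exists>a. \<exists>\<kappa> \<kappa>'. bundle_morphism T1 H1 \<alpha>1 T2 H2 \<alpha>2 \<Theta> a bs1 bs2 c \<kappa> \<and>
      bundle_morphism T2 H2 \<alpha>2 T1 H1 \<alpha>1 \<Xi> (- \<Xi> a) bs2 bs1 c \<kappa>'"
    using morph unfolding Q_def by blast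
  from bchoice[OF this] obtain a where a: "\<forall>c\<in>Q. \<exists>\<kappa> \<kappa>'. bundle_morphism T1 H1 \<alpha>1 T2 H2 \<alpha>2 \<Theta> (a c) bs1 bs2 c \<kappa> \<and>
      bundle_morphism T2 H2 \<alpha>2 T1 H1 \<alpha>1 \<Xi> (- \<Xi> (a c)) bs2 bs1 c \<kappa>'" by blast
  define J where "J c = twist (cover T1) H2 \<Theta> (a c)" for c :: "nat \<Rightarrow> real"
  \<comment> \<open>The scalar removes the constant of \<open>twist_twist\<close> and makes K c an
    exact inverse of J c.\<close>
  define K where "K c \<psi> = form_scale (exp (- (of_real pi * H2 (a c) (a c)))) (twist (cover T2) H1 \<Xi> (- \<Xi> (a c)) \<psi>)" for c :: "nat \<Rightarrow> real" and \<psi>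
  have gA: "graded (eigenspace T1 A.L k \<nu>) Q (A.component bs1 k \<nu>) (\<lambda>c. A.proj bs1 c (length bs1))" for \<nu>
    using A.graded_eigenspace[OF bs1] unfolding Q_def freqs[symmetric] .
  have gB: "graded (eigenspace T2 B.L k \<nu>) Q (B.component bs2 k \<nu>) (\<lambda>c. B.proj bs2 c (length bs2))" for \<nu>
    using B.graded_eigenspace[OF bs2] unfolding Q_def .
  have maps: "linear_between (B.component bs2 k \<nu> c) (A.component bs1 k \<nu> c) (J c) \<and>
      linear_between (A.component bs1 k \<nu> c) (B.component bs2 k \<nu> c) (K c) \<and>
      (\<forall>\<phi>\<in>B.component bs2 k \<nu> c. K c (J c \<phi>) = \<phi>) \<and> (\<forall>\<psi>\<in>A.component bs1 k \<nu> c. J c (K c \<psi>) = \<psi>)"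
    if c: "c \<in> Q" for c \<nu>
  proof -
    obtain \<kappa> \<kappa>' where m: "bundle_morphism T1 H1 \<alpha>1 T2 H2 \<alpha>2 \<Theta> (a c) bs1 bs2 c \<kappa>"
      "bundle_morphism T2 H2 \<alpha>2 T1 H1 \<alpha>1 \<Xi> (- \<Xi> (a c)) bs2 bs1 c \<kappa>'" using a c by blast
    interpret M: bundle_morphism T1 H1 \<alpha>1 T2 H2 \<alpha>2 \<Theta> "a c" bs1 bs2 c \<kappa> by (rule m(1))
    interpret N: bundle_morphism T2 H2 \<alpha>2 T1 H1 \<alpha>1 \<Xi> "- \<Xi> (a c)" bs2 bs1 c \<kappa>' by (rule m(2))
    have sm: "\<phi> \<in> smooth_forms (cover T2) k" if "\<phi> \<in> B.component bs2 k \<nu> c" for \<phi>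
      using that B.BF_smooth B.eigenspace_BF by (auto simp: B.component_def)
    have sm': "\<psi> \<in> smooth_forms (cover T1) k" if "\<psi> \<in> A.component bs1 k \<nu> c" for \<psi>
      using that A.BF_smooth A.eigenspace_BF by (auto simp: A.component_def)
    have cancel: "form_scale (exp (- x)) (form_scale (exp x) \<omega>) = \<omega>" for x and \<omega> :: "'c form"
      by (simp_all add: form_scale_def fun_eq_iff mult.assoc[symmetric] exp_minus)
    have KJ: "K c (J c \<phi>) = \<phi>" if "\<phi> \<in> B.component bs2 k \<nu> c" for \<phi>
    proof -
      have "twist (cover T2) H1 \<Xi> (- \<Xi> (a c)) (J c \<phi>) = form_scale (exp (of_real pi * H2 (a c) (a c))) \<phi>"
        unfolding J_def
        by (rule twist_twist[OF A.sW B.sW B.H M.lin N.lin M.\<Theta>_mem N.\<Theta>_mem inv2 M.\<Theta>_H B.W M.a sm[OF that]])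
      then show ?thesis unfolding K_def by (simp only: cancel)
    qed
    have JK: "J c (K c \<psi>) = \<psi>" if "\<psi> \<in> A.component bs1 k \<nu> c" for \<psi>
    proof -
      have aa: "- \<Theta> (- \<Xi> (a c)) = a c"
        using inv2[OF M.a] by (simp add: linear_neg[OF M.lin])
      \<comment> \<open>The constant of the opposite composition lives at - \<Xi> a on the first
        torus. It is the same number, so one normalization works in both orders.\<close>
      have Haa: "H1 (- \<Xi> (a c)) (- \<Xi> (a c)) = H2 (a c) (a c)"
      proof -
        have "H1 (- \<Xi> (a c)) (- \<Xi> (a c)) = H2 (\<Theta> (- \<Xi> (a c))) (\<Theta> (- \<Xi> (a c)))" using M.\<Theta>_H[OF N.a N.a] by simp
        also have "\<Theta> (- \<Xi> (a c)) = (-1) *\<^sub>R a c" using aa by (metis scaleR_minus1_left minus_minus)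
        also have "H2 ((-1) *\<^sub>R a c) ((-1) *\<^sub>R a c) = H2 (a c) (a c)"
          using rlinear_on_scale[OF rlinear_hermitian_left[OF B.W B.H subspace_scale[OF B.sW M.a, of "-1"]] M.a, of "-1"]
            rlinear_on_scale[OF rlinear_hermitian_right[OF B.W B.H M.a] M.a, of "-1"] by simp
        finally show ?thesis .
      qed
      have "twist (cover T1) H2 \<Theta> (- \<Theta> (- \<Xi> (a c))) (twist (cover T2) H1 \<Xi> (- \<Xi> (a c)) \<psi>) =
          form_scale (exp (of_real pi * H1 (- \<Xi> (a c)) (- \<Xi> (a c)))) \<psi>"
        by (rule twist_twist[OF B.sW A.sW A.H N.lin M.lin N.\<Theta>_mem M.\<Theta>_mem inv1 N.\<Theta>_H A.W N.a sm'[OF that]])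
      then have "J c (twist (cover T2) H1 \<Xi> (- \<Xi> (a c)) \<psi>) = form_scale (exp (of_real pi * H2 (a c) (a c))) \<psi>"
        unfolding aa Haa J_def .
      then have "J c (K c \<psi>) = form_scale (exp (- (of_real pi * H2 (a c) (a c))))
          (form_scale (exp (of_real pi * H2 (a c) (a c))) \<psi>)"
        unfolding K_def J_def M.tw_scale by simp
      then show ?thesis by (simp only: cancel)
    qed
    have "linear_between (A.component bs1 k \<nu> c) (B.component bs2 k \<nu> c) (K c)"
      unfolding K_def[abs_def] by (rule linear_between_scale[OF B.component_subspace N.tw_linear_between])
    then show ?thesis
      using M.tw_linear_between[of k \<nu>] KJ JK by (simp add: J_def)
  qed
  note m = maps[THEN conjunct1] maps[THEN conjunct2, THEN conjunct1]
    maps[THEN conjunct2, THEN conjunct2, THEN conjunct1, rule_format]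
    maps[THEN conjunct2, THEN conjunct2, THEN conjunct2, rule_format]
  show "dolbeault_spectrum T1 (L_bundle H1 \<alpha>1) k = dolbeault_spectrum T2 (L_bundle H2 \<alpha>2) k"
  proof -
    have "(\<exists>x\<in>eigenspace T1 A.L k \<nu>. x \<noteq> 0) \<longleftrightarrow> (\<exists>y\<in>eigenspace T2 B.L k \<nu>. y \<noteq> 0)" for \<nu>
    proof
      assume "\<exists>x\<in>eigenspace T1 A.L k \<nu>. x \<noteq> 0"
      then obtain x where x: "x \<in> eigenspace T1 A.L k \<nu>" "x \<noteq> 0" ..
      show "\<exists>y\<in>eigenspace T2 B.L k \<nu>. y \<noteq> 0"
        by (rule graded_nonzero[OF gA gB _ _ _ x]) (erule m(2), erule m(1), erule (1) m(4))
    next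
      assume "\<exists>y\<in>eigenspace T2 B.L k \<nu>. y \<noteq> 0"
      then obtain y where y: "y \<in> eigenspace T2 B.L k \<nu>" "y \<noteq> 0" ..
      show "\<exists>x\<in>eigenspace T1 A.L k \<nu>. x \<noteq> 0"
        by (rule graded_nonzero[OF gB gA _ _ _ y]) (erule m(1), erule m(2), erule (1) m(3))
    qed
    then show ?thesis by (simp only: dolbeault_spectrum_def)
  qed
  let ?E1 = "eigenspace T1 A.L k \<mu>" and ?E2 = "eigenspace T2 B.L k \<mu>"
  have 1: "(\<exists>B'. finite B' \<and> ?E2 \<subseteq> form_space.span B') \<and> form_space.dim ?E2 = form_space.dim ?E1"
    if "finite C" "?E1 \<subseteq> form_space.span C" for C
    by (rule graded_dim_eq[OF gA gB _ _ _ _ that]) (erule m(2), erule m(1), erule (1) m(4), erule (1) m(3))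
  have 2: "(\<exists>B'. finite B' \<and> ?E1 \<subseteq> form_space.span B') \<and> form_space.dim ?E1 = form_space.dim ?E2"
    if "finite C" "?E2 \<subseteq> form_space.span C" for C
    by (rule graded_dim_eq[OF gB gA _ _ _ _ that]) (erule m(1), erule m(2), erule (1) m(3), erule (1) m(4))
  show "multiplicity_of T1 (L_bundle H1 \<alpha>1) k \<mu> = multiplicity_of T2 (L_bundle H2 \<alpha>2) k \<mu>"
  proof (cases "\<exists>C. finite C \<and> ?E1 \<subseteq> form_space.span C")
    case True
    then show ?thesis unfolding multiplicity_of_def using 1 by auto
  next
    case False
    \<comment> \<open>A finite spanning set on the other side would produce one here, so both
      multiplicities are infinite.\<close>
    then have "\<not> (\<exists>C. finite C \<and> ?E2 \<subseteq> form_space.span C)" using 2 by blast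
    with False show ?thesis unfolding multiplicity_of_def by (simp only: if_False)
  qed
qed

section \<open>Splitting off the kernel\<close>

lemma hermitian_on_subset: "hermitian_on W H \<Longrightarrow> W' \<subseteq> W \<Longrightarrow> hermitian_on W' H"
  unfolding hermitian_on_def by blast

lemma subspace_UNIV_complex: "complex_space.subspace UNIV"
  by simp

text \<open>Integral multiples reduce to repeated sums and one negation, so properties of lattice
  vectors can be checked on a basis without handling coefficients.\<close>

lemma int_span_closure:
  fixes C :: "'a::real_vector set"
  assumes x: "x \<in> int_module.span C" and N0: "N 0" and Nadd: "\<And>x y. N x \<Longrightarrow> N y \<Longrightarrow> N (x + y)"
    and Nneg: "\<And>x. N x \<Longrightarrow> N (- x)" and NC: "\<And>c. c \<in> C \<Longrightarrow> N c"
  shows "N x"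
proof -
  have Nnat: "N (real n *\<^sub>R x)" if x: "N x" for n x
  proof (induct n)
    case (Suc n)
    have "real (Suc n) *\<^sub>R x = real n *\<^sub>R x + x" by (simp add: scaleR_add_left)
    then show ?case using Nadd[OF Suc x] by simp
  qed (simp add: N0)
  have Nint: "N (of_int k *\<^sub>R x)" if x: "N x" for k x
  proof (cases k rule: int_cases2)
    case (nonneg n)
    then show ?thesis using Nnat[OF x, of n] by simp
  next
    case (nonpos n)
    then show ?thesis using Nneg[OF Nnat[OF x, of n]] by simp
  qed
  have "int_module.subspace {x. N x}"
    using N0 Nadd Nint by (simp add: int_module.subspace_def)
  moreover have "C \<subseteq> {x. N x}" using NC by blast
  ultimately show ?thesis using int_module.span_minimal[of C "{x. N x}"] x by blast
qed

text \<open>\<open>s\<close> is the complex-linear section with values in the orthogonal complement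
  of the kernel. The forms on the quotient enter only through their values on images under
  \<open>pr\<close>, so everything about them is derived on \<open>range pr\<close>.\<close>

locale kernel_splitting =
  fixes g H :: "'a::complex_euclidean \<Rightarrow> 'a \<Rightarrow> complex" and U :: "'a set" and \<alpha> :: "'a \<Rightarrow> complex"
    and pr :: "'a \<Rightarrow> 'b::complex_euclidean" and g'' H'' :: "'b \<Rightarrow> 'b \<Rightarrow> complex" and \<beta> :: "'b \<Rightarrow> complex"
    and s :: "'b \<Rightarrow> 'a"
  assumes g: "hermitian g" "positive_definite g" and U: "is_lattice UNIV U"
    and H: "hermitian H" and H_int: "\<forall>u\<in>U. \<forall>v\<in>U. Im (H u v) \<in> \<int>"
    and \<alpha>: "semicharacter H U \<alpha>"
    and pr: "Vector_Spaces.linear scaleC scaleC pr" and pr_ker: "{v. pr v = 0} = form_kernel H"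
    and H'': "\<forall>v w. H'' (pr v) (pr w) = H v w"
    and g'': "\<forall>v\<in>form_orthogonal g (form_kernel H). \<forall>w\<in>form_orthogonal g (form_kernel H). g'' (pr v) (pr w) = g v w"
    and \<beta>: "semicharacter H'' (pr ` U) \<beta>"
    and s: "Vector_Spaces.linear scaleC scaleC s" and s_orth: "\<And>x. s x \<in> form_orthogonal g (form_kernel H)"
    and pr_s: "\<And>x. x \<in> range pr \<Longrightarrow> pr (s x) = x"
begin

abbreviation V' where "V' \<equiv> form_kernel H"
abbreviation U' where "U' \<equiv> U \<inter> V'"
abbreviation U'' where "U'' \<equiv> pr ` U"

lemma g_on: "hermitian_on W g" and H_on: "hermitian_on W H"
  using hermitian_on_subset[OF hermitian_on_UNIV] g(1) H by blast+

lemma pr_lin: "linear pr" and s_lin: "linear s"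
  using complex_linear_imp_linear pr s by blast+

lemma V'_iff: "v \<in> V' \<longleftrightarrow> pr v = 0"
  using pr_ker by blast

lemma V'_left: "v \<in> V' \<Longrightarrow> H v w = 0"
  by (simp add: form_kernel_def)

lemma V'_right: "v \<in> V' \<Longrightarrow> H w v = 0"
  using hermitian_on_cnj[OF H_on, of v UNIV w] V'_left[of v w] by simp

lemma V'_subspace: "complex_space.subspace V'"
proof -
  have "pr (x + y) = pr x + pr y" "pr (c *\<^sub>C x) = c *\<^sub>C pr x" for x y c
    using pr by (simp_all add: Vector_Spaces.linear_iff)
  then show ?thesis
    by (auto simp: complex_space.subspace_def V'_iff linear_0[OF pr_lin])
qed

lemma V'_real_subspace: "subspace V'"
  using complex_subspace_imp_subspace[OF V'_subspace] .

lemma V'_diff_s: "v - s (pr v) \<in> V'"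
  by (simp add: V'_iff linear_diff[OF pr_lin] pr_s)

lemma H_right_V': "w - w' \<in> V' \<Longrightarrow> H v w = H v w'"
  using hermitian_on_add_right[OF subspace_UNIV_complex H_on, of w' "w - w'" v] V'_right[of "w - w'" v] by simp

lemma U_subspace: "int_module.subspace U"
  using U by (simp add: is_lattice_def)

lemma U_discrete: "uniform_discrete U"
  using U discrete_subgroup_uniform by (auto simp: is_lattice_def)

lemma U_span: "span U = UNIV"
proof -
  obtain B where B: "lattice_basis U B" "card B = dim (UNIV :: 'a set)"
    using U by (auto simp: is_lattice_def)
  have "independent B" using lattice_basis_independent[OF B(1) U_discrete] .
  then have "UNIV \<subseteq> span B"
    using card_eq_dim[of B UNIV] B by (auto simp: lattice_basis_def)
  then show ?thesis using lattice_basis_span[OF B(1)] by blast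
qed

lemma U''_subspace: "int_module.subspace U''"
  unfolding int_module.subspace_def
proof (intro conjI ballI allI)
  show "0 \<in> U''" using int_module.subspace_0[OF U_subspace] linear_0[OF pr_lin] by (metis image_eqI)
  show "x + y \<in> U''" if "x \<in> U''" "y \<in> U''" for x y
    using that int_module.subspace_add[OF U_subspace] by (auto simp: linear_add[OF pr_lin, symmetric])
  show "of_int k *\<^sub>R x \<in> U''" if "x \<in> U''" for k x
    using that int_module.subspace_scale[OF U_subspace] by (auto simp: linear_scale[OF pr_lin, symmetric])
qed

lemma U''_span: "span U'' = range pr"
  using linear_span_image[OF pr_lin, of U] U_span by simp

text \<open>The real part of H(v,w) is, up to sign, the imaginary part of H(v, i w), so the
  imaginary part decides membership in the kernel; by real linearity it may be tested on a spanning
  set.\<close>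

lemma kernelI:
  assumes "span B = UNIV" "\<And>b. b \<in> B \<Longrightarrow> Im (H v b) = 0"
  shows "v \<in> V'"
proof -
  have rl: "rlinear_on UNIV (\<lambda>w. H v w)" by (rule rlinear_hermitian_right[OF subspace_UNIV_complex H_on]) simp
  have im: "Im (H v w) = 0" for w
  proof -
    have "w \<in> span B" using assms(1) by simp
    then show ?thesis
    proof (induct rule: span_induct_alt)
      case base
      then show ?case using rlinear_on_0[OF rl] by simp
    next
      case (step c x y)
      then show ?case using assms(2) by (simp add: rlinear_on_add[OF rl] rlinear_on_scale[OF rl])
    qed
  qed
  have "Re (H v w) = 0" for w
    using im[of "\<i> *\<^sub>C w"] hermitian_on_scale_right[OF subspace_UNIV_complex H_on, of w v \<i>] by simp
  with im show ?thesis by (simp add: form_kernel_def complex_eq_iff)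
qed

lemma H''_s: "x \<in> range pr \<Longrightarrow> H'' x (pr w) = H (s x) w"
  using H'' pr_s by metis

text \<open>Integrality of Im H is what keeps the image of the lattice discrete. For a short x = pr
  u the numbers Im H(u,b) are integers and equal Im H(s x, b), which is less than 1 in modulus; so
  they vanish for all b in a basis, and s x lies in the kernel.\<close>

lemma U''_discrete: "uniform_discrete U''"
  unfolding discrete_subgroup_iff[OF U''_subspace]
proof -
  obtain B where B: "lattice_basis U B" using U by (auto simp: is_lattice_def)
  have finB: "finite B" and spB: "span B = UNIV" and BU: "B \<subseteq> U"
    using B lattice_basis_span[OF B] U_span lattice_basis_subset[OF B] by (auto simp: lattice_basis_def)
  have "\<exists>K>0. \<forall>x. \<bar>Im (H (s x) b)\<bar> \<le> K * norm x" for b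
  proof -
    have rl: "rlinear_on UNIV (\<lambda>v. H v b)" by (rule rlinear_hermitian_left[OF subspace_UNIV_complex H_on]) simp
    have "linear (\<lambda>x. Im (H (s x) b))"
      by (rule linearI) (simp_all add: linear_add[OF s_lin] linear_scale[OF s_lin] rlinear_on_add[OF rl] rlinear_on_scale[OF rl])
    then have "bounded_linear (\<lambda>x. Im (H (s x) b))" by (simp add: linear_conv_bounded_linear)
    then obtain K where "K > 0" "\<And>x. norm (Im (H (s x) b)) \<le> norm x * K" using bounded_linear.pos_bounded by blast
    then show ?thesis by (intro exI[of _ K]) (simp add: mult.commute)
  qed
  then obtain K where K: "\<And>b. K b > 0" "\<And>b x. \<bar>Im (H (s x) b)\<bar> \<le> K b * norm x" by metis
  \<comment> \<open>A common bound for the finitely many functionals; the added 1 keeps it positive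
    when \<open>B\<close> is empty.\<close>
  define M where "M = (\<Sum>b\<in>B. K b) + 1"
  have M: "M > 0" unfolding M_def using K(1) by (intro add_nonneg_pos sum_nonneg) (auto intro: less_imp_le)
  have KM: "K b \<le> M" if "b \<in> B" for b
    using member_le_sum[of b B K] that finB K(1) by (simp add: M_def less_imp_le add_increasing2)
  have "x = 0" if x: "x \<in> U''" "norm x < 1 / M" for x
  proof -
    obtain u where u: "u \<in> U" "x = pr u" using x by blast
    have "Im (H (s x) b) = 0" if b: "b \<in> B" for b
    proof -
      have "H (s x) b = H u b" using H''_s[of x b] H'' u by auto
      then have "Im (H (s x) b) \<in> \<int>" using H_int u b BU by auto
      moreover have "\<bar>Im (H (s x) b)\<bar> < 1"
      proof -
        have "\<bar>Im (H (s x) b)\<bar> \<le> K b * norm x" using K(2) .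
        also have "\<dots> \<le> M * norm x" using KM[OF b] by (intro mult_right_mono) auto
        also have "\<dots> < 1" using x(2) M by (simp add: field_simps)
        finally show ?thesis .
      qed
      ultimately show ?thesis by (auto elim!: Ints_cases)
    qed
    then have "s x \<in> V'" using kernelI[of B] spB by blast
    then show "x = 0" using pr_s[of x] u by (simp add: V'_iff)
  qed
  then show "\<exists>e>0. \<forall>x\<in>U''. norm x < e \<longrightarrow> x = 0" using M by (intro exI[of _ "1 / M"]) auto
qed

lemma U'_subspace: "int_module.subspace U'"
  unfolding int_module.subspace_def
  using int_module.subspace_0[OF U_subspace] int_module.subspace_add[OF U_subspace] int_module.subspace_scale[OF U_subspace]
    subspace_0[OF V'_real_subspace] subspace_add[OF V'_real_subspace] subspace_scale[OF V'_real_subspace]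
  by auto

text \<open>U' together with lifts of a basis of U'' generates U and hence spans V. In a kernel
  vector the lifted part must be 0, because the projected lifts are independent over the reals; this
  is where discreteness of U'' enters.\<close>

lemma U'_span: "span U' = V'"
proof
  show "span U' \<subseteq> V'" using V'_real_subspace by (simp add: span_minimal)
  obtain C where C: "lattice_basis U'' C" using discrete_subgroup_basis[OF U''_subspace U''_discrete] by blast
  have finC: "finite C" and spC: "int_module.span C = U''" using C by (auto simp: lattice_basis_def)
  have indC: "independent C" using lattice_basis_independent[OF C U''_discrete] .
  have "\<forall>c\<in>C. \<exists>u. u \<in> U \<and> pr u = c" using lattice_basis_subset[OF C] by blast
  from bchoice[OF this] obtain l where l: "\<And>c. c \<in> C \<Longrightarrow> l c \<in> U" "\<And>c. c \<in> C \<Longrightarrow> pr (l c) = c" by blast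
  have "U \<subseteq> span (U' \<union> l ` C)"
  proof
    fix u assume u: "u \<in> U"
    then have "pr u \<in> int_module.span C" using spC by blast
    then obtain k where k: "pr u = (\<Sum>c\<in>C. of_int (k c) *\<^sub>R c)" by (auto simp: int_span_finite[OF finC])
    define y where "y = (\<Sum>c\<in>C. of_int (k c) *\<^sub>R l c)"
    have yU: "y \<in> U" unfolding y_def
      by (intro int_module.subspace_sum[OF U_subspace] int_module.subspace_scale[OF U_subspace] l(1))
    have "pr y = pr u" unfolding k y_def by (simp add: linear_sum[OF pr_lin] linear_scale[OF pr_lin] l(2))
    then have "u - y \<in> U'" using int_module.subspace_diff[OF U_subspace u yU] by (simp add: V'_iff linear_diff[OF pr_lin])
    then have "u - y \<in> span (U' \<union> l ` C)" by (intro span_base) simp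
    moreover have "y \<in> span (U' \<union> l ` C)" unfolding y_def by (intro span_sum span_scale span_base) simp
    ultimately have "u - y + y \<in> span (U' \<union> l ` C)" by (rule span_add)
    then show "u \<in> span (U' \<union> l ` C)" by simp
  qed
  then have all: "v \<in> span (U' \<union> l ` C)" for v
    using span_minimal[of U "span (U' \<union> l ` C)"] U_span by auto
  show "V' \<subseteq> span U'"
  proof
    fix v assume v: "v \<in> V'"
    obtain x y where xy: "v = x + y" "x \<in> span U'" "y \<in> span (l ` C)" using all[of v] unfolding span_Un by blast
    obtain t where t: "y = (\<Sum>w\<in>l ` C. t w *\<^sub>R w)" using xy(3) finC by (auto simp: span_finite)
    have inj: "inj_on l C" by (rule inj_onI) (metis l(2))
    have y: "y = (\<Sum>c\<in>C. t (l c) *\<^sub>R l c)" unfolding t by (simp add: sum.reindex[OF inj])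
    have "x \<in> V'" using xy(2) span_minimal[of U' V'] V'_real_subspace by auto
    then have "pr y = 0" using v xy(1) by (simp add: V'_iff linear_add[OF pr_lin])
    then have "(\<Sum>c\<in>C. t (l c) *\<^sub>R c) = 0"
      unfolding y by (simp add: linear_sum[OF pr_lin] linear_scale[OF pr_lin] l(2))
    then have "t (l c) = 0" if "c \<in> C" for c
      using independentD[OF indC finC order_refl, of "\<lambda>c. t (l c)"] that by blast
    then have "y = 0" unfolding y by simp
    then show "v \<in> span U'" using xy by simp
  qed
qed

section \<open>Multipliers on U and U'' and the compensating translation\<close>

lemma cis_exp: "exp (\<i> * of_real x) = cis x"
  by (simp add: cis_conv_exp)

lemma \<alpha>_norm: "u \<in> U \<Longrightarrow> cmod (\<alpha> u) = 1"
  and \<alpha>_add: "u \<in> U \<Longrightarrow> v \<in> U \<Longrightarrow> \<alpha> (u + v) = \<alpha> u * \<alpha> v * cis (pi * Im (H u v))"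
  using \<alpha> unfolding semicharacter_def cis_exp by blast+

lemma \<beta>_norm: "x \<in> U'' \<Longrightarrow> cmod (\<beta> x) = 1"
  and \<beta>_add: "x \<in> U'' \<Longrightarrow> y \<in> U'' \<Longrightarrow> \<beta> (x + y) = \<beta> x * \<beta> y * cis (pi * Im (H'' x y))"
  using \<beta> unfolding semicharacter_def cis_exp by blast+

lemma H_zero: "H 0 0 = 0"
  using V'_left[of 0] by (simp add: V'_iff linear_0[OF pr_lin])

lemma zero_U: "0 \<in> U" using int_module.subspace_0[OF U_subspace] .

lemma \<alpha>_zero: "\<alpha> 0 = 1"
proof -
  have "\<alpha> 0 = \<alpha> 0 * \<alpha> 0" using \<alpha>_add[OF zero_U zero_U] H_zero by simp
  moreover have "\<alpha> 0 \<noteq> 0" using \<alpha>_norm[OF zero_U] by auto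
  ultimately show ?thesis by simp
qed

lemma \<beta>_zero: "\<beta> 0 = 1"
proof -
  have z: "0 \<in> U''" using int_module.subspace_0[OF U''_subspace] .
  have "H'' 0 0 = 0" using H''[rule_format, of 0 0] H_zero by (simp add: linear_0[OF pr_lin])
  then have "\<beta> 0 = \<beta> 0 * \<beta> 0" using \<beta>_add[OF z z] by simp
  moreover have "\<beta> 0 \<noteq> 0" using \<beta>_norm[OF z] by auto
  ultimately show ?thesis by simp
qed

lemma \<alpha>_neg: assumes u: "u \<in> U" shows "\<alpha> (- u) * \<alpha> u = 1" "- u \<in> U"
proof -
  show nu: "- u \<in> U" using int_module.subspace_neg[OF U_subspace u] .
  have "H (- u) u = - H u u"
    using rlinear_on_scale[OF rlinear_hermitian_left[OF subspace_UNIV_complex H_on], of u u "-1"] by simp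
  moreover have "Im (H u u) = 0" using hermitian_on_diag_real[OF subspace_UNIV_complex H_on, of u] by (metis Im_complex_of_real UNIV_I)
  ultimately show "\<alpha> (- u) * \<alpha> u = 1" using \<alpha>_add[OF nu u] \<alpha>_zero by simp
qed

lemma \<beta>_neg: assumes x: "x \<in> U''" shows "\<beta> (- x) * \<beta> x = 1" "- x \<in> U''"
proof -
  show nx: "- x \<in> U''" using int_module.subspace_neg[OF U''_subspace x] .
  obtain u where u: "x = pr u" using x by blast
  have "H'' (- x) x = H (- u) u" using H'' unfolding u linear_neg[OF pr_lin, symmetric] by blast
  moreover have "H (- u) u = - H u u"
    using rlinear_on_scale[OF rlinear_hermitian_left[OF subspace_UNIV_complex H_on], of u u "-1"] by simp
  moreover have "Im (H u u) = 0" using hermitian_on_diag_real[OF subspace_UNIV_complex H_on, of u] by (metis Im_complex_of_real UNIV_I)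
  ultimately show "\<beta> (- x) * \<beta> x = 1" using \<beta>_add[OF nx x] \<beta>_zero by simp
qed

text \<open>\<open>Im H\<close> is nondegenerate modulo its kernel, so it represents every functional that factors
  through \<open>pr\<close>.\<close>

lemma functional_represented:
  assumes f: "linear (f :: 'b \<Rightarrow> real)"
  shows "\<exists>a. \<forall>w. Im (H a w) = f (pr w)"
proof -
  note rlL = rlinear_hermitian_left[OF subspace_UNIV_complex H_on]
  \<comment> \<open>Functionals of the form Im H(a, .), written as vectors through the ambient inner
    product, which serves only as a duality.\<close>
  define S where "S = {r. \<exists>a. \<forall>w. w \<bullet> r = Im (H a w)}"
  have S: "subspace S"
    unfolding subspace_def
  proof (intro conjI ballI allI)
    show "0 \<in> S" unfolding S_def using V'_left[of 0] by (auto simp: V'_iff linear_0[OF pr_lin] intro!: exI[of _ 0])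
    show "x + y \<in> S" if "x \<in> S" "y \<in> S" for x y
    proof -
      obtain a b where "\<forall>w. w \<bullet> x = Im (H a w)" "\<forall>w. w \<bullet> y = Im (H b w)" using \<open>x \<in> S\<close> \<open>y \<in> S\<close> by (auto simp: S_def)
      then show ?thesis unfolding S_def
        by (intro CollectI exI[of _ "a + b"]) (simp add: inner_add_right rlinear_on_add[OF rlL])
    qed
    show "c *\<^sub>R x \<in> S" if "x \<in> S" for c x
    proof -
      obtain a where "\<forall>w. w \<bullet> x = Im (H a w)" using \<open>x \<in> S\<close> by (auto simp: S_def)
      then show ?thesis unfolding S_def
        by (intro CollectI exI[of _ "c *\<^sub>R a"]) (simp add: rlinear_on_scale[OF rlL])
    qed
  qed
  have linfpr: "linear (\<lambda>w. f (pr w))" using linear_compose[OF pr_lin f] by (simp add: o_def)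
  define r where "r = adjoint (\<lambda>w. f (pr w)) 1"
  have r: "w \<bullet> r = f (pr w)" for w unfolding r_def using adjoint_works[OF linfpr, of w 1] by simp
  obtain y z where yz: "y \<in> span S" "\<And>w. w \<in> span S \<Longrightarrow> orthogonal z w" "r = y + z"
    using orthogonal_subspace_decomp_exists[of S r] by blast
  have spS: "span S = S" using S by (simp add: span_eq_iff)
  \<comment> \<open>A vector orthogonal to all of S is annihilated by every Im H(w, .), hence lies
    in the kernel, where \<open>f (pr _)\<close> vanishes. So z is orthogonal to r as well and must
    be 0.\<close>
  have "Im (H z w) = 0" for w
  proof -
    define l where "l v = Im (H w v)" for v
    have "linear l" unfolding l_def
      by (rule linearI) (simp_all add: rlinear_on_add[OF rlinear_hermitian_right[OF subspace_UNIV_complex H_on]]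
        rlinear_on_scale[OF rlinear_hermitian_right[OF subspace_UNIV_complex H_on]])
    then have adj: "v \<bullet> adjoint l 1 = Im (H w v)" for v using adjoint_works[of l v 1] by (simp add: l_def)
    then have "adjoint l 1 \<in> S" unfolding S_def by blast
    then have "Im (H w z) = 0" using yz(2) spS adj[of z] by (simp add: orthogonal_def)
    moreover have "Im (H z w) = - Im (H w z)" using hermitian_on_cnj[OF H_on, of w UNIV z, symmetric] by simp
    ultimately show ?thesis by simp
  qed
  then have "z \<in> V'" using kernelI[of UNIV z] by simp
  then have "z \<bullet> r = 0" using r[of z] linear_0[OF f] by (simp add: V'_iff)
  moreover have "z \<bullet> y = 0" using yz(1,2) by (simp add: orthogonal_def)
  ultimately have "z = 0" using yz(3) by (simp add: inner_add_right)
  then have "r \<in> S" using yz spS by simp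
  then show ?thesis using r by (auto simp: S_def)
qed

lemma unit_phase:
  assumes "cmod w = 1" obtains \<theta> where "cis (2 * pi * \<theta>) = w"
proof -
  have "cis (2 * pi * (Arg w / (2 * pi))) = w"
    using rcis_cmod_Arg[of w] assms by (simp add: rcis_def)
  then show ?thesis using that by blast
qed

text \<open>The requirement on a at one vector x of U'' with lift v: the ratio of
  \<open>\<beta> x\<close> and \<open>\<alpha> v\<close>, and the phase of the kernel vector by
  which the section misses the lift, are made up by the phase of the translation.\<close>

definition matches :: "('a \<Rightarrow> real) \<Rightarrow> 'a \<Rightarrow> 'b \<Rightarrow> 'a \<Rightarrow> bool" where
  "matches \<kappa> a x v \<longleftrightarrow> \<beta> x = \<alpha> v * cis (2 * pi * Im (H a v)) * cis (2 * pi * \<kappa> (s x - v))"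

context
  fixes \<kappa> :: "'a \<Rightarrow> real"
  assumes \<kappa>: "linear \<kappa>" and \<kappa>_U': "\<And>u. u \<in> U' \<Longrightarrow> cis (2 * pi * \<kappa> u) = \<alpha> u"
begin

text \<open>Two lifts differ by a vector of U'. There the functional \<open>\<kappa>\<close>
  reproduces \<alpha>, and Im H(a, .) does not see it.\<close>

lemma matches_indep:
  assumes v: "v \<in> U" "s x - v \<in> V'" and w: "w \<in> U" "s x - w \<in> V'" and m: "matches \<kappa> a x v"
  shows "matches \<kappa> a x w"
proof -
  define u where "u = w - v"
  have "u = (s x - v) - (s x - w)" by (simp add: u_def)
  then have uV: "u \<in> V'" using subspace_diff[OF V'_real_subspace v(2) w(2)] by simp
  have uU: "u \<in> U" unfolding u_def using int_module.subspace_diff[OF U_subspace w(1) v(1)] .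
  have wu: "w = v + u" by (simp add: u_def)
  have "\<alpha> w = \<alpha> v * \<alpha> u" unfolding wu using \<alpha>_add[OF v(1) uU] V'_right[OF uV, of v] by simp
  moreover have "H a w = H a v" by (rule H_right_V') (use uV in \<open>simp add: u_def\<close>)
  moreover have "\<alpha> u * cis (2 * pi * \<kappa> (s x - w)) = cis (2 * pi * \<kappa> (s x - v))"
  proof -
    have "\<kappa> (s x - v) = \<kappa> u + \<kappa> (s x - w)"
      unfolding linear_add[OF \<kappa>, symmetric] by (simp add: u_def)
    then show ?thesis using \<kappa>_U'[of u] uU uV by (simp add: cis_mult[symmetric] distrib_left)
  qed
  ultimately show ?thesis
    using m unfolding matches_def by (simp add: ac_simps)
qed

text \<open>\<alpha> and \<beta> obey the same cocycle, since the form on U'' is induced by H. It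
  cancels in the comparison, which leaves an identity between characters.\<close>

lemma matches_add:
  assumes x: "x \<in> U''" "v \<in> U" "pr v = x" "matches \<kappa> a x v" and y: "y \<in> U''" "w \<in> U" "pr w = y" "matches \<kappa> a y w"
  shows "matches \<kappa> a (x + y) (v + w)"
proof -
  have "H'' x y = H v w" using H'' x(3) y(3) by blast
  moreover have "H a (v + w) = H a v + H a w" using hermitian_on_add_right[OF subspace_UNIV_complex H_on] by simp
  moreover have "\<kappa> (s (x + y) - (v + w)) = \<kappa> (s x - v) + \<kappa> (s y - w)"
    unfolding linear_add[OF \<kappa>, symmetric] by (simp add: linear_add[OF s_lin] algebra_simps)
  ultimately show ?thesis
    using x(4) y(4) \<beta>_add[OF x(1) y(1)] \<alpha>_add[OF x(2) y(2)]
    unfolding matches_def by (simp add: distrib_left cis_mult[symmetric] ac_simps)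
qed

lemma matches_neg:
  assumes x: "x \<in> U''" "v \<in> U" "matches \<kappa> a x v"
  shows "matches \<kappa> a (- x) (- v)"
proof -
  define P where "P = cis (2 * pi * Im (H a v))" 
  define Q where "Q = cis (2 * pi * \<kappa> (s x - v))"
  have "H a (- v) = - H a v"
    using rlinear_on_scale[OF rlinear_hermitian_right[OF subspace_UNIV_complex H_on], of a v "-1"] by simp
  then have P': "cis (2 * pi * Im (H a (- v))) = inverse P" by (simp add: P_def)
  have "\<kappa> (s (- x) - - v) = - \<kappa> (s x - v)"
    unfolding linear_neg[OF \<kappa>, symmetric] by (simp add: linear_neg[OF s_lin])
  then have Q': "cis (2 * pi * \<kappa> (s (- x) - - v)) = inverse Q" by (simp add: Q_def)
  have "\<beta> (- x) = inverse (\<beta> x)" using \<beta>_neg(1)[OF x(1)] by (metis inverse_unique mult.commute)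
  also have "\<beta> x = \<alpha> v * P * Q" using x(3) by (simp add: matches_def P_def Q_def)
  also have "inverse (\<alpha> v * P * Q) = inverse (\<alpha> v) * inverse P * inverse Q" by simp
  also have "inverse (\<alpha> v) = \<alpha> (- v)" using \<alpha>_neg(1)[OF x(2)] by (metis inverse_unique mult.commute)
  finally show ?thesis unfolding matches_def P' Q' .
qed

text \<open>On an integral basis of U'' the required phases can be prescribed freely. This basis is
  independent over the reals, so their logarithms extend to a real functional, and nondegeneracy
  modulo the kernel represents it by some a.\<close>

lemma translation_exists:
  "\<exists>a. \<forall>x\<in>U''. \<forall>v\<in>U. s x - v \<in> V' \<longrightarrow> matches \<kappa> a x v"
proof -
  obtain C where C: "lattice_basis U'' C" using discrete_subgroup_basis[OF U''_subspace U''_discrete] by blast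
  have spC: "int_module.span C = U''" using C by (auto simp: lattice_basis_def)
  have indC: "independent C" using lattice_basis_independent[OF C U''_discrete] .
  have CU: "C \<subseteq> U''" using lattice_basis_subset[OF C] .
  have "\<forall>c\<in>C. \<exists>u. u \<in> U \<and> pr u = c" using CU by blast
  from bchoice[OF this] obtain l where l: "\<And>c. c \<in> C \<Longrightarrow> l c \<in> U" "\<And>c. c \<in> C \<Longrightarrow> pr (l c) = c" by blast
  have "\<forall>c\<in>C. \<exists>\<theta>. cis (2 * pi * \<theta>) = \<beta> c / (\<alpha> (l c) * cis (2 * pi * \<kappa> (s c - l c)))"
  proof
    fix c assume c: "c \<in> C"
    have "cmod (\<beta> c / (\<alpha> (l c) * cis (2 * pi * \<kappa> (s c - l c)))) = 1"
      using \<beta>_norm[of c] \<alpha>_norm[OF l(1)[OF c]] c CU by (auto simp: norm_divide norm_mult)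
    then show "\<exists>\<theta>. cis (2 * pi * \<theta>) = \<beta> c / (\<alpha> (l c) * cis (2 * pi * \<kappa> (s c - l c)))"
      using unit_phase by blast
  qed
  from bchoice[OF this] obtain \<theta> where
    \<theta>: "\<And>c. c \<in> C \<Longrightarrow> cis (2 * pi * \<theta> c) = \<beta> c / (\<alpha> (l c) * cis (2 * pi * \<kappa> (s c - l c)))" by blast
  obtain f where f: "linear f" "\<forall>c\<in>C. f c = \<theta> c"
    using real_vector.linear_independent_extend[OF indC, of \<theta>] by (auto simp: linear_def)
  obtain a where a: "\<And>w. Im (H a w) = f (pr w)" using functional_represented[OF f(1)] by blast
  \<comment> \<open>Only some matching lift is carried through the induction; the passage to every
    lift is made once, at the end.\<close>
  define N where "N x \<longleftrightarrow> x \<in> U'' \<and> (\<exists>v\<in>U. pr v = x \<and> matches \<kappa> a x v)" for x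
  have N0: "N 0"
    unfolding N_def using zero_U linear_0[OF pr_lin] int_module.subspace_0[OF U''_subspace] linear_0[OF f(1)]
    by (auto intro!: bexI[of _ 0] simp: matches_def \<alpha>_zero \<beta>_zero a linear_0[OF s_lin] linear_0[OF \<kappa>])
  have Nadd: "N (x + y)" if xy: "N x" "N y" for x y
  proof -
    obtain v w where v: "v \<in> U" "pr v = x" "matches \<kappa> a x v" and w: "w \<in> U" "pr w = y" "matches \<kappa> a y w"
      and xy': "x \<in> U''" "y \<in> U''" using xy by (auto simp: N_def)
    have "matches \<kappa> a (x + y) (v + w)" using matches_add[OF xy'(1) v xy'(2) w] .
    moreover have "pr (v + w) = x + y" using v w by (simp add: linear_add[OF pr_lin])
    ultimately show ?thesis
      unfolding N_def
      using int_module.subspace_add[OF U_subspace v(1) w(1)] int_module.subspace_add[OF U''_subspace xy'] by blast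
  qed
  have Nneg: "N (- x)" if x: "N x" for x
  proof -
    obtain v where v: "v \<in> U" "pr v = x" "matches \<kappa> a x v" and x': "x \<in> U''" using x by (auto simp: N_def)
    have "matches \<kappa> a (- x) (- v)" using matches_neg[OF x' v(1,3)] .
    moreover have "pr (- v) = - x" using v by (simp add: linear_neg[OF pr_lin])
    ultimately show ?thesis unfolding N_def using \<alpha>_neg(2)[OF v(1)] \<beta>_neg(2)[OF x'] by blast
  qed
  have NC: "N c" if c: "c \<in> C" for c
  proof -
    have "\<alpha> (l c) \<noteq> 0" using \<alpha>_norm[OF l(1)[OF c]] by auto
    moreover have "Im (H a (l c)) = \<theta> c" using a l(2)[OF c] f(2) c by simp
    ultimately have "matches \<kappa> a c (l c)"
      unfolding matches_def using \<theta>[OF c] by (simp add: field_simps)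
    then show ?thesis unfolding N_def using c CU l[OF c] by blast
  qed
  have N: "N x" if "x \<in> U''" for x
    using int_span_closure[of x C N] that spC N0 Nadd Nneg NC by blast
  have "matches \<kappa> a x v" if x: "x \<in> U''" and v: "v \<in> U" "s x - v \<in> V'" for x v
  proof -
    obtain w where w: "w \<in> U" "pr w = x" "matches \<kappa> a x w" using N[OF x] by (auto simp: N_def)
    have "s x - w \<in> V'" using x w(2) pr_s[of x] by (auto simp: V'_iff linear_diff[OF pr_lin])
    then show ?thesis using matches_indep[OF w(1) _ v w(3)] by blast
  qed
  then show ?thesis by blast
qed

end

end

text \<open>The product metric and the pulled back form are built from data on the quotient that are
  known only by their values. They inherit sesquilinearity from V through the splitting map.\<close>

lemma hermitian_on_pullback:
  assumes H: "hermitian_on UNIV H" and f: "Vector_Spaces.linear scaleC scaleC f"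
    and W: "complex_space.subspace W" and eq: "\<And>x y. x \<in> W \<Longrightarrow> y \<in> W \<Longrightarrow> H (f x) (f y) = H' x y"
  shows "hermitian_on W H'"
proof -
  have f: "f (x + y) = f x + f y" "f (c *\<^sub>C x) = c *\<^sub>C f x" for x y c
    using f by (simp_all add: Vector_Spaces.linear_iff)
  show ?thesis
    unfolding hermitian_on_def
  proof (intro conjI ballI allI)
    fix x y z assume xyz: "x \<in> W" "y \<in> W" "z \<in> W"
    have "x + y \<in> W" using complex_space.subspace_add[OF W xyz(1,2)] .
    then show "H' (x + y) z = H' x z + H' y z"
      using xyz hermitian_on_add_left[OF H, of "f x" "f y" "f z"] by (simp add: eq[symmetric] f)
  next
    fix c x y assume xy: "x \<in> W" "y \<in> W"
    have "c *\<^sub>C x \<in> W" using complex_space.subspace_scale[OF W xy(1)] .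
    then show "H' (c *\<^sub>C x) y = c * H' x y"
      using xy hermitian_on_scale_left[OF H, of "f x" "f y"] by (simp add: eq[symmetric] f)
  next
    fix x y assume xy: "x \<in> W" "y \<in> W"
    then show "H' y x = cnj (H' x y)"
      using hermitian_on_cnj[OF H, of "f x" "f y"] by (simp add: eq[symmetric])
  qed
qed

text \<open>With 0 in both factors, the two axes of the product contain copies of A and B, whose
  spans add up to the product of the spans.\<close>

lemma span_Times:
  assumes "0 \<in> A" "0 \<in> B"
  shows "span (A \<times> B) = span A \<times> span B"
proof
  show "span (A \<times> B) \<subseteq> span A \<times> span B"
    by (intro span_minimal subspace_Times subspace_span) (auto intro: span_base)
  have l: "linear (\<lambda>x. (x, 0))" and r: "linear (\<lambda>y. (0, y))"
    by (rule linearI; simp)+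
  have "(x, y) \<in> span (A \<times> B)" if "x \<in> span A" "y \<in> span B" for x y
  proof -
    have "(x, 0) \<in> span ((\<lambda>x. (x, 0)) ` A)" using that(1) linear_span_image[OF l, of A] by blast
    also have "\<dots> \<subseteq> span (A \<times> B)" using assms by (intro span_mono) auto
    finally have 1: "(x, 0) \<in> span (A \<times> B)" .
    have "(0, y) \<in> span ((\<lambda>y. (0, y)) ` B)" using that(2) linear_span_image[OF r, of B] by blast
    also have "\<dots> \<subseteq> span (A \<times> B)" using assms by (intro span_mono) auto
    finally have "(0, y) \<in> span (A \<times> B)" .
    from span_add[OF 1 this] show ?thesis by simp
  qed
  then show "span A \<times> span B \<subseteq> span (A \<times> B)" by auto
qed

text \<open>Positivity makes \<open>pr\<close> injective on the orthogonal complement N of its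
  kernel K. Since every vector splits along K and N, a left inverse of \<open>pr\<close> on N with
  values in N is a section over the range.\<close>

lemma orthogonal_section_exists:
  fixes g :: "'a::complex_euclidean \<Rightarrow> 'a \<Rightarrow> complex" and pr :: "'a \<Rightarrow> 'b::complex_euclidean"
  assumes g: "hermitian g" "positive_definite g" and pr: "Vector_Spaces.linear scaleC scaleC pr"
  shows "\<exists>s. Vector_Spaces.linear scaleC scaleC s \<and> (\<forall>x. s x \<in> form_orthogonal g {v. pr v = 0}) \<and>
    (\<forall>x\<in>range pr. pr (s x) = x)"
proof -
  define K where "K = {v. pr v = 0}"
  define N where "N = form_orthogonal g K"
  have pr_simps: "pr (x + y) = pr x + pr y" "pr (c *\<^sub>C x) = c *\<^sub>C pr x" for x y c
    using pr by (simp_all add: Vector_Spaces.linear_iff)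
  have prl: "linear pr" using complex_linear_imp_linear[OF pr] .
  have pr_diff: "pr (x - y) = pr x - pr y" for x y using linear_diff[OF prl] .
  have gU: "hermitian_on UNIV g" using hermitian_on_UNIV[OF g(1)] .
  note g_left = hermitian_on_add_left[OF gU UNIV_I UNIV_I UNIV_I] hermitian_on_scale_left[OF gU UNIV_I UNIV_I]
  have K: "complex_space.subspace K"
    by (auto simp: complex_space.subspace_def K_def pr_simps linear_0[OF prl])
  have g0: "g 0 w = 0" for w using g_left(2)[of 0 0 w] by simp
  have N: "complex_space.subspace N"
    unfolding complex_space.subspace_def N_def form_orthogonal_def by (auto simp: g_left g0)
  \<comment> \<open>The construction of orthonormal bases speaks of the cover and the metric only,
    so the kernel is viewed as a torus with an empty placeholder for the lattice.\<close>
  interpret K: hermitian_torus "\<lparr> cover = K, lat = {}, metric = g \<rparr>"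
    using K hermitian_on_subset[OF gU, of K] g(2)
    by unfold_locales (simp_all add: positive_definite_def)
  have decomp: "\<exists>p\<in>K. v - p \<in> N" for v
  proof -
    obtain E where E: "orthonormal_basis \<lparr> cover = K, lat = {}, metric = g \<rparr> E"
      using K.orthonormal_basis_exists by blast
    note E' = K.orthonormal_basisD[OF E, simplified]
    define p where "p = (\<Sum>e\<in>E. Re (g v e) *\<^sub>R e)"
    have pK: "p \<in> K"
      unfolding p_def using E'(2) complex_subspace_imp_subspace[OF K] by (intro subspace_sum subspace_scale) auto
    note rlL = rlinear_hermitian_left[OF subspace_UNIV_complex gU UNIV_I]
    note rlR = rlinear_hermitian_right[OF subspace_UNIV_complex gU UNIV_I]
    have diff: "g (x - y) w = g x w - g y w" for x y w
      using g_left(1)[of "x - y" y w] by simp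
    have orth: "Re (g (v - p) e) = 0" if e: "e \<in> E" for e
    proof -
      have "g p e = (\<Sum>f\<in>E. Re (g v f) *\<^sub>R g f e)"
        unfolding p_def by (rule rlinear_on_sum[OF rlL subspace_UNIV E'(1)]) simp
      then have "Re (g p e) = (\<Sum>f\<in>E. Re (g v f) * Re (g f e))" by simp
      also have "\<dots> = (\<Sum>f\<in>E. if e = f then Re (g v f) else 0)"
        using E'(4) e by (intro sum.cong) auto
      also have "\<dots> = Re (g v e)" using e E'(1) by simp
      finally show ?thesis by (simp add: diff)
    qed
    have re: "Re (g (v - p) w) = 0" if "w \<in> K" for w
    proof -
      have "w \<in> span E" using that E'(3) by simp
      then show ?thesis
      proof (induct rule: span_induct_alt)
        case base
        then show ?case using rlinear_on_0[OF rlR] by simp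
      next
        case (step c x y)
        then show ?case using orth by (simp add: rlinear_on_add[OF rlR] rlinear_on_scale[OF rlR])
      qed
    qed
    \<comment> \<open>The projection was formed with Re g. As K is closed under multiplication by i,
      testing on i w supplies the imaginary part.\<close>
    have "g (v - p) w = 0" if w: "w \<in> K" for w
    proof -
      have "Re (g (v - p) (\<i> *\<^sub>C w)) = 0" using re complex_space.subspace_scale[OF K w] by blast
      then have "Im (g (v - p) w) = 0"
        using hermitian_on_scale_right[OF subspace_UNIV_complex gU, of w "v - p" \<i>] by simp
      with re[OF w] show ?thesis by (simp add: complex_eq_iff)
    qed
    then show ?thesis using pK by (auto simp: N_def form_orthogonal_def)
  qed
  interpret vector_space_pair "scaleC :: complex \<Rightarrow> 'a \<Rightarrow> 'a" "scaleC :: complex \<Rightarrow> 'b \<Rightarrow> 'b" ..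
  have "inj_on pr N"
  proof (rule inj_onI)
    fix x y assume xy: "x \<in> N" "y \<in> N" "pr x = pr y"
    have "x - y \<in> N" using complex_space.subspace_diff[OF N xy(1,2)] .
    moreover have "x - y \<in> K" using xy(3) by (simp add: K_def pr_diff)
    ultimately have "g (x - y) (x - y) = 0" by (simp add: N_def form_orthogonal_def)
    then show "x = y" using g(2) unfolding positive_definite_def by (metis eq_iff_diff_eq_0 less_irrefl zero_complex.simps(1))
  qed
  from linear_exists_left_inverse_on[OF pr N this]
  obtain s where s: "s ` UNIV \<subseteq> N" "Vector_Spaces.linear scaleC scaleC s" "\<forall>v\<in>N. s (pr v) = v" by blast
  have "pr (s (pr v)) = pr v" for v
  proof -
    obtain p where p: "p \<in> K" "v - p \<in> N" using decomp by blast
    have "pr v = pr (v - p)" using p(1) by (simp add: K_def pr_diff)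
    then show ?thesis using s(3) p(2) by simp
  qed
  then show ?thesis using s unfolding N_def K_def by blast
qed

section \<open>The product torus and the original torus as bundle data\<close>

context kernel_splitting
begin

abbreviation "T1 \<equiv> \<lparr> cover = V', lat = U', metric = g \<rparr> \<times>\<^sub>T \<lparr> cover = range pr, lat = U'', metric = g'' \<rparr>"
abbreviation "T2 \<equiv> \<lparr> cover = UNIV, lat = U, metric = g \<rparr>"

text \<open>The curvature form of the tensor product: the flat factor contributes nothing, so only
  the V'' component matters.\<close>

definition H1 :: "'a \<times> 'b \<Rightarrow> 'a \<times> 'b \<Rightarrow> complex" where "H1 x y = H'' (snd x) (snd y)"
definition \<alpha>1 :: "'a \<times> 'b \<Rightarrow> complex" where "\<alpha>1 u = \<alpha> (fst u) * \<beta> (snd u)"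
definition \<Theta> :: "'a \<times> 'b \<Rightarrow> 'a" where "\<Theta> p = fst p + s (snd p)"
definition \<Xi> :: "'a \<Rightarrow> 'a \<times> 'b" where "\<Xi> v = (v - s (pr v), pr v)"

lemma cover_T1: "cover T1 = V' \<times> range pr" and lat_T1: "lat T1 = U' \<times> U''"
  and metric_T1: "metric T1 x y = g (fst x) (fst y) + g'' (snd x) (snd y)"
  by (simp_all add: prod_torus_def)

text \<open>The flat factor has constant weight and no exponential in its factor of automorphy, so
  tensoring with it only multiplies the multiplier.\<close>

lemma product_bundle: "pullback fst (flat_bundle \<alpha>) \<otimes>\<^sub>L pullback snd (L_bundle H'' \<beta>) = L_bundle H1 \<alpha>1"
  by (simp add: pullback_def tensor_def flat_bundle_def L_bundle_def H1_def[abs_def] \<alpha>1_def[abs_def] mult.assoc)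

lemma pr_simps: "pr (x + y) = pr x + pr y" "pr (c *\<^sub>C x) = c *\<^sub>C pr x" "pr (x - y) = pr x - pr y"
  using pr by (simp_all add: Vector_Spaces.linear_iff linear_diff[OF pr_lin])

lemma s_simps: "s (x + y) = s x + s y" "s (c *\<^sub>C x) = c *\<^sub>C s x"
  using s by (simp_all add: Vector_Spaces.linear_iff)

lemma \<Theta>_complex_linear: "Vector_Spaces.linear scaleC scaleC \<Theta>"
  unfolding Vector_Spaces.linear_iff
  by (simp add: complex_space.vector_space_axioms \<Theta>_def s_simps scaleC_prod_def scaleC_add_right algebra_simps)

lemma \<Xi>_complex_linear: "Vector_Spaces.linear scaleC scaleC \<Xi>"
  unfolding Vector_Spaces.linear_iff
  by (simp add: complex_space.vector_space_axioms \<Xi>_def s_simps pr_simps scaleC_prod_def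
      complex_space.scale_right_diff_distrib)

lemma \<Theta>_linear: "linear \<Theta>" and \<Xi>_linear: "linear \<Xi>"
  using complex_linear_imp_linear \<Theta>_complex_linear \<Xi>_complex_linear by blast+

lemma pr_s_range [simp]: "pr (s (pr v)) = pr v"
  by (simp add: pr_s)

lemma \<Xi>_cover: "\<Xi> v \<in> cover T1"
  by (simp add: \<Xi>_def cover_T1 V'_diff_s)

lemma \<Theta>_\<Xi>: "\<Theta> (\<Xi> v) = v"
  by (simp add: \<Xi>_def \<Theta>_def)

lemma pr_\<Theta>: "x \<in> cover T1 \<Longrightarrow> pr (\<Theta> x) = snd x"
  by (auto simp: cover_T1 \<Theta>_def pr_simps V'_iff)

lemma \<Xi>_\<Theta>: "x \<in> cover T1 \<Longrightarrow> \<Xi> (\<Theta> x) = x"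
  unfolding \<Xi>_def by (simp only: pr_\<Theta>) (simp add: \<Theta>_def prod_eq_iff)

lemma \<Theta>_bij: "bij_betw \<Theta> (cover T1) (cover T2)" and \<Xi>_bij: "bij_betw \<Xi> (cover T2) (cover T1)"
  using \<Theta>_\<Xi> \<Xi>_\<Theta> \<Xi>_cover
  by (auto intro!: bij_betw_byWitness[where f' = \<Xi>] bij_betw_byWitness[where f' = \<Theta>])

text \<open>The section takes values in the orthogonal complement of V', so the mixed terms vanish
  and the metric of V splits as the product metric.\<close>

lemma isometry:
  assumes x: "x \<in> cover T1" and y: "y \<in> cover T1"
  shows "g (\<Theta> x) (\<Theta> y) = metric T1 x y"
proof -
  have fx: "fst x \<in> V'" "fst y \<in> V'" and sx: "snd x \<in> range pr" "snd y \<in> range pr"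
    using x y by (auto simp: cover_T1)
  have o1: "g (s z) w = 0" if "w \<in> V'" for z w
    using s_orth[of z] that by (simp add: form_orthogonal_def)
  have o2: "g w (s z) = 0" if "w \<in> V'" for z w
    using hermitian_on_cnj[OF g_on, of "s z" UNIV w] o1[OF that] by simp
  have "g'' (snd x) (snd y) = g'' (pr (s (snd x))) (pr (s (snd y)))" using sx by (simp only: pr_s)
  also have "\<dots> = g (s (snd x)) (s (snd y))" using g'' s_orth by blast
  finally have gs: "g'' (snd x) (snd y) = g (s (snd x)) (s (snd y))" .
  have "g (\<Theta> x) (\<Theta> y) = g (fst x) (fst y) + g (fst x) (s (snd y)) + (g (s (snd x)) (fst y) + g (s (snd x)) (s (snd y)))"
    unfolding \<Theta>_def
    by (simp add: hermitian_on_add_left[OF g_on, of _ UNIV] hermitian_on_add_right[OF subspace_UNIV_complex g_on])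
  then show ?thesis unfolding metric_T1 gs using o1[OF fx(2)] o2[OF fx(1)] by simp
qed

lemma H_pr: "H v w = H'' (pr v) (pr w)"
  using H'' by simp

lemma \<Theta>_H: "x \<in> cover T1 \<Longrightarrow> y \<in> cover T1 \<Longrightarrow> H (\<Theta> x) (\<Theta> y) = H1 x y"
  by (simp only: H_pr[of "\<Theta> x"] H1_def pr_\<Theta>)

lemma \<Xi>_isometry: "metric T1 (\<Xi> x) (\<Xi> y) = g x y"
  using isometry[OF \<Xi>_cover \<Xi>_cover] by (simp only: \<Theta>_\<Xi>)

lemma \<Xi>_H: "H1 (\<Xi> x) (\<Xi> y) = H x y"
  using \<Theta>_H[OF \<Xi>_cover \<Xi>_cover] by (simp only: \<Theta>_\<Xi>)

lemma cover_T1_subspace: "complex_space.subspace (cover T1)"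
proof -
  have "0 \<in> range pr" by (metis linear_0[OF pr_lin] rangeI)
  moreover have "x + y \<in> range pr" "c *\<^sub>C x \<in> range pr" if "x \<in> range pr" "y \<in> range pr" for x y c
    using that by (auto simp: pr_simps[symmetric])
  ultimately show ?thesis
    using V'_subspace unfolding cover_T1 complex_space.subspace_def
    by (simp add: scaleC_prod_def mem_Times_iff)
qed

lemma torus_bundle_T2: "torus_bundle T2 H \<alpha>"
  using g_on H_on U_subspace U_discrete U_span \<alpha>_norm g(2)
  by unfold_locales (auto simp: positive_definite_def)

lemma U'_discrete: "uniform_discrete U'"
  using U_discrete U'_subspace U_subspace unfolding discrete_subgroup_iff[OF U_subspace] discrete_subgroup_iff[OF U'_subspace]
  by blast

lemma torus_bundle_T1: "torus_bundle T1 H1 \<alpha>1"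
proof unfold_locales
  show "complex_space.subspace (cover T1)" by (rule cover_T1_subspace)
  show "hermitian_on (cover T1) (metric T1)"
    by (rule hermitian_on_pullback[OF g_on \<Theta>_complex_linear cover_T1_subspace isometry])
  show "hermitian_on (cover T1) H1"
    by (rule hermitian_on_pullback[OF H_on \<Theta>_complex_linear cover_T1_subspace \<Theta>_H])
  show "Re (metric T1 x x) > 0" if x: "x \<in> cover T1" "x \<noteq> 0" for x
  proof -
    have "\<Theta> x \<noteq> 0" using \<Xi>_\<Theta>[OF x(1)] x(2) linear_0[OF \<Xi>_linear] by auto
    then show ?thesis using g(2) unfolding isometry[OF x(1) x(1), symmetric] positive_definite_def by blast
  qed
  show sub: "int_module.subspace (lat T1)"
    using U'_subspace U''_subspace unfolding lat_T1 int_module.subspace_def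
    by (auto simp: zero_prod_def)
  obtain e e' where e: "e > 0" "\<And>x. x \<in> U' \<Longrightarrow> norm x < e \<Longrightarrow> x = 0" "e' > 0" "\<And>x. x \<in> U'' \<Longrightarrow> norm x < e' \<Longrightarrow> x = 0"
    using U'_discrete U''_discrete
    unfolding discrete_subgroup_iff[OF U''_subspace] discrete_subgroup_iff[OF U'_subspace] by blast
  show "uniform_discrete (lat T1)"
    unfolding discrete_subgroup_iff[OF sub]
  proof (intro exI[of _ "min e e'"] conjI ballI impI)
    show "min e e' > 0" using e by simp
    fix x assume x: "x \<in> lat T1" "norm x < min e e'"
    obtain u w where uw: "x = (u, w)" "u \<in> U'" "w \<in> U''" using x(1) unfolding lat_T1 by blast
    have "norm u < e" "norm w < e'" using x(2) norm_fst_le[of u w] norm_snd_le[of w u] uw(1) by auto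
    then show "x = 0" using e(2)[OF uw(2)] e(4)[OF uw(3)] uw(1) by (simp add: zero_prod_def)
  qed
  show "span (lat T1) = cover T1"
    using span_Times[OF int_module.subspace_0[OF U'_subspace] int_module.subspace_0[OF U''_subspace]]
    unfolding lat_T1 cover_T1 U'_span U''_span .
  show "cmod (\<alpha>1 u) = 1" if "u \<in> lat T1" for u
  proof -
    have "fst u \<in> U" "snd u \<in> U''" using that unfolding lat_T1 by auto
    then show ?thesis unfolding \<alpha>1_def norm_mult using \<alpha>_norm \<beta>_norm by simp
  qed
qed

lemma kerH_T2: "torus_bundle.kerH T2 H = V'"
  unfolding torus_bundle.kerH_def[OF torus_bundle_T2] form_kernel_def by simp

text \<open>\<open>\<Theta>\<close> carries the pulled back form to H, so kernel vectors go to V',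
  where \<open>pr\<close> reads off a zero second component.\<close>

lemma kerH_T1: "torus_bundle.kerH T1 H1 = V' \<times> {0}"
proof -
  have "snd x = 0" if x: "x \<in> cover T1" "\<forall>w\<in>cover T1. H1 x w = 0" for x
  proof -
    have "H (\<Theta> x) v = 0" for v using x(2) \<Xi>_cover[of v] \<Theta>_H[OF x(1) \<Xi>_cover, of v] by (simp add: \<Theta>_\<Xi>)
    then have "\<Theta> x \<in> V'" by (simp add: form_kernel_def)
    then show ?thesis using pr_\<Theta>[OF x(1)] by (simp add: V'_iff)
  qed
  moreover have "H1 (v, 0) w = 0" if w: "w \<in> cover T1" for v w
  proof -
    have "H 0 (\<Theta> w) = 0" using V'_left[of 0] by (simp add: V'_iff linear_0[OF pr_lin])
    then show ?thesis unfolding H1_def H_pr pr_\<Theta>[OF w] by (simp add: linear_0[OF pr_lin])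
  qed
  moreover have "0 \<in> range pr" by (metis linear_0[OF pr_lin] rangeI)
  ultimately show ?thesis
    unfolding torus_bundle.kerH_def[OF torus_bundle_T1] cover_T1 by (auto simp: prod_eq_iff)
qed

context
  fixes bs :: "'a list"
  assumes bs: "distinct bs" "lattice_basis U' (set bs)"
begin

abbreviation "bs1 \<equiv> map (\<lambda>b. (b, 0 :: 'b)) bs"

lemma bs_U': "set bs \<subseteq> U'" and bs_span: "span (set bs) = V'" and bs_independent: "independent (set bs)"
  and bs_int_span: "int_module.span (set bs) = U'"
  using lattice_basis_subset[OF bs(2)] lattice_basis_span[OF bs(2)] U'_span
    lattice_basis_independent[OF bs(2) U'_discrete] bs(2)
  by (auto simp: lattice_basis_def)

lemma bs1_lat: "set bs1 \<subseteq> lat T1 \<inter> torus_bundle.kerH T1 H1"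
  using bs_U' int_module.subspace_0[OF U''_subspace] unfolding lat_T1 kerH_T1 by auto

lemma bs1_span: "torus_bundle.kerH T1 H1 \<subseteq> span (set bs1)"
proof -
  have "linear (\<lambda>b. (b, 0 :: 'b))" by (rule linearI) simp_all
  from linear_span_image[OF this, of "set bs"] show ?thesis
    unfolding kerH_T1 by (auto simp: bs_span)
qed

text \<open>On vectors of U' x {0} the product multiplier is \<alpha>, because \<beta> is 1 at 0; so
  both eigenspaces are graded by the same index set.\<close>

lemma freqs_eq: "torus_bundle.freqs \<alpha>1 bs1 = torus_bundle.freqs \<alpha> bs"
proof -
  have "\<alpha>1 (b, 0) = \<alpha> b" for b by (simp add: \<alpha>1_def \<beta>_zero)
  then show ?thesis
    unfolding torus_bundle.freqs_def[OF torus_bundle_T1] torus_bundle.freqs_def[OF torus_bundle_T2] by auto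
qed

lemma \<Theta>_bs1: "bs = map \<Theta> bs1"
  by (rule nth_equalityI) (simp_all add: \<Theta>_def linear_0[OF s_lin])

lemma \<Xi>_bs: "bs1 = map \<Xi> bs"
proof -
  have "\<Xi> b = (b, 0)" if "b \<in> set bs" for b
    using that bs_U' by (auto simp: \<Xi>_def V'_iff linear_0[OF s_lin])
  then show ?thesis by simp
qed

text \<open>The maps in the two directions use the same a and the same functional, with reversed
  signs; only the lattice conditions have to be verified separately.\<close>

lemma morphisms_exist:
  assumes c: "c \<in> torus_bundle.freqs \<alpha> bs"
  shows "\<exists>a \<kappa> \<kappa>'. bundle_morphism T1 H1 \<alpha>1 T2 H \<alpha> \<Theta> a bs1 bs c \<kappa> \<and>
    bundle_morphism T2 H \<alpha> T1 H1 \<alpha>1 \<Xi> (- \<Xi> a) bs bs1 c \<kappa>'"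
proof -
  have c_\<alpha>: "cis (2 * pi * c i) = \<alpha> (bs ! i)" if "i < length bs" for i
    using c that unfolding torus_bundle.freqs_def[OF torus_bundle_T2] by blast
  \<comment> \<open>Distinctness of the list makes the frequency a function of the basis vector, so
    it extends to a linear functional.\<close>
  have "inj_on ((!) bs) {..<length bs}" using bs(1) by (intro inj_on_nth) auto
  then have inv: "inv_into {..<length bs} ((!) bs) (bs ! i) = i" if "i < length bs" for i
    using that by (simp add: inv_into_f_f)
  obtain \<kappa> :: "'a \<Rightarrow> real" where \<kappa>: "linear \<kappa>" "\<forall>b\<in>set bs. \<kappa> b = c (inv_into {..<length bs} ((!) bs) b)"
    using real_vector.linear_independent_extend[OF bs_independent, of "\<lambda>b. c (inv_into {..<length bs} ((!) bs) b)"] by (auto simp: linear_def)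
  have \<kappa>_bs: "\<kappa> (bs ! i) = c i" if "i < length bs" for i
    using \<kappa>(2) inv[OF that] that by simp
  \<comment> \<open>On U' the form vanishes, so \<alpha> is a genuine character there, and so is
    exp(2 pi i \<kappa>). They agree on a basis by the choice of c, hence on all of U'.\<close>
  define N where "N u \<longleftrightarrow> u \<in> U' \<and> cis (2 * pi * \<kappa> u) = \<alpha> u" for u
  have N: "N u" if u: "u \<in> U'" for u
  proof (rule int_span_closure[where C = "set bs"])
    show "u \<in> int_module.span (set bs)" using u bs_int_span by simp
    show "N 0" using int_module.subspace_0[OF U'_subspace] by (simp add: N_def linear_0[OF \<kappa>(1)] \<alpha>_zero)
    show "N (x + y)" if "N x" "N y" for x y
    proof -
      have xy: "x \<in> U'" "y \<in> U'" using that by (auto simp: N_def)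
      have "\<alpha> (x + y) = \<alpha> x * \<alpha> y" using \<alpha>_add[of x y] V'_left[of x y] xy by simp
      then show ?thesis using that int_module.subspace_add[OF U'_subspace xy]
        by (simp add: N_def linear_add[OF \<kappa>(1)] distrib_left cis_mult[symmetric])
    qed
    show "N (- x)" if "N x" for x
    proof -
      have x: "x \<in> U'" "cis (2 * pi * \<kappa> x) = \<alpha> x" using that by (auto simp: N_def)
      have "\<alpha> (- x) = inverse (\<alpha> x)" using \<alpha>_neg(1)[of x] x(1) by (metis IntD1 inverse_unique mult.commute)
      moreover have "cis (2 * pi * \<kappa> (- x)) = inverse (cis (2 * pi * \<kappa> x))"
        by (simp add: linear_neg[OF \<kappa>(1)])
      ultimately show ?thesis unfolding N_def x(2)
        using int_module.subspace_neg[OF U'_subspace x(1)] by simp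
    qed
    show "N b" if "b \<in> set bs" for b
    proof -
      obtain i where "i < length bs" "b = bs ! i" using \<open>b \<in> set bs\<close> by (auto simp: in_set_conv_nth)
      then show ?thesis using c_\<alpha> \<kappa>_bs bs_U' that by (auto simp: N_def)
    qed
  qed
  then have \<kappa>_U': "cis (2 * pi * \<kappa> u) = \<alpha> u" if "u \<in> U'" for u using that by (simp add: N_def)
  have tr: "\<exists>a. \<forall>x\<in>U''. \<forall>v\<in>U. s x - v \<in> V' \<longrightarrow> matches \<kappa> a x v"
    by (rule translation_exists[OF \<kappa>(1)]) (rule \<kappa>_U')
  obtain a where a: "\<And>x v. x \<in> U'' \<Longrightarrow> v \<in> U \<Longrightarrow> s x - v \<in> V' \<Longrightarrow>
      \<beta> x = \<alpha> v * cis (2 * pi * Im (H a v)) * cis (2 * pi * \<kappa> (s x - v))"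
    using tr unfolding matches_def by blast
  define \<kappa>' where "\<kappa>' = (\<lambda>x. \<kappa> (\<Theta> x))"
  have \<kappa>': "linear \<kappa>'" unfolding \<kappa>'_def using linear_compose[OF \<Theta>_linear \<kappa>(1)] by (simp add: o_def)
  have \<alpha>_mult: "\<alpha>1 u = \<alpha> v * cis (2 * pi * Im (H a v)) * cis (2 * pi * \<kappa> (\<Theta> u - v))"
    if u: "u \<in> lat T1" and v: "v \<in> U" "s (snd u) - v \<in> V'" for u v
  proof -
    have u': "fst u \<in> U'" "snd u \<in> U''" using u unfolding lat_T1 by auto
    have "\<kappa> (\<Theta> u - v) = \<kappa> (fst u) + \<kappa> (s (snd u) - v)"
      unfolding linear_add[OF \<kappa>(1), symmetric] by (simp add: \<Theta>_def algebra_simps)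
    then show ?thesis
      unfolding \<alpha>1_def a[OF u'(2) v] \<kappa>_U'[OF u'(1), symmetric] by (simp add: distrib_left cis_mult[symmetric] ac_simps)
  qed
  interpret A: torus_bundle T1 H1 \<alpha>1 by (rule torus_bundle_T1)
  interpret B: torus_bundle T2 H \<alpha> by (rule torus_bundle_T2)
  have "bundle_morphism T1 H1 \<alpha>1 T2 H \<alpha> \<Theta> a bs1 bs c \<kappa>"
  proof (rule bundle_morphism.intro[OF torus_bundle_T1 torus_bundle_T2], rule bundle_morphism_axioms.intro)
    show "bij_betw \<Theta> (cover T1) (cover T2)" by (rule \<Theta>_bij)
    show "metric T2 (\<Theta> x) (\<Theta> y) = metric T1 x y" if "x \<in> cover T1" "y \<in> cover T1" for x y
      using isometry[OF that] by simp
    show "H (\<Theta> x) (\<Theta> y) = H1 x y" if "x \<in> cover T1" "y \<in> cover T1" for x y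
      using \<Theta>_H[OF that] .
    show "a \<in> cover T2" by simp
    show "bs = map \<Theta> bs1" by (rule \<Theta>_bs1)
    show "set bs \<subseteq> B.kerH" "B.kerH \<subseteq> span (set bs)" unfolding kerH_T2 bs_span using bs_U' by auto
    show "linear \<kappa>" by (rule \<kappa>(1))
    show "\<kappa> (bs ! i) = c i" if "i < length bs" for i using \<kappa>_bs[OF that] .
    show "set bs1 \<subseteq> cover T1" using bs1_lat A.lat_cover by blast
    show "\<exists>v\<in>lat T2. \<Theta> u - v \<in> B.kerH \<and> \<alpha>1 u = \<alpha> v * cis (2 * pi * Im (H a v)) * cis (2 * pi * \<kappa> (\<Theta> u - v))"
      if u: "u \<in> lat T1" for u
    proof -
      have u': "fst u \<in> V'" "snd u \<in> U''" using u unfolding lat_T1 by auto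
      obtain v where v: "v \<in> U" "snd u = pr v" using u'(2) by blast
      have "s (snd u) - v \<in> V'" unfolding v(2) by (simp add: V'_iff pr_simps)
      moreover have "\<Theta> u - v \<in> V'" unfolding \<Theta>_def v(2) using u'(1) by (simp add: V'_iff pr_simps)
      ultimately show ?thesis using \<alpha>_mult[OF u v(1)] v(1) unfolding kerH_T2 by auto
    qed
  qed (fact \<Theta>_complex_linear)
  moreover have "bundle_morphism T2 H \<alpha> T1 H1 \<alpha>1 \<Xi> (- \<Xi> a) bs bs1 c \<kappa>'"
  proof (rule bundle_morphism.intro[OF torus_bundle_T2 torus_bundle_T1], rule bundle_morphism_axioms.intro)
    show "Vector_Spaces.linear scaleC scaleC \<Xi>" by (rule \<Xi>_complex_linear)
    show "bij_betw \<Xi> (cover T2) (cover T1)" by (rule \<Xi>_bij)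
    show "metric T1 (\<Xi> x) (\<Xi> y) = metric T2 x y" for x y
      using \<Xi>_isometry by simp
    show "H1 (\<Xi> x) (\<Xi> y) = H x y" for x y by (rule \<Xi>_H)
    show "- \<Xi> a \<in> cover T1" using subspace_neg[OF A.sW \<Xi>_cover] .
    show "bs1 = map \<Xi> bs" by (rule \<Xi>_bs)
    show "set bs \<subseteq> cover T2" by simp
    show "set bs1 \<subseteq> A.kerH" using bs1_lat by blast
    show "A.kerH \<subseteq> span (set bs1)" by (rule bs1_span)
    show "linear \<kappa>'" by (rule \<kappa>')
    show "\<kappa>' (bs1 ! i) = c i" if "i < length bs1" for i
      using that \<kappa>_bs[of i] by (simp add: \<kappa>'_def \<Theta>_def linear_0[OF s_lin])
    show "\<exists>u\<in>lat T1. \<Xi> v - u \<in> A.kerH \<and>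
        \<alpha> v = \<alpha>1 u * cis (2 * pi * Im (H1 (- \<Xi> a) u)) * cis (2 * pi * \<kappa>' (\<Xi> v - u))" if v: "v \<in> lat T2" for v
    proof -
      \<comment> \<open>The product lattice vector above pr v with trivial V' component. The defect
        \<Xi> v - u corresponds under \<Theta> to v - \<Theta> u, the negative of the defect for
        \<Theta>, so every phase is inverted and the relation for \<Theta> turns into the one for
        \<Xi>.\<close>
      define u where "u = (0 :: 'a, pr v)"
      have vU: "v \<in> U" using v by simp
      have u: "u \<in> lat T1" unfolding lat_T1 u_def using vU int_module.subspace_0[OF U'_subspace] by auto
      have sv: "s (snd u) - v \<in> V'" by (simp add: u_def V'_iff pr_simps)
      have k: "\<Xi> v - u \<in> A.kerH" unfolding kerH_T1 by (simp add: \<Xi>_def u_def V'_diff_s)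
      have uc: "u \<in> cover T1" using u A.lat_cover by blast
      have \<Theta>u: "\<Theta> u = s (pr v)" by (simp add: u_def \<Theta>_def)
      have "H1 (- \<Xi> a) u = H (- a) (\<Theta> u)"
        using \<Xi>_H[of "- a" "\<Theta> u"] \<Xi>_\<Theta>[OF uc] by (simp add: linear_neg[OF \<Xi>_linear])
      also have "\<dots> = H (- a) v" unfolding H_pr \<Theta>u by simp
      also have "\<dots> = - H a v"
        using rlinear_on_scale[OF rlinear_hermitian_left[OF subspace_UNIV_complex H_on], of v a "-1"] by simp
      finally have H1: "H1 (- \<Xi> a) u = - H a v" .
      have "\<kappa>' (\<Xi> v - u) = \<kappa> (- (\<Theta> u - v))"
        by (simp add: \<kappa>'_def linear_diff[OF \<Theta>_linear] \<Theta>_\<Xi>)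
      also have "\<dots> = - \<kappa> (\<Theta> u - v)" by (rule linear_neg[OF \<kappa>(1)])
      finally have \<kappa>': "\<kappa>' (\<Xi> v - u) = - \<kappa> (\<Theta> u - v)" .
      have "\<alpha>1 u * cis (2 * pi * Im (H1 (- \<Xi> a) u)) * cis (2 * pi * \<kappa>' (\<Xi> v - u)) =
          \<alpha> v * (cis (2 * pi * Im (H a v)) * cis (2 * pi * - Im (H a v))) *
            (cis (2 * pi * \<kappa> (\<Theta> u - v)) * cis (2 * pi * - \<kappa> (\<Theta> u - v)))"
        unfolding \<alpha>_mult[OF u vU sv] H1 \<kappa>' uminus_complex.simps by (simp only: ac_simps)
      also have "\<dots> = \<alpha> v" unfolding cis_mult by simp
      finally show ?thesis using u k by metis
    qed
  qed
  ultimately show ?thesis by blast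
qed

end

theorem isospectral_splitting:
  "dolbeault_spectrum T2 (L_bundle H \<alpha>) k =
      dolbeault_spectrum T1 (pullback fst (flat_bundle \<alpha>) \<otimes>\<^sub>L pullback snd (L_bundle H'' \<beta>)) k \<and>
   multiplicity_of T2 (L_bundle H \<alpha>) k \<mu> =
      multiplicity_of T1 (pullback fst (flat_bundle \<alpha>) \<otimes>\<^sub>L pullback snd (L_bundle H'' \<beta>)) k \<mu>"
proof -
  obtain B where B: "lattice_basis U' B" using discrete_subgroup_basis[OF U'_subspace U'_discrete] by blast
  then have "finite B" by (simp add: lattice_basis_def)
  then obtain bs where bs: "set bs = B" "distinct bs" using finite_distinct_list by blast
  have bs': "distinct bs" "lattice_basis U' (set bs)" using bs B by auto
  have bs2: "set bs \<subseteq> lat T2 \<inter> torus_bundle.kerH T2 H"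
    using bs_U'[OF bs'] unfolding kerH_T2 by auto
  note iso = isospectral[OF torus_bundle_T1 torus_bundle_T2 bs1_lat[OF bs'] bs2 freqs_eq[OF bs'] \<Xi>_\<Theta> \<Theta>_\<Xi> morphisms_exist[OF bs']]
  show ?thesis unfolding product_bundle using iso[where k = k] iso(2)[where k = k and \<mu> = \<mu>] by simp
qed

end

theorem mainTheorem5:
  fixes g H :: "'a::complex_euclidean \<Rightarrow> 'a \<Rightarrow> complex"
    and U :: "'a set" and \<alpha> :: "'a \<Rightarrow> complex"
    and V' U' :: "'a set" and pr :: "'a \<Rightarrow> 'b::complex_euclidean"
    and V'' U'' :: "'b set" and g'' H'' :: "'b \<Rightarrow> 'b \<Rightarrow> complex" and \<beta> :: "'b \<Rightarrow> complex"
    and T T' :: "'a torus" and T'' :: "'b torus"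
    and L P :: "'a line_bundle" and L'' :: "'b line_bundle"
    and k :: nat
  assumes "hermitian g" and "positive_definite g"
    and "is_lattice UNIV U"
    and "hermitian H" and "\<forall>u\<in>U. \<forall>v\<in>U. Im (H u v) \<in> \<int>"
    and "semicharacter H U \<alpha>"
    and "T = \<lparr> cover = UNIV, lat = U, metric = g \<rparr>"
    and "L = L_bundle H \<alpha>"
    and "V' = form_kernel H" and "V' \<noteq> {0}"
    and "U' = U \<inter> V'"
    and "T' = \<lparr> cover = V', lat = U', metric = g \<rparr>"
    and "P = flat_bundle \<alpha>"
    \<comment> \<open>\<open>pr\<close> is the projection onto the quotient \<open>V'' = V/V'\<close>\<close>
    and "Vector_Spaces.linear scaleC scaleC pr" and "{v. pr v = 0} = V'"
    and "V'' = range pr" and "U'' = pr ` U"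
    and "\<forall>v w. H'' (pr v) (pr w) = H v w"
    and "\<forall>v\<in>form_orthogonal g V'. \<forall>w\<in>form_orthogonal g V'. g'' (pr v) (pr w) = g v w"
    and "T'' = \<lparr> cover = V'', lat = U'', metric = g'' \<rparr>"
    and "semicharacter H'' U'' \<beta>"
    and "L'' = L_bundle H'' \<beta>"
  shows "dolbeault_spectrum T L k =
      dolbeault_spectrum (T' \<times>\<^sub>T T'') (pullback fst P \<otimes>\<^sub>L pullback snd L'') k
    \<and> (\<forall>\<mu>. multiplicity_of T L k \<mu> =
      multiplicity_of (T' \<times>\<^sub>T T'') (pullback fst P \<otimes>\<^sub>L pullback snd L'') k \<mu>)"
proof -
  note [simp] = assms(7,8,12,13,20,22)
  have ker: "{v. pr v = 0} = form_kernel H" using assms(9,15) by simp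
  obtain s where s: "Vector_Spaces.linear scaleC scaleC s" "\<forall>x. s x \<in> form_orthogonal g {v. pr v = 0}"
      "\<forall>x\<in>range pr. pr (s x) = x"
    using orthogonal_section_exists[OF assms(1,2,14)] by blast
  interpret kernel_splitting g H U \<alpha> pr g'' H'' \<beta> s
  proof (rule kernel_splitting.intro)
    show "hermitian g" "positive_definite g" "is_lattice UNIV U" "hermitian H"
      "\<forall>u\<in>U. \<forall>v\<in>U. Im (H u v) \<in> \<int>" "semicharacter H U \<alpha>" "Vector_Spaces.linear scaleC scaleC pr"
      "\<forall>v w. H'' (pr v) (pr w) = H v w" by (fact assms)+
    show "semicharacter H'' (pr ` U) \<beta>" using assms(17,21) by simp
    show "\<forall>v\<in>form_orthogonal g (form_kernel H). \<forall>w\<in>form_orthogonal g (form_kernel H). g'' (pr v) (pr w) = g v w"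
      using assms(9,19) by simp
    show "s x \<in> form_orthogonal g (form_kernel H)" for x using s(2) ker by simp
    show "pr (s x) = x" if "x \<in> range pr" for x using s(3) that by blast
  qed (fact ker s(1))+
  show ?thesis
    using isospectral_splitting[of k] assms(9,11,16,17) by simp
qed

end
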